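(* For every $N \in \mathbb{N}$ and $p \in (1,\infty)$, there exists a constant $C' = C'(p,N)$ such that for all $s \in (0,1)$ and all $u \in (I-\Delta)^{-s/2} L^p(\mathbb{R}^N)$, we have $$\left[\frac{u(x)-u(y)}{|x-y|^{\frac{N}{p}+s}} \right]_{L^{p,\infty}(\mathbb{R}^N \times \mathbb{R}^N)} \leq C' \|(I-\Delta)^{s/2} u\|_{L^p(\mathbb{R}^N)}.$$
   Context: $\mathcal{L}^{2N}$ denotes Lebesgue measure on $\mathbb{R}^{2N} = \mathbb{R}^N\times\mathbb{R}^N$, and $|\cdot|$ is the Euclidean norm. For a measurable function $F(x,y)$ on $\mathbb{R}^N \times \mathbb{R}^N$ (defined almost everywhere) and $1 \leq p < \infty$, the weak-$L^p$ quasi-norm is $$[F]_{L^{p,\infty}(\mathbb{R}^N \times \mathbb{R}^N)} := \sup_{\lambda > 0} \left( \lambda^p \mathcal{L}^{2N} \{(x,y) \in \mathbb{R}^{2N} : |F(x,y)| \geq \lambda\}\right)^{1/p}.$$ The Bessel potential space $(I-\Delta)^{-s/2}L^p(\mathbb{R}^N)$ is the space of tempered distributions $u$ such that $(I-\Delta)^{s/2}u \in L^p(\mathbb{R}^N)$, where $(I-\Delta)^{s/2}$ is the Fourier multiplier operator with symbol $(1+4\pi^2|\xi|^2)^{s/2}$ (with the Fourier inversion convention $\mathcal{F}^{-1}\phi(x) = \int_{\mathbb{R}^N}\phi(\xi)e^{2\pi i x\cdot\xi}\,d\xi$); for $s>0$ it is contained in $L^p(\mathbb{R}^N)$. The constant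 $C'$ does not depend on $s$. *)

theory Defs
  imports "HOL-Analysis.Analysis"
begin

section \<open>Schwartz functions and tempered distributions\<close>

text \<open>
  The list \<open>bs\<close> of basis vectors plays the role of a multi-index. Since
  \<open>frechet_derivative\<close> is total, differentiability has to be demanded separately;
  this happens in \<open>smooth\<close>.
\<close>

primrec iter_partial ::
  "'a::euclidean_space list \<Rightarrow> ('a \<Rightarrow> complex) \<Rightarrow> 'a \<Rightarrow> complex" where
  "iter_partial [] f = f"
| "iter_partial (b # bs) f = (\<lambda>x. frechet_derivative (iter_partial bs f) (at x) b)"

definition smooth :: "('a::euclidean_space \<Rightarrow> complex) \<Rightarrow> bool" where
  "smooth f \<longleftrightarrow> (\<forall>bs\<in>lists Basis. \<forall>x. iter_partial bs f differentiable at x)"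

definition schwartz :: "('a::euclidean_space \<Rightarrow> complex) set" where
  "schwartz = {f. smooth f \<and>
     (\<forall>k::nat. \<forall>bs\<in>lists Basis. bounded (range (\<lambda>x. (1 + norm x) ^ k * norm (iter_partial bs f x))))}"

text \<open>Only meaningful for Schwartz functions, where the supremum is finite.\<close>

definition schwartz_seminorm ::
  "nat \<Rightarrow> 'a::euclidean_space list \<Rightarrow> ('a \<Rightarrow> complex) \<Rightarrow> real" where
  "schwartz_seminorm k bs f = (SUP x. (1 + norm x) ^ k * norm (iter_partial bs f x))"

text \<open>
  Continuity of a linear functional on the Schwartz space, whose topology is generated by the
  seminorms above, means that it is bounded by a finite sum of them. The values of
  a distribution outside \<open>schwartz\<close> are irrelevant and never used.
\<close>

definition tempered_distribution ::
  "(('a::euclidean_space \<Rightarrow> complex) \<Rightarrow> complex) \<Rightarrow> bool" where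
  "tempered_distribution T \<longleftrightarrow>
     (\<forall>\<phi>\<in>schwartz. \<forall>\<psi>\<in>schwartz. T (\<lambda>x. \<phi> x + \<psi> x) = T \<phi> + T \<psi>) \<and>
     (\<forall>c. \<forall>\<phi>\<in>schwartz. T (\<lambda>x. c * \<phi> x) = c * T \<phi>) \<and>
     (\<exists>C m. \<forall>\<phi>\<in>schwartz.
        norm (T \<phi>) \<le> C * (\<Sum>bs\<in>{bs \<in> lists Basis. length bs \<le> m}. schwartz_seminorm m bs \<phi>))"

text \<open>The distribution \<open>T\<close> is the function \<open>u\<close> (which is then unique up to null sets).\<close>

definition represents ::
  "('a::euclidean_space \<Rightarrow> complex) \<Rightarrow> (('a \<Rightarrow> complex) \<Rightarrow> complex) \<Rightarrow> bool" where
  "represents u T \<longleftrightarrow> u \<in> borel_measurable lebesgue \<and>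
     (\<forall>\<phi>\<in>schwartz. integrable lebesgue (\<lambda>x. u x * \<phi> x) \<and> T \<phi> = (LINT x|lebesgue. u x * \<phi> x))"


section \<open>Fourier multipliers\<close>

definition fourier :: "('a::euclidean_space \<Rightarrow> complex) \<Rightarrow> 'a \<Rightarrow> complex" where
  "fourier \<phi> \<xi> = (LINT x|lebesgue. \<phi> x * cis (- (2 * pi * (x \<bullet> \<xi>))))"

definition inv_fourier :: "('a::euclidean_space \<Rightarrow> complex) \<Rightarrow> 'a \<Rightarrow> complex" where
  "inv_fourier \<phi> x = (LINT \<xi>|lebesgue. \<phi> \<xi> * cis (2 * pi * (x \<bullet> \<xi>)))"

definition distr_fourier ::
  "(('a::euclidean_space \<Rightarrow> complex) \<Rightarrow> complex) \<Rightarrow> ('a \<Rightarrow> complex) \<Rightarrow> complex" where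
  "distr_fourier T = (\<lambda>\<phi>. T (fourier \<phi>))"

definition distr_inv_fourier ::
  "(('a::euclidean_space \<Rightarrow> complex) \<Rightarrow> complex) \<Rightarrow> ('a \<Rightarrow> complex) \<Rightarrow> complex" where
  "distr_inv_fourier T = (\<lambda>\<phi>. T (inv_fourier \<phi>))"

text \<open>Intended for smooth \<open>m\<close> all of whose derivatives grow at most polynomially.\<close>

definition distr_mult ::
  "('a::euclidean_space \<Rightarrow> complex) \<Rightarrow> (('a \<Rightarrow> complex) \<Rightarrow> complex) \<Rightarrow> ('a \<Rightarrow> complex) \<Rightarrow> complex" where
  "distr_mult m T = (\<lambda>\<phi>. T (\<lambda>\<xi>. m \<xi> * \<phi> \<xi>))"

definition fourier_multiplier ::
  "('a::euclidean_space \<Rightarrow> complex) \<Rightarrow> (('a \<Rightarrow> complex) \<Rightarrow> complex) \<Rightarrow> ('a \<Rightarrow> complex) \<Rightarrow> complex" where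
  "fourier_multiplier m T = distr_inv_fourier (distr_mult m (distr_fourier T))"

text \<open>The operator $(I - \Delta)^{s/2}$.\<close>

definition bessel_op ::
  "real \<Rightarrow> (('a::euclidean_space \<Rightarrow> complex) \<Rightarrow> complex) \<Rightarrow> ('a \<Rightarrow> complex) \<Rightarrow> complex" where
  "bessel_op s = fourier_multiplier (\<lambda>\<xi>. of_real ((1 + 4 * pi\<^sup>2 * (norm \<xi>)\<^sup>2) powr (s / 2)))"


section \<open>Function spaces\<close>

definition Lp_space :: "real \<Rightarrow> ('a::euclidean_space \<Rightarrow> complex) set" where
  "Lp_space p = {g \<in> borel_measurable lebesgue. integrable lebesgue (\<lambda>x. norm (g x) powr p)}"

definition Lp_norm :: "real \<Rightarrow> ('a::euclidean_space \<Rightarrow> complex) \<Rightarrow> real" where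
  "Lp_norm p g = (LINT x|lebesgue. norm (g x) powr p) powr (1 / p)"

definition bessel_potential_space ::
  "real \<Rightarrow> real \<Rightarrow> (('a::euclidean_space \<Rightarrow> complex) \<Rightarrow> complex) set" where
  "bessel_potential_space s p =
     {U. tempered_distribution U \<and> (\<exists>g\<in>Lp_space p. represents g (bessel_op s U))}"

text \<open>Real powers of extended nonnegative reals, for positive exponents.\<close>

definition ennpowr :: "ennreal \<Rightarrow> real \<Rightarrow> ennreal" where
  "ennpowr x r = (if x = \<infinity> then \<infinity> else ennreal (enn2real x powr r))"

text \<open>
  A function of two variables enters as one on the product space, which as an Euclidean
  space carries its own Lebesgue measure.
\<close>

definition weak_Lp_norm :: "real \<Rightarrow> ('a::euclidean_space \<Rightarrow> complex) \<Rightarrow> ennreal" where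
  "weak_Lp_norm p F =
     (SUP l\<in>{0<..}. ennpowr (ennreal (l powr p) * emeasure lebesgue {z. l \<le> norm (F z)}) (1 / p))"

end

theory Submission
  imports Defs "HOL-Complex_Analysis.Complex_Analysis" "HOL-Real_Asymp.Real_Asymp" "HOL-Probability.Probability"
begin

text \<open>
  Every \<open>u\<close> in the Bessel potential space is, up to a constant comparable to \<open>s\<close>, the superposition
  $\int_0^\infty t^{s-1} e^{-t^2} (G_t * g)\, dt$ of Gaussian averages of $g = (I - \Delta)^{s/2} u$ at scale \<open>t\<close>;
  this is verified by testing against heat kernels and their Bessel potentials. In the difference of this
  integral at \<open>x\<close> and \<open>y\<close> the scales $t < |x - y|$ contribute at most the maximal function of \<open>g\<close>,
  times $|x - y|^s / s$; the factor $1 / s$ is the one that the constant compensates. At the scales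
  $t > |x - y|$ a first order expansion of the Gaussian leaves a quadratic remainder, which the maximal function
  controls again, and a linear term. Being odd, the linear term is an average over directions of truncated
  one-dimensional Hilbert transforms of \<open>g\<close>, uniformly in \<open>s\<close>; these are bounded in $L^p$ by the
  theorems of M. Riesz and Cotlar. So $|u(x) - u(y)| \le |x - y|^s (\Psi(x) + \Psi(y))$ with
  $\|\Psi\|_p \le C \|g\|_p$, and the set where the quotient is at least \<open>\<lambda>\<close> lies in
  $\{\lambda |x - y|^{N/p} \le \Psi(x) + \Psi(y)\}$, whose measure is at most $C \lambda^{-p} \|\Psi\|_p^p$.
\<close>

section \<open>Powers in the extended reals and the maximal function\<close>

text \<open>What rules out maximal functions alone is the limit s to 1: bounding the linear term
  that way costs the integral of t^(s - 2) over t > r, that is r^(s - 1) / (1 - s). Cancellation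
  must be used, and since the weight t^(s - 1) exp (-t^2) decreases in t, the second mean value
  theorem trades it for unweighted truncations with a factor 2 for every s; the quadratic remainder
  leaves only 1 / (2 - s). The truncations vary with r = |x - y|, so a maximal Hilbert transform is
  required and not just the Hilbert transform. Heat kernels serve as test functions because their
  Bessel potentials are again mixtures of Gaussians: the Fourier transforms are explicit, and the
  mixtures generate a class closed under differentiation, which settles membership in the Schwartz
  space. Conversely, heat kernels of all times and centres determine a function almost everywhere.
  The estimates are first proved for bounded real \<open>g\<close>, where Fubini and differences of
  integrals are unproblematic, with constants that do not see the bound; complex \<open>g\<close> in
  L^p follow by truncation.\<close>

lemma ennpowr_ennreal [simp]: "0 \<le> c \<Longrightarrow> ennpowr (ennreal c) r = ennreal (c powr r)"
  by (simp add: ennpowr_def)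

lemma ennpowr_top [simp]: "ennpowr \<infinity> r = \<infinity>" "ennpowr top r = top"
  by (simp_all add: ennpowr_def)

lemma ennpowr_zero [simp]: "ennpowr 0 r = 0"
  by (simp add: ennpowr_def)

lemma ennpowr_mono:
  assumes "x \<le> y" "0 < r"
  shows "ennpowr x r \<le> ennpowr y r"
proof (cases y)
  case (real b)
  then obtain a where a: "x = ennreal a" "0 \<le> a"
    using assms(1) by (cases x) (auto simp: top_unique)
  with real assms show ?thesis by (auto intro!: ennreal_leI powr_mono2)
qed auto

lemma ennpowr_inverse:
  assumes "0 < r" shows "ennpowr (ennpowr x r) (1 / r) = x" "ennpowr (ennpowr x (1 / r)) r = x"
  using assms by (cases x; auto simp: powr_powr)+

lemma borel_measurable_ennpowr [measurable (raw)]: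
  assumes "f \<in> borel_measurable M" shows "(\<lambda>x. ennpowr (f x) r) \<in> borel_measurable M"
  using assms unfolding ennpowr_def infinity_ennreal_def[symmetric] by measurable

lemma ennpowr_cmult:
  assumes "0 \<le> c" "0 < r"
  shows "ennpowr (ennreal c * x) r = ennreal (c powr r) * ennpowr x r"
proof (cases x)
  case (real a)
  then show ?thesis using assms by (simp flip: ennreal_mult add: powr_mult)
next
  case top
  then show ?thesis using assms by (cases "c = 0") (auto simp: ennreal_mult_top)
qed

text \<open>The bound x + y \<le> 2 max x y gives a constant that works for every positive
  exponent.\<close>

lemma ennpowr_add_le:
  assumes "0 < r"
  shows "ennpowr (x + y) r \<le> ennreal (2 powr r) * (ennpowr x r + ennpowr y r)"
proof -
  have "x + y \<le> ennreal 2 * max x y"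
    by (metis add_mono ennreal_numeral max.cobounded1 max.cobounded2 mult_2)
  then have "ennpowr (x + y) r \<le> ennreal (2 powr r) * ennpowr (max x y) r"
    using ennpowr_mono[OF _ assms] ennpowr_cmult[of 2 r] assms by (metis zero_le_numeral)
  also have "ennpowr (max x y) r \<le> ennpowr x r + ennpowr y r"
    by (cases "x \<le> y") (auto simp: max_def)
  finally show ?thesis by (simp add: mult_left_mono)
qed

text \<open>A positive power is an order isomorphism of the extended half-line, with the power 1 / r
  as its inverse, and so preserves suprema.\<close>

lemma ennpowr_SUP:
  assumes "0 < r" "I \<noteq> {}"
  shows "ennpowr (SUP i\<in>I. f i) r = (SUP i\<in>I. ennpowr (f i) r)"
proof (rule antisym)
  let ?z = "SUP i\<in>I. ennpowr (f i) r"
  have "f i \<le> ennpowr ?z (1 / r)" if "i \<in> I" for i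
    using ennpowr_mono[OF SUP_upper[OF that], of "1 / r" "\<lambda>i. ennpowr (f i) r"] assms
    by (simp add: ennpowr_inverse)
  then have "(SUP i\<in>I. f i) \<le> ennpowr ?z (1 / r)" by (rule SUP_least)
  then have "ennpowr (SUP i\<in>I. f i) r \<le> ennpowr (ennpowr ?z (1 / r)) r"
    by (rule ennpowr_mono[OF _ assms(1)])
  then show "ennpowr (SUP i\<in>I. f i) r \<le> ?z" using assms by (simp add: ennpowr_inverse)
qed (auto intro!: SUP_least ennpowr_mono SUP_upper assms)

lemma nn_integral_powr_from_0:
  fixes b p :: real
  assumes "0 < p" "0 \<le> b"
  shows "(\<integral>\<^sup>+ l. ennreal (l powr (p - 1)) * indicator {0<..<b} l \<partial>lborel) = ennreal (b powr p / p)"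
proof -
  have "((\<lambda>x. x powr (p - 1)) has_integral (b powr (p - 1 + 1) / (p - 1 + 1))) {0..b}"
    using assms by (intro has_integral_powr_from_0) auto
  then have h: "((\<lambda>x. x powr (p - 1)) has_integral (b powr p / p)) {0..b}" by simp
  have "(\<integral>\<^sup>+ l. ennreal (l powr (p - 1)) * indicator {0<..<b} l \<partial>lborel)
      = (\<integral>\<^sup>+ l. ennreal (indicator {0..b} l * l powr (p - 1)) \<partial>lborel)"
    using AE_lborel_singleton[of 0] AE_lborel_singleton[of b]
    by (intro nn_integral_cong_AE) (auto simp: indicator_def)
  also have "\<dots> = ennreal (b powr p / p)"
    using h by (intro nn_integral_has_integral_lborel)
      (auto simp: has_integral_restrict_UNIV[of "{0..b}", symmetric] indicator_def
        elim!: has_integral_eq[rotated])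
  finally show ?thesis .
qed

text \<open>The integral of p l^(p - 1) over 0 < l < x / c, multiplied by c^p. The free scale
  \<open>c\<close> is there because the maximal theorem compares the level (1 + w) l of the maximal
  function with the level l of the function.\<close>

lemma ennpowr_layer_cake:
  assumes "0 < p" "0 < c"
  shows "ennpowr x p
    = (\<integral>\<^sup>+ l. ennreal (c powr p * p * l powr (p - 1)) * indicator {l. 0 < l \<and> ennreal (c * l) < x} l \<partial>lborel)"
    (is "_ = ?I x")
proof -
  have fin: "ennpowr (ennreal b) p = ?I (ennreal b)" if "0 \<le> b" for b
  proof -
    have "?I (ennreal b) = (\<integral>\<^sup>+ l. ennreal (c powr p * p) * (ennreal (l powr (p - 1)) * indicator {0<..<b / c} l) \<partial>lborel)"
    proof (intro nn_integral_cong)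
      fix l :: real
      have "(0 < l \<and> ennreal (c * l) < ennreal b) = (0 < l \<and> l < b / c)"
        using assms ennreal_less_iff[of "c * l" b] by (auto simp: field_simps simp del: ennreal_mult'')
      then show "ennreal (c powr p * p * l powr (p - 1)) * indicator {l. 0 < l \<and> ennreal (c * l) < ennreal b} l
        = ennreal (c powr p * p) * (ennreal (l powr (p - 1)) * indicator {0<..<b / c} l)"
        using assms by (simp add: indicator_def ennreal_mult)
    qed
    also have "\<dots> = ennreal (c powr p * p) * ennreal ((b / c) powr p / p)"
      using assms that by (subst nn_integral_cmult) (auto simp: nn_integral_powr_from_0)
    also have "\<dots> = ennreal (b powr p)"
      using assms that by (subst ennreal_mult[symmetric]) (auto simp: powr_divide)
    finally show ?thesis using that by simp
  qed
  show ?thesis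
  proof (cases x)
    case (real b) then show ?thesis using fin by simp
  next
    case top
    \<comment> \<open>At infinity the integral dominates the one for each finite value n^(1 / p),
      which is n.\<close>
    have "ennreal (real n) \<le> ?I x" for n :: nat
    proof -
      have "ennreal (real n) = ennpowr (ennreal (real n powr (1 / p))) p"
        using assms by (simp add: powr_powr)
      also have "\<dots> = ?I (ennreal (real n powr (1 / p)))" by (intro fin) auto
      also have "\<dots> \<le> ?I x"
        by (intro nn_integral_mono) (auto simp: indicator_def top less_top)
      finally show ?thesis .
    qed
    moreover have "J = \<infinity>" if "\<And>n::nat. ennreal (real n) \<le> J" for J
      using that ennreal_Ex_less_of_nat[of J]
      by (metis less_top ennreal_of_nat_eq_real_of_nat leD infinity_ennreal_def)
    ultimately have "?I x = \<infinity>" by blast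
    then show ?thesis by (simp add: top)
  qed
qed

lemma ennpowr_mult_self:
  assumes "1 < p"
  shows "f * ennpowr f (p - 1) = ennpowr f p"
proof (cases f)
  case (real a)
  then show ?thesis using assms
    by (cases "a = 0") (auto simp flip: ennreal_mult simp: powr_diff)
qed (auto simp: ennreal_top_mult)

text \<open>The uncentred Hardy-Littlewood maximal function, normalised by r^N in place of the
  volume of the ball; the volume of the unit ball therefore enters the constants.\<close>

definition max_fun :: "('a::euclidean_space \<Rightarrow> ennreal) \<Rightarrow> 'a \<Rightarrow> ennreal" where
  "max_fun f x = (SUP (c, r)\<in>{(c, r). 0 < r \<and> x \<in> ball c r}.
     ennreal (1 / r ^ DIM('a)) * (\<integral>\<^sup>+y\<in>ball c r. f y \<partial>lborel))"

lemma max_fun_upper: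
  fixes f :: "'a::euclidean_space \<Rightarrow> ennreal"
  assumes "0 < r" "x \<in> ball c r"
  shows "ennreal (1 / r ^ DIM('a)) * (\<integral>\<^sup>+y\<in>ball c r. f y \<partial>lborel) \<le> max_fun f x"
  unfolding max_fun_def using assms by (intro SUP_upper2[of "(c, r)"]) auto

lemma max_fun_mono: "(\<And>x. f x \<le> g x) \<Longrightarrow> max_fun f x \<le> max_fun g x"
  unfolding max_fun_def
  by (intro SUP_mono') (auto intro!: mult_left_mono nn_integral_mono mult_right_mono)

lemma max_fun_add_le:
  assumes [measurable]: "f \<in> borel_measurable borel" "g \<in> borel_measurable borel"
  shows "max_fun (\<lambda>x. f x + g x) x \<le> max_fun f x + max_fun g x"
  unfolding max_fun_def[of "\<lambda>x. f x + g x"]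
proof (rule SUP_least, clarify)
  fix c :: 'a and r :: real assume "0 < r" "x \<in> ball c r"
  then show "ennreal (1 / r ^ DIM('a)) * (\<integral>\<^sup>+y\<in>ball c r. f y + g y \<partial>lborel) \<le> max_fun f x + max_fun g x"
    by (subst distrib_right, subst nn_integral_add)
      (auto simp: distrib_left simp del: mem_ball intro!: add_mono max_fun_upper)
qed

definition unit_vol :: "'a::euclidean_space itself \<Rightarrow> real" where
  "unit_vol _ = measure lborel (ball (0::'a) 1)"

lemma emeasure_ball_unit_vol:
  assumes "0 \<le> r"
  shows "emeasure lborel (ball (c::'a::euclidean_space) r) = ennreal (unit_vol TYPE('a) * r ^ DIM('a))"
  using emeasure_lborel_ball_finite[of c r] content_ball_conv_unit_ball[OF assms, of c]
  by (subst emeasure_eq_ennreal_measure) (auto simp: unit_vol_def mult.commute)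

lemma unit_vol_pos: "0 < unit_vol TYPE('a::euclidean_space)"
  unfolding unit_vol_def by (rule content_ball_pos) simp

lemma max_fun_const_le:
  "max_fun (\<lambda>_::'a::euclidean_space. ennreal l) x \<le> ennreal (unit_vol TYPE('a) * l)"
proof (cases "0 \<le> l")
  case True
  then show ?thesis
    unfolding max_fun_def
  proof (intro SUP_least, clarify)
    fix c :: 'a and r :: real assume r: "0 < r"
    have "(\<integral>\<^sup>+y\<in>ball c r. ennreal l \<partial>lborel) = ennreal l * ennreal (unit_vol TYPE('a) * r ^ DIM('a))"
      using r by (simp add: nn_integral_cmult_indicator emeasure_ball_unit_vol)
    then show "ennreal (1 / r ^ DIM('a)) * (\<integral>\<^sup>+y\<in>ball c r. ennreal l \<partial>lborel) \<le> ennreal (unit_vol TYPE('a) * l)"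
      using r True unit_vol_pos[where 'a='a] by (simp add: field_simps flip: ennreal_mult)
  qed
next
  case False
  then show ?thesis unfolding max_fun_def by (auto simp: ennreal_neg intro!: SUP_least)
qed

definition heavy_balls :: "('a::euclidean_space \<Rightarrow> ennreal) \<Rightarrow> ennreal \<Rightarrow> ('a \<times> real) set" where
  "heavy_balls f l = {(c, r). 0 < r \<and> l < ennreal (1 / r ^ DIM('a)) * (\<integral>\<^sup>+y\<in>ball c r. f y \<partial>lborel)}"

text \<open>Every point of a heavy ball, not only its centre, sees its average. Superlevel sets are
  thus unions of open balls, which settles measurability.\<close>

lemma max_fun_superlevel:
  fixes f :: "'a::euclidean_space \<Rightarrow> ennreal"
  shows "{x. l < max_fun f x} = (\<Union>i\<in>heavy_balls f l. ball (fst i) (snd i))"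
proof (rule set_eqI)
  fix x
  have "l < max_fun f x \<longleftrightarrow> (\<exists>i\<in>{(c, r). 0 < r \<and> x \<in> ball c r}.
      l < (case i of (c, r) \<Rightarrow> ennreal (1 / r ^ DIM('a)) * (\<integral>\<^sup>+y\<in>ball c r. f y \<partial>lborel)))"
    unfolding max_fun_def by (rule less_SUP_iff)
  also have "\<dots> \<longleftrightarrow> (\<exists>i\<in>heavy_balls f l. x \<in> ball (fst i) (snd i))"
    unfolding heavy_balls_def Bex_def by (intro ex_cong1) (simp add: case_prod_beta conj_ac)
  finally show "x \<in> {x. l < max_fun f x} \<longleftrightarrow> x \<in> (\<Union>i\<in>heavy_balls f l. ball (fst i) (snd i))"
    by blast
qed

lemma borel_measurable_max_fun [measurable]: "max_fun f \<in> borel_measurable borel"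
proof (rule borel_measurableI_greater)
  fix l
  have "open {x. l < max_fun f x}" unfolding max_fun_superlevel by auto
  then show "{x \<in> space borel. l < max_fun f x} \<in> sets borel" by simp
qed

text \<open>Vitali: disjoint heavy balls are chosen whose fivefold dilates cover the superlevel set.
  Each carries mass at least l r^N, and by disjointness the masses add up to at most the integral of
  \<open>f\<close>.\<close>

lemma max_fun_weak:
  fixes f :: "'a::euclidean_space \<Rightarrow> ennreal"
  assumes [measurable]: "f \<in> borel_measurable borel" and "0 < l"
  shows "emeasure lborel {x. ennreal l < max_fun f x}
    \<le> ennreal (5 ^ DIM('a) * unit_vol TYPE('a) / l) * (\<integral>\<^sup>+x. f x \<partial>lborel)"
proof (cases "(\<integral>\<^sup>+x. f x \<partial>lborel)")
  case top
  then show ?thesis using assms unit_vol_pos[where 'a='a] by (simp add: ennreal_mult_top)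
next
  case (real I)
  let ?K = "heavy_balls f (ennreal l)"
  have mass: "ennreal (l * r ^ DIM('a)) \<le> (\<integral>\<^sup>+y\<in>ball c r. f y \<partial>lborel)" if "(c, r) \<in> ?K" for c r
  proof -
    have r: "0 < r" and "ennreal l \<le> ennreal (1 / r ^ DIM('a)) * (\<integral>\<^sup>+y\<in>ball c r. f y \<partial>lborel)"
      using that by (auto simp: heavy_balls_def)
    then have "ennreal (r ^ DIM('a)) * ennreal l
        \<le> ennreal (r ^ DIM('a)) * (ennreal (1 / r ^ DIM('a)) * (\<integral>\<^sup>+y\<in>ball c r. f y \<partial>lborel))"
      by (intro mult_left_mono) auto
    also have "\<dots> = (\<integral>\<^sup>+y\<in>ball c r. f y \<partial>lborel)"
      using r by (simp add: mult.assoc[symmetric] ennreal_mult[symmetric])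
    finally show ?thesis using r assms by (simp add: ennreal_mult mult.commute)
  qed
  \<comment> \<open>The covering lemma needs bounded radii: l r^N \<le> I caps r at I / l as soon as
    r \<ge> 1.\<close>
  have bound: "0 < snd i \<and> snd i \<le> max 1 (I / l)" if i: "i \<in> ?K" for i
  proof -
    obtain c r where [simp]: "i = (c, r)" by force
    have r: "0 < r" using i by (auto simp: heavy_balls_def)
    have "ennreal (l * r ^ DIM('a)) \<le> (\<integral>\<^sup>+x. f x \<partial>lborel)"
      using mass[of c r] i by (auto elim!: order_trans intro!: nn_integral_mono simp: indicator_def)
    then have "l * r ^ DIM('a) \<le> I" using real by simp
    then have "r ^ DIM('a) \<le> I / l" using assms by (simp add: field_simps)
    moreover have "r \<le> r ^ DIM('a)" if "1 \<le> r"
      using that by (intro self_le_power) auto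
    ultimately show ?thesis using r by (cases "1 \<le> r") auto
  qed
  have sub: "{x. ennreal l < max_fun f x} \<subseteq> (\<Union>i\<in>?K. ball (fst i) (snd i))"
    by (simp add: max_fun_superlevel)
  obtain C where C: "countable C" "C \<subseteq> ?K"
     "pairwise (\<lambda>i j. disjnt (ball (fst i) (snd i)) (ball (fst j) (snd j))) C"
     "{x. ennreal l < max_fun f x} \<subseteq> (\<Union>i\<in>C. ball (fst i) (5 * snd i))"
    by (rule Vitali_covering_lemma_balls[OF sub bound])
  \<comment> \<open>The chosen balls and their dilates, reindexed by natural numbers. Indices that
    number no ball get the empty set, so finite and infinite families are both handled by
    series.\<close>
  define X where "X n = (if n \<in> to_nat_on C ` C then ball (fst (from_nat_into C n)) (snd (from_nat_into C n)) else {})" for n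
  define Y where "Y n = (if n \<in> to_nat_on C ` C then ball (fst (from_nat_into C n)) (5 * snd (from_nat_into C n)) else {})" for n
  have [measurable]: "X n \<in> sets borel" "Y n \<in> sets borel" for n by (auto simp: X_def Y_def)
  have disj: "disjoint_family X"
    unfolding disjoint_family_on_def
  proof (intro ballI impI)
    fix m n :: nat assume mn: "m \<noteq> n"
    show "X m \<inter> X n = {}"
    proof (cases "m \<in> to_nat_on C ` C \<and> n \<in> to_nat_on C ` C")
      case True
      then obtain i j where ij: "i \<in> C" "j \<in> C" "m = to_nat_on C i" "n = to_nat_on C j" by blast
      then have "i \<noteq> j" using mn by blast
      then have "ball (fst i) (snd i) \<inter> ball (fst j) (snd j) = {}"
        using C(3) ij unfolding pairwise_def disjnt_def by blast
      then show ?thesis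
        using C(1) ij(1,2) unfolding X_def ij(3,4) by (simp del: mem_ball)
    qed (auto simp: X_def)
  qed
  have cov: "{x. ennreal l < max_fun f x} \<subseteq> (\<Union>n. Y n)"
  proof
    fix x assume "x \<in> {x. ennreal l < max_fun f x}"
    then obtain i where i: "i \<in> C" "x \<in> ball (fst i) (5 * snd i)" using C(4) by blast
    then have "x \<in> Y (to_nat_on C i)" using C(1) unfolding Y_def by (simp del: mem_ball)
    then show "x \<in> (\<Union>n. Y n)" by blast
  qed
  have le: "emeasure lborel (Y n) \<le> ennreal (5 ^ DIM('a) * unit_vol TYPE('a) / l) * (\<integral>\<^sup>+y\<in>X n. f y \<partial>lborel)" for n
  proof (cases "n \<in> to_nat_on C ` C")
    case True
    obtain c r where cr: "from_nat_into C n = (c, r)" by force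
    obtain i where i: "i \<in> C" "n = to_nat_on C i" using True by blast
    then have "i = (c, r)" using cr C(1) by simp
    then have "(c, r) \<in> ?K" using i C(2) by blast
    then have m: "ennreal (l * r ^ DIM('a)) \<le> (\<integral>\<^sup>+y\<in>ball c r. f y \<partial>lborel)" and r: "0 < r"
      using mass by (auto simp: heavy_balls_def)
    have "emeasure lborel (Y n) = ennreal (5 ^ DIM('a) * unit_vol TYPE('a) / l) * ennreal (l * r ^ DIM('a))"
      using True r cr assms unit_vol_pos[where 'a='a]
      by (simp add: Y_def emeasure_ball_unit_vol power_mult_distrib flip: ennreal_mult)
    also have "\<dots> \<le> ennreal (5 ^ DIM('a) * unit_vol TYPE('a) / l) * (\<integral>\<^sup>+y\<in>X n. f y \<partial>lborel)"
      using m True cr by (intro mult_left_mono) (auto simp: X_def)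
    finally show ?thesis .
  qed (simp add: Y_def)
  have "emeasure lborel {x. ennreal l < max_fun f x} \<le> emeasure lborel (\<Union>n. Y n)"
    by (rule emeasure_mono[OF cov]) simp
  also have "\<dots> \<le> (\<Sum>n. emeasure lborel (Y n))"
    by (rule emeasure_subadditive_countably) auto
  also have "\<dots> \<le> (\<Sum>n. ennreal (5 ^ DIM('a) * unit_vol TYPE('a) / l) * (\<integral>\<^sup>+y\<in>X n. f y \<partial>lborel))"
    by (intro suminf_le le) auto
  also have "\<dots> = ennreal (5 ^ DIM('a) * unit_vol TYPE('a) / l) * (\<Sum>n. \<integral>\<^sup>+y\<in>X n. f y \<partial>lborel)"
    by simp
  also have "(\<Sum>n. \<integral>\<^sup>+y\<in>X n. f y \<partial>lborel) = (\<integral>\<^sup>+y\<in>(\<Union>n. X n). f y \<partial>lborel)"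
    using disj by (intro nn_integral_disjoint_family[symmetric]) auto
  also have "\<dots> \<le> (\<integral>\<^sup>+y. f y \<partial>lborel)"
    by (intro nn_integral_mono) (auto simp: indicator_def)
  finally show ?thesis by (simp add: mult_left_mono)
qed

text \<open>Marcinkiewicz interpolation between the weak bound for integrable functions and the
  bound for constants.\<close>

lemma max_fun_strong:
  fixes p :: real
  assumes p: "1 < p"
  shows "\<exists>C>0. \<forall>f :: 'a::euclidean_space \<Rightarrow> ennreal. f \<in> borel_measurable borel \<longrightarrow>
    (\<integral>\<^sup>+x. ennpowr (max_fun f x) p \<partial>lborel) \<le> ennreal C * (\<integral>\<^sup>+x. ennpowr (f x) p \<partial>lborel)"
proof -
  define w where "w = unit_vol TYPE('a)"
  have w: "0 < w" unfolding w_def by (rule unit_vol_pos)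
  define A where "A = 5 ^ DIM('a) * w"
  have A: "0 < A" using w by (simp add: A_def)
  \<comment> \<open>(1 + w)^p p is the layer-cake density at scale 1 + w, \<open>A\<close> the
    weak-type constant, and 1 / (p - 1) comes from integrating l^(p - 2) up to
    \<open>f x\<close>.\<close>
  define C where "C = (1 + w) powr p * p * A / (p - 1)"
  have "0 < C" unfolding C_def using w A p by auto
  moreover have "(\<integral>\<^sup>+x. ennpowr (max_fun f x) p \<partial>lborel) \<le> ennreal C * (\<integral>\<^sup>+x. ennpowr (f x) p \<partial>lborel)"
    if [measurable]: "f \<in> borel_measurable borel" for f :: "'a \<Rightarrow> ennreal"
  proof -
    \<comment> \<open>\<open>f\<close> is at most its part above height l plus the constant l, whose
      maximal function is at most w l. Exceeding (1 + w) l therefore forces the maximal function of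
      the part above l to exceed l.\<close>
    have lev: "emeasure lborel {x. ennreal ((1 + w) * l) < max_fun f x}
      \<le> ennreal (A / l) * (\<integral>\<^sup>+x. f x * indicator {x. ennreal l < f x} x \<partial>lborel)" if l: "0 < l" for l
    proof -
      let ?g = "\<lambda>x. f x * indicator {x. ennreal l < f x} x"
      have "max_fun f x \<le> max_fun ?g x + ennreal (w * l)" for x
      proof -
        have "max_fun f x \<le> max_fun (\<lambda>x. ?g x + ennreal l) x"
          by (intro max_fun_mono) (auto simp: indicator_def)
        also have "\<dots> \<le> max_fun ?g x + max_fun (\<lambda>_. ennreal l) x"
          by (intro max_fun_add_le) auto
        also have "max_fun (\<lambda>_. ennreal l) x \<le> ennreal (w * l)"
          unfolding w_def by (rule max_fun_const_le)
        finally show ?thesis by (simp add: add_left_mono)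
      qed
      then have "{x. ennreal ((1 + w) * l) < max_fun f x} \<subseteq> {x. ennreal l < max_fun ?g x}"
      proof (safe, goal_cases)
        case (1 x)
        have "ennreal l + ennreal (w * l) < max_fun ?g x + ennreal (w * l)"
          using less_le_trans[OF 1(2) 1(1)] l w by (simp add: distrib_right flip: ennreal_plus)
        then show ?case
          by (metis add_right_mono linorder_not_le)
      qed
      then have "emeasure lborel {x. ennreal ((1 + w) * l) < max_fun f x} \<le> emeasure lborel {x. ennreal l < max_fun ?g x}"
        by (intro emeasure_mono) auto
      also have "\<dots> \<le> ennreal (A / l) * (\<integral>\<^sup>+x. ?g x \<partial>lborel)"
        unfolding A_def w_def using l by (intro max_fun_weak) auto
      finally show ?thesis .
    qed
    have "(\<integral>\<^sup>+x. ennpowr (max_fun f x) p \<partial>lborel)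
      = (\<integral>\<^sup>+x. \<integral>\<^sup>+ l. ennreal ((1 + w) powr p * p * l powr (p - 1)) *
          indicator {l. 0 < l \<and> ennreal ((1 + w) * l) < max_fun f x} l \<partial>lborel \<partial>lborel)"
      using p w by (subst ennpowr_layer_cake[of p "1 + w"]) auto
    also have "\<dots> = (\<integral>\<^sup>+l. \<integral>\<^sup>+ x. ennreal ((1 + w) powr p * p * l powr (p - 1)) *
          indicator {l. 0 < l \<and> ennreal ((1 + w) * l) < max_fun f x} l \<partial>lborel \<partial>lborel)"
      by (rule lborel_pair.Fubini') measurable
    also have "\<dots> \<le> (\<integral>\<^sup>+l. \<integral>\<^sup>+ x. ennreal C * (ennreal ((p - 1) * l powr (p - 2)) * f x *
          indicator {l. 0 < l \<and> ennreal l < f x} l) \<partial>lborel \<partial>lborel)"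
    proof (rule nn_integral_mono)
      fix l :: real
      show "(\<integral>\<^sup>+ x. ennreal ((1 + w) powr p * p * l powr (p - 1)) *
          indicator {l. 0 < l \<and> ennreal ((1 + w) * l) < max_fun f x} l \<partial>lborel)
        \<le> (\<integral>\<^sup>+ x. ennreal C * (ennreal ((p - 1) * l powr (p - 2)) * f x *
          indicator {l. 0 < l \<and> ennreal l < f x} l) \<partial>lborel)"
      proof (cases "0 < l")
        case True
        have "(\<integral>\<^sup>+ x. ennreal ((1 + w) powr p * p * l powr (p - 1)) *
          indicator {l. 0 < l \<and> ennreal ((1 + w) * l) < max_fun f x} l \<partial>lborel)
          = (\<integral>\<^sup>+ x. ennreal ((1 + w) powr p * p * l powr (p - 1)) *
          indicator {x. ennreal ((1 + w) * l) < max_fun f x} x \<partial>lborel)"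
          using True by (intro nn_integral_cong) (auto simp: indicator_def)
        also have "\<dots> = ennreal ((1 + w) powr p * p * l powr (p - 1)) * emeasure lborel {x. ennreal ((1 + w) * l) < max_fun f x}"
          by (rule nn_integral_cmult_indicator) simp
        also have "\<dots> \<le> ennreal ((1 + w) powr p * p * l powr (p - 1)) *
           (ennreal (A / l) * (\<integral>\<^sup>+x. f x * indicator {x. ennreal l < f x} x \<partial>lborel))"
          by (intro mult_left_mono lev True) auto
        also have "\<dots> = ennreal (C * ((p - 1) * l powr (p - 2))) * (\<integral>\<^sup>+x. f x * indicator {x. ennreal l < f x} x \<partial>lborel)"
        proof -
          have "l powr (p - 1) / l = l powr (p - 2)"
            using True powr_diff[of l "p - 1" 1] by simp
          then have "l powr (p - 1) = l * l powr (p - 2)"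
            using True by (simp add: field_simps)
          then have "(1 + w) powr p * p * l powr (p - 1) * (A / l) = C * ((p - 1) * l powr (p - 2))"
            using p True by (simp add: C_def)
          then show ?thesis
            using p A True by (subst mult.assoc[symmetric], subst ennreal_mult[symmetric]) auto
        qed
        also have "\<dots> = (\<integral>\<^sup>+ x. ennreal C * (ennreal ((p - 1) * l powr (p - 2)) * f x *
          indicator {l. 0 < l \<and> ennreal l < f x} l) \<partial>lborel)"
          using True p \<open>0 < C\<close> by (subst nn_integral_cmult[symmetric])
            (auto simp: ennreal_mult mult.assoc indicator_def intro!: nn_integral_cong)
        finally show ?thesis .
      qed (simp add: indicator_def)
    qed
    also have "\<dots> = (\<integral>\<^sup>+x. \<integral>\<^sup>+ l. ennreal C * (ennreal ((p - 1) * l powr (p - 2)) * f x *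
          indicator {l. 0 < l \<and> ennreal l < f x} l) \<partial>lborel \<partial>lborel)"
      by (rule lborel_pair.Fubini') measurable
    \<comment> \<open>The inner integral is the layer cake for the exponent p - 1 at scale 1, and f
      f^(p - 1) = f^p.\<close>
    also have "\<dots> = (\<integral>\<^sup>+x. ennreal C * ennpowr (f x) p \<partial>lborel)"
    proof (rule nn_integral_cong)
      fix x
      have "(\<integral>\<^sup>+ l. ennreal C * (ennreal ((p - 1) * l powr (p - 2)) * f x *
          indicator {l. 0 < l \<and> ennreal l < f x} l) \<partial>lborel)
        = (\<integral>\<^sup>+ l. ennreal C * f x * (ennreal (1 powr (p - 1) * (p - 1) * l powr (p - 1 - 1)) *
          indicator {l. 0 < l \<and> ennreal (1 * l) < f x} l) \<partial>lborel)"
        by (intro nn_integral_cong) (simp add: mult_ac)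
      also have "\<dots> = ennreal C * f x * ennpowr (f x) (p - 1)"
        using p by (subst nn_integral_cmult, simp, subst ennpowr_layer_cake[of "p - 1" 1 "f x"]) auto
      finally show "(\<integral>\<^sup>+ l. ennreal C * (ennreal ((p - 1) * l powr (p - 2)) * f x *
          indicator {l. 0 < l \<and> ennreal l < f x} l) \<partial>lborel) = ennreal C * ennpowr (f x) p"
        using ennpowr_mult_self[OF p, of "f x"] by (simp add: mult.assoc)
    qed
    also have "\<dots> = ennreal C * (\<integral>\<^sup>+x. ennpowr (f x) p \<partial>lborel)"
      by (rule nn_integral_cmult) simp
    finally show ?thesis .
  qed
  ultimately show ?thesis by auto
qed

section \<open>Averages against rescaled decaying kernels under the maximal function\<close>

lemma nn_integral_lborel_affine:
  fixes f :: "'a::euclidean_space \<Rightarrow> ennreal"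
  assumes [measurable]: "f \<in> borel_measurable borel" and "c \<noteq> 0"
  shows "(\<integral>\<^sup>+x. f x \<partial>lborel) = ennreal (\<bar>c\<bar> ^ DIM('a)) * (\<integral>\<^sup>+v. f (a + c *\<^sub>R v) \<partial>lborel)"
  by (subst lborel_affine[OF assms(2), of a])
    (simp add: nn_integral_density nn_integral_distr nn_integral_cmult)

lemma max_fun_ball:
  fixes f :: "'a::euclidean_space \<Rightarrow> ennreal"
  assumes [measurable]: "f \<in> borel_measurable borel" and t: "0 < t" "0 < R"
  shows "(\<integral>\<^sup>+v. indicator (ball 0 R) v * f (x - t *\<^sub>R v) \<partial>lborel) \<le> ennreal (R ^ DIM('a)) * max_fun f x"
proof -
  let ?I = "\<integral>\<^sup>+v. indicator (ball 0 R) v * f (x - t *\<^sub>R v) \<partial>lborel"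
  have "(\<integral>\<^sup>+y. f y * indicator (ball x (t * R)) y \<partial>lborel)
      = ennreal (\<bar>- t\<bar> ^ DIM('a)) * (\<integral>\<^sup>+v. f (x + (- t) *\<^sub>R v) * indicator (ball x (t * R)) (x + (- t) *\<^sub>R v) \<partial>lborel)"
    using t by (intro nn_integral_lborel_affine) (measurable, auto)
  also have "(\<integral>\<^sup>+v. f (x + (- t) *\<^sub>R v) * indicator (ball x (t * R)) (x + (- t) *\<^sub>R v) \<partial>lborel) = ?I"
    using assms by (intro nn_integral_cong) (auto simp: indicator_def dist_norm)
  finally have eq: "(\<integral>\<^sup>+y. f y * indicator (ball x (t * R)) y \<partial>lborel) = ennreal (t ^ DIM('a)) * ?I"
    using assms by simp
  have "?I = ennreal (R ^ DIM('a)) * (ennreal (1 / (t * R) ^ DIM('a)) * (ennreal (t ^ DIM('a)) * ?I))"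
    using assms by (simp add: mult.assoc[symmetric] power_mult_distrib flip: ennreal_mult)
  also have "\<dots> \<le> ennreal (R ^ DIM('a)) * max_fun f x"
    unfolding eq[symmetric] using assms by (intro mult_left_mono max_fun_upper) auto
  finally show ?thesis .
qed

lemma ennreal_term_le_suminf: "F (k::nat) \<le> (\<Sum>j. F j :: ennreal)"
  using sum_le_suminf[of F "{k}"] by simp

text \<open>Only the term of the least \<open>k\<close> with \<open>norm v < 2 ^ k\<close> is used;
  by minimality 2^k \<le> 2 (1 + norm v).\<close>

lemma dyadic_kernel_bound:
  fixes v :: "'a::euclidean_space"
  shows "ennreal (1 / (1 + norm v) ^ Suc n)
    \<le> (\<Sum>k. ennreal (2 ^ Suc n / 2 ^ (k * Suc n)) * indicator (ball 0 (2 ^ k)) v)"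
proof -
  define k where "k = (LEAST k::nat. norm v < 2 ^ k)"
  have ex: "\<exists>k::nat. norm v < 2 ^ k" using real_arch_pow[of 2 "norm v"] by auto
  have k: "norm v < 2 ^ k" unfolding k_def using ex by (rule LeastI_ex)
  have "2 ^ k \<le> 2 * (1 + norm v)"
  proof (cases k)
    case (Suc j)
    then have "\<not> norm v < 2 ^ j" unfolding k_def by (intro not_less_Least) simp
    then show ?thesis using Suc by simp
  qed simp
  then have "1 / (1 + norm v) \<le> 2 / 2 ^ k"
    by (simp add: field_simps add_pos_nonneg)
  then have "(1 / (1 + norm v)) ^ Suc n \<le> (2 / 2 ^ k) ^ Suc n" by (intro power_mono) auto
  then have "1 / (1 + norm v) ^ Suc n \<le> 2 ^ Suc n / 2 ^ (k * Suc n)"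
    unfolding power_mult power_divide by simp
  then have "ennreal (1 / (1 + norm v) ^ Suc n) \<le> ennreal (2 ^ Suc n / 2 ^ (k * Suc n)) * indicator (ball 0 (2 ^ k)) v"
    using k by (simp add: indicator_def del: power_Suc)
  also have "\<dots> \<le> (\<Sum>j. ennreal (2 ^ Suc n / 2 ^ (j * Suc n)) * indicator (ball 0 (2 ^ j)) v)"
    by (rule ennreal_term_le_suminf)
  finally show ?thesis .
qed

text \<open>The ball of radius 2^k contributes 2^(k N) times the maximal function against the
  coefficient 2^(N + 1) 2^(-k (N + 1)). The exponent N + 1 thus leaves a geometric series, with sum
  2^(N + 2).\<close>

lemma max_fun_kernel:
  fixes f :: "'a::euclidean_space \<Rightarrow> ennreal"
  assumes [measurable]: "f \<in> borel_measurable borel" and t: "0 < t"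
  shows "(\<integral>\<^sup>+v. ennreal (1 / (1 + norm v) ^ Suc DIM('a)) * f (x - t *\<^sub>R v) \<partial>lborel)
    \<le> ennreal (2 ^ (DIM('a) + 2)) * max_fun f x"
proof -
  let ?n = "DIM('a)"
  have "(\<integral>\<^sup>+v. ennreal (1 / (1 + norm v) ^ Suc ?n) * f (x - t *\<^sub>R v) \<partial>lborel)
    \<le> (\<integral>\<^sup>+v. (\<Sum>k. ennreal (2 ^ Suc ?n / 2 ^ (k * Suc ?n)) * (indicator (ball 0 (2 ^ k)) v * f (x - t *\<^sub>R v))) \<partial>lborel)"
    unfolding mult.assoc[symmetric] ennreal_suminf_multc
    by (intro nn_integral_mono mult_right_mono dyadic_kernel_bound) auto
  also have "\<dots> = (\<Sum>k. ennreal (2 ^ Suc ?n / 2 ^ (k * Suc ?n)) * (\<integral>\<^sup>+v. indicator (ball 0 (2 ^ k)) v * f (x - t *\<^sub>R v) \<partial>lborel))"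
  proof -
    have [measurable]: "(\<lambda>v. indicator (ball 0 (2 ^ k)) v * f (x - t *\<^sub>R v)) \<in> borel_measurable lborel" for k :: nat
    proof -
      have "(\<lambda>v. indicator (ball 0 (2 ^ k)) v * f (x - t *\<^sub>R v)) \<in> borel_measurable borel"
        by (rule borel_measurable_times_ennreal) (measurable, auto)
      then show ?thesis by simp
    qed
    show ?thesis by (subst nn_integral_suminf, measurable, subst nn_integral_cmult, measurable)
  qed
  also have "\<dots> \<le> (\<Sum>k. ennreal (2 ^ Suc ?n / 2 ^ (k * Suc ?n)) * (ennreal ((2 ^ k) ^ ?n) * max_fun f x))"
    by (intro suminf_le mult_left_mono max_fun_ball t) auto
  also have "\<dots> = (\<Sum>k. ennreal (2 ^ Suc ?n * (1 / 2) ^ k)) * max_fun f x"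
  proof -
    have "ennreal (2 ^ Suc ?n / 2 ^ (k * Suc ?n)) * ennreal ((2 ^ k) ^ ?n) = ennreal (2 ^ Suc ?n * (1 / 2) ^ k)" for k :: nat
      by (simp flip: ennreal_mult power_mult add: power_add field_simps)
    then show ?thesis by (simp add: mult.assoc[symmetric] del: power_Suc)
  qed
  also have "(\<Sum>k. ennreal (2 ^ Suc ?n * (1 / 2) ^ k)) = ennreal (\<Sum>k. 2 ^ Suc ?n * (1 / 2) ^ k)"
    by (intro suminf_ennreal2 summable_mult) auto
  also have "(\<Sum>k. 2 ^ Suc ?n * (1 / 2 :: real) ^ k) = 2 ^ (?n + 2)"
    by (subst suminf_mult) (auto simp: suminf_geometric)
  finally show ?thesis .
qed

section \<open>M. Riesz's theorem on conjugate functions\<close>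

text \<open>For 1 < p \<le> 2 the angle p \<theta> has passed pi / 2 but not pi when \<theta> is
  close to pi / 2, so there -B cos (p \<theta>) alone pays for the sine. At smaller \<theta> the
  cosine of \<theta> is bounded below and the term with \<open>A\<close> pays.\<close>

lemma cos_riesz_ineq:
  fixes p :: real
  assumes "1 < p" "p \<le> 2"
  obtains A B where "0 < A" "0 < B"
    "\<And>\<theta>. \<bar>\<theta>\<bar> < pi / 2 \<Longrightarrow> \<bar>sin \<theta>\<bar> powr p \<le> A * cos \<theta> powr p - B * cos (p * \<theta>)"
proof -
  \<comment> \<open>The midpoint of pi / (2 p), where cos (p \<theta>) changes sign, and pi /
    2.\<close>
  define \<theta>0 where "\<theta>0 = (pi / 2) * ((1 + 1 / p) / 2)"
  have "1 / p < 1" using assms by simp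
  moreover have "pi * 1 < pi * p" using assms by (intro mult_strict_left_mono) auto
  ultimately have \<theta>0: "0 < \<theta>0" "\<theta>0 < pi / 2" "pi / 2 < p * \<theta>0"
    using assms by (auto simp: \<theta>0_def field_simps intro!: add_pos_pos)
  have "p * \<theta>0 \<le> 2 * \<theta>0" using assms \<theta>0 by (intro mult_right_mono) auto
  then have p\<theta>0: "p * \<theta>0 < pi" using \<theta>0 by linarith
  have c: "cos (p * \<theta>0) < 0" using \<theta>0 p\<theta>0 cos_monotone_0_pi[of "pi / 2" "p * \<theta>0"] by simp
  \<comment> \<open>\<open>B\<close> makes -B cos (p \<theta>) at least 1 beyond \<theta>0;
    \<open>A\<close> makes A cos^p \<theta> at least 1 + B before it, which also covers the loss of
    at most \<open>B\<close> there.\<close>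
  define B where "B = 1 / - cos (p * \<theta>0)"
  define A where "A = (1 + B) / cos \<theta>0 powr p"
  have B: "0 < B" using c by (simp add: B_def divide_pos_pos zero_less_divide_iff)
  have c0: "0 < cos \<theta>0" using \<theta>0 by (intro cos_gt_zero_pi) auto
  have A: "0 < A" using B c0 by (simp add: A_def)
  have main: "\<bar>sin \<theta>\<bar> powr p \<le> A * cos \<theta> powr p - B * cos (p * \<theta>)" if \<theta>: "0 \<le> \<theta>" "\<theta> < pi / 2" for \<theta>
  proof -
    have s1: "\<bar>sin \<theta>\<bar> powr p \<le> 1" using assms by (intro powr_le1) auto
    show ?thesis
    proof (cases "\<theta>0 \<le> \<theta>")
      case True
      have "p * \<theta> \<le> 2 * \<theta>" using assms \<theta> by (intro mult_right_mono) auto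
      then have "p * \<theta> \<le> pi" using \<theta> by linarith
      then have "cos (p * \<theta>) \<le> cos (p * \<theta>0)"
        using True assms \<theta>0 by (intro cos_monotone_0_pi_le) auto
      then have "1 \<le> - B * cos (p * \<theta>)" using c by (simp add: B_def field_simps)
      moreover have "0 \<le> A * cos \<theta> powr p" using A by simp
      ultimately show ?thesis using s1 by linarith
    next
      case False
      then have "cos \<theta>0 \<le> cos \<theta>" using \<theta> \<theta>0 by (intro cos_monotone_0_pi_le) auto
      then have "cos \<theta>0 powr p \<le> cos \<theta> powr p" using c0 assms by (intro powr_mono2) auto
      then have "1 + B \<le> A * cos \<theta> powr p" using c0 B mult_left_mono[of "cos \<theta>0 powr p" "cos \<theta> powr p" "1 + B"] by (simp add: A_def pos_le_divide_eq)
      moreover have "B * cos (p * \<theta>) \<le> B" using B by simp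
      ultimately show ?thesis using s1 by linarith
    qed
  qed
  show ?thesis
  proof (rule that[OF A B])
    fix \<theta> :: real assume "\<bar>\<theta>\<bar> < pi / 2"
    then show "\<bar>sin \<theta>\<bar> powr p \<le> A * cos \<theta> powr p - B * cos (p * \<theta>)"
      using main[of "\<bar>\<theta>\<bar>"] by (cases "0 \<le> \<theta>") auto
  qed
qed

text \<open>In polar coordinates both sides are homogeneous of degree p, so this is the
  trigonometric inequality times |z|^p; on the right half-plane the principal power has argument p
  \<theta>.\<close>

lemma powr_riesz_ineq:
  fixes p :: real
  assumes "1 < p" "p \<le> 2"
  obtains A B where "0 < A" "0 < B"
    "\<And>z. 0 < Re z \<Longrightarrow> \<bar>Im z\<bar> powr p \<le> A * Re z powr p - B * Re (z powr of_real p)"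
proof -
  obtain A B where AB: "0 < A" "0 < B"
    "\<And>\<theta>. \<bar>\<theta>\<bar> < pi / 2 \<Longrightarrow> \<bar>sin \<theta>\<bar> powr p \<le> A * cos \<theta> powr p - B * cos (p * \<theta>)"
    using cos_riesz_ineq[OF assms] by blast
  show ?thesis
  proof (rule that[OF AB(1,2)])
    fix z :: complex assume z: "0 < Re z"
    then have nz: "z \<noteq> 0" by auto
    define \<theta> where "\<theta> = Im (Ln z)"
    have \<theta>: "\<bar>\<theta>\<bar> < pi / 2" using z Re_Ln_pos_lt[OF nz] unfolding \<theta>_def by blast
    have z_eq: "z = of_real (norm z) * cis \<theta>"
      unfolding \<theta>_def using nz
      by (metis Re_Ln cis_conv_exp complex_eq exp_Ln exp_add exp_of_real norm_eq_zero exp_ln zero_less_norm_iff)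
    have "Im z = norm z * sin \<theta>" "Re z = norm z * cos \<theta>"
      by (subst z_eq, simp)+
    moreover have "0 < cos \<theta>" using \<theta> by (intro cos_gt_zero_pi) auto
    moreover have "Re (z powr of_real p) = norm z powr p * cos (p * \<theta>)"
      using nz by (simp add: powr_def Re_exp \<theta>_def)
    moreover have "norm z powr p * \<bar>sin \<theta>\<bar> powr p \<le> norm z powr p * (A * cos \<theta> powr p - B * cos (p * \<theta>))"
      by (intro mult_left_mono AB \<theta>) auto
    ultimately show "\<bar>Im z\<bar> powr p \<le> A * Re z powr p - B * Re (z powr of_real p)"
      by (simp add: abs_mult powr_mult algebra_simps)
  qed
qed

text \<open>Bounded functions vanishing outside an interval: the kernel integrals below converge
  absolutely on them, and the class survives positive parts, translations and the cut-off dual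
  function used for large exponents.\<close>

definition bdd_cs :: "(real \<Rightarrow> real) \<Rightarrow> bool" where
  "bdd_cs f \<longleftrightarrow> f \<in> borel_measurable borel \<and> (\<exists>K A. \<forall>x. \<bar>f x\<bar> \<le> K \<and> (A < \<bar>x\<bar> \<longrightarrow> f x = 0))"

lemma bdd_csD [measurable_dest]: "bdd_cs f \<Longrightarrow> f \<in> borel_measurable borel"
  by (simp add: bdd_cs_def)

lemma bdd_csE:
  assumes "bdd_cs f"
  obtains K A where "0 < K" "0 < A" "\<And>x. \<bar>f x\<bar> \<le> K" "\<And>x. A < \<bar>x\<bar> \<Longrightarrow> f x = 0"
proof -
  obtain K A where "\<And>x. \<bar>f x\<bar> \<le> K" "\<And>x. A < \<bar>x\<bar> \<Longrightarrow> f x = 0"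
    using assms unfolding bdd_cs_def by blast
  then show ?thesis by (intro that[of "\<bar>K\<bar> + 1" "\<bar>A\<bar> + 1"]) (auto intro: order_trans[of _ K])
qed

lemma bdd_cs_mono:
  assumes "bdd_cs f" "g \<in> borel_measurable borel" "\<And>x. \<bar>g x\<bar> \<le> c * \<bar>f x\<bar>"
  shows "bdd_cs g"
proof -
  obtain K A where KA: "0 < K" "0 < A" "\<And>x. \<bar>f x\<bar> \<le> K" "\<And>x. A < \<bar>x\<bar> \<Longrightarrow> f x = 0"
    using bdd_csE[OF assms(1)] by blast
  have "\<bar>g x\<bar> \<le> \<bar>c\<bar> * K" for x
  proof -
    have "\<bar>g x\<bar> \<le> \<bar>c\<bar> * \<bar>f x\<bar>" using assms(3)[of x] mult_right_mono[of c "\<bar>c\<bar>" "\<bar>f x\<bar>"] by linarith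
    also have "\<dots> \<le> \<bar>c\<bar> * K" by (intro mult_left_mono KA) auto
    finally show ?thesis .
  qed
  moreover have "g x = 0" if "A < \<bar>x\<bar>" for x using assms(3)[of x] KA(4)[OF that] by simp
  ultimately show ?thesis unfolding bdd_cs_def using assms(2) by blast
qed

lemma integrable_bdd_cs_mult:
  fixes k :: "real \<Rightarrow> 'b::{real_normed_field, banach, second_countable_topology}"
  assumes f: "bdd_cs f" and [measurable]: "k \<in> borel_measurable borel" and k: "\<And>x. norm (k x) \<le> B"
  shows "integrable lborel (\<lambda>x. k x * of_real (f x))"
proof -
  obtain K A where KA: "0 < K" "0 < A" "\<And>x. \<bar>f x\<bar> \<le> K" "\<And>x. A < \<bar>x\<bar> \<Longrightarrow> f x = 0"
    using bdd_csE[OF f] by blast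
  have [measurable]: "f \<in> borel_measurable borel" using f by (rule bdd_csD)
  have "0 \<le> B" using k[of 0] norm_ge_zero order_trans by blast
  have i: "integrable lborel (\<lambda>x. indicator {-A..A} x * (B * K) :: real)"
    by (intro integrable_mult_left integrable_real_indicator) (auto simp: emeasure_lborel_Icc_eq)
  show ?thesis
  proof (rule Bochner_Integration.integrable_bound[OF i])
    show "AE x in lborel. norm (k x * of_real (f x)) \<le> norm (indicator {-A..A} x * (B * K) :: real)"
    proof (intro AE_I2)
      fix x
      show "norm (k x * of_real (f x)) \<le> norm (indicator {-A..A} x * (B * K) :: real)"
      proof (cases "A < \<bar>x\<bar>")
        case False
        then show ?thesis using KA(1) KA(3)[of x] k[of x] \<open>0 \<le> B\<close>
          by (auto simp: indicator_def norm_mult abs_mult intro!: mult_mono)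
      qed (simp add: KA)
    qed
  qed simp
qed

lemma integrable_bdd_cs: "bdd_cs f \<Longrightarrow> integrable lborel f"
  using integrable_bdd_cs_mult[of f "\<lambda>_. 1::real" 1] by simp

text \<open>The classical kernel carries a factor 1 / pi. It is dropped here and in the conjugate
  integral, and returns as the \<open>pi\<close> of the semigroup law.\<close>

definition poisson :: "real \<Rightarrow> (real \<Rightarrow> real) \<Rightarrow> real \<Rightarrow> real" where
  "poisson e f x = (LINT t|lborel. e / ((x - t)\<^sup>2 + e\<^sup>2) * f t)"

definition conj_poisson :: "real \<Rightarrow> (real \<Rightarrow> real) \<Rightarrow> real \<Rightarrow> real" where
  "conj_poisson e f x = (LINT t|lborel. (x - t) / ((x - t)\<^sup>2 + e\<^sup>2) * f t)"

lemma poisson_kernel_bounds: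
  fixes e x :: real
  assumes "0 < e"
  shows "\<bar>e / (x\<^sup>2 + e\<^sup>2)\<bar> \<le> 1 / e" "\<bar>x / (x\<^sup>2 + e\<^sup>2)\<bar> \<le> 1 / e"
proof -
  have p: "0 < x\<^sup>2 + e\<^sup>2" using assms by (intro add_nonneg_pos) auto
  show "\<bar>e / (x\<^sup>2 + e\<^sup>2)\<bar> \<le> 1 / e" using p assms by (simp add: divide_simps power2_eq_square)
  have "0 \<le> (\<bar>x\<bar> - e)\<^sup>2" by simp
  then have "2 * (\<bar>x\<bar> * e) \<le> x\<^sup>2 + e\<^sup>2" by (simp add: power2_diff)
  then have "\<bar>x\<bar> * e \<le> x\<^sup>2 + e\<^sup>2" using p by linarith
  then show "\<bar>x / (x\<^sup>2 + e\<^sup>2)\<bar> \<le> 1 / e" using p assms by (simp add: divide_simps)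
qed

lemma integrable_poisson:
  assumes "bdd_cs f" "0 < e"
  shows "integrable lborel (\<lambda>t. e / ((x - t)\<^sup>2 + e\<^sup>2) * f t)"
    "integrable lborel (\<lambda>t. (x - t) / ((x - t)\<^sup>2 + e\<^sup>2) * f t)"
  using integrable_bdd_cs_mult[OF assms(1), of "\<lambda>t. e / ((x - t)\<^sup>2 + e\<^sup>2)" "1 / e"]
    integrable_bdd_cs_mult[OF assms(1), of "\<lambda>t. (x - t) / ((x - t)\<^sup>2 + e\<^sup>2)" "1 / e"]
    poisson_kernel_bounds[OF assms(2)] by auto

lemma borel_measurable_poisson [measurable]:
  assumes [measurable]: "f \<in> borel_measurable borel"
  shows "poisson e f \<in> borel_measurable borel" "conj_poisson e f \<in> borel_measurable borel"
  unfolding poisson_def[abs_def] conj_poisson_def[abs_def] by measurable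

text \<open>With t = x - e v the kernel becomes 1 / (1 + v^2) \<le> 2 / (1 + |v|)^2, the case N = 1
  of \<open>max_fun_kernel\<close>; the constant is 2 times 2^3.\<close>

lemma poisson_le_max_fun:
  fixes h :: "real \<Rightarrow> ennreal"
  assumes [measurable]: "h \<in> borel_measurable borel" and e: "0 < e"
  shows "(\<integral>\<^sup>+t. ennreal (e / ((x - t)\<^sup>2 + e\<^sup>2)) * h t \<partial>lborel) \<le> ennreal 16 * max_fun h x"
proof -
  have "(\<integral>\<^sup>+t. ennreal (e / ((x - t)\<^sup>2 + e\<^sup>2)) * h t \<partial>lborel)
    = ennreal (\<bar>- e\<bar> ^ DIM(real)) * (\<integral>\<^sup>+v. ennreal (e / ((x - (x + (- e) *\<^sub>R v))\<^sup>2 + e\<^sup>2)) * h (x + (- e) *\<^sub>R v) \<partial>lborel)"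
    using e by (intro nn_integral_lborel_affine) simp_all
  also have "\<dots> = (\<integral>\<^sup>+v. ennreal e * (ennreal (e / ((x - (x + (- e) *\<^sub>R v))\<^sup>2 + e\<^sup>2)) * h (x + (- e) *\<^sub>R v)) \<partial>lborel)"
    using e by (subst nn_integral_cmult) auto
  also have "\<dots> \<le> (\<integral>\<^sup>+v. ennreal 2 * (ennreal (1 / (1 + norm v) ^ Suc DIM(real)) * h (x - e *\<^sub>R v)) \<partial>lborel)"
  proof (rule nn_integral_mono)
    fix v :: real
    have "e * (e / ((e * v)\<^sup>2 + e\<^sup>2)) = 1 / (1 + v\<^sup>2)"
    proof -
      have "e * (e / ((e * v)\<^sup>2 + e\<^sup>2)) = (e * e) / ((e * e) * (1 + v\<^sup>2))"
        by (simp add: power_mult_distrib algebra_simps power2_eq_square)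
      also have "\<dots> = 1 / (1 + v\<^sup>2)" using e by simp
      finally show ?thesis .
    qed
    also have "\<dots> \<le> 2 / (1 + \<bar>v\<bar>)\<^sup>2"
    proof -
      have "0 \<le> (1 - \<bar>v\<bar>)\<^sup>2" by simp
      then have "(1 + \<bar>v\<bar>)\<^sup>2 \<le> 2 * (1 + v\<^sup>2)" by (simp add: power2_sum power2_diff)
      then show ?thesis by (simp add: divide_simps add_pos_nonneg)
    qed
    finally have "e * (e / ((e * v)\<^sup>2 + e\<^sup>2)) \<le> 2 * (1 / (1 + norm v) ^ Suc DIM(real))" by (simp add: power2_eq_square)
    then have "ennreal e * ennreal (e / ((e * v)\<^sup>2 + e\<^sup>2)) \<le> ennreal 2 * ennreal (1 / (1 + norm v) ^ Suc DIM(real))"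
      using e by (subst (1 2) ennreal_mult[symmetric]) (auto intro!: ennreal_leI)
    then show "ennreal e * (ennreal (e / ((x - (x + (- e) *\<^sub>R v))\<^sup>2 + e\<^sup>2)) * h (x + (- e) *\<^sub>R v))
      \<le> ennreal 2 * (ennreal (1 / (1 + norm v) ^ Suc DIM(real)) * h (x - e *\<^sub>R v))"
      using mult_right_mono[of _ _ "h (x - e * v)"] by (simp add: mult.assoc[symmetric])
  qed
  also have "\<dots> = ennreal 2 * (\<integral>\<^sup>+v. ennreal (1 / (1 + norm v) ^ Suc DIM(real)) * h (x - e *\<^sub>R v) \<partial>lborel)"
    by (rule nn_integral_cmult) measurable
  also have "\<dots> \<le> ennreal 2 * (ennreal (2 ^ (DIM(real) + 2)) * max_fun h x)"
    by (intro mult_left_mono max_fun_kernel e) auto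
  also have "\<dots> = ennreal 16 * max_fun h x"
    by (simp add: mult.assoc[symmetric] flip: ennreal_mult)
  finally show ?thesis .
qed

lemma abs_poisson_le:
  assumes "bdd_cs f" "0 < e"
  shows "ennreal \<bar>poisson e f x\<bar> \<le> ennreal 16 * max_fun (\<lambda>t. ennreal \<bar>f t\<bar>) x"
proof -
  have [measurable]: "f \<in> borel_measurable borel" using assms(1) by (rule bdd_csD)
  have "ennreal \<bar>poisson e f x\<bar> \<le> (\<integral>\<^sup>+t. ennreal \<bar>e / ((x - t)\<^sup>2 + e\<^sup>2) * f t\<bar> \<partial>lborel)"
    unfolding poisson_def
    using integral_norm_bound_ennreal[OF integrable_poisson(1)[OF assms, of x]] by simp
  also have "\<dots> = (\<integral>\<^sup>+t. ennreal (e / ((x - t)\<^sup>2 + e\<^sup>2)) * ennreal \<bar>f t\<bar> \<partial>lborel)"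
    using assms by (intro nn_integral_cong) (simp add: abs_mult flip: ennreal_mult)
  also have "\<dots> \<le> ennreal 16 * max_fun (\<lambda>t. ennreal \<bar>f t\<bar>) x"
    using assms by (intro poisson_le_max_fun) auto
  finally show ?thesis .
qed

text \<open>On the upper half-plane its real part is the Poisson integral and its imaginary part the
  conjugate one. It is the holomorphic function that ties the operator to be bounded to one that is
  already controlled.\<close>

definition cauchy_transform :: "(real \<Rightarrow> real) \<Rightarrow> complex \<Rightarrow> complex" where
  "cauchy_transform f z = (LINT t|lborel. \<i> / (z - of_real t) * of_real (f t))"

lemma integrable_cauchy_kernel:
  assumes "bdd_cs f" "0 < Im z"
  shows "integrable lborel (\<lambda>t. \<i> / (z - of_real t) * of_real (f t))"
    "integrable lborel (\<lambda>t. \<i> / (z - of_real t)\<^sup>2 * of_real (f t))"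
proof -
  have n: "Im z \<le> norm (z - of_real t)" for t
    using abs_Im_le_cmod[of "z - of_real t"] assms by simp
  have "norm (\<i> / (z - of_real t)) \<le> 1 / Im z" "norm (\<i> / (z - of_real t)\<^sup>2) \<le> 1 / (Im z)\<^sup>2" for t
    using n[of t] assms by (auto simp: norm_divide norm_power intro!: divide_left_mono mult_pos_pos power_mono)
  then show "integrable lborel (\<lambda>t. \<i> / (z - of_real t) * of_real (f t))"
    "integrable lborel (\<lambda>t. \<i> / (z - of_real t)\<^sup>2 * of_real (f t))"
    by (intro integrable_bdd_cs_mult[OF assms(1)]; measurable)+
qed

lemma cauchy_transform_poisson:
  assumes "bdd_cs f" "0 < e"
  shows "cauchy_transform f (Complex x e) = Complex (poisson e f x) (conj_poisson e f x)"
proof -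
  have i: "integrable lborel (\<lambda>t. \<i> / (Complex x e - of_real t) * of_real (f t))"
    using assms by (intro integrable_cauchy_kernel) auto
  have eq: "\<i> / (Complex x e - of_real t) * of_real (f t)
      = Complex (e / ((x - t)\<^sup>2 + e\<^sup>2) * f t) ((x - t) / ((x - t)\<^sup>2 + e\<^sup>2) * f t)" for t
    by (simp add: complex_eq_iff Re_divide Im_divide)
  have "Re (cauchy_transform f (Complex x e)) = poisson e f x"
    unfolding cauchy_transform_def poisson_def integral_Re[OF i, symmetric] unfolding eq by simp
  moreover have "Im (cauchy_transform f (Complex x e)) = conj_poisson e f x"
    unfolding cauchy_transform_def conj_poisson_def integral_Im[OF i, symmetric] unfolding eq by simp
  ultimately show ?thesis by (simp add: complex_eq_iff)
qed

text \<open>The difference quotient of the kernel, corrected by the derivative, is exactly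
  \<open>b - a\<close> times a kernel that stays bounded away from the real axis. This is how the
  transform is differentiated under the integral.\<close>

lemma cauchy_kernel_difference:
  fixes a b c :: complex
  assumes "a \<noteq> 0" "b \<noteq> 0" "b \<noteq> a"
  shows "(\<i> / b * c - \<i> / a * c) / (b - a) + \<i> / a\<^sup>2 * c = (b - a) * (\<i> / (a\<^sup>2 * b) * c)"
proof -
  have "\<i> / b * c - \<i> / a * c = (b - a) * (- (\<i> / (a * b) * c))"
    using assms by (simp add: divide_simps) (simp add: algebra_simps)
  then have "(\<i> / b * c - \<i> / a * c) / (b - a) = - (\<i> / (a * b) * c)"
    using assms by simp
  then show ?thesis
    using assms by (simp add: divide_simps power2_eq_square, simp add: algebra_simps)
qed

lemma cauchy_transform_holomorphic:
  assumes f: "bdd_cs f"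
  shows "cauchy_transform f holomorphic_on {z. 0 < Im z}"
proof -
  have "(cauchy_transform f has_field_derivative - (LINT t|lborel. \<i> / (z - of_real t)\<^sup>2 * of_real (f t))) (at z)"
    if z: "0 < Im z" for z
  proof -
    let ?D = "LINT t|lborel. \<i> / (z - of_real t)\<^sup>2 * of_real (f t)"
    define C where "C = 2 / (Im z) ^ 3 * (LINT t|lborel. \<bar>f t\<bar>)"
    have est: "norm ((cauchy_transform f w - cauchy_transform f z) / (w - z) + ?D) \<le> C * norm (w - z)"
      if w: "w \<noteq> z" "norm (w - z) < Im z / 2" for w
    proof -
      \<comment> \<open>Within Im z / 2 of z the imaginary part stays above Im z / 2, which bounds
        the kernels uniformly in t.\<close>
      have "\<bar>Im (w - z)\<bar> < Im z / 2" using abs_Im_le_cmod[of "w - z"] w by linarith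
      then have Imw: "Im z / 2 < Im w" by (simp only: minus_complex.simps)
      have pos: "0 < Im w" using Imw z by linarith
      have id: "(\<i> / (w - of_real t) * of_real (f t) - \<i> / (z - of_real t) * of_real (f t)) / (w - z) + \<i> / (z - of_real t)\<^sup>2 * of_real (f t)
        = (w - z) * (\<i> / ((z - of_real t)\<^sup>2 * (w - of_real t)) * of_real (f t))" for t
      proof -
        have "z - of_real t \<noteq> 0" "w - of_real t \<noteq> 0" "w - z \<noteq> 0"
          using z pos w by (auto simp: complex_eq_iff)
        then show ?thesis using cauchy_kernel_difference[of "z - of_real t" "w - of_real t" "of_real (f t)"] by simp
      qed
      have ker: "norm (\<i> / ((z - of_real t)\<^sup>2 * (w - of_real t))) \<le> 2 / (Im z) ^ 3" for t
      proof -
        have a: "Im z \<le> norm (z - of_real t)" "Im z / 2 \<le> norm (w - of_real t)"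
          using abs_Im_le_cmod[of "z - of_real t"] abs_Im_le_cmod[of "w - of_real t"] z Imw by auto
        then have "(Im z)\<^sup>2 * (Im z / 2) \<le> (norm (z - of_real t))\<^sup>2 * norm (w - of_real t)"
          using z by (intro mult_mono power_mono) auto
        then have "1 / ((norm (z - of_real t))\<^sup>2 * norm (w - of_real t)) \<le> 1 / ((Im z)\<^sup>2 * (Im z / 2))"
          using z a by (intro divide_left_mono mult_pos_pos zero_less_power; linarith?)
        then show ?thesis by (simp add: norm_divide norm_mult norm_power power2_eq_square power3_eq_cube)
      qed
      note I = integrable_cauchy_kernel[OF f pos] integrable_cauchy_kernel[OF f z]
      have "(cauchy_transform f w - cauchy_transform f z) / (w - z) + ?D
        = (LINT t|lborel. (\<i> / (w - of_real t) * of_real (f t) - \<i> / (z - of_real t) * of_real (f t)) / (w - z) + \<i> / (z - of_real t)\<^sup>2 * of_real (f t))"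
        unfolding cauchy_transform_def using I by simp
      also have "\<dots> = (w - z) * (LINT t|lborel. \<i> / ((z - of_real t)\<^sup>2 * (w - of_real t)) * of_real (f t))"
        unfolding id by (rule integral_mult_right_zero)
      finally have eq: "norm ((cauchy_transform f w - cauchy_transform f z) / (w - z) + ?D)
        = norm (w - z) * norm (LINT t|lborel. \<i> / ((z - of_real t)\<^sup>2 * (w - of_real t)) * of_real (f t))"
        by (simp add: norm_mult)
      have "norm (LINT t|lborel. \<i> / ((z - of_real t)\<^sup>2 * (w - of_real t)) * of_real (f t))
          \<le> (LINT t|lborel. 2 / (Im z) ^ 3 * \<bar>f t\<bar>)"
      proof (rule Bochner_Integration.integral_norm_bound_integral)
        show "integrable lborel (\<lambda>t. \<i> / ((z - of_real t)\<^sup>2 * (w - of_real t)) * of_real (f t))"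
          by (intro integrable_bdd_cs_mult[OF f _ ker]) measurable
        show "integrable lborel (\<lambda>t. 2 / Im z ^ 3 * \<bar>f t\<bar>)"
          using integrable_bdd_cs[OF f] by (intro integrable_mult_right integrable_abs)
        show "norm (\<i> / ((z - of_real t)\<^sup>2 * (w - of_real t)) * of_real (f t)) \<le> 2 / Im z ^ 3 * \<bar>f t\<bar>" for t
          using mult_right_mono[OF ker[of t], of "\<bar>f t\<bar>"] unfolding norm_mult by simp
      qed
      also have "\<dots> = C" by (simp add: C_def)
      finally show ?thesis unfolding eq mult.commute[of C] by (rule mult_left_mono) simp
    qed
    have "((\<lambda>w. (cauchy_transform f w - cauchy_transform f z) / (w - z) + ?D) \<longlongrightarrow> 0) (at z)"
    proof (rule Lim_null_comparison)
      have "\<forall>\<^sub>F w in at z. w \<noteq> z \<and> norm (w - z) < Im z / 2"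
        using z by (auto simp: eventually_at dist_norm intro!: exI[of _ "Im z / 2"])
      then show "\<forall>\<^sub>F w in at z. norm ((cauchy_transform f w - cauchy_transform f z) / (w - z) + ?D) \<le> C * norm (w - z)"
        by (rule eventually_mono) (use est in auto)
      show "((\<lambda>w. C * norm (w - z)) \<longlongrightarrow> 0) (at z)" by (auto intro!: tendsto_eq_intros)
    qed
    then have "((\<lambda>w. (cauchy_transform f w - cauchy_transform f z) / (w - z) + ?D - ?D) \<longlongrightarrow> 0 - ?D) (at z)"
      by (intro tendsto_diff tendsto_const)
    then show ?thesis by (simp add: has_field_derivative_iff)
  qed
  then show ?thesis
    by (auto simp: holomorphic_on_def field_differentiable_def intro: has_field_derivative_at_within)
qed

text \<open>For t in the support the distance from z is at least |z| - A. The resulting decay of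
  order 1 / |z| is what the contour estimate consumes.\<close>

lemma cauchy_transform_bound:
  assumes f: "bdd_cs f" and A: "\<And>x. A < \<bar>x\<bar> \<Longrightarrow> f x = 0" and z: "A < norm z" "0 < Im z"
  shows "norm (cauchy_transform f z) \<le> (LINT t|lborel. \<bar>f t\<bar>) / (norm z - A)"
proof -
  have "norm (cauchy_transform f z) \<le> (LINT t|lborel. 1 / (norm z - A) * \<bar>f t\<bar>)"
    unfolding cauchy_transform_def
  proof (rule Bochner_Integration.integral_norm_bound_integral)
    show "integrable lborel (\<lambda>t. \<i> / (z - of_real t) * of_real (f t))"
      by (rule integrable_cauchy_kernel[OF f z(2)])
    show "integrable lborel (\<lambda>t. 1 / (norm z - A) * \<bar>f t\<bar>)"
      using integrable_bdd_cs[OF f] by (intro integrable_mult_right integrable_abs)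
    show "norm (\<i> / (z - of_real t) * of_real (f t)) \<le> 1 / (norm z - A) * \<bar>f t\<bar>" for t
    proof (cases "A < \<bar>t\<bar>")
      case False
      then have "norm z - A \<le> norm (z - of_real t)"
        using norm_triangle_ineq2[of z "of_real t"] by simp
      then have "1 / norm (z - of_real t) \<le> 1 / (norm z - A)"
        using z by (intro divide_left_mono mult_pos_pos) auto
      then show ?thesis using mult_right_mono[of _ _ "\<bar>f t\<bar>"] by (simp add: norm_mult norm_divide) fastforce
    qed (simp add: A)
  qed
  then show ?thesis by simp
qed

lemma cmod_powr_of_real: "cmod (z powr of_real p) = cmod z powr p"
  by (cases "z = 0") (simp_all add: powr_def)

text \<open>Strict positivity keeps the Cauchy transform in the open right half-plane, off the
  branch cut of the principal power.\<close>

lemma poisson_pos: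
  assumes "bdd_cs f" "\<And>x. 0 \<le> f x" "0 < (LINT t|lborel. f t)" "0 < e"
  shows "0 < poisson e f x"
proof -
  have "0 \<le> poisson e f x"
    unfolding poisson_def using assms by (intro integral_nonneg_AE) auto
  moreover have "poisson e f x \<noteq> 0"
  proof
    assume "poisson e f x = 0"
    then have "AE t in lborel. e / ((x - t)\<^sup>2 + e\<^sup>2) * f t = 0"
      unfolding poisson_def using assms
      by (subst (asm) integral_nonneg_eq_0_iff_AE[OF integrable_poisson(1)]) auto
    moreover have "e / ((x - t)\<^sup>2 + e\<^sup>2) \<noteq> 0" for t
      using assms(4) by (simp add: add_nonneg_eq_0_iff)
    ultimately have "AE t in lborel. f t = 0" by (simp add: assms)
    then have "(LINT t|lborel. f t) = 0" by (rule integral_eq_zero_AE)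
    then show False using assms by simp
  qed
  ultimately show ?thesis by simp
qed

text \<open>
  The contour argument behind M. Riesz's theorem: the integral over \<open>[-R, R]\<close> is moved to the two
  legs of a triangle, where \<open>p > 1\<close> beats the length of the path.
\<close>

lemma cauchy_transform_powr_integral:
  assumes f: "bdd_cs f" "\<And>x. 0 \<le> f x" "0 < (LINT t|lborel. f t)"
    and e: "0 < e" and p: "1 < p"
  shows "((\<lambda>R. integral {-R..R} (\<lambda>x. cauchy_transform f (Complex x e) powr of_real p)) \<longlongrightarrow> 0) at_top"
    and "continuous_on UNIV (\<lambda>x. cauchy_transform f (Complex x e) powr of_real p)"
proof -
  let ?H = "{z. 0 < Im z}"
  let ?\<Phi> = "\<lambda>z. cauchy_transform f z powr of_real p"
  obtain K A where A: "0 < A" "\<And>x. A < \<bar>x\<bar> \<Longrightarrow> f x = 0" using bdd_csE[OF f(1)] by metis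
  define L where "L = (LINT t|lborel. \<bar>f t\<bar>)"
  have L: "0 \<le> L" unfolding L_def by (intro integral_nonneg_AE) auto
  have conv: "convex ?H" by (rule convex_halfspace_Im_gt)
  have op: "open ?H" by (rule open_halfspace_Im_gt)
  have "0 < Re (cauchy_transform f z)" if "z \<in> ?H" for z
    using cauchy_transform_poisson[OF f(1), of "Im z" "Re z"] poisson_pos[OF f, of "Im z" "Re z"] that by simp
  then have "cauchy_transform f z \<notin> \<real>\<^sub>\<le>\<^sub>0" if "z \<in> ?H" for z
    using that by (fastforce simp: complex_nonpos_Reals_iff)
  then have hol: "?\<Phi> holomorphic_on ?H"
    using cauchy_transform_holomorphic[OF f(1)]
    by (intro holomorphic_on_powr holomorphic_on_const) auto
  have "continuous_on ?H ?\<Phi>" by (rule holomorphic_on_imp_continuous_on[OF hol])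
  moreover have "continuous_on UNIV (\<lambda>x. Complex x e)"
    unfolding Complex_eq by (intro continuous_intros)
  ultimately show "continuous_on UNIV (\<lambda>x. ?\<Phi> (Complex x e))"
    by (rule continuous_on_compose2) (use e in auto)
  \<comment> \<open>A primitive on the convex half-plane: the integral over the base becomes a
    difference of its values, and the legs are estimated by the mean value inequality.\<close>
  obtain G where G: "\<And>z. z \<in> ?H \<Longrightarrow> (G has_field_derivative ?\<Phi> z) (at z within ?H)"
    using holomorphic_convex_primitive'[OF conv op hol] by metis
  then have G: "(G has_field_derivative ?\<Phi> z) (at z)" if "0 < Im z" for z
    using that at_within_open[OF _ op] by fastforce
  have FTC: "integral {-R..R} (\<lambda>x. ?\<Phi> (Complex x e)) = G (Complex R e) - G (Complex (-R) e)" if "0 < R" for R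
  proof (intro integral_unique fundamental_theorem_of_calculus)
    fix x assume "x \<in> {-R..R}"
    have "((\<lambda>x. Complex x e) has_vector_derivative 1) (at x within {-R..R})"
      unfolding Complex_eq by (auto intro!: derivative_eq_intros)
    from field_vector_diff_chain_within[OF this, of G "?\<Phi> (Complex x e)"] G[of "Complex x e"] e
    show "((\<lambda>x. G (Complex x e)) has_vector_derivative ?\<Phi> (Complex x e)) (at x within {-R..R})"
      by (simp add: o_def has_field_derivative_at_within)
  qed (use that in auto)
  \<comment> \<open>The apex of the triangle is i (R + e). On a leg |Re z| + |Im z| \<ge> R, hence
    |z| \<ge> R / 2, and R \<ge> 4 A leaves |z| - A \<ge> R / 4.\<close>
  have leg: "norm (G w - G (Complex 0 (R + e))) \<le> (4 * L / R) powr p * (2 * R)"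
    if R: "4 * A \<le> R" and w: "w = Complex R e \<or> w = Complex (- R) e" for R w
  proof -
    have R0: "0 < R" using R A by linarith
    define S where "S = closed_segment (Complex 0 (R + e)) w"
    have S: "R / 2 \<le> norm z \<and> 0 < Im z" if "z \<in> S" for z
    proof -
      obtain u where u: "0 \<le> u" "u \<le> 1" "z = (1 - u) *\<^sub>R Complex 0 (R + e) + u *\<^sub>R w"
        using \<open>z \<in> S\<close> unfolding S_def closed_segment_def by auto
      have Im: "Im z = (1 - u) * R + e" and Re: "\<bar>Re z\<bar> = u * R"
        using arg_cong[OF u(3), of Im] arg_cong[OF u(3), of Re] u(1,2) w R0
        by (auto simp: algebra_simps abs_mult)
      have "0 \<le> (1 - u) * R" using u R0 by simp
      then have "0 < Im z" "R \<le> \<bar>Re z\<bar> + \<bar>Im z\<bar>"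
        using e unfolding Re Im by (auto simp: algebra_simps)
      then show ?thesis using abs_Re_le_cmod[of z] abs_Im_le_cmod[of z] by linarith
    qed
    have bd: "norm (?\<Phi> z) \<le> (4 * L / R) powr p" if "z \<in> S" for z
    proof -
      have n: "A + R / 4 \<le> norm z" "0 < Im z" using S[OF that] R by auto
      have "norm (cauchy_transform f z) \<le> L / (norm z - A)"
        unfolding L_def using n R0 A by (intro cauchy_transform_bound[OF f(1)]) auto
      also have "\<dots> \<le> L / (R / 4)" using n R0 L by (intro divide_left_mono mult_pos_pos) auto
      finally have "norm (cauchy_transform f z) \<le> 4 * L / R" by (simp add: mult.commute)
      then show ?thesis unfolding cmod_powr_of_real using p by (intro powr_mono2) auto
    qed
    have "norm (G w - G (Complex 0 (R + e))) \<le> (4 * L / R) powr p * norm (w - Complex 0 (R + e))"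
      using S bd by (intro field_differentiable_bound[of S G ?\<Phi>])
        (auto simp: S_def intro!: has_field_derivative_at_within G)
    also have "norm (w - Complex 0 (R + e)) \<le> 2 * R"
      using w R0 cmod_le[of "w - Complex 0 (R + e)"] by auto
    finally show ?thesis by (simp add: mult_left_mono)
  qed
  \<comment> \<open>Two legs of length at most 2 R with integrand at most (4 L / R)^p: the total
    decays like R^(1 - p).\<close>
  have bound: "norm (integral {-R..R} (\<lambda>x. ?\<Phi> (Complex x e))) \<le> 4 * (4 * L) powr p * R powr (1 - p)" if R: "4 * A \<le> R" for R
  proof -
    have R0: "0 < R" using R A by linarith
    have "norm (integral {-R..R} (\<lambda>x. ?\<Phi> (Complex x e)))
      = norm ((G (Complex R e) - G (Complex 0 (R + e))) - (G (Complex (-R) e) - G (Complex 0 (R + e))))"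
      using FTC[OF R0] by simp
    also have "\<dots> \<le> (4 * L / R) powr p * (2 * R) + (4 * L / R) powr p * (2 * R)"
      by (intro order_trans[OF norm_triangle_ineq4] add_mono leg R) auto
    also have "\<dots> = 4 * (4 * L) powr p * R powr (1 - p)"
      using R0 L by (simp add: powr_divide powr_diff)
    finally show ?thesis .
  qed
  show "((\<lambda>R. integral {-R..R} (\<lambda>x. ?\<Phi> (Complex x e))) \<longlongrightarrow> 0) at_top"
  proof (rule Lim_null_comparison)
    show "\<forall>\<^sub>F R in at_top. norm (integral {-R..R} (\<lambda>x. ?\<Phi> (Complex x e))) \<le> 4 * (4 * L) powr p * R powr (1 - p)"
      using eventually_ge_at_top[of "4 * A"] by eventually_elim (rule bound)
    show "((\<lambda>R. 4 * (4 * L) powr p * R powr (1 - p)) \<longlongrightarrow> 0) at_top"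
      using p by (intro tendsto_mult_right_zero tendsto_neg_powr filterlim_ident) auto
  qed
qed

text \<open>Monotone convergence. The bounds may carry an error that vanishes only in the limit, as
  the contour term does.\<close>

lemma nn_integral_le_of_cutoffs:
  fixes f :: "real \<Rightarrow> ennreal"
  assumes [measurable]: "f \<in> borel_measurable borel"
    and "\<And>n::nat. (\<integral>\<^sup>+x\<in>{-real n..real n}. f x \<partial>lborel) \<le> C n" and C: "C \<longlonglongrightarrow> c"
  shows "(\<integral>\<^sup>+x. f x \<partial>lborel) \<le> c"
proof -
  have inc: "incseq (\<lambda>n x. f x * indicator {-real n..real n} x)"
    by (auto simp: incseq_def le_fun_def indicator_def)
  have "(\<lambda>n. \<integral>\<^sup>+x\<in>{-real n..real n}. f x \<partial>lborel) \<longlonglongrightarrow> (\<integral>\<^sup>+x. f x \<partial>lborel)"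
  proof (rule nn_integral_LIMSEQ[OF inc])
    show "(\<lambda>n. f x * indicator {-real n..real n} x) \<longlonglongrightarrow> f x" for x
    proof (rule tendsto_eventually)
      obtain m :: nat where "\<bar>x\<bar> \<le> real m" using real_arch_simple by blast
      then show "\<forall>\<^sub>F n in sequentially. f x * indicator {-real n..real n} x = f x"
        by (intro eventually_sequentiallyI[of m]) (auto simp: indicator_def)
    qed
  qed simp
  then show ?thesis using C assms(2) by (intro LIMSEQ_le) auto
qed

lemma set_integrable_Re_norm:
  fixes f :: "'b \<Rightarrow> complex"
  assumes "set_integrable M J f"
  shows "integrable M (\<lambda>x. indicator J x * Re (f x))"
    "integrable M (\<lambda>x. indicator J x * norm (f x))"
    "(LINT x|M. indicator J x * Re (f x)) = Re (LINT x|M. indicator J x *\<^sub>R f x)"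
  using integrable_Re[OF assms[unfolded set_integrable_def]]
    integrable_norm[OF assms[unfolded set_integrable_def]]
    integral_Re[OF assms[unfolded set_integrable_def]] by simp_all

text \<open>\<open>powr_riesz_ineq\<close> is integrated along the line Im z = e. The integral of
  the real part of the p-th power tends to 0 by the contour argument; what remains is the p-th power
  of the Poisson integral, which the maximal function controls.\<close>

lemma riesz_nonneg:
  fixes p :: real
  assumes p: "1 < p" "p \<le> 2"
  obtains C where "0 < C" "\<And>f e. bdd_cs f \<Longrightarrow> (\<And>x. 0 \<le> f x) \<Longrightarrow> 0 < e \<Longrightarrow>
    (\<integral>\<^sup>+x. ennreal (\<bar>conj_poisson e f x\<bar> powr p) \<partial>lborel) \<le> ennreal C * (\<integral>\<^sup>+x. ennreal (\<bar>f x\<bar> powr p) \<partial>lborel)"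
proof -
  obtain A B where AB: "0 < A" "0 < B"
    "\<And>z. 0 < Re z \<Longrightarrow> \<bar>Im z\<bar> powr p \<le> A * Re z powr p - B * Re (z powr of_real p)"
    using powr_riesz_ineq[OF p] by blast
  obtain C1 where C1: "0 < C1" "\<And>f :: real \<Rightarrow> ennreal. f \<in> borel_measurable borel \<Longrightarrow>
    (\<integral>\<^sup>+x. ennpowr (max_fun f x) p \<partial>lborel) \<le> ennreal C1 * (\<integral>\<^sup>+x. ennpowr (f x) p \<partial>lborel)"
    using max_fun_strong[OF p(1), where 'a=real] by blast
  define C where "C = A * (16 powr p * C1)"
  have C: "0 < C" using AB C1 by (simp add: C_def)
  show ?thesis
  proof (rule that[OF C])
    fix f e assume f: "bdd_cs f" "\<And>x. 0 \<le> f x" and e: "(0::real) < e"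
    have [measurable]: "f \<in> borel_measurable borel" using f(1) by (rule bdd_csD)
    have i: "integrable lborel f" by (rule integrable_bdd_cs[OF f(1)])
    have nn: "0 \<le> (LINT t|lborel. f t)" using f(2) by (intro integral_nonneg_AE) auto
    show "(\<integral>\<^sup>+x. ennreal (\<bar>conj_poisson e f x\<bar> powr p) \<partial>lborel) \<le> ennreal C * (\<integral>\<^sup>+x. ennreal (\<bar>f x\<bar> powr p) \<partial>lborel)"
    \<comment> \<open>A nonnegative function of integral 0 vanishes almost everywhere. It is split
      off because its Poisson integral is not strictly positive.\<close>
    proof (cases "(LINT t|lborel. f t) = 0")
      case True
      then have ae: "AE t in lborel. f t = 0"
        using f(2) by (subst (asm) integral_nonneg_eq_0_iff_AE[OF i]) auto
      have "conj_poisson e f x = 0" for x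
        unfolding conj_poisson_def by (rule integral_eq_zero_AE) (use ae in auto)
      then show ?thesis using p by simp
    next
      case False
      then have f3: "0 < (LINT t|lborel. f t)" using nn by simp
      let ?\<Phi> = "\<lambda>x. cauchy_transform f (Complex x e) powr of_real p"
      note contour = cauchy_transform_powr_integral[OF f f3 e p(1)]
      define P where "P = (\<integral>\<^sup>+x. ennreal (poisson e f x powr p) \<partial>lborel)"
      have "P \<le> (\<integral>\<^sup>+x. ennpowr (ennreal 16 * max_fun (\<lambda>t. ennreal \<bar>f t\<bar>) x) p \<partial>lborel)"
        unfolding P_def
      proof (rule nn_integral_mono)
        fix x
        have "ennreal (poisson e f x powr p) = ennpowr (ennreal \<bar>poisson e f x\<bar>) p"
          using poisson_pos[OF f f3 e, of x] by simp
        also have "\<dots> \<le> ennpowr (ennreal 16 * max_fun (\<lambda>t. ennreal \<bar>f t\<bar>) x) p"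
          using p by (intro ennpowr_mono abs_poisson_le f e) auto
        finally show "ennreal (poisson e f x powr p) \<le> ennpowr (ennreal 16 * max_fun (\<lambda>t. ennreal \<bar>f t\<bar>) x) p" .
      qed
      also have "\<dots> = ennreal (16 powr p) * (\<integral>\<^sup>+x. ennpowr (max_fun (\<lambda>t. ennreal \<bar>f t\<bar>) x) p \<partial>lborel)"
        using p by (subst nn_integral_cmult[symmetric]) (auto simp: ennpowr_cmult[of 16, simplified])
      also have "\<dots> \<le> ennreal (16 powr p) * (ennreal C1 * (\<integral>\<^sup>+x. ennpowr (ennreal \<bar>f x\<bar>) p \<partial>lborel))"
        by (intro mult_left_mono C1) auto
      finally have P: "P \<le> ennreal (16 powr p * C1) * (\<integral>\<^sup>+x. ennreal (\<bar>f x\<bar> powr p) \<partial>lborel)"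
        using C1 by (simp add: ennreal_mult mult.assoc)
      \<comment> \<open>On [-n, n] the estimate holds up to the error \<open>B\<close> times the
        modulus of the integral of the complex power, which tends to 0.\<close>
      have "(\<integral>\<^sup>+x. ennreal (\<bar>conj_poisson e f x\<bar> powr p) \<partial>lborel) \<le> ennreal A * P + 0"
      proof (rule nn_integral_le_of_cutoffs)
        fix n :: nat
        let ?J = "{-real n..real n}"
        have hi: "?\<Phi> integrable_on ?J"
          using contour(2) by (intro integrable_continuous_interval continuous_on_subset[OF contour(2)]) auto
        have bi: "set_integrable lborel ?J ?\<Phi>"
          unfolding set_integrable_def
          by (intro borel_integrable_compact compact_Icc continuous_on_subset[OF contour(2)]) auto
        show "(\<integral>\<^sup>+x\<in>?J. ennreal (\<bar>conj_poisson e f x\<bar> powr p) \<partial>lborel)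
          \<le> ennreal A * P + ennreal (B * norm (integral ?J ?\<Phi>))"
        proof -
          have re: "integrable lborel (\<lambda>x. indicator ?J x * Re (?\<Phi> x))"
            by (rule set_integrable_Re_norm(1)[OF bi])
          have pb: "integrable lborel (\<lambda>x. indicator ?J x * poisson e f x powr p)"
          proof -
            have "integrable lborel (\<lambda>x. indicator ?J x * (norm (?\<Phi> x)))"
              by (rule set_integrable_Re_norm(2)[OF bi])
            then show ?thesis
            proof (rule Bochner_Integration.integrable_bound)
              show "AE x in lborel. norm (indicator ?J x * poisson e f x powr p) \<le> norm (indicator ?J x * norm (?\<Phi> x))"
              proof (rule AE_I2)
                fix x
                have "poisson e f x \<le> norm (cauchy_transform f (Complex x e))"
                  using complex_Re_le_cmod[of "cauchy_transform f (Complex x e)"] by (simp add: cauchy_transform_poisson f e)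
                then have "poisson e f x powr p \<le> norm (?\<Phi> x)"
                  unfolding cmod_powr_of_real using p poisson_pos[OF f f3 e, of x] by (intro powr_mono2) auto
                then show "norm (indicator ?J x * poisson e f x powr p) \<le> norm (indicator ?J x * norm (?\<Phi> x))"
                  by (simp add: indicator_def)
              qed
            qed measurable
          qed
          have "(\<integral>\<^sup>+x\<in>?J. ennreal (\<bar>conj_poisson e f x\<bar> powr p) \<partial>lborel)
            \<le> (\<integral>\<^sup>+x. ennreal (A * (indicator ?J x * poisson e f x powr p) - B * (indicator ?J x * Re (?\<Phi> x))) \<partial>lborel)"
          proof (rule nn_integral_mono)
            fix x
            show "ennreal (\<bar>conj_poisson e f x\<bar> powr p) * indicator ?J x
              \<le> ennreal (A * (indicator ?J x * poisson e f x powr p) - B * (indicator ?J x * Re (?\<Phi> x)))"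
              using AB(3)[of "cauchy_transform f (Complex x e)"] poisson_pos[OF f f3 e, of x]
              by (auto simp: cauchy_transform_poisson f e indicator_def intro!: ennreal_leI)
          qed
          also have "\<dots> = ennreal (A * (LINT x|lborel. indicator ?J x * poisson e f x powr p) - B * (LINT x|lborel. indicator ?J x * Re (?\<Phi> x)))"
          proof (subst nn_integral_eq_integral)
            show "integrable lborel (\<lambda>x. A * (indicator ?J x * poisson e f x powr p) - B * (indicator ?J x * Re (?\<Phi> x)))"
              using re pb by simp
            show "AE x in lborel. 0 \<le> A * (indicator ?J x * poisson e f x powr p) - B * (indicator ?J x * Re (?\<Phi> x))"
            proof (rule AE_I2)
              fix x
              have "0 \<le> \<bar>Im (cauchy_transform f (Complex x e))\<bar> powr p" by simp
              also have "\<dots> \<le> A * Re (cauchy_transform f (Complex x e)) powr p - B * Re (?\<Phi> x)"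
                using poisson_pos[OF f f3 e, of x] by (intro AB(3)) (simp add: cauchy_transform_poisson f e)
              finally show "0 \<le> A * (indicator ?J x * poisson e f x powr p) - B * (indicator ?J x * Re (?\<Phi> x))"
                by (simp add: cauchy_transform_poisson f e indicator_def)
            qed
          qed (use re pb in simp)
          also have "(LINT x|lborel. indicator ?J x * Re (?\<Phi> x)) = Re (integral ?J ?\<Phi>)"
          proof -
            have "integral ?J ?\<Phi> = (LINT x|lborel. indicator ?J x *\<^sub>R ?\<Phi> x)"
              using set_borel_integral_eq_integral(2)[OF bi] by (simp add: set_lebesgue_integral_def)
            then show ?thesis using set_integrable_Re_norm(3)[OF bi] by (simp only:)
          qed
          also have "ennreal (A * (LINT x|lborel. indicator ?J x * poisson e f x powr p) - B * Re (integral ?J ?\<Phi>))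
             \<le> ennreal (A * (LINT x|lborel. indicator ?J x * poisson e f x powr p) + B * norm (integral ?J ?\<Phi>))"
          proof (rule ennreal_leI)
            have "- Re (integral ?J ?\<Phi>) \<le> norm (integral ?J ?\<Phi>)" using abs_Re_le_cmod[of "integral ?J ?\<Phi>"] by linarith
            then have "B * (- Re (integral ?J ?\<Phi>)) \<le> B * norm (integral ?J ?\<Phi>)" using AB by (intro mult_left_mono) auto
            then show "A * (LINT x|lborel. indicator ?J x * poisson e f x powr p) - B * Re (integral ?J ?\<Phi>)
              \<le> A * (LINT x|lborel. indicator ?J x * poisson e f x powr p) + B * norm (integral ?J ?\<Phi>)" by simp
          qed
          also have "\<dots> = ennreal A * ennreal (LINT x|lborel. indicator ?J x * poisson e f x powr p) + ennreal (B * norm (integral ?J ?\<Phi>))"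
            using AB by (subst ennreal_plus) (auto simp: ennreal_mult integral_nonneg_AE)
          also have "ennreal (LINT x|lborel. indicator ?J x * poisson e f x powr p) \<le> P"
            unfolding P_def by (subst nn_integral_eq_integral[OF pb, symmetric])
              (auto intro!: nn_integral_mono simp: indicator_def)
          finally show ?thesis by (simp add: mult_left_mono add_right_mono)
        qed
      next
        have "(\<lambda>n. integral {-real n..real n} ?\<Phi>) \<longlonglongrightarrow> 0"
          using filterlim_compose[OF contour(1) filterlim_real_sequentially] by simp
        then have "(\<lambda>n. B * norm (integral {-real n..real n} ?\<Phi>)) \<longlonglongrightarrow> B * norm (0::complex)"
          by (intro tendsto_intros)
        then have "(\<lambda>n. ennreal (B * norm (integral {-real n..real n} ?\<Phi>))) \<longlonglongrightarrow> ennreal 0"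
          by (intro tendsto_ennrealI) simp
        then show "(\<lambda>n. ennreal A * P + ennreal (B * norm (integral {-real n..real n} ?\<Phi>))) \<longlonglongrightarrow> ennreal A * P + 0"
          by (intro tendsto_add tendsto_const) simp
      qed measurable
      also have "ennreal A * P + 0 \<le> ennreal A * (ennreal (16 powr p * C1) * (\<integral>\<^sup>+x. ennreal (\<bar>f x\<bar> powr p) \<partial>lborel))"
        using P by (simp add: mult_left_mono)
      also have "\<dots> = ennreal C * (\<integral>\<^sup>+x. ennreal (\<bar>f x\<bar> powr p) \<partial>lborel)"
        using AB C1 by (simp add: C_def ennreal_mult mult.assoc)
      finally show ?thesis .
    qed
  qed
qed

text \<open>Linearity and the splitting into positive and negative part, at the cost of the factor
  2^p times 2.\<close>

lemma riesz_le_2: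
  fixes p :: real
  assumes p: "1 < p" "p \<le> 2"
  obtains C where "0 < C" "\<And>f e. bdd_cs f \<Longrightarrow> 0 < e \<Longrightarrow>
    (\<integral>\<^sup>+x. ennreal (\<bar>conj_poisson e f x\<bar> powr p) \<partial>lborel) \<le> ennreal C * (\<integral>\<^sup>+x. ennreal (\<bar>f x\<bar> powr p) \<partial>lborel)"
proof -
  obtain C where C: "0 < C" "\<And>f e. bdd_cs f \<Longrightarrow> (\<And>x. 0 \<le> f x) \<Longrightarrow> 0 < e \<Longrightarrow>
    (\<integral>\<^sup>+x. ennreal (\<bar>conj_poisson e f x\<bar> powr p) \<partial>lborel) \<le> ennreal C * (\<integral>\<^sup>+x. ennreal (\<bar>f x\<bar> powr p) \<partial>lborel)"
    using riesz_nonneg[OF p] by blast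
  show ?thesis
  proof (rule that)
    show "0 < 2 powr p * (2 * C)" using C by simp
    fix f e assume f: "bdd_cs f" and e: "(0::real) < e"
    have [measurable]: "f \<in> borel_measurable borel" using f by (rule bdd_csD)
    define g h where "g x = max (f x) 0" and "h x = max (- f x) 0" for x
    have [measurable]: "g \<in> borel_measurable borel" "h \<in> borel_measurable borel"
      unfolding g_def[abs_def] h_def[abs_def] by measurable
    have g: "bdd_cs g" "\<And>x. 0 \<le> g x" "\<And>x. \<bar>g x\<bar> \<le> \<bar>f x\<bar>"
      by (auto intro!: bdd_cs_mono[OF f, of g 1]) (auto simp: g_def)
    have h: "bdd_cs h" "\<And>x. 0 \<le> h x" "\<And>x. \<bar>h x\<bar> \<le> \<bar>f x\<bar>"
      by (auto intro!: bdd_cs_mono[OF f, of h 1]) (auto simp: h_def)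
    have "conj_poisson e f x = conj_poisson e g x - conj_poisson e h x" for x
    proof -
      have "f = (\<lambda>x. g x - h x)" by (auto simp: g_def h_def)
      then show ?thesis
        unfolding conj_poisson_def
        by (subst Bochner_Integration.integral_diff[OF integrable_poisson(2)[OF g(1) e] integrable_poisson(2)[OF h(1) e], symmetric])
          (simp add: right_diff_distrib)
    qed
    then have le: "ennreal (\<bar>conj_poisson e f x\<bar> powr p)
      \<le> ennreal (2 powr p) * (ennreal (\<bar>conj_poisson e g x\<bar> powr p) + ennreal (\<bar>conj_poisson e h x\<bar> powr p))" for x
    proof -
      assume eq: "\<And>x. conj_poisson e f x = conj_poisson e g x - conj_poisson e h x"
      have "ennreal (\<bar>conj_poisson e f x\<bar> powr p) = ennpowr (ennreal \<bar>conj_poisson e f x\<bar>) p" by simp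
      also have "\<dots> \<le> ennpowr (ennreal \<bar>conj_poisson e g x\<bar> + ennreal \<bar>conj_poisson e h x\<bar>) p"
        using p by (intro ennpowr_mono) (auto simp: eq simp flip: ennreal_plus intro!: ennreal_leI)
      also have "\<dots> \<le> ennreal (2 powr p) * (ennpowr (ennreal \<bar>conj_poisson e g x\<bar>) p + ennpowr (ennreal \<bar>conj_poisson e h x\<bar>) p)"
        using p by (intro ennpowr_add_le) auto
      finally show ?thesis by simp
    qed
    have le2: "(\<integral>\<^sup>+x. ennreal (\<bar>k x\<bar> powr p) \<partial>lborel) \<le> (\<integral>\<^sup>+x. ennreal (\<bar>f x\<bar> powr p) \<partial>lborel)"
      if "\<And>x. \<bar>k x\<bar> \<le> \<bar>f x\<bar>" for k
      using p that by (intro nn_integral_mono ennreal_leI powr_mono2) auto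
    have "(\<integral>\<^sup>+x. ennreal (\<bar>conj_poisson e f x\<bar> powr p) \<partial>lborel)
      \<le> (\<integral>\<^sup>+x. ennreal (2 powr p) * (ennreal (\<bar>conj_poisson e g x\<bar> powr p) + ennreal (\<bar>conj_poisson e h x\<bar> powr p)) \<partial>lborel)"
      by (intro nn_integral_mono le)
    also have "\<dots> = ennreal (2 powr p) * ((\<integral>\<^sup>+x. ennreal (\<bar>conj_poisson e g x\<bar> powr p) \<partial>lborel) + (\<integral>\<^sup>+x. ennreal (\<bar>conj_poisson e h x\<bar> powr p) \<partial>lborel))"
      by (subst nn_integral_cmult, measurable, subst nn_integral_add) auto
    also have "\<dots> \<le> ennreal (2 powr p) * (ennreal C * (\<integral>\<^sup>+x. ennreal (\<bar>f x\<bar> powr p) \<partial>lborel) + ennreal C * (\<integral>\<^sup>+x. ennreal (\<bar>f x\<bar> powr p) \<partial>lborel))"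
      by (intro mult_left_mono add_mono order_trans[OF C(2)] le2 g h e) auto
    also have "\<dots> = ennreal (2 powr p * (2 * C)) * (\<integral>\<^sup>+x. ennreal (\<bar>f x\<bar> powr p) \<partial>lborel)"
      using C by (simp add: ennreal_mult mult_2[symmetric] mult.assoc)
    finally show "(\<integral>\<^sup>+x. ennreal (\<bar>conj_poisson e f x\<bar> powr p) \<partial>lborel)
      \<le> ennreal (2 powr p * (2 * C)) * (\<integral>\<^sup>+x. ennreal (\<bar>f x\<bar> powr p) \<partial>lborel)" .
  qed
qed

section \<open>Duality and the exponents above 2\<close>

lemma bdd_cs_nn_integral_powr:
  assumes "bdd_cs f" "0 < p"
  shows "(\<integral>\<^sup>+x. ennreal (\<bar>f x\<bar> powr p) \<partial>lborel) < \<infinity>"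
proof -
  obtain K A where KA: "0 < K" "0 < A" "\<And>x. \<bar>f x\<bar> \<le> K" "\<And>x. A < \<bar>x\<bar> \<Longrightarrow> f x = 0"
    using bdd_csE[OF assms(1)] by blast
  have "(\<integral>\<^sup>+x. ennreal (\<bar>f x\<bar> powr p) \<partial>lborel) \<le> (\<integral>\<^sup>+x. ennreal (K powr p) * indicator {-A..A} x \<partial>lborel)"
  proof (rule nn_integral_mono)
    fix x
    show "ennreal (\<bar>f x\<bar> powr p) \<le> ennreal (K powr p) * indicator {-A..A} x"
    proof (cases "A < \<bar>x\<bar>")
      case False
      then show ?thesis using KA(3)[of x] assms
        by (auto simp: indicator_def abs_le_iff intro!: ennreal_leI powr_mono2)
    qed (use KA assms in auto)
  qed
  also have "\<dots> < \<infinity>"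
    by (subst nn_integral_cmult_indicator) (auto simp: emeasure_lborel_Icc_eq ennreal_mult_less_top)
  finally show ?thesis .
qed

lemma lborel_Fubini_swap:
  fixes F :: "'a::euclidean_space \<Rightarrow> 'b::euclidean_space \<Rightarrow> 'c::{banach, second_countable_topology}"
  assumes [measurable]: "(\<lambda>(x, y). F x y) \<in> borel_measurable (lborel \<Otimes>\<^sub>M lborel)"
    and fin: "(\<integral>\<^sup>+x. \<integral>\<^sup>+y. ennreal (norm (F x y)) \<partial>lborel \<partial>lborel) < \<infinity>"
  shows "(LINT x|lborel. LINT y|lborel. F x y) = (LINT y|lborel. LINT x|lborel. F x y)"
proof -
  have "integrable (lborel \<Otimes>\<^sub>M lborel) (\<lambda>(x, y). F x y)"
  proof (rule integrableI_bounded)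
    have "(\<integral>\<^sup>+z. ennreal (norm (case z of (x, y) \<Rightarrow> F x y)) \<partial>(lborel \<Otimes>\<^sub>M lborel))
      = (\<integral>\<^sup>+x. \<integral>\<^sup>+y. ennreal (norm (F x y)) \<partial>lborel \<partial>lborel)"
      by (subst lborel.nn_integral_fst[symmetric]) (auto simp: split_beta')
    then show "(\<integral>\<^sup>+z. ennreal (norm (case z of (x, y) \<Rightarrow> F x y)) \<partial>(lborel \<Otimes>\<^sub>M lborel)) < \<infinity>"
      using fin by simp
  qed simp
  then show ?thesis using lborel_pair.Fubini_integral[of F] by simp
qed

text \<open>The kernel is odd, so transposition changes the sign; its bound 1 / e gives the absolute
  convergence that Fubini requires.\<close>

lemma conj_poisson_adjoint:
  assumes f: "bdd_cs f" and h: "bdd_cs h" and e: "0 < e"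
  shows "(LINT x|lborel. conj_poisson e f x * h x) = - (LINT t|lborel. f t * conj_poisson e h t)"
proof -
  have [measurable]: "f \<in> borel_measurable borel" "h \<in> borel_measurable borel" using f h by (auto dest: bdd_csD)
  let ?F = "\<lambda>(x, t). (x - t) / ((x - t)\<^sup>2 + e\<^sup>2) * (f t * h x)"
  have "(\<integral>\<^sup>+x. \<integral>\<^sup>+t. ennreal (norm (?F (x, t))) \<partial>lborel \<partial>lborel)
      \<le> (\<integral>\<^sup>+x. \<integral>\<^sup>+t. ennreal (1 / e) * ennreal \<bar>h x\<bar> * ennreal \<bar>f t\<bar> \<partial>lborel \<partial>lborel)"
  proof (intro nn_integral_mono)
    fix x t
    have "norm (?F (x, t)) \<le> 1 / e * \<bar>h x\<bar> * \<bar>f t\<bar>"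
      using mult_right_mono[OF poisson_kernel_bounds(2)[OF e, of "x - t"], of "\<bar>f t * h x\<bar>"] e
      unfolding real_norm_def prod.case abs_mult by (simp add: mult_ac)
    then show "ennreal (norm (?F (x, t))) \<le> ennreal (1 / e) * ennreal \<bar>h x\<bar> * ennreal \<bar>f t\<bar>"
      using e by (simp flip: ennreal_mult)
  qed
  also have "\<dots> = ennreal (1 / e) * (\<integral>\<^sup>+x. ennreal \<bar>h x\<bar> \<partial>lborel) * (\<integral>\<^sup>+t. ennreal \<bar>f t\<bar> \<partial>lborel)"
    by (simp add: nn_integral_cmult nn_integral_multc)
  also have "\<dots> < \<infinity>"
    using integrable_bdd_cs[OF f] integrable_bdd_cs[OF h] by (simp add: integrable_iff_bounded ennreal_mult_less_top)
  finally have swap: "(LINT x|lborel. LINT t|lborel. ?F (x, t)) = (LINT t|lborel. LINT x|lborel. ?F (x, t))"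
    by (intro lborel_Fubini_swap) (auto simp: split_beta')
  have "(LINT x|lborel. conj_poisson e f x * h x) = (LINT x|lborel. LINT t|lborel. ?F (x, t))"
    unfolding conj_poisson_def by (simp add: mult.assoc flip: integral_mult_left_zero)
  also have "\<dots> = (LINT t|lborel. LINT x|lborel. ?F (x, t))"
    by (rule swap)
  also have "\<dots> = (LINT t|lborel. - (f t * conj_poisson e h t))"
  proof (rule Bochner_Integration.integral_cong)
    fix t
    have "(LINT x|lborel. ?F (x, t)) = (LINT x|lborel. - f t * ((t - x) / ((t - x)\<^sup>2 + e\<^sup>2) * h x))"
      by (intro Bochner_Integration.integral_cong) (auto simp: power2_commute[of t] divide_simps algebra_simps)
    also have "\<dots> = - (f t * conj_poisson e h t)"
      unfolding conj_poisson_def by (subst integral_mult_right_zero) simp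
    finally show "(LINT x|lborel. ?F (x, t)) = - (f t * conj_poisson e h t)" .
  qed simp
  finally show ?thesis by simp
qed

text \<open>Young's inequality for l a and b / l with the factors 1 / p and 1 / q dropped. The free
  \<open>l\<close> will make the dual term small enough to be absorbed.\<close>

lemma young_ineq:
  fixes a b l p q :: real
  assumes "0 \<le> a" "0 \<le> b" "0 < l" "1 < p" "1 / p + 1 / q = 1"
  shows "a * b \<le> l powr p * a powr p + l powr (- q) * b powr q"
proof -
  have "1 / q = 1 - 1 / p" using assms by linarith
  moreover have "1 / p < 1" "0 < 1 / p" using assms by auto
  ultimately have "0 < 1 / q" "1 / q < 1" by linarith+
  then have q1: "1 < q" by (simp add: divide_less_eq_1)
  have "(l * a) * (b / l) \<le> (l * a) powr p / p + (b / l) powr q / q"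
    using assms q1 by (intro Youngs_inequality) auto
  also have "\<dots> \<le> (l * a) powr p + (b / l) powr q"
    using assms q1 by (intro add_mono) (auto simp: divide_le_eq mult_le_cancel_left1)
  also have "\<dots> = l powr p * a powr p + l powr (- q) * b powr q"
    using assms by (simp add: powr_mult powr_divide powr_minus_divide)
  finally show ?thesis using assms by simp
qed

text \<open>For \<open>p > 2\<close> the bound follows by duality from the one for the conjugate exponent.\<close>

lemma riesz_ge_2:
  fixes p :: real
  assumes p: "2 \<le> p"
  obtains C where "0 < C" "\<And>f e. bdd_cs f \<Longrightarrow> 0 < e \<Longrightarrow>
    (\<integral>\<^sup>+x. ennreal (\<bar>conj_poisson e f x\<bar> powr p) \<partial>lborel) \<le> ennreal C * (\<integral>\<^sup>+x. ennreal (\<bar>f x\<bar> powr p) \<partial>lborel)"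
proof -
  define q where "q = p / (p - 1)"
  have q: "1 < q" "q \<le> 2" "1 / p + 1 / q = 1" "(p - 1) * q = p"
    using p by (auto simp: q_def field_simps)
  obtain C where C: "0 < C" "\<And>f e. bdd_cs f \<Longrightarrow> 0 < e \<Longrightarrow>
    (\<integral>\<^sup>+x. ennreal (\<bar>conj_poisson e f x\<bar> powr q) \<partial>lborel) \<le> ennreal C * (\<integral>\<^sup>+x. ennreal (\<bar>f x\<bar> powr q) \<partial>lborel)"
    using riesz_le_2[OF q(1,2)] by blast
  \<comment> \<open>Chosen such that l^(-q) C = 1 / 2: the dual term becomes half of the quantity to
    be bounded.\<close>
  define l where "l = (2 * C) powr (1 / q)"
  have l: "0 < l" "l powr (- q) * C = 1 / 2"
    using C q by (auto simp: l_def powr_powr powr_minus field_simps)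
  show ?thesis
  proof (rule that)
    show "0 < 2 * l powr p" using l by simp
    fix f e assume f: "bdd_cs f" and e: "(0::real) < e"
    have [measurable]: "f \<in> borel_measurable borel" using f by (rule bdd_csD)
    define I where "I = (LINT x|lborel. \<bar>f x\<bar> powr p)"
    have If: "integrable lborel (\<lambda>x. \<bar>f x\<bar> powr p)"
      using bdd_cs_nn_integral_powr[OF f, of p] p by (intro integrableI_bounded) auto
    have I: "(\<integral>\<^sup>+x. ennreal (\<bar>f x\<bar> powr p) \<partial>lborel) = ennreal I"
      unfolding I_def by (intro nn_integral_eq_integral If) auto
    let ?V = "conj_poisson e f"
    \<comment> \<open>The kernel is at most 1 / e. Boundedness of the conjugate integral is what
      admits the dual function below to \<open>bdd_cs\<close>.\<close>
    obtain B where B: "\<And>x. \<bar>?V x\<bar> \<le> B"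
    proof -
      have "\<bar>?V x\<bar> \<le> (LINT t|lborel. 1 / e * \<bar>f t\<bar>)" for x
        unfolding conj_poisson_def real_norm_def[symmetric]
      proof (rule Bochner_Integration.integral_norm_bound_integral)
        show "norm ((x - t) / ((x - t)\<^sup>2 + e\<^sup>2) * f t) \<le> 1 / e * norm (f t)" for t
          using mult_right_mono[OF poisson_kernel_bounds(2)[OF e, of "x - t"], of "\<bar>f t\<bar>"]
          unfolding real_norm_def abs_mult by simp
      qed (use integrable_poisson(2)[OF f e] integrable_bdd_cs[OF f] in auto)
      then show ?thesis by (rule that)
    qed
    have cut: "(\<integral>\<^sup>+x\<in>{-real n..real n}. ennreal (\<bar>?V x\<bar> powr p) \<partial>lborel) \<le> ennreal (2 * l powr p * I)" for n :: nat
    proof -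
      \<comment> \<open>The extremal function of the duality pairing, sgn V |V|^(p - 1), cut off to
        [-n, n]; then |h|^q = V h, which is |V|^p on the window. The cutoff also makes
        \<open>X\<close> finite, so that X / 2 can be subtracted.\<close>
      define h where "h x = indicator {-real n..real n} x * (sgn (?V x) * \<bar>?V x\<bar> powr (p - 1))" for x
      have [measurable]: "h \<in> borel_measurable borel" unfolding h_def[abs_def] by measurable
      have h: "bdd_cs h"
      proof -
        have "\<bar>h x\<bar> \<le> B powr (p - 1) \<and> (real n < \<bar>x\<bar> \<longrightarrow> h x = 0)" for x
        proof -
          have "\<bar>h x\<bar> \<le> \<bar>?V x\<bar> powr (p - 1)" by (auto simp: h_def indicator_def abs_mult sgn_real_def)
          also have "\<dots> \<le> B powr (p - 1)" using B[of x] p by (intro powr_mono2) auto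
          finally show ?thesis by (auto simp: h_def indicator_def)
        qed
        then show ?thesis unfolding bdd_cs_def by auto
      qed
      have hq: "\<bar>h x\<bar> powr q = ?V x * h x" "?V x * h x = indicator {-real n..real n} x * \<bar>?V x\<bar> powr p" for x
      proof -
        have a: "\<bar>?V x\<bar> * \<bar>?V x\<bar> powr (p - 1) = \<bar>?V x\<bar> powr p"
          using p by (cases "?V x = 0") (auto simp: powr_diff)
        show 2: "?V x * h x = indicator {-real n..real n} x * \<bar>?V x\<bar> powr p"
          unfolding a[symmetric] by (auto simp: h_def indicator_def sgn_real_def)
        show "\<bar>h x\<bar> powr q = ?V x * h x"
          unfolding 2 using p q by (auto simp: h_def indicator_def abs_mult powr_powr sgn_real_def)
      qed
      define X where "X = (LINT x|lborel. ?V x * h x)"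
      have Xi: "integrable lborel (\<lambda>x. ?V x * h x)"
        using integrable_bdd_cs_mult[OF h, of ?V B] B by simp
      have X: "(\<integral>\<^sup>+x. ennreal (\<bar>h x\<bar> powr q) \<partial>lborel) = ennreal X"
        unfolding hq(1) X_def by (intro nn_integral_eq_integral Xi) (auto simp: hq(2))
      have X0: "0 \<le> X" unfolding X_def by (intro integral_nonneg_AE) (auto simp: hq(2))
      have W: "(\<integral>\<^sup>+x. ennreal (\<bar>conj_poisson e h x\<bar> powr q) \<partial>lborel) \<le> ennreal (C * X)"
        using C(2)[OF h e] C(1) X0 by (simp add: X ennreal_mult)
      have Wi: "integrable lborel (\<lambda>x. \<bar>conj_poisson e h x\<bar> powr q)"
        using le_less_trans[OF W ennreal_less_top] by (intro integrableI_bounded) auto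
      have Wr: "(LINT x|lborel. \<bar>conj_poisson e h x\<bar> powr q) \<le> C * X"
        using W C(1) X0 by (subst (asm) nn_integral_eq_integral[OF Wi]) (auto simp: ennreal_le_iff)
      have "X = \<bar>LINT t|lborel. f t * conj_poisson e h t\<bar>"
        using conj_poisson_adjoint[OF f h e] X0 by (simp add: X_def)
      also have "\<dots> \<le> (LINT t|lborel. l powr p * \<bar>f t\<bar> powr p + l powr (- q) * \<bar>conj_poisson e h t\<bar> powr q)"
      proof (rule integral_abs_bound_integral)
        show *: "\<bar>f t * conj_poisson e h t\<bar> \<le> l powr p * \<bar>f t\<bar> powr p + l powr (- q) * \<bar>conj_poisson e h t\<bar> powr q" for t
          unfolding abs_mult using p q l by (intro young_ineq) auto
        show 1: "integrable lborel (\<lambda>t. l powr p * \<bar>f t\<bar> powr p + l powr (- q) * \<bar>conj_poisson e h t\<bar> powr q)"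
          using If Wi by simp
        show "integrable lborel (\<lambda>t. f t * conj_poisson e h t)"
          by (rule Bochner_Integration.integrable_bound[OF 1]) (use * in \<open>auto intro: order_trans[OF _ abs_ge_self]\<close>)
      qed
      also have "\<dots> = l powr p * I + l powr (- q) * (LINT t|lborel. \<bar>conj_poisson e h t\<bar> powr q)"
        using If Wi by (simp add: I_def)
      also have "\<dots> \<le> l powr p * I + l powr (- q) * (C * X)"
        using Wr by (intro add_left_mono mult_left_mono) auto
      also have "\<dots> = l powr p * I + X / 2"
        using l(2) by (simp add: mult.assoc[symmetric])
      finally have "X \<le> 2 * l powr p * I" by simp
      moreover have "(\<integral>\<^sup>+x\<in>{-real n..real n}. ennreal (\<bar>?V x\<bar> powr p) \<partial>lborel) = ennreal X"
        unfolding X[symmetric] hq by (intro nn_integral_cong) (auto simp: indicator_def)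
      ultimately show ?thesis by (simp add: ennreal_leI)
    qed
    have "(\<integral>\<^sup>+x. ennreal (\<bar>?V x\<bar> powr p) \<partial>lborel) \<le> ennreal (2 * l powr p * I)"
      by (rule nn_integral_le_of_cutoffs[OF _ cut]) auto
    then show "(\<integral>\<^sup>+x. ennreal (\<bar>?V x\<bar> powr p) \<partial>lborel) \<le> ennreal (2 * l powr p) * (\<integral>\<^sup>+x. ennreal (\<bar>f x\<bar> powr p) \<partial>lborel)"
      unfolding I by (subst ennreal_mult'[symmetric]) simp_all
  qed
qed

theorem riesz_conj_poisson:
  fixes p :: real
  assumes p: "1 < p"
  obtains C where "0 < C" "\<And>f e. bdd_cs f \<Longrightarrow> 0 < e \<Longrightarrow>
    (\<integral>\<^sup>+x. ennreal (\<bar>conj_poisson e f x\<bar> powr p) \<partial>lborel) \<le> ennreal C * (\<integral>\<^sup>+x. ennreal (\<bar>f x\<bar> powr p) \<partial>lborel)"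
  using riesz_le_2[OF p] riesz_ge_2 by (metis linear)

section \<open>The semigroup law for conjugate Poisson integrals\<close>

lemma norm_integral_le_nn_integral:
  fixes f :: "'b \<Rightarrow> 'c::{banach, second_countable_topology}"
  shows "ennreal (norm (integral\<^sup>L M f)) \<le> (\<integral>\<^sup>+x. ennreal (norm (f x)) \<partial>M)"
  by (cases "integrable M f") (simp_all add: integral_norm_bound_ennreal not_integrable_integral_eq)

lemma integrable_poisson_kernel:
  assumes "0 < (e::real)"
  shows "integrable lborel (\<lambda>y. e / ((x - y)\<^sup>2 + e\<^sup>2))"
proof (rule integrableI_bounded)
  have "(\<integral>\<^sup>+y. ennreal (norm (e / ((x - y)\<^sup>2 + e\<^sup>2))) \<partial>lborel) = (\<integral>\<^sup>+y. ennreal (e / ((x - y)\<^sup>2 + e\<^sup>2)) * ennreal 1 \<partial>lborel)"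
    using assms by simp
  also have "\<dots> \<le> ennreal 16 * max_fun (\<lambda>_. ennreal 1) x"
    using assms by (intro poisson_le_max_fun) auto
  also have "\<dots> \<le> ennreal 16 * ennreal (unit_vol TYPE(real) * 1)"
    by (intro mult_left_mono max_fun_const_le) auto
  also have "\<dots> < \<infinity>" by (simp add: ennreal_mult_less_top)
  finally show "(\<integral>\<^sup>+y. ennreal (norm (e / ((x - y)\<^sup>2 + e\<^sup>2))) \<partial>lborel) < \<infinity>" .
qed simp

lemma ln_quadratic_ratio_tendsto:
  fixes x e d :: real
  assumes "0 < e" "0 < d"
  shows "((\<lambda>y. ln ((y - x)\<^sup>2 + e\<^sup>2) - ln (y\<^sup>2 + d\<^sup>2)) \<longlongrightarrow> 0) at_top"
    "((\<lambda>y. ln ((y - x)\<^sup>2 + e\<^sup>2) - ln (y\<^sup>2 + d\<^sup>2)) \<longlongrightarrow> 0) at_bot"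
  by real_asymp+

lemma arctan_affine_tendsto:
  fixes x e :: real
  assumes "0 < e"
  shows "((\<lambda>y. arctan ((y - x) / e)) \<longlongrightarrow> pi / 2) at_top" "((\<lambda>y. arctan ((y - x) / e)) \<longlongrightarrow> - (pi / 2)) at_bot"
  using assms by real_asymp+

text \<open>Partial fractions give an elementary primitive, and the integral is read off its limits
  at both ends. The condition on x keeps the common factor \<open>D\<close> positive also when e =
  d.\<close>

lemma poisson_conj_poisson_kernel:
  fixes x e d :: real
  assumes x: "x \<noteq> 0" and e: "0 < e" and d: "0 < d"
  shows "integrable lborel (\<lambda>y. e / ((x - y)\<^sup>2 + e\<^sup>2) * (y / (y\<^sup>2 + d\<^sup>2)))"
    and "(LINT y|lborel. e / ((x - y)\<^sup>2 + e\<^sup>2) * (y / (y\<^sup>2 + d\<^sup>2))) = pi * (x / (x\<^sup>2 + (e + d)\<^sup>2))"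
proof -
  let ?g = "\<lambda>y. e / ((x - y)\<^sup>2 + e\<^sup>2) * (y / (y\<^sup>2 + d\<^sup>2))"
  show int: "integrable lborel ?g"
  proof (rule Bochner_Integration.integrable_bound)
    show "integrable lborel (\<lambda>y. 1 / d * (e / ((x - y)\<^sup>2 + e\<^sup>2)))"
      by (intro integrable_mult_right integrable_poisson_kernel e)
    show "AE y in lborel. norm (?g y) \<le> norm (1 / d * (e / ((x - y)\<^sup>2 + e\<^sup>2)))"
    proof (rule AE_I2)
      fix y
      show "norm (?g y) \<le> norm (1 / d * (e / ((x - y)\<^sup>2 + e\<^sup>2)))"
        using mult_right_mono[OF poisson_kernel_bounds(2)[OF d, of y], of "\<bar>e / ((x - y)\<^sup>2 + e\<^sup>2)\<bar>"] d
        unfolding real_norm_def abs_mult by (simp add: mult.commute)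
    qed
  qed simp
  \<comment> \<open>Partial fractions: with X = (y - x)^2 + e^2 and Y = y^2 + d^2, the function D e
    y / (X Y) equals (a (y - x) + b e) / X + (c d - a y) / Y. The opposite signs of a join the
    logarithms into that of X / Y.\<close>
  define a where "a = - (e * (x\<^sup>2 + e\<^sup>2 - d\<^sup>2))"
  define b where "b = x * (x\<^sup>2 + e\<^sup>2 + d\<^sup>2)"
  define c where "c = - (2 * x * d * e)"
  define D where "D = (x\<^sup>2 + (e + d)\<^sup>2) * (x\<^sup>2 + (e - d)\<^sup>2)"
  define G where "G y = a / 2 * (ln ((y - x)\<^sup>2 + e\<^sup>2) - ln (y\<^sup>2 + d\<^sup>2)) + b * arctan ((y - x) / e) + c * arctan (y / d)" for y
  have pos: "0 < (y - x)\<^sup>2 + e\<^sup>2" "0 < y\<^sup>2 + d\<^sup>2" for y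
    using e d by (auto intro: add_nonneg_pos)
  have der: "(G has_real_derivative D * ?g y) (at y)" for y
  proof -
    have D1: "((\<lambda>y. ln ((y - x)\<^sup>2 + e\<^sup>2)) has_real_derivative 2 * (y - x) / ((y - x)\<^sup>2 + e\<^sup>2)) (at y)"
      using pos(1)[of y] by (auto intro!: derivative_eq_intros simp: divide_simps)
    have D2: "((\<lambda>y. ln (y\<^sup>2 + d\<^sup>2)) has_real_derivative 2 * y / (y\<^sup>2 + d\<^sup>2)) (at y)"
      using pos(2)[of y] by (auto intro!: derivative_eq_intros simp: divide_simps)
    have at: "((\<lambda>y. arctan ((y - z) / r)) has_real_derivative r / ((y - z)\<^sup>2 + r\<^sup>2)) (at y)" if "0 < r" for z r
    proof -
      have "1 + ((y - z) / r)\<^sup>2 = ((y - z)\<^sup>2 + r\<^sup>2) / r\<^sup>2" using that by (simp add: power_divide field_simps)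
      then have "1 / r * inverse (1 + ((y - z) / r)\<^sup>2) = r\<^sup>2 / (r * ((y - z)\<^sup>2 + r\<^sup>2))" by simp
      also have "\<dots> = r / ((y - z)\<^sup>2 + r\<^sup>2)" using that by (simp add: power2_eq_square)
      finally have "1 / r * inverse (1 + ((y - z) / r)\<^sup>2) = r / ((y - z)\<^sup>2 + r\<^sup>2)" .
      then have "((\<lambda>y. arctan ((y - z) / r)) has_real_derivative (1 / r * inverse (1 + ((y - z) / r)\<^sup>2))) (at y) \<Longrightarrow> ?thesis"
        by simp
      moreover have "((\<lambda>y. arctan ((y - z) / r)) has_real_derivative (1 / r * inverse (1 + ((y - z) / r)\<^sup>2))) (at y)"
        using that by (auto intro!: derivative_eq_intros)
      ultimately show ?thesis by blast
    qed
    have "(G has_real_derivative a / 2 * (2 * (y - x) / ((y - x)\<^sup>2 + e\<^sup>2) - 2 * y / (y\<^sup>2 + d\<^sup>2))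
        + b * (e / ((y - x)\<^sup>2 + e\<^sup>2)) + c * (d / (y\<^sup>2 + d\<^sup>2))) (at y)"
      unfolding G_def[abs_def] using at[OF e, of x] at[OF d, of 0]
      by (intro DERIV_add DERIV_cmult DERIV_diff D1 D2) auto
    moreover have "a / 2 * (2 * (y - x) / ((y - x)\<^sup>2 + e\<^sup>2) - 2 * y / (y\<^sup>2 + d\<^sup>2))
        + b * (e / ((y - x)\<^sup>2 + e\<^sup>2)) + c * (d / (y\<^sup>2 + d\<^sup>2)) = D * ?g y"
    proof -
      define X Y where "X = (y - x)\<^sup>2 + e\<^sup>2" and "Y = y\<^sup>2 + d\<^sup>2"
      have XY: "0 < X" "0 < Y" using pos by (auto simp: X_def Y_def)
      have "(a * (y - x) + b * e) * Y + (c * d - a * y) * X = D * (e * y)"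
        unfolding a_def b_def c_def D_def X_def Y_def by algebra
      then have "((a * (y - x) + b * e) * Y + (c * d - a * y) * X) / (X * Y) = D * (e * y) / (X * Y)" by simp
      then have "(a * (y - x) + b * e) / X + (c * d - a * y) / Y = D * (e / X * (y / Y))"
        using XY by (simp add: add_divide_distrib)
      then show ?thesis
        unfolding power2_commute[of x y] X_def[symmetric] Y_def[symmetric]
        by (simp add: add_divide_distrib diff_divide_distrib algebra_simps)
    qed
    ultimately show ?thesis by simp
  qed
  \<comment> \<open>The ratio inside the logarithm tends to 1 at both ends, and the arctangents tend
    to pi / 2 and - pi / 2, so the total is pi (b + c).\<close>
  have lim: "(G \<longlongrightarrow> a / 2 * 0 + b * (pi / 2) + c * (pi / 2)) at_top" "(G \<longlongrightarrow> a / 2 * 0 + b * (- (pi / 2)) + c * (- (pi / 2))) at_bot"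
    unfolding G_def[abs_def]
    by (intro tendsto_add tendsto_mult tendsto_const ln_quadratic_ratio_tendsto arctan_affine_tendsto
          arctan_affine_tendsto[of d 0, simplified] e d)+
  have "(LBINT y=-\<infinity>..\<infinity>. D * ?g y) = pi / 2 * (b + c) - (- (pi / 2) * (b + c))"
  proof (rule interval_integral_FTC_integrable)
    show "(G has_vector_derivative D * ?g y) (at y)" for y
      using der by (simp add: has_real_derivative_iff_has_vector_derivative)
    show "isCont (\<lambda>y. D * ?g y) y" for y
      using pos(1)[of y] pos(2)[of y] by (auto intro!: continuous_intros simp: power2_commute[of x y])
    show "set_integrable lborel (einterval (-\<infinity>) \<infinity>) (\<lambda>y. D * ?g y)"
      using integrable_mult_right[OF int, of D] by (simp only: set_integrable_def einterval_eq indicator_UNIV scaleR_one)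
    have eqs: "a / 2 * 0 + b * (- (pi / 2)) + c * (- (pi / 2)) = - (pi / 2) * (b + c)"
        "a / 2 * 0 + b * (pi / 2) + c * (pi / 2) = pi / 2 * (b + c)" by (simp_all add: algebra_simps)
    show "((G \<circ> real_of_ereal) \<longlongrightarrow> - (pi / 2) * (b + c)) (at_right (-\<infinity>))"
      using lim(2) unfolding eqs by (simp only: ereal_tendsto_simps1)
    show "((G \<circ> real_of_ereal) \<longlongrightarrow> pi / 2 * (b + c)) (at_left \<infinity>)"
      using lim(1) unfolding eqs by (simp only: ereal_tendsto_simps1)
  qed simp
  then have "(LINT y|lborel. D * ?g y) = pi * (b + c)"
    by (simp only: interval_lebesgue_integral_def set_lebesgue_integral_def einterval_eq indicator_UNIV scaleR_one if_True
        ereal_less_eq ereal_infty_less_eq)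
  moreover define I where "I = (LINT y|lborel. ?g y)"
  ultimately have "D * I = pi * (b + c)" by (simp only: integral_mult_right_zero)
  \<comment> \<open>The sum is x times one of the two factors of \<open>D\<close>; cancelling it
    leaves the other factor, which carries e + d.\<close>
  also have "b + c = x * (x\<^sup>2 + (e - d)\<^sup>2)" unfolding b_def c_def by algebra
  finally have eq: "D * I = pi * (x * (x\<^sup>2 + (e - d)\<^sup>2))" .
  have p: "0 < x\<^sup>2 + (e - d)\<^sup>2" "0 < x\<^sup>2 + (e + d)\<^sup>2" using x by (auto intro: add_pos_nonneg)
  have "(x\<^sup>2 + (e - d)\<^sup>2) * ((x\<^sup>2 + (e + d)\<^sup>2) * I) = (x\<^sup>2 + (e - d)\<^sup>2) * (pi * x)"
    using eq unfolding D_def by (simp only: mult_ac)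
  then have "(x\<^sup>2 + (e + d)\<^sup>2) * I = pi * x" using p(1) mult_left_cancel[of "x\<^sup>2 + (e - d)\<^sup>2"] by (metis less_irrefl)
  then have "I = pi * (x / (x\<^sup>2 + (e + d)\<^sup>2))" using p(2) nonzero_mult_div_cancel_left[of "x\<^sup>2 + (e + d)\<^sup>2" I] by (metis less_irrefl times_divide_eq_right)
  then show "(LINT y|lborel. ?g y) = pi * (x / (x\<^sup>2 + (e + d)\<^sup>2))" by (simp only: I_def)
qed

lemma conj_poisson_semigroup:
  assumes f: "bdd_cs f" and e: "0 < e" and d: "0 < d"
  shows "pi * conj_poisson (e + d) f x = (LINT y|lborel. e / ((x - y)\<^sup>2 + e\<^sup>2) * conj_poisson d f y)"
proof -
  have [measurable]: "f \<in> borel_measurable borel" using f by (rule bdd_csD)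
  let ?F = "\<lambda>y t. e / ((x - y)\<^sup>2 + e\<^sup>2) * ((y - t) / ((y - t)\<^sup>2 + d\<^sup>2) * f t)"
  have "(\<integral>\<^sup>+y. \<integral>\<^sup>+t. ennreal (norm (?F y t)) \<partial>lborel \<partial>lborel)
      \<le> (\<integral>\<^sup>+y. \<integral>\<^sup>+t. ennreal (1 / d) * ennreal (e / ((x - y)\<^sup>2 + e\<^sup>2)) * ennreal \<bar>f t\<bar> \<partial>lborel \<partial>lborel)"
  proof (intro nn_integral_mono)
    fix y t
    have "norm (?F y t) \<le> 1 / d * (e / ((x - y)\<^sup>2 + e\<^sup>2)) * \<bar>f t\<bar>"
      using mult_right_mono[OF poisson_kernel_bounds(2)[OF d, of "y - t"], of "\<bar>e / ((x - y)\<^sup>2 + e\<^sup>2) * f t\<bar>"] e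
      unfolding real_norm_def abs_mult by (simp add: mult_ac)
    then show "ennreal (norm (?F y t)) \<le> ennreal (1 / d) * ennreal (e / ((x - y)\<^sup>2 + e\<^sup>2)) * ennreal \<bar>f t\<bar>"
      using e d by (simp flip: ennreal_mult)
  qed
  also have "\<dots> = ennreal (1 / d) * (\<integral>\<^sup>+y. ennreal (e / ((x - y)\<^sup>2 + e\<^sup>2)) \<partial>lborel) * (\<integral>\<^sup>+t. ennreal \<bar>f t\<bar> \<partial>lborel)"
    by (simp add: nn_integral_cmult nn_integral_multc)
  also have "\<dots> < \<infinity>"
    using integrable_bdd_cs[OF f] integrable_poisson_kernel[OF e, of x] e
    by (simp add: integrable_iff_bounded ennreal_mult_less_top)
  finally have fin: "(\<integral>\<^sup>+y. \<integral>\<^sup>+t. ennreal (norm (?F y t)) \<partial>lborel \<partial>lborel) < \<infinity>" .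
  have "(LINT y|lborel. e / ((x - y)\<^sup>2 + e\<^sup>2) * conj_poisson d f y) = (LINT y|lborel. LINT t|lborel. ?F y t)"
    unfolding conj_poisson_def by (simp only: integral_mult_right_zero)
  also have "\<dots> = (LINT t|lborel. LINT y|lborel. ?F y t)"
    by (intro lborel_Fubini_swap fin) (auto simp: split_beta')
  also have "\<dots> = (LINT t|lborel. pi * ((x - t) / ((x - t)\<^sup>2 + (e + d)\<^sup>2) * f t))"
  proof (rule integral_cong_AE)
    show "AE t in lborel. (LINT y|lborel. ?F y t) = pi * ((x - t) / ((x - t)\<^sup>2 + (e + d)\<^sup>2) * f t)"
      using AE_lborel_singleton[of x]
    proof eventually_elim
      case (elim t)
      have "(LINT y|lborel. ?F y t) = (LINT y|lborel. e / ((x - y)\<^sup>2 + e\<^sup>2) * ((y - t) / ((y - t)\<^sup>2 + d\<^sup>2))) * f t"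
        by (simp only: integral_mult_left_zero[symmetric] mult.assoc)
      also have "(LINT y|lborel. e / ((x - y)\<^sup>2 + e\<^sup>2) * ((y - t) / ((y - t)\<^sup>2 + d\<^sup>2)))
        = (LINT y|lborel. e / (((x - t) - y)\<^sup>2 + e\<^sup>2) * (y / (y\<^sup>2 + d\<^sup>2)))"
        by (subst lborel_integral_real_affine[of 1 _ t]) (simp_all add: diff_diff_eq)
      also have "\<dots> = pi * ((x - t) / ((x - t)\<^sup>2 + (e + d)\<^sup>2))"
        using elim by (intro poisson_conj_poisson_kernel e d) auto
      finally show ?case by (simp only: mult.assoc)
    qed
  qed measurable
  also have "\<dots> = pi * conj_poisson (e + d) f x"
    unfolding conj_poisson_def by (rule integral_mult_right_zero)
  finally show ?thesis ..
qed

text \<open>By the semigroup law, the conjugate integral at any larger height is a Poisson average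
  of the one at height \<open>d\<close>. A supremum over heights is thus dominated by the maximal
  function of one single function, which is the heart of Cotlar's argument.\<close>

lemma conj_poisson_le_max_fun:
  assumes f: "bdd_cs f" and d: "0 < d" "d < a"
  shows "ennreal \<bar>conj_poisson a f x\<bar> \<le> ennreal 16 * max_fun (\<lambda>y. ennreal \<bar>conj_poisson d f y\<bar>) x"
proof -
  have [measurable]: "f \<in> borel_measurable borel" using f by (rule bdd_csD)
  define e where "e = a - d"
  have e: "0 < e" "a = e + d" using d by (auto simp: e_def)
  have "\<bar>conj_poisson a f x\<bar> \<le> pi * \<bar>conj_poisson a f x\<bar>"
    using pi_gt3 by (simp add: mult_le_cancel_right1)
  also have "\<dots> = \<bar>LINT y|lborel. e / ((x - y)\<^sup>2 + e\<^sup>2) * conj_poisson d f y\<bar>"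
    unfolding conj_poisson_semigroup[OF f e(1) d(1), of x, symmetric] e(2) abs_mult by simp
  finally have "ennreal \<bar>conj_poisson a f x\<bar> \<le> ennreal (norm (LINT y|lborel. e / ((x - y)\<^sup>2 + e\<^sup>2) * conj_poisson d f y))"
    by (simp add: ennreal_leI)
  also have "\<dots> \<le> (\<integral>\<^sup>+y. ennreal (norm (e / ((x - y)\<^sup>2 + e\<^sup>2) * conj_poisson d f y)) \<partial>lborel)"
    by (rule norm_integral_le_nn_integral)
  also have "\<dots> = (\<integral>\<^sup>+y. ennreal (e / ((x - y)\<^sup>2 + e\<^sup>2)) * ennreal \<bar>conj_poisson d f y\<bar> \<partial>lborel)"
    using e by (intro nn_integral_cong) (simp add: abs_mult flip: ennreal_mult)
  also have "\<dots> \<le> ennreal 16 * max_fun (\<lambda>y. ennreal \<bar>conj_poisson d f y\<bar>) x"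
    using e by (intro poisson_le_max_fun) auto
  finally show ?thesis .
qed


section \<open>Truncated Hilbert transforms and Cotlar's inequality\<close>

definition trunc_kernel :: "real \<Rightarrow> real \<Rightarrow> real \<Rightarrow> real" where
  "trunc_kernel a b v = indicator {a..b} v / v + indicator {a..b} (- v) / v"

text \<open>The line is folded at 0, where the kernel is odd. Applied to the translate of f by x it
  is the convolution of f with \<open>trunc_kernel\<close> at x.\<close>

definition trunc_hilbert :: "real \<Rightarrow> real \<Rightarrow> (real \<Rightarrow> real) \<Rightarrow> real" where
  "trunc_hilbert a b f = (LINT t|lborel. indicator {a..b} t * ((f (- t) - f t) / t))"

text \<open>For |v| \<ge> c the difference of 1 / v and the conjugate kernel of height c is c / v
  times the Poisson kernel; for |v| \<le> c the conjugate kernel is itself at most the Poisson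
  kernel. Where |v| lies relative to a and b decides which comparison applies at each
  height.\<close>

lemma trunc_kernel_bound:
  assumes "0 < a" "a \<le> b"
  shows "\<bar>trunc_kernel a b v - (v / (v\<^sup>2 + a\<^sup>2) - v / (v\<^sup>2 + b\<^sup>2))\<bar> \<le> a / (v\<^sup>2 + a\<^sup>2) + b / (v\<^sup>2 + b\<^sup>2)"
proof -
  have far: "\<bar>1 / v - v / (v\<^sup>2 + c\<^sup>2)\<bar> \<le> c / (v\<^sup>2 + c\<^sup>2)" if "0 < c" "c \<le> \<bar>v\<bar>" for c
  proof -
    have p: "0 < v\<^sup>2 + c\<^sup>2" "v \<noteq> 0" using that by (auto intro: add_nonneg_pos)
    have "1 / v - v / (v\<^sup>2 + c\<^sup>2) = (c / v) * (c / (v\<^sup>2 + c\<^sup>2))"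
      using p by (simp add: divide_simps power2_eq_square)
    moreover have "\<bar>c / v\<bar> \<le> 1" using that by (simp add: abs_div_pos)
    ultimately show ?thesis
      using mult_right_mono[of "\<bar>c / v\<bar>" 1 "c / (v\<^sup>2 + c\<^sup>2)"] that p by (simp add: abs_mult)
  qed
  have near: "\<bar>v / (v\<^sup>2 + c\<^sup>2)\<bar> \<le> c / (v\<^sup>2 + c\<^sup>2)" if "0 < c" "\<bar>v\<bar> \<le> c" for c
    using that by (simp add: divide_right_mono)
  consider "\<bar>v\<bar> < a" | "a \<le> \<bar>v\<bar>" "\<bar>v\<bar> \<le> b" | "b < \<bar>v\<bar>" by linarith
  then show ?thesis
  proof cases
    case 1
    then have "trunc_kernel a b v = 0" using assms by (auto simp: trunc_kernel_def indicator_def)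
    then show ?thesis using near[of a] near[of b] 1 assms by linarith
  next
    case 2
    then have "trunc_kernel a b v = 1 / v" using assms by (auto simp: trunc_kernel_def indicator_def)
    then show ?thesis using far[of a] near[of b] 2 assms by linarith
  next
    case 3
    then have "trunc_kernel a b v = 0" using assms by (auto simp: trunc_kernel_def indicator_def)
    moreover have "v / (v\<^sup>2 + a\<^sup>2) - v / (v\<^sup>2 + b\<^sup>2) = (1 / v - v / (v\<^sup>2 + b\<^sup>2)) - (1 / v - v / (v\<^sup>2 + a\<^sup>2))" by simp
    ultimately show ?thesis using far[of a] far[of b] 3 assms by linarith
  qed
qed

lemma bdd_cs_affine:
  assumes "bdd_cs f" "\<bar>c\<bar> = 1"
  shows "bdd_cs (\<lambda>t. f (x + c * t))"
proof -
  obtain K A where KA: "0 < K" "0 < A" "\<And>x. \<bar>f x\<bar> \<le> K" "\<And>x. A < \<bar>x\<bar> \<Longrightarrow> f x = 0"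
    using bdd_csE[OF assms(1)] by blast
  have "f (x + c * t) = 0" if "A + \<bar>x\<bar> < \<bar>t\<bar>" for t
  proof (rule KA(4))
    have "\<bar>t\<bar> = \<bar>c * t\<bar>" using assms(2) by (simp add: abs_mult)
    then show "A < \<bar>x + c * t\<bar>" using that by linarith
  qed
  moreover have "(\<lambda>t. f (x + c * t)) \<in> borel_measurable borel"
    using bdd_csD[OF assms(1)] by measurable
  ultimately show ?thesis unfolding bdd_cs_def using KA(3) by blast
qed

lemma trunc_hilbert_le:
  assumes f: "bdd_cs f" and ab: "0 < a" "a \<le> b"
  shows "\<bar>trunc_hilbert a b (\<lambda>t. f (x + t))\<bar>
    \<le> \<bar>conj_poisson a f x\<bar> + \<bar>conj_poisson b f x\<bar> + \<bar>poisson a (\<lambda>t. \<bar>f t\<bar>) x\<bar> + \<bar>poisson b (\<lambda>t. \<bar>f t\<bar>) x\<bar>"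
proof -
  have [measurable]: "f \<in> borel_measurable borel" using f by (rule bdd_csD)
  have b0: "0 < b" using ab by simp
  have af: "bdd_cs (\<lambda>t. \<bar>f t\<bar>)" by (rule bdd_cs_mono[OF f, of _ 1]) auto
  have kb: "norm (indicator {a..b} t / t) \<le> 1 / a" for t :: real
    using ab by (auto simp: indicator_def intro!: divide_left_mono)
  have f1: "bdd_cs (\<lambda>t. f (x - t))" "bdd_cs (\<lambda>t. f (x + t))"
    using bdd_cs_affine[OF f, of "-1" x] bdd_cs_affine[OF f, of 1 x] by auto
  note i1 = integrable_bdd_cs_mult[OF f1(1) _ kb, simplified] integrable_bdd_cs_mult[OF f1(2) _ kb, simplified]
  have kb2: "norm (indicator {a..b} (x - t) / (x - t)) \<le> 1 / a" "norm (indicator {a..b} (t - x) / (t - x)) \<le> 1 / a" for t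
    using kb[of "x - t"] kb[of "t - x"] by auto
  have i2: "integrable lborel (\<lambda>t. indicator {a..b} (x - t) / (x - t) * f t)" "integrable lborel (\<lambda>t. indicator {a..b} (t - x) / (t - x) * f t)"
    using integrable_bdd_cs_mult[OF f _ kb2(1), simplified] integrable_bdd_cs_mult[OF f _ kb2(2), simplified] by auto
  have "trunc_hilbert a b (\<lambda>t. f (x + t)) = (LINT t|lborel. indicator {a..b} t / t * f (x - t) - indicator {a..b} t / t * f (x + t))"
    unfolding trunc_hilbert_def by (intro Bochner_Integration.integral_cong) (auto simp: diff_divide_distrib right_diff_distrib)
  also have "\<dots> = (LINT t|lborel. indicator {a..b} t / t * f (x - t)) - (LINT t|lborel. indicator {a..b} t / t * f (x + t))"
    using i1 by (intro Bochner_Integration.integral_diff) auto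
  also have "(LINT t|lborel. indicator {a..b} t / t * f (x - t)) = (LINT t|lborel. indicator {a..b} (x - t) / (x - t) * f t)"
    by (subst lborel_integral_real_affine[of "-1" _ x]) simp_all
  also have "(LINT t|lborel. indicator {a..b} t / t * f (x + t)) = (LINT t|lborel. indicator {a..b} (t - x) / (t - x) * f t)"
    by (subst lborel_integral_real_affine[of "1" _ "- x"]) simp_all
  also have "(LINT t|lborel. indicator {a..b} (x - t) / (x - t) * f t) - (LINT t|lborel. indicator {a..b} (t - x) / (t - x) * f t)
     = (LINT t|lborel. indicator {a..b} (x - t) / (x - t) * f t - indicator {a..b} (t - x) / (t - x) * f t)"
    using i2 by (intro Bochner_Integration.integral_diff[symmetric]) auto
  also have "\<dots> = (LINT t|lborel. trunc_kernel a b (x - t) * f t)"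
  proof (intro Bochner_Integration.integral_cong refl)
    fix t
    have "w / (t - x) = - (w / (x - t))" for w by (metis minus_diff_eq minus_divide_right)
    then show "indicator {a..b} (x - t) / (x - t) * f t - indicator {a..b} (t - x) / (t - x) * f t = trunc_kernel a b (x - t) * f t"
      by (simp add: trunc_kernel_def algebra_simps)
  qed
  finally have H: "trunc_hilbert a b (\<lambda>t. f (x + t)) = (LINT t|lborel. trunc_kernel a b (x - t) * f t)" .
  have iK: "integrable lborel (\<lambda>t. trunc_kernel a b (x - t) * f t)"
  proof -
    have [measurable]: "trunc_kernel a b \<in> borel_measurable borel" unfolding trunc_kernel_def[abs_def] by measurable
    have "norm (trunc_kernel a b v) \<le> 1 / a" for v
      using kb[of v] kb[of "- v"] ab by (auto simp: trunc_kernel_def indicator_def)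
    then show ?thesis using integrable_bdd_cs_mult[OF f, of "\<lambda>t. trunc_kernel a b (x - t)" "1 / a"] by simp
  qed
  note ip = integrable_poisson[OF f ab(1), of x] integrable_poisson[OF f b0, of x]
    integrable_poisson[OF af ab(1), of x] integrable_poisson[OF af b0, of x]
  have "\<bar>(LINT t|lborel. trunc_kernel a b (x - t) * f t) - (conj_poisson a f x - conj_poisson b f x)\<bar>
    = \<bar>LINT t|lborel. trunc_kernel a b (x - t) * f t - ((x - t) / ((x - t)\<^sup>2 + a\<^sup>2) * f t - (x - t) / ((x - t)\<^sup>2 + b\<^sup>2) * f t)\<bar>"
    unfolding conj_poisson_def
    by (simp only: Bochner_Integration.integral_diff[OF ip(2) ip(4)] Bochner_Integration.integral_diff[OF iK Bochner_Integration.integrable_diff[OF ip(2) ip(4)]])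
  also have "\<dots> \<le> (LINT t|lborel. a / ((x - t)\<^sup>2 + a\<^sup>2) * \<bar>f t\<bar> + b / ((x - t)\<^sup>2 + b\<^sup>2) * \<bar>f t\<bar>)"
  proof (rule integral_abs_bound_integral)
    show "integrable lborel (\<lambda>t. trunc_kernel a b (x - t) * f t - ((x - t) / ((x - t)\<^sup>2 + a\<^sup>2) * f t - (x - t) / ((x - t)\<^sup>2 + b\<^sup>2) * f t))"
      by (intro Bochner_Integration.integrable_diff iK ip)
    show "integrable lborel (\<lambda>t. a / ((x - t)\<^sup>2 + a\<^sup>2) * \<bar>f t\<bar> + b / ((x - t)\<^sup>2 + b\<^sup>2) * \<bar>f t\<bar>)"
      by (intro Bochner_Integration.integrable_add ip)
    fix t
    have "\<bar>trunc_kernel a b (x - t) * f t - ((x - t) / ((x - t)\<^sup>2 + a\<^sup>2) * f t - (x - t) / ((x - t)\<^sup>2 + b\<^sup>2) * f t)\<bar>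
      = \<bar>trunc_kernel a b (x - t) - ((x - t) / ((x - t)\<^sup>2 + a\<^sup>2) - (x - t) / ((x - t)\<^sup>2 + b\<^sup>2))\<bar> * \<bar>f t\<bar>"
      unfolding abs_mult[symmetric] by (simp only: left_diff_distrib)
    also have "\<dots> \<le> (a / ((x - t)\<^sup>2 + a\<^sup>2) + b / ((x - t)\<^sup>2 + b\<^sup>2)) * \<bar>f t\<bar>"
      by (intro mult_right_mono trunc_kernel_bound ab) auto
    finally show "\<bar>trunc_kernel a b (x - t) * f t - ((x - t) / ((x - t)\<^sup>2 + a\<^sup>2) * f t - (x - t) / ((x - t)\<^sup>2 + b\<^sup>2) * f t)\<bar>
      \<le> a / ((x - t)\<^sup>2 + a\<^sup>2) * \<bar>f t\<bar> + b / ((x - t)\<^sup>2 + b\<^sup>2) * \<bar>f t\<bar>" by (simp only: distrib_right)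
  qed
  also have "\<dots> = poisson a (\<lambda>t. \<bar>f t\<bar>) x + poisson b (\<lambda>t. \<bar>f t\<bar>) x"
    unfolding poisson_def by (rule Bochner_Integration.integral_add[OF ip(5) ip(7)])
  finally show ?thesis unfolding H by linarith
qed

text \<open>All truncations are compared with conjugate Poisson integrals, and these with the one of
  height \<open>d\<close>. M. Riesz's bound is then applied once, at that height, and its constant
  does not depend on the height.\<close>

theorem maximal_hilbert:
  fixes p :: real
  assumes p: "1 < p"
  obtains C where "0 < C" "\<And>f d. bdd_cs f \<Longrightarrow> 0 < d \<Longrightarrow>
    (\<integral>\<^sup>+x. ennpowr (SUP (a, b)\<in>{(a, b). d < a \<and> a \<le> b}. ennreal \<bar>trunc_hilbert a b (\<lambda>t. f (x + t))\<bar>) p \<partial>lborel)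
      \<le> ennreal C * (\<integral>\<^sup>+x. ennreal (\<bar>f x\<bar> powr p) \<partial>lborel)"
proof -
  obtain C1 where C1: "0 < C1" "\<And>f :: real \<Rightarrow> ennreal. f \<in> borel_measurable borel \<Longrightarrow>
    (\<integral>\<^sup>+x. ennpowr (max_fun f x) p \<partial>lborel) \<le> ennreal C1 * (\<integral>\<^sup>+x. ennpowr (f x) p \<partial>lborel)"
    using max_fun_strong[OF p, where 'a=real] by blast
  obtain C2 where C2: "0 < C2" "\<And>f e. bdd_cs f \<Longrightarrow> 0 < e \<Longrightarrow>
    (\<integral>\<^sup>+x. ennreal (\<bar>conj_poisson e f x\<bar> powr p) \<partial>lborel) \<le> ennreal C2 * (\<integral>\<^sup>+x. ennreal (\<bar>f x\<bar> powr p) \<partial>lborel)"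
    using riesz_conj_poisson[OF p] by blast
  show ?thesis
  proof (rule that)
    \<comment> \<open>32 collects two conjugate and two Poisson terms, each with constant 16; 2^p
      separates the sum of the two maximal functions.\<close>
    let ?K = "32 powr p * 2 powr p"
    show "0 < ?K * (C1 * C2 + C1)" using C1 C2 by (simp add: add_pos_pos)
    fix f d assume f: "bdd_cs f" and d: "0 < (d::real)"
    have [measurable]: "f \<in> borel_measurable borel" using f by (rule bdd_csD)
    let ?S = "\<lambda>x. SUP (a, b)\<in>{(a, b). d < a \<and> a \<le> b}. ennreal \<bar>trunc_hilbert a b (\<lambda>t. f (x + t))\<bar>"
    let ?M1 = "\<lambda>x. max_fun (\<lambda>y. ennreal \<bar>conj_poisson d f y\<bar>) x" and ?M2 = "\<lambda>x. max_fun (\<lambda>t. ennreal \<bar>f t\<bar>) x"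
    let ?I = "\<integral>\<^sup>+x. ennreal (\<bar>f x\<bar> powr p) \<partial>lborel"
    have "?S x \<le> ennreal 32 * (?M1 x + ?M2 x)" for x
    proof (rule SUP_least, clarify)
      fix a b assume ab: "d < a" "a \<le> b"
      have a0: "0 < a" "0 < b" "d < b" using ab d by auto
      have af: "bdd_cs (\<lambda>t. \<bar>f t\<bar>)" by (rule bdd_cs_mono[OF f, of _ 1]) auto
      have "ennreal \<bar>trunc_hilbert a b (\<lambda>t. f (x + t))\<bar>
        \<le> ennreal \<bar>conj_poisson a f x\<bar> + ennreal \<bar>conj_poisson b f x\<bar> + ennreal \<bar>poisson a (\<lambda>t. \<bar>f t\<bar>) x\<bar> + ennreal \<bar>poisson b (\<lambda>t. \<bar>f t\<bar>) x\<bar>"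
        using ennreal_leI[OF trunc_hilbert_le[OF f a0(1) ab(2), of x]] by (simp add: ennreal_plus)
      also have "\<dots> \<le> ennreal 16 * ?M1 x + ennreal 16 * ?M1 x + ennreal 16 * ?M2 x + ennreal 16 * ?M2 x"
        using abs_poisson_le[OF af a0(1), of x] abs_poisson_le[OF af a0(2), of x]
        by (intro add_mono conj_poisson_le_max_fun f d ab a0) auto
      also have "\<dots> = (ennreal 16 + ennreal 16) * (?M1 x + ?M2 x)"
        by (simp only: distrib_left distrib_right ac_simps)
      also have "ennreal 16 + ennreal 16 = ennreal 32" by (simp only: ennreal_plus[symmetric]) simp
      finally show "ennreal \<bar>trunc_hilbert a b (\<lambda>t. f (x + t))\<bar> \<le> ennreal 32 * (?M1 x + ?M2 x)" .
    qed
    then have "(\<integral>\<^sup>+x. ennpowr (?S x) p \<partial>lborel) \<le> (\<integral>\<^sup>+x. ennreal ?K * (ennpowr (?M1 x) p + ennpowr (?M2 x) p) \<partial>lborel)"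
    proof (intro nn_integral_mono)
      fix x assume le: "\<And>x. ?S x \<le> ennreal 32 * (?M1 x + ?M2 x)"
      have "ennpowr (?S x) p \<le> ennpowr (ennreal 32 * (?M1 x + ?M2 x)) p"
        using p by (intro ennpowr_mono le) auto
      also have "\<dots> = ennreal (32 powr p) * ennpowr (?M1 x + ?M2 x) p"
        using p by (intro ennpowr_cmult) auto
      also have "\<dots> \<le> ennreal (32 powr p) * (ennreal (2 powr p) * (ennpowr (?M1 x) p + ennpowr (?M2 x) p))"
        using p by (intro mult_left_mono ennpowr_add_le) auto
      also have "\<dots> = ennreal ?K * (ennpowr (?M1 x) p + ennpowr (?M2 x) p)"
        by (simp only: ennreal_mult[OF powr_ge_zero powr_ge_zero] mult.assoc)
      finally show "ennpowr (?S x) p \<le> ennreal ?K * (ennpowr (?M1 x) p + ennpowr (?M2 x) p)" .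
    qed
    also have "\<dots> = ennreal ?K * ((\<integral>\<^sup>+x. ennpowr (?M1 x) p \<partial>lborel) + (\<integral>\<^sup>+x. ennpowr (?M2 x) p \<partial>lborel))"
      by (subst nn_integral_cmult, measurable, subst nn_integral_add) auto
    also have "\<dots> \<le> ennreal ?K * (ennreal C1 * (ennreal C2 * ?I) + ennreal C1 * ?I)"
    proof (intro mult_left_mono add_mono)
      have "(\<integral>\<^sup>+x. ennpowr (?M1 x) p \<partial>lborel) \<le> ennreal C1 * (\<integral>\<^sup>+x. ennpowr (ennreal \<bar>conj_poisson d f x\<bar>) p \<partial>lborel)"
        by (rule C1(2)) measurable
      also have "\<dots> \<le> ennreal C1 * (ennreal C2 * ?I)"
        using C2(2)[OF f d] by (intro mult_left_mono) auto
      finally show "(\<integral>\<^sup>+x. ennpowr (?M1 x) p \<partial>lborel) \<le> ennreal C1 * (ennreal C2 * ?I)" .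
      have "(\<integral>\<^sup>+x. ennpowr (?M2 x) p \<partial>lborel) \<le> ennreal C1 * (\<integral>\<^sup>+x. ennpowr (ennreal \<bar>f x\<bar>) p \<partial>lborel)"
        by (rule C1(2)) measurable
      then show "(\<integral>\<^sup>+x. ennpowr (?M2 x) p \<partial>lborel) \<le> ennreal C1 * ?I" by simp
    qed auto
    also have "\<dots> = ennreal (?K * (C1 * C2 + C1)) * ?I"
    proof -
      have "ennreal (?K * (C1 * C2 + C1)) = ennreal ?K * (ennreal C1 * ennreal C2 + ennreal C1)"
        using C1 C2 by (simp only: ennreal_mult[symmetric] ennreal_plus[symmetric] less_imp_le mult_nonneg_nonneg powr_ge_zero add_nonneg_nonneg)
      then show ?thesis by (simp only: distrib_right distrib_left mult.assoc)
    qed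
    finally show "(\<integral>\<^sup>+x. ennpowr (?S x) p \<partial>lborel) \<le> ennreal (?K * (C1 * C2 + C1)) * ?I" .
  qed
qed

section \<open>Directional maximal Hilbert transforms\<close>

text \<open>Rational endpoints make the supremum countable, hence measurable. The upper bound on the
  endpoints is needed for transference, and the lower one is the \<open>d\<close> of
  \<open>maximal_hilbert\<close>.\<close>

definition rat_windows :: "nat \<Rightarrow> (real \<times> real) set" where
  "rat_windows n = {(a, b). a \<in> \<rat> \<and> b \<in> \<rat> \<and> 1 / real (Suc n) < a \<and> a \<le> b \<and> b \<le> real (Suc n)}"

definition dir_hilbert_upto :: "nat \<Rightarrow> ('a::euclidean_space \<Rightarrow> real) \<Rightarrow> 'a \<Rightarrow> 'a \<Rightarrow> ennreal" where
  "dir_hilbert_upto n g v x = (SUP (a, b)\<in>rat_windows n. ennreal \<bar>trunc_hilbert a b (\<lambda>t. g (x + t *\<^sub>R v))\<bar>)"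

definition dir_hilbert :: "('a::euclidean_space \<Rightarrow> real) \<Rightarrow> 'a \<Rightarrow> 'a \<Rightarrow> ennreal" where
  "dir_hilbert g v x = (SUP n. dir_hilbert_upto n g v x)"

lemma countable_rat_windows: "countable (rat_windows n)"
proof (rule countable_subset)
  show "rat_windows n \<subseteq> \<rat> \<times> \<rat>" by (auto simp: rat_windows_def)
qed (auto intro: countable_rat)

lemma rat_windows_mono: "m \<le> n \<Longrightarrow> rat_windows m \<subseteq> rat_windows n"
proof -
  assume "m \<le> n"
  then have "1 / real (Suc n) \<le> 1 / real (Suc m)" by (intro divide_left_mono) auto
  then show ?thesis using \<open>m \<le> n\<close> by (auto simp: rat_windows_def)
qed

lemma borel_measurable_dir_hilbert_upto [measurable]:
  fixes g :: "'a::euclidean_space \<Rightarrow> real"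
  assumes [measurable]: "g \<in> borel_measurable borel"
  shows "(\<lambda>(v, x). dir_hilbert_upto n g v x) \<in> borel_measurable (borel \<Otimes>\<^sub>M borel)"
proof -
  have 1: "(\<lambda>z. ennreal \<bar>trunc_hilbert a b (\<lambda>t. g (snd z + t *\<^sub>R fst z))\<bar>) \<in> borel_measurable (borel \<Otimes>\<^sub>M borel)" for a b
    unfolding trunc_hilbert_def by measurable
  have "(\<lambda>z. SUP w\<in>rat_windows n. case w of (a, b) \<Rightarrow> ennreal \<bar>trunc_hilbert a b (\<lambda>t. g (snd z + t *\<^sub>R fst z))\<bar>)
      \<in> borel_measurable (borel \<Otimes>\<^sub>M borel)"
    by (rule borel_measurable_SUP[OF countable_rat_windows]) (use 1 in \<open>auto simp: split_beta'\<close>)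
  then show ?thesis by (simp add: dir_hilbert_upto_def split_beta')
qed

lemma borel_measurable_dir_hilbert [measurable]:
  fixes g :: "'a::euclidean_space \<Rightarrow> real"
  assumes [measurable]: "g \<in> borel_measurable borel"
  shows "(\<lambda>(v, x). dir_hilbert g v x) \<in> borel_measurable (borel \<Otimes>\<^sub>M borel)"
proof -
  have "(\<lambda>z. SUP n. dir_hilbert_upto n g (fst z) (snd z)) \<in> borel_measurable (borel \<Otimes>\<^sub>M borel)"
    using borel_measurable_dir_hilbert_upto[OF assms] by (intro borel_measurable_SUP) (auto simp: split_beta')
  then show ?thesis by (simp add: dir_hilbert_def split_beta')
qed

lemma nn_integral_translate:
  fixes f :: "'a::euclidean_space \<Rightarrow> ennreal"
  assumes "f \<in> borel_measurable borel"
  shows "(\<integral>\<^sup>+x. f (x + a) \<partial>lborel) = (\<integral>\<^sup>+x. f x \<partial>lborel)"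
  using nn_integral_lborel_affine[OF assms, of 1 a] by (simp add: add.commute)

text \<open>
  Transference: averaging over translates along a line turns the one-dimensional estimate into
  one in \<open>'a\<close>; the cutoff to a window three times as long costs the factor 3.
\<close>

lemma dir_hilbert_upto_Lp:
  fixes p C :: real
  assumes p: "1 < p" and C: "0 < C" "\<And>f d. bdd_cs f \<Longrightarrow> 0 < d \<Longrightarrow>
    (\<integral>\<^sup>+x. ennpowr (SUP (a, b)\<in>{(a, b). d < a \<and> a \<le> b}. ennreal \<bar>trunc_hilbert a b (\<lambda>t. f (x + t))\<bar>) p \<partial>lborel)
      \<le> ennreal C * (\<integral>\<^sup>+x. ennreal (\<bar>f x\<bar> powr p) \<partial>lborel)"
    and g[measurable]: "g \<in> (borel_measurable borel :: ('a::euclidean_space \<Rightarrow> real) set)" and K: "\<And>x. \<bar>g x\<bar> \<le> K"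
  shows "(\<integral>\<^sup>+x. ennpowr (dir_hilbert_upto n g v x) p \<partial>lborel)
    \<le> ennreal (3 * C) * (\<integral>\<^sup>+x. ennreal (\<bar>g x\<bar> powr p) \<partial>lborel)"
proof -
  define m where "m = real (Suc n)"
  have m: "0 < m" by (simp add: m_def)
  have bm: "(\<lambda>x. ennpowr (dir_hilbert_upto n g v x) p) \<in> borel_measurable borel"
    using borel_measurable_dir_hilbert_upto[OF g, of n] by measurable
  have [measurable]: "(\<lambda>(x, s). ennpowr (dir_hilbert_upto n g v (x + s *\<^sub>R v)) p) \<in> borel_measurable (borel \<Otimes>\<^sub>M borel)"
    using measurable_compose[OF _ bm, of "\<lambda>(x, s). x + s *\<^sub>R v" "borel \<Otimes>\<^sub>M borel"] by (simp add: split_beta')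
  have line: "(\<integral>\<^sup>+s\<in>{0..m}. ennpowr (dir_hilbert_upto n g v (x + s *\<^sub>R v)) p \<partial>lborel)
    \<le> ennreal C * (\<integral>\<^sup>+s\<in>{-m..2*m}. ennreal (\<bar>g (x + s *\<^sub>R v)\<bar> powr p) \<partial>lborel)" for x
  proof -
    define f where "f s = indicator {-m..2*m} s * g (x + s *\<^sub>R v)" for s
    have [measurable]: "f \<in> borel_measurable borel" unfolding f_def[abs_def] by measurable
    have f: "bdd_cs f"
    proof -
      have "\<bar>f s\<bar> \<le> K \<and> (2 * m < \<bar>s\<bar> \<longrightarrow> f s = 0)" for s
        using K[of "x + s *\<^sub>R v"] m by (auto simp: f_def indicator_def)
      then show ?thesis unfolding bdd_cs_def by auto
    qed
    have "(\<integral>\<^sup>+s\<in>{0..m}. ennpowr (dir_hilbert_upto n g v (x + s *\<^sub>R v)) p \<partial>lborel)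
      \<le> (\<integral>\<^sup>+s. ennpowr (SUP (a, b)\<in>{(a, b). 1 / m < a \<and> a \<le> b}. ennreal \<bar>trunc_hilbert a b (\<lambda>t. f (s + t))\<bar>) p \<partial>lborel)"
    proof (rule nn_integral_mono)
      fix s
      show "ennpowr (dir_hilbert_upto n g v (x + s *\<^sub>R v)) p * indicator {0..m} s
        \<le> ennpowr (SUP (a, b)\<in>{(a, b). 1 / m < a \<and> a \<le> b}. ennreal \<bar>trunc_hilbert a b (\<lambda>t. f (s + t))\<bar>) p"
      proof (cases "s \<in> {0..m}")
        case True
        have "dir_hilbert_upto n g v (x + s *\<^sub>R v)
          \<le> (SUP (a, b)\<in>{(a, b). 1 / m < a \<and> a \<le> b}. ennreal \<bar>trunc_hilbert a b (\<lambda>t. f (s + t))\<bar>)"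
          unfolding dir_hilbert_upto_def
        proof (rule SUP_least, clarify)
          fix a b assume "(a, b) \<in> rat_windows n"
          then have ab: "1 / m < a" "a \<le> b" "b \<le> m" by (auto simp: rat_windows_def m_def)
          moreover have "0 < 1 / m" using m by simp
          ultimately have a0: "0 < a" by linarith
          \<comment> \<open>For s in [0, m] and t in [a, b] with b \<le> m the points s - t and s +
            t stay in [-m, 2 m], so the cutoff is invisible.\<close>
          have "trunc_hilbert a b (\<lambda>t. g (x + s *\<^sub>R v + t *\<^sub>R v)) = trunc_hilbert a b (\<lambda>t. f (s + t))"
            unfolding trunc_hilbert_def
          proof (intro Bochner_Integration.integral_cong refl)
            fix t
            show "indicator {a..b} t * ((g (x + s *\<^sub>R v + - t *\<^sub>R v) - g (x + s *\<^sub>R v + t *\<^sub>R v)) / t)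
              = indicator {a..b} t * ((f (s + - t) - f (s + t)) / t)"
              using True ab a0 by (auto simp: indicator_def f_def scaleR_left.add scaleR_left.diff algebra_simps)
          qed
          then show "ennreal \<bar>trunc_hilbert a b (\<lambda>t. g (x + s *\<^sub>R v + t *\<^sub>R v))\<bar>
            \<le> (SUP (a, b)\<in>{(a, b). 1 / m < a \<and> a \<le> b}. ennreal \<bar>trunc_hilbert a b (\<lambda>t. f (s + t))\<bar>)"
            using ab by (intro SUP_upper2[of "(a, b)"]) auto
        qed
        then show ?thesis using True p by (auto intro!: ennpowr_mono)
      qed simp
    qed
    also have "\<dots> \<le> ennreal C * (\<integral>\<^sup>+s. ennreal (\<bar>f s\<bar> powr p) \<partial>lborel)"
      using m by (intro C(2) f) simp
    also have "(\<integral>\<^sup>+s. ennreal (\<bar>f s\<bar> powr p) \<partial>lborel) = (\<integral>\<^sup>+s\<in>{-m..2*m}. ennreal (\<bar>g (x + s *\<^sub>R v)\<bar> powr p) \<partial>lborel)"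
      using p by (intro nn_integral_cong) (auto simp: f_def indicator_def)
    finally show ?thesis .
  qed
  have len: "(\<integral>\<^sup>+s. c * indicator {a..b} s \<partial>lborel) = c * ennreal (b - a)" if "a \<le> b" for c :: ennreal and a b :: real
    using that by (subst nn_integral_cmult_indicator) auto
  let ?L = "\<integral>\<^sup>+x. ennpowr (dir_hilbert_upto n g v x) p \<partial>lborel" and ?R = "\<integral>\<^sup>+x. ennreal (\<bar>g x\<bar> powr p) \<partial>lborel"
  \<comment> \<open>By translation invariance, averaging over s in [0, m] multiplies the left side
    by m; the window on the right has length 3 m.\<close>
  have "?L * ennreal m = (\<integral>\<^sup>+s. ?L * indicator {0..m} s \<partial>lborel)"
    using m by (subst len) auto
  also have "\<dots> = (\<integral>\<^sup>+s. \<integral>\<^sup>+x. ennpowr (dir_hilbert_upto n g v (x + s *\<^sub>R v)) p * indicator {0..m} s \<partial>lborel \<partial>lborel)"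
    using nn_integral_translate[OF bm] by (simp add: nn_integral_multc)
  also have "\<dots> = (\<integral>\<^sup>+x. \<integral>\<^sup>+s. ennpowr (dir_hilbert_upto n g v (x + s *\<^sub>R v)) p * indicator {0..m} s \<partial>lborel \<partial>lborel)"
    by (rule lborel_pair.Fubini'[symmetric]) measurable
  also have "\<dots> \<le> (\<integral>\<^sup>+x. ennreal C * (\<integral>\<^sup>+s\<in>{-m..2*m}. ennreal (\<bar>g (x + s *\<^sub>R v)\<bar> powr p) \<partial>lborel) \<partial>lborel)"
    by (intro nn_integral_mono line)
  also have "\<dots> = ennreal C * (\<integral>\<^sup>+x. (\<integral>\<^sup>+s\<in>{-m..2*m}. ennreal (\<bar>g (x + s *\<^sub>R v)\<bar> powr p) \<partial>lborel) \<partial>lborel)"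
    by (rule nn_integral_cmult) measurable
  also have "(\<integral>\<^sup>+x. (\<integral>\<^sup>+s\<in>{-m..2*m}. ennreal (\<bar>g (x + s *\<^sub>R v)\<bar> powr p) \<partial>lborel) \<partial>lborel)
      = (\<integral>\<^sup>+s. \<integral>\<^sup>+x. ennreal (\<bar>g (x + s *\<^sub>R v)\<bar> powr p) * indicator {-m..2*m} s \<partial>lborel \<partial>lborel)"
    by (rule lborel_pair.Fubini') measurable
  also have "\<dots> = (\<integral>\<^sup>+s. ?R * indicator {-m..2*m} s \<partial>lborel)"
    using nn_integral_translate[of "\<lambda>x. ennreal (\<bar>g x\<bar> powr p)"] by (simp add: nn_integral_multc)
  also have "\<dots> = ?R * ennreal (3 * m)" using m by (subst len) auto
  also have "ennreal C * (?R * ennreal (3 * m)) = ennreal (3 * C) * ?R * ennreal m"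
    using C m by (simp add: ennreal_mult ac_simps)
  finally show ?thesis
    using m by (subst (asm) ennreal_mult_le_mult_iff[of "ennreal m", simplified mult.commute[of "ennreal m"]]) auto
qed

text \<open>The bound for a single \<open>n\<close> has a constant free of \<open>n\<close>, and
  monotone convergence does the rest. That it is also free of \<open>v\<close> allows averaging over
  directions.\<close>

theorem dir_hilbert_Lp:
  fixes p :: real
  assumes p: "1 < p"
  obtains C where "0 < C" "\<And>(g :: 'a::euclidean_space \<Rightarrow> real) K v. g \<in> borel_measurable borel \<Longrightarrow> (\<And>x. \<bar>g x\<bar> \<le> K) \<Longrightarrow>
    (\<integral>\<^sup>+x. ennpowr (dir_hilbert g v x) p \<partial>lborel) \<le> ennreal C * (\<integral>\<^sup>+x. ennreal (\<bar>g x\<bar> powr p) \<partial>lborel)"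
proof -
  obtain C where C: "0 < C" "\<And>f d. bdd_cs f \<Longrightarrow> 0 < d \<Longrightarrow>
    (\<integral>\<^sup>+x. ennpowr (SUP (a, b)\<in>{(a, b). d < a \<and> a \<le> b}. ennreal \<bar>trunc_hilbert a b (\<lambda>t. f (x + t))\<bar>) p \<partial>lborel)
      \<le> ennreal C * (\<integral>\<^sup>+x. ennreal (\<bar>f x\<bar> powr p) \<partial>lborel)"
    using maximal_hilbert[OF p] by blast
  show ?thesis
  proof (rule that)
    show "0 < 3 * C" using C by simp
    fix g :: "'a \<Rightarrow> real" and K v
    assume g[measurable]: "g \<in> borel_measurable borel" and K: "\<And>x. \<bar>g x\<bar> \<le> K"
    have mono: "dir_hilbert_upto m g v x \<le> dir_hilbert_upto n g v x" if "m \<le> n" for m n x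
      unfolding dir_hilbert_upto_def by (intro SUP_subset_mono rat_windows_mono that) simp
    have [measurable]: "(\<lambda>x. dir_hilbert_upto n g v x) \<in> borel_measurable borel" for n
      using borel_measurable_dir_hilbert_upto[OF g, of n] by measurable
    have "(\<integral>\<^sup>+x. ennpowr (dir_hilbert g v x) p \<partial>lborel) = (\<integral>\<^sup>+x. (SUP n. ennpowr (dir_hilbert_upto n g v x) p) \<partial>lborel)"
      unfolding dir_hilbert_def using p by (subst ennpowr_SUP) auto
    also have "\<dots> = (SUP n. \<integral>\<^sup>+x. ennpowr (dir_hilbert_upto n g v x) p \<partial>lborel)"
      by (rule nn_integral_monotone_convergence_SUP)
        (use p in \<open>auto simp: incseq_def le_fun_def intro!: ennpowr_mono mono\<close>)
    also have "\<dots> \<le> ennreal (3 * C) * (\<integral>\<^sup>+x. ennreal (\<bar>g x\<bar> powr p) \<partial>lborel)"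
      by (intro SUP_least dir_hilbert_upto_Lp[OF p C g K])
    finally show "(\<integral>\<^sup>+x. ennpowr (dir_hilbert g v x) p \<partial>lborel) \<le> ennreal (3 * C) * (\<integral>\<^sup>+x. ennreal (\<bar>g x\<bar> powr p) \<partial>lborel)" .
  qed
qed

text \<open>Real endpoints are approximated by rational ones: the integrand is bounded on t \<ge> a
  / 2, so moving the endpoints slightly changes the integral little.\<close>

lemma trunc_hilbert_le_dir_hilbert:
  fixes g :: "'a::euclidean_space \<Rightarrow> real"
  assumes g[measurable]: "g \<in> borel_measurable borel" and K: "\<And>x. \<bar>g x\<bar> \<le> K" and ab: "0 < a" "a \<le> b"
  shows "ennreal \<bar>trunc_hilbert a b (\<lambda>t. g (x + t *\<^sub>R v))\<bar> \<le> dir_hilbert g v x"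
proof (rule ennreal_le_epsilon)
  fix e :: real assume e: "0 < e"
  define F where "F t = (g (x + - t *\<^sub>R v) - g (x + t *\<^sub>R v)) / t" for t
  have [measurable]: "F \<in> borel_measurable borel" unfolding F_def[abs_def] by measurable
  have K0: "0 \<le> K" using K[of 0] by linarith
  \<comment> \<open>2 K / (a / 2) bounds |F| on t \<ge> a / 2; the added 1 keeps \<open>B\<close>
    positive when K = 0.\<close>
  define B where "B = 4 * K / a + 1"
  have B: "0 < B" using K0 ab by (simp add: B_def add_nonneg_pos)
  have FB: "\<bar>F t\<bar> \<le> B" if "a / 2 \<le> t" for t
  proof -
    have "\<bar>g (x + - t *\<^sub>R v) - g (x + t *\<^sub>R v)\<bar> \<le> 2 * K"
      using K[of "x + - t *\<^sub>R v"] K[of "x + t *\<^sub>R v"] by linarith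
    then have "\<bar>F t\<bar> \<le> 2 * K / (a / 2)"
      unfolding F_def abs_divide using that ab K0 by (intro frac_le) auto
    then show ?thesis by (simp add: B_def)
  qed
  \<comment> \<open>The two end intervals are shorter than d each and contribute at most 2 d B =
    e.\<close>
  define d where "d = e / (2 * B)"
  have d: "0 < d" using e B by (simp add: d_def)
  obtain a' where a': "a' \<in> \<rat>" "max (a / 2) (a - d) < a'" "a' < a"
    using Rats_dense_in_real[of "max (a / 2) (a - d)" a] ab d by auto
  obtain b' where b': "b' \<in> \<rat>" "b < b'" "b' < b + d"
    using Rats_dense_in_real[of b "b + d"] d by auto
  obtain n :: nat where n: "max (1 / a') b' < real n" using reals_Archimedean2 by blast
  have a0: "0 < a'" using a' ab by linarith
  have "1 / real (Suc n) < a'" using n a0 by (simp add: field_simps)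
  then have win: "(a', b') \<in> rat_windows n" using a' b' n ab by (auto simp: rat_windows_def)
  have intF: "integrable lborel (\<lambda>t. indicator {c..c'} t * F t)" if "a / 2 \<le> c" for c c'
  proof (rule Bochner_Integration.integrable_bound)
    show "integrable lborel (\<lambda>t. indicator {c..c'} t * B)" by (intro integrable_mult_left integrable_real_indicator) (auto simp: emeasure_lborel_Icc_eq)
    show "AE t in lborel. norm (indicator {c..c'} t * F t) \<le> norm (indicator {c..c'} t * B)"
      using FB B that by (intro AE_I2) (auto simp: indicator_def)
  qed measurable
  have "trunc_hilbert a b (\<lambda>t. g (x + t *\<^sub>R v)) - trunc_hilbert a' b' (\<lambda>t. g (x + t *\<^sub>R v))
    = (LINT t|lborel. indicator {a..b} t * F t - indicator {a'..b'} t * F t)"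
    unfolding trunc_hilbert_def F_def[symmetric] using a' ab by (intro Bochner_Integration.integral_diff[symmetric] intF) auto
  also have "\<bar>\<dots>\<bar> \<le> (LINT t|lborel. indicator {a'..a} t * B + indicator {b..b'} t * B)"
  proof (rule integral_abs_bound_integral)
    show "integrable lborel (\<lambda>t. indicator {a..b} t * F t - indicator {a'..b'} t * F t)"
      using a' ab by (intro Bochner_Integration.integrable_diff intF) auto
    show "integrable lborel (\<lambda>t. indicator {a'..a} t * B + indicator {b..b'} t * B)"
      by (intro Bochner_Integration.integrable_add integrable_mult_left integrable_real_indicator) (auto simp: emeasure_lborel_Icc_eq)
    show "\<bar>indicator {a..b} t * F t - indicator {a'..b'} t * F t\<bar> \<le> indicator {a'..a} t * B + indicator {b..b'} t * B" for t
      using FB[of t] B a' b' ab by (auto simp: indicator_def)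
  qed
  also have "\<dots> = (a - a') * B + (b' - b) * B"
    using a' b' by (subst Bochner_Integration.integral_add) (auto intro!: integrable_mult_left integrable_real_indicator simp: emeasure_lborel_Icc_eq)
  also have "\<dots> \<le> d * B + d * B" using a' b' B by (intro add_mono mult_right_mono) auto
  also have "\<dots> = e" using B by (simp add: d_def field_simps)
  finally have "\<bar>trunc_hilbert a b (\<lambda>t. g (x + t *\<^sub>R v))\<bar> \<le> \<bar>trunc_hilbert a' b' (\<lambda>t. g (x + t *\<^sub>R v))\<bar> + e" by linarith
  then have "ennreal \<bar>trunc_hilbert a b (\<lambda>t. g (x + t *\<^sub>R v))\<bar> \<le> ennreal \<bar>trunc_hilbert a' b' (\<lambda>t. g (x + t *\<^sub>R v))\<bar> + ennreal e"
    using e by (metis abs_ge_zero ennreal_leI ennreal_plus less_imp_le)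
  also have "ennreal \<bar>trunc_hilbert a' b' (\<lambda>t. g (x + t *\<^sub>R v))\<bar> \<le> dir_hilbert g v x"
    unfolding dir_hilbert_def dir_hilbert_upto_def
    by (rule SUP_upper2[of n], simp, rule SUP_upper2[OF win]) simp
  finally show "ennreal \<bar>trunc_hilbert a b (\<lambda>t. g (x + t *\<^sub>R v))\<bar> \<le> dir_hilbert g v x + ennreal e" by (simp add: add_right_mono)
qed

section \<open>Differences of Bessel averages\<close>

text \<open>The heat kernel at time 1 without its factor (4 pi)^(-N / 2).\<close>

definition gauss :: "'a::euclidean_space \<Rightarrow> real" where
  "gauss v = exp (- (norm v)\<^sup>2 / 4)"

definition bessel_weight :: "real \<Rightarrow> real \<Rightarrow> real" where
  "bessel_weight s t = t powr (s - 1) * exp (- t\<^sup>2)"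

definition gauss_avg :: "real \<Rightarrow> ('a::euclidean_space \<Rightarrow> real) \<Rightarrow> 'a \<Rightarrow> real" where
  "gauss_avg t g x = (LINT v|lborel. gauss v * g (x - t *\<^sub>R v))"

text \<open>
  Up to a normalising constant this is $(I - \Delta)^{-s/2} g$, written as a superposition of the
  heat semigroup at times \<open>t\<^sup>2\<close>.
\<close>

definition bessel_avg :: "real \<Rightarrow> ('a::euclidean_space \<Rightarrow> real) \<Rightarrow> 'a \<Rightarrow> real" where
  "bessel_avg s g x = (LINT t|lborel. indicator {0<..} t * (bessel_weight s t * gauss_avg t g x))"

section \<open>Gaussian bounds, weights and integrability\<close>

lemma gauss_pos [simp]: "0 < gauss v" "0 \<le> gauss v" "gauss v \<noteq> 0"
  by (simp_all add: gauss_def)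

lemma gauss_minus [simp]: "gauss (- v) = gauss v"
  by (simp add: gauss_def)

lemma borel_measurable_gauss [measurable]: "gauss \<in> borel_measurable borel"
  unfolding gauss_def[abs_def] by measurable

lemma borel_measurable_bessel_weight [measurable]: "bessel_weight s \<in> borel_measurable borel"
  unfolding bessel_weight_def[abs_def] by measurable

lemma bessel_weight_nonneg [simp]: "0 \<le> bessel_weight s t"
  by (simp add: bessel_weight_def)

lemma bessel_weight_le: "bessel_weight s t \<le> t powr (s - 1)"
  unfolding bessel_weight_def by (rule mult_left_le) auto

lemma bessel_weight_decreasing:
  assumes "s < 1" "0 < t" "t \<le> t'"
  shows "bessel_weight s t' \<le> bessel_weight s t"
  unfolding bessel_weight_def using assms
  by (intro mult_mono powr_mono2') (auto intro: power_mono)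

text \<open>A single term of the exponential series gives (1 + r)^k \<le> k! e^(1 + r), and 1 + r -
  r^2 / 4 \<le> 2 by completing the square.\<close>

lemma power_times_gauss_bound:
  "(1 + r) ^ k * exp (- r\<^sup>2 / 4) \<le> fact k * exp 2" if "0 \<le> (r::real)"
proof -
  have "(1 + r) ^ k / fact k \<le> exp (1 + r)"
  proof -
    have "(\<Sum>i\<in>{k}. (1 + r) ^ i /\<^sub>R fact i) \<le> (\<Sum>i. (1 + r) ^ i /\<^sub>R fact i)"
      using that by (intro sum_le_suminf summable_exp_generic) auto
    then show ?thesis by (simp add: exp_def divide_inverse mult.commute)
  qed
  then have "(1 + r) ^ k \<le> fact k * exp (1 + r)" by (simp add: field_simps)
  then have "(1 + r) ^ k * exp (- r\<^sup>2 / 4) \<le> fact k * exp (1 + r) * exp (- r\<^sup>2 / 4)"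
    by (intro mult_right_mono) auto
  also have "\<dots> = fact k * exp (1 + r - r\<^sup>2 / 4)" by (simp only: mult.assoc exp_add[symmetric]) simp
  also have "\<dots> \<le> fact k * exp 2"
  proof -
    have "0 \<le> (r / 2 - 1)\<^sup>2" by simp
    then have "1 + r - r\<^sup>2 / 4 \<le> 2" by (simp add: power2_diff power_divide)
    then show ?thesis by simp
  qed
  finally show ?thesis .
qed

lemma norm_power_gauss_le:
  fixes v :: "'a::euclidean_space"
  shows "(1 + norm v) ^ k * gauss v \<le> fact (k + Suc DIM('a)) * exp 2 * (1 / (1 + norm v) ^ Suc DIM('a))"
proof -
  have "(1 + norm v) ^ k * gauss v * (1 + norm v) ^ Suc DIM('a) = (1 + norm v) ^ (k + Suc DIM('a)) * exp (- (norm v)\<^sup>2 / 4)"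
    by (simp only: gauss_def power_add mult_ac)
  also have "\<dots> \<le> fact (k + Suc DIM('a)) * exp 2" by (rule power_times_gauss_bound) simp
  finally show ?thesis
    unfolding times_divide_eq_right mult_1_right
    by (subst pos_le_divide_eq) (intro zero_less_power add_pos_nonneg; simp)
qed

lemma integrable_power_kernel: "integrable lborel (\<lambda>v::'a::euclidean_space. 1 / (1 + norm v) ^ Suc DIM('a))"
proof (rule integrableI_bounded)
  let ?k = "\<lambda>v::'a. 1 / (1 + norm v) ^ Suc DIM('a)"
  have "(\<integral>\<^sup>+v. ennreal (norm (?k v)) \<partial>lborel) = (\<integral>\<^sup>+v. ennreal (?k v) * (\<lambda>_. ennreal 1) (0 - 1 *\<^sub>R v) \<partial>lborel)"
    by simp
  also have "\<dots> \<le> ennreal (2 ^ (DIM('a) + 2)) * max_fun (\<lambda>_. ennreal 1) (0::'a)"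
    by (rule max_fun_kernel[of "\<lambda>_. ennreal 1" 1 0]) auto
  also have "\<dots> \<le> ennreal (2 ^ (DIM('a) + 2)) * ennreal (unit_vol TYPE('a) * 1)"
    by (intro mult_left_mono max_fun_const_le) auto
  also have "\<dots> < \<infinity>" by (simp add: ennreal_mult_less_top)
  finally show "(\<integral>\<^sup>+v. ennreal (norm (?k v)) \<partial>lborel) < \<infinity>" .
qed simp

lemma integrable_power_gauss: "integrable lborel (\<lambda>v::'a::euclidean_space. (1 + norm v) ^ k * gauss v)"
proof (rule Bochner_Integration.integrable_bound)
  show "integrable lborel (\<lambda>v::'a. fact (k + Suc DIM('a)) * exp 2 * (1 / (1 + norm v) ^ Suc DIM('a)))"
    by (intro integrable_mult_right integrable_power_kernel)
  show "AE v::'a in lborel. norm ((1 + norm v) ^ k * gauss v) \<le> norm (fact (k + Suc DIM('a)) * exp 2 * (1 / (1 + norm v) ^ Suc DIM('a)))"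
  proof (rule AE_I2)
    fix v :: 'a
    have "norm ((1 + norm v) ^ k * gauss v) = (1 + norm v) ^ k * gauss v" by simp
    also note norm_power_gauss_le[of v k]
    also have "fact (k + Suc DIM('a)) * exp 2 * (1 / (1 + norm v) ^ Suc DIM('a)) \<le> norm (fact (k + Suc DIM('a)) * exp 2 * (1 / (1 + norm v) ^ Suc DIM('a)) :: real)"
      by simp
    finally show "norm ((1 + norm v) ^ k * gauss v) \<le> norm (fact (k + Suc DIM('a)) * exp 2 * (1 / (1 + norm v) ^ Suc DIM('a)))" .
  qed
qed simp

lemma integrable_gauss: "integrable lborel (gauss :: 'a::euclidean_space \<Rightarrow> real)"
  using integrable_power_gauss[of 0, where 'a='a] by simp

lemma integrable_norm_gauss: "integrable lborel (\<lambda>v::'a::euclidean_space. norm v * gauss v)"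
proof (rule Bochner_Integration.integrable_bound)
  show "integrable lborel (\<lambda>v::'a. (1 + norm v) ^ 1 * gauss v)" by (rule integrable_power_gauss)
qed (auto intro!: AE_I2 mult_right_mono)

lemma nn_integral_powr_to_inf:
  fixes a b :: real
  assumes "a < -1" "0 < b"
  shows "(\<integral>\<^sup>+ t. ennreal (t powr a) * indicator {b..} t \<partial>lborel) = ennreal (- (b powr (a + 1) / (a + 1)))"
proof -
  have h: "((\<lambda>x. x powr a) has_integral (- (b powr (a + 1) / (a + 1)))) {b..}"
    using has_integral_powr_to_inf[OF assms] by simp
  have "(\<integral>\<^sup>+ t. ennreal (t powr a) * indicator {b..} t \<partial>lborel) = (\<integral>\<^sup>+ t. ennreal (indicator {b..} t * t powr a) \<partial>lborel)"
    by (intro nn_integral_cong) (auto simp: indicator_def)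
  also have "\<dots> = ennreal (- (b powr (a + 1) / (a + 1)))"
    using h by (intro nn_integral_has_integral_lborel)
      (auto simp: has_integral_restrict_UNIV[of "{b..}", symmetric] indicator_def elim!: has_integral_eq[rotated])
  finally show ?thesis .
qed

lemma integrable_bessel_weight:
  assumes "0 < s" "s < 1"
  shows "integrable lborel (\<lambda>t. indicator {0<..} t * bessel_weight s t)"
proof (rule integrableI_bounded)
  have "(\<integral>\<^sup>+ t. ennreal (norm (indicator {0<..} t * bessel_weight s t)) \<partial>lborel)
    \<le> (\<integral>\<^sup>+ t. ennreal (t powr (s - 1)) * indicator {0<..<1} t + ennreal (t powr (s - 3)) * indicator {1..} t \<partial>lborel)"
  proof (rule nn_integral_mono)
    fix t :: real
    have "bessel_weight s t \<le> t powr (s - 3)" if "1 \<le> t"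
    proof -
      have "t\<^sup>2 * exp (- t\<^sup>2) \<le> 1"
      proof -
        have "t\<^sup>2 \<le> exp (t\<^sup>2)" using exp_ge_add_one_self[of "t\<^sup>2"] by linarith
        then show ?thesis by (simp add: exp_minus field_simps)
      qed
      moreover have "t powr (s - 1) = t powr (s - 3) * t\<^sup>2"
        using that by (simp add: powr_add[symmetric] flip: powr_numeral)
      ultimately show ?thesis
        using mult_left_mono[of "t\<^sup>2 * exp (- t\<^sup>2)" 1 "t powr (s - 3)"] by (simp add: bessel_weight_def mult.assoc)
    qed
    then show "ennreal (norm (indicator {0<..} t * bessel_weight s t))
      \<le> ennreal (t powr (s - 1)) * indicator {0<..<1} t + ennreal (t powr (s - 3)) * indicator {1..} t"
      using bessel_weight_le[of s t] by (auto simp: indicator_def intro!: ennreal_leI)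
  qed
  also have "\<dots> = ennreal (1 powr s / s) + ennreal (- (1 powr (s - 3 + 1) / (s - 3 + 1)))"
    using assms by (subst nn_integral_add) (auto simp: nn_integral_powr_from_0 nn_integral_powr_to_inf)
  also have "\<dots> < \<infinity>" by simp
  finally show "(\<integral>\<^sup>+ t. ennreal (norm (indicator {0<..} t * bessel_weight s t)) \<partial>lborel) < \<infinity>" .
qed simp

lemma kernel_avg_le_max_fun:
  fixes g :: "'a::euclidean_space \<Rightarrow> real"
  assumes [measurable]: "g \<in> borel_measurable borel" "k \<in> borel_measurable borel" and t: "0 < t" and c: "0 \<le> c"
    and k: "\<And>v. \<bar>k v\<bar> \<le> c * (1 / (1 + norm v) ^ Suc DIM('a))"
  shows "ennreal \<bar>LINT v|lborel. k v * g (x - t *\<^sub>R v)\<bar> \<le> ennreal (c * 2 ^ (DIM('a) + 2)) * max_fun (\<lambda>y. ennreal \<bar>g y\<bar>) x"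
proof -
  have ker0: "0 \<le> 1 / (1 + norm v) ^ Suc DIM('a)" for v :: 'a
    by (intro divide_nonneg_nonneg zero_le_power) auto
  have "ennreal \<bar>LINT v|lborel. k v * g (x - t *\<^sub>R v)\<bar> \<le> (\<integral>\<^sup>+v. ennreal (norm (k v * g (x - t *\<^sub>R v))) \<partial>lborel)"
    using norm_integral_le_nn_integral[of lborel "\<lambda>v. k v * g (x - t *\<^sub>R v)"] by simp
  also have "\<dots> \<le> (\<integral>\<^sup>+v. ennreal c * (ennreal (1 / (1 + norm v) ^ Suc DIM('a)) * ennreal \<bar>g (x - t *\<^sub>R v)\<bar>) \<partial>lborel)"
  proof (rule nn_integral_mono)
    fix v
    have "norm (k v * g (x - t *\<^sub>R v)) \<le> c * ((1 / (1 + norm v) ^ Suc DIM('a)) * \<bar>g (x - t *\<^sub>R v)\<bar>)"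
      unfolding real_norm_def abs_mult mult.assoc[symmetric] by (intro mult_right_mono k) simp
    then show "ennreal (norm (k v * g (x - t *\<^sub>R v))) \<le> ennreal c * (ennreal (1 / (1 + norm v) ^ Suc DIM('a)) * ennreal \<bar>g (x - t *\<^sub>R v)\<bar>)"
      using c by (metis ennreal_leI ennreal_mult abs_ge_zero ker0 mult_nonneg_nonneg)
  qed
  also have "\<dots> = ennreal c * (\<integral>\<^sup>+v. ennreal (1 / (1 + norm v) ^ Suc DIM('a)) * ennreal \<bar>g (x - t *\<^sub>R v)\<bar> \<partial>lborel)"
    by (rule nn_integral_cmult) measurable
  also have "\<dots> \<le> ennreal c * (ennreal (2 ^ (DIM('a) + 2)) * max_fun (\<lambda>y. ennreal \<bar>g y\<bar>) x)"
    by (intro mult_left_mono max_fun_kernel[where f = "\<lambda>y. ennreal \<bar>g y\<bar>"] t) auto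
  also have "\<dots> = ennreal (c * 2 ^ (DIM('a) + 2)) * max_fun (\<lambda>y. ennreal \<bar>g y\<bar>) x"
    using c by (simp add: ennreal_mult mult.assoc)
  finally show ?thesis .
qed

text \<open>The gradient of \<open>gauss\<close> at v is -(v / 2) gauss v, so this is the remainder
  of the first order Taylor expansion with step \<open>e\<close>.\<close>

definition gauss_rem :: "'a::euclidean_space \<Rightarrow> 'a \<Rightarrow> real" where
  "gauss_rem e v = gauss (v + e) - gauss v + (e \<bullet> v) / 2 * gauss v"

text \<open>Taylor's formula along the segment from v to v + e: at an intermediate point z the
  second derivative is a quadratic polynomial times gauss z. A step of length at most 1 gives 1 +
  |v| \<le> 2 (1 + |z|), so decay in z becomes decay in v at the cost of 2^(N + 1).\<close>

lemma gauss_rem_bound: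
  fixes e v :: "'a::euclidean_space"
  assumes e: "norm e \<le> 1"
  shows "\<bar>gauss_rem e v\<bar> \<le> (norm e)\<^sup>2 * (2 ^ Suc DIM('a) * (fact (2 + Suc DIM('a)) * exp 2)) * (1 / (1 + norm v) ^ Suc DIM('a))"
proof -
  \<comment> \<open>The exponent along the segment, with derivative \<open>q1\<close> and constant
    second derivative - |e|^2 / 2; this explains the shape of \<open>diff\<close> below.\<close>
  define q where "q \<theta> = - ((norm v)\<^sup>2 + 2 * \<theta> * (e \<bullet> v) + \<theta>\<^sup>2 * (norm e)\<^sup>2) / 4" for \<theta> :: real
  define q1 where "q1 \<theta> = - (e \<bullet> v + \<theta> * (norm e)\<^sup>2) / 2" for \<theta> :: real
  have "(norm (v + \<theta> *\<^sub>R e))\<^sup>2 = (norm v)\<^sup>2 + 2 * \<theta> * (e \<bullet> v) + \<theta>\<^sup>2 * (norm e)\<^sup>2" for \<theta>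
    unfolding power2_norm_eq_inner by (simp add: inner_add inner_commute power2_eq_square algebra_simps)
  then have gq: "gauss (v + \<theta> *\<^sub>R e) = exp (q \<theta>)" for \<theta>
    by (simp add: gauss_def q_def)
  define diff where "diff m \<theta> = (if m = 0 then exp (q \<theta>) else if m = 1 then q1 \<theta> * exp (q \<theta>)
     else ((q1 \<theta>)\<^sup>2 - (norm e)\<^sup>2 / 2) * exp (q \<theta>))" for m :: nat and \<theta>
  have dq: "(q has_real_derivative q1 \<theta>) (at \<theta>)" for \<theta>
    unfolding q_def[abs_def] q1_def by (auto intro!: derivative_eq_intros simp: field_simps)
  have dq1: "(q1 has_real_derivative - (norm e)\<^sup>2 / 2) (at \<theta>)" for \<theta>
    unfolding q1_def[abs_def] by (auto intro!: derivative_eq_intros simp: field_simps)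
  have "\<exists>t. 0 < t \<and> t < 1 \<and> exp (q 1) = (\<Sum>m<2. diff m 0 / fact m * (1 - 0) ^ m) + diff 2 t / fact 2 * (1 - 0)\<^sup>2"
  proof (rule Taylor_up)
    show "\<forall>m t. m < 2 \<and> 0 \<le> t \<and> t \<le> 1 \<longrightarrow> (diff m has_real_derivative diff (Suc m) t) (at t)"
    proof (intro allI impI)
      fix m :: nat and t :: real assume "m < 2 \<and> 0 \<le> t \<and> t \<le> 1"
      then have "m = 0 \<or> m = 1" by auto
      then show "(diff m has_real_derivative diff (Suc m) t) (at t)"
        unfolding diff_def[abs_def]
        by (auto intro!: derivative_eq_intros dq dq1 simp: algebra_simps power2_eq_square)
    qed
  qed (auto simp: diff_def)
  then obtain \<theta> where \<theta>: "0 < \<theta>" "\<theta> < 1"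
    and T: "exp (q 1) = (\<Sum>m<2. diff m 0 / fact m * (1 - 0) ^ m) + diff 2 \<theta> / fact 2 * (1 - 0)\<^sup>2" by blast
  have "exp (q 1) = exp (q 0) + q1 0 * exp (q 0) + ((q1 \<theta>)\<^sup>2 - (norm e)\<^sup>2 / 2) * exp (q \<theta>) / 2"
    using T by (simp add: diff_def numeral_2_eq_2)
  then have rem: "gauss_rem e v = ((q1 \<theta>)\<^sup>2 - (norm e)\<^sup>2 / 2) * exp (q \<theta>) / 2"
    using gq[of 0] gq[of 1] by (simp add: gauss_rem_def q1_def)
  define z where "z = v + \<theta> *\<^sub>R e"
  have "q1 \<theta> = - (e \<bullet> z) / 2"
    by (simp add: q1_def z_def inner_add_right power2_norm_eq_inner)
  then have "\<bar>q1 \<theta>\<bar> \<le> norm e * norm z / 2"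
    using Cauchy_Schwarz_ineq2[of e z] by simp
  then have "\<bar>q1 \<theta>\<bar>\<^sup>2 \<le> (norm e * norm z / 2)\<^sup>2" by (intro power_mono) auto
  then have q1b: "(q1 \<theta>)\<^sup>2 \<le> (norm e)\<^sup>2 * (norm z)\<^sup>2 / 4" by (simp add: power_mult_distrib power_divide)
  have "\<bar>(q1 \<theta>)\<^sup>2 - (norm e)\<^sup>2 / 2\<bar> \<le> (norm e)\<^sup>2 * (norm z)\<^sup>2 / 4 + (norm e)\<^sup>2 / 2"
    using q1b zero_le_power2[of "q1 \<theta>"] zero_le_power2[of "norm e"] unfolding abs_le_iff by linarith
  also have "\<dots> \<le> (norm e)\<^sup>2 * (1 + norm z)\<^sup>2"
  proof -
    have "(norm z)\<^sup>2 / 4 + 1 / 2 \<le> (1 + norm z)\<^sup>2"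
      using zero_le_power2[of "norm z"] norm_ge_zero[of z] unfolding power2_sum power_one by linarith
    then have "(norm e)\<^sup>2 * ((norm z)\<^sup>2 / 4 + 1 / 2) \<le> (norm e)\<^sup>2 * (1 + norm z)\<^sup>2" by (intro mult_left_mono) auto
    then show ?thesis by (simp add: distrib_left)
  qed
  finally have "\<bar>gauss_rem e v\<bar> \<le> (norm e)\<^sup>2 * (1 + norm z)\<^sup>2 * gauss z / 2"
    unfolding rem z_def gq by (simp add: abs_mult mult_right_mono)
  also have "\<dots> \<le> (norm e)\<^sup>2 * ((1 + norm z)\<^sup>2 * gauss z)" by simp
  also have "\<dots> \<le> (norm e)\<^sup>2 * (fact (2 + Suc DIM('a)) * exp 2 * (1 / (1 + norm z) ^ Suc DIM('a)))"
    by (intro mult_left_mono norm_power_gauss_le) auto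
  also have "\<dots> \<le> (norm e)\<^sup>2 * (fact (2 + Suc DIM('a)) * exp 2 * (2 ^ Suc DIM('a) * (1 / (1 + norm v) ^ Suc DIM('a))))"
  proof (intro mult_left_mono)
    show "1 / (1 + norm z) ^ Suc DIM('a) \<le> 2 ^ Suc DIM('a) * (1 / (1 + norm v) ^ Suc DIM('a))"
    proof -
      have "norm v \<le> norm z + norm (\<theta> *\<^sub>R e)" unfolding z_def using norm_triangle_ineq4[of "v + \<theta> *\<^sub>R e" "\<theta> *\<^sub>R e"] by simp
      moreover have "norm (\<theta> *\<^sub>R e) \<le> 1 * 1" using \<theta> e unfolding norm_scaleR by (intro mult_mono) auto
      moreover have "1 + a \<le> 2 * (1 + c)" if "a \<le> c + b" "b \<le> 1 * 1" "0 \<le> c" for a b c :: real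
        using that by simp
      ultimately have "1 + norm v \<le> 2 * (1 + norm z)" using norm_ge_zero[of z] by blast
      then have "(1 + norm v) ^ Suc DIM('a) \<le> (2 * (1 + norm z)) ^ Suc DIM('a)" by (intro power_mono) auto
      moreover have "0 < (1 + norm v) ^ Suc DIM('a)" "0 < (1 + norm z) ^ Suc DIM('a)" by (intro zero_less_power add_pos_nonneg; simp)+
      ultimately show ?thesis
        unfolding power_mult_distrib by (simp add: field_simps del: power_Suc)
    qed
  qed auto
  finally show ?thesis by (simp only: mult_ac)
qed

section \<open>Shifted averages and weighted Hilbert transforms\<close>

lemma integrable_gauss_mult:
  fixes g :: "'a::euclidean_space \<Rightarrow> real"
  assumes [measurable]: "g \<in> borel_measurable borel" "k \<in> borel_measurable borel" and g: "\<And>x. \<bar>g x\<bar> \<le> K"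
    and k: "integrable lborel k"
  shows "integrable lborel (\<lambda>v. k v * g (x + c *\<^sub>R v))"
proof (rule Bochner_Integration.integrable_bound)
  show "integrable lborel (\<lambda>v. K * k v)" using k by (rule integrable_mult_right)
  have "norm (k v * g (x + c *\<^sub>R v)) \<le> norm (K * k v)" for v
    using mult_right_mono[OF order_trans[OF g abs_ge_self], of "\<bar>k v\<bar>" "x + c *\<^sub>R v"] by (simp add: abs_mult mult.commute)
  then show "AE v in lborel. norm (k v * g (x + c *\<^sub>R v)) \<le> norm (K * k v)" by simp
qed measurable

lemma lborel_integrable_affine_translate:
  fixes f :: "'a::euclidean_space \<Rightarrow> 'b::{banach, second_countable_topology}"
  assumes "integrable lborel f"
  shows "integrable lborel (\<lambda>v. f (v + a))"
proof -
  have "integrable (distr lborel borel ((+) a)) f" using assms by (simp add: lborel_distr_plus)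
  then have "integrable lborel (\<lambda>v. f (a + v))"
    by (subst (asm) integrable_distr_eq) (use borel_measurable_integrable[OF assms] in auto)
  then show ?thesis by (simp add: add.commute)
qed

text \<open>With the shift moved onto the kernel, both averages use the same values of
  \<open>g\<close>, and only the smooth kernel is differenced.\<close>

lemma gauss_avg_translate:
  fixes g :: "'a::euclidean_space \<Rightarrow> real"
  assumes [measurable]: "g \<in> borel_measurable borel" and "t \<noteq> 0"
  shows "gauss_avg t g (x + h) = (LINT v|lborel. gauss (v + h /\<^sub>R t) * g (x - t *\<^sub>R v))"
proof -
  have "gauss_avg t g (x + h) = (LINT v|distr lborel borel ((+) (h /\<^sub>R t)). gauss v * g (x + h - t *\<^sub>R v))"
    unfolding gauss_avg_def lborel_distr_plus ..
  also have "\<dots> = (LINT v|lborel. gauss (h /\<^sub>R t + v) * g (x + h - t *\<^sub>R (h /\<^sub>R t + v)))"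
    using assms(1) by (intro integral_distr) measurable
  also have "\<dots> = (LINT v|lborel. gauss (v + h /\<^sub>R t) * g (x - t *\<^sub>R v))"
    using assms by (simp add: algebra_simps)
  finally show ?thesis .
qed

text \<open>
  The weight is decreasing, so the second mean value theorem bounds the weighted integral by
  unweighted truncations.
\<close>

lemma weighted_hilbert_le:
  fixes g :: "'a::euclidean_space \<Rightarrow> real"
  assumes s: "0 < s" "s < 1" and g[measurable]: "g \<in> borel_measurable borel" and K: "\<And>x. \<bar>g x\<bar> \<le> K" and r: "0 < r"
  shows "ennreal \<bar>LINT t|lborel. indicator {r..} t * (bessel_weight s t * ((g (x - t *\<^sub>R v) - g (x + t *\<^sub>R v)) / t))\<bar>
    \<le> ennreal (2 * r powr (s - 1)) * dir_hilbert g v x"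
proof -
  define F where "F t = (g (x - t *\<^sub>R v) - g (x + t *\<^sub>R v)) / t" for t
  have [measurable]: "F \<in> borel_measurable borel" unfolding F_def[abs_def] by measurable
  have K0: "0 \<le> K" using K[of 0] by linarith
  have FB: "\<bar>F t\<bar> \<le> 2 * K / r" if "r \<le> t" for t
  proof -
    have "\<bar>g (x - t *\<^sub>R v) - g (x + t *\<^sub>R v)\<bar> \<le> 2 * K"
      using K[of "x - t *\<^sub>R v"] K[of "x + t *\<^sub>R v"] by linarith
    then show ?thesis unfolding F_def abs_divide using that r K0 by (intro frac_le) auto
  qed
  have J: "integral {c..d} F = trunc_hilbert c d (\<lambda>t. g (x + t *\<^sub>R v))" and Fi: "F integrable_on {c..d}" if "r \<le> c" for c d
  proof -
    have "integrable lborel (\<lambda>t. indicator {c..d} t *\<^sub>R F t)"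
    proof (rule Bochner_Integration.integrable_bound)
      show "integrable lborel (\<lambda>t. indicator {c..d} t * (2 * K / r))"
        by (intro integrable_mult_left integrable_real_indicator) (auto simp: emeasure_lborel_Icc_eq)
      show "AE t in lborel. norm (indicator {c..d} t *\<^sub>R F t) \<le> norm (indicator {c..d} t * (2 * K / r))"
        using FB that r K0 by (intro AE_I2) (auto simp: indicator_def)
    qed measurable
    then have si: "set_integrable lborel {c..d} F" by (simp add: set_integrable_def)
    show "F integrable_on {c..d}" by (rule set_borel_integral_eq_integral(1)[OF si])
    show "integral {c..d} F = trunc_hilbert c d (\<lambda>t. g (x + t *\<^sub>R v))"
      unfolding set_borel_integral_eq_integral(2)[OF si, symmetric]
      by (simp add: set_lebesgue_integral_def trunc_hilbert_def F_def)
  qed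
  have Jb: "ennreal \<bar>integral {c..d} F\<bar> \<le> dir_hilbert g v x" if "r \<le> c" "c \<le> d" for c d
    unfolding J[OF that(1)] using that r by (intro trunc_hilbert_le_dir_hilbert[OF g K]) auto
  define W where "W b t = indicator {r..b} t * (bessel_weight s t * F t)" for b t
  have Wb: "\<bar>bessel_weight s t * F t\<bar> \<le> 2 * K / r * bessel_weight s t" if "r \<le> t" for t
    using mult_right_mono[OF FB[OF that], of "bessel_weight s t"] by (simp add: abs_mult mult.commute)
  have dom: "integrable lborel (\<lambda>t. 2 * K / r * (indicator {0<..} t * bessel_weight s t))"
    by (intro integrable_mult_right integrable_bessel_weight s)
  have cut: "ennreal \<bar>LINT t|lborel. W b t\<bar> \<le> ennreal (2 * r powr (s - 1)) * dir_hilbert g v x" if b: "r \<le> b" for b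
  proof -
    have "integrable lborel (W b)"
    proof (rule Bochner_Integration.integrable_bound[OF dom])
      show "AE t in lborel. norm (W b t) \<le> norm (2 * K / r * (indicator {0<..} t * bessel_weight s t))"
        using Wb r K0 by (intro AE_I2) (auto simp: W_def indicator_def)
    qed (unfold W_def[abs_def], measurable)
    then have si: "set_integrable lborel {r..b} (\<lambda>t. bessel_weight s t * F t)"
      by (simp add: set_integrable_def W_def[abs_def])
    \<comment> \<open>The mean value theorem used here takes an increasing weight, hence the minus
      signs. It yields two truncations meeting at c, each with a coefficient of at most r^(s - 1);
      this is the factor 2.\<close>
    obtain c where c: "c \<in> {r..b}" "((\<lambda>t. - bessel_weight s t * F t) has_integral
        (- bessel_weight s r) * integral {r..c} F + (- bessel_weight s b) * integral {c..b} F) {r..b}"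
    proof (rule second_mean_value_theorem_full[of F r b "\<lambda>t. - bessel_weight s t"])
      show "F integrable_on {r..b}" by (rule Fi) simp
      show "- bessel_weight s t \<le> - bessel_weight s t'" if "r \<le> t" "t \<le> t'" for t t'
        using that r s by (simp add: bessel_weight_decreasing)
    qed (use b in auto)
    have "(LINT t|lborel. W b t) = integral {r..b} (\<lambda>t. bessel_weight s t * F t)"
      unfolding set_borel_integral_eq_integral(2)[OF si, symmetric] by (simp add: set_lebesgue_integral_def W_def)
    also have "\<dots> = bessel_weight s r * integral {r..c} F + bessel_weight s b * integral {c..b} F"
      using has_integral_neg[OF c(2)] by (intro integral_unique) (simp add: add.commute)
    finally have "\<bar>LINT t|lborel. W b t\<bar> \<le> r powr (s - 1) * \<bar>integral {r..c} F\<bar> + r powr (s - 1) * \<bar>integral {c..b} F\<bar>"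
    proof -
      assume eq: "(LINT t|lborel. W b t) = bessel_weight s r * integral {r..c} F + bessel_weight s b * integral {c..b} F"
      have "bessel_weight s r \<le> r powr (s - 1)" by (rule bessel_weight_le)
      moreover have "bessel_weight s b \<le> r powr (s - 1)"
        using bessel_weight_decreasing[OF s(2) r b] bessel_weight_le[of s r] by linarith
      ultimately show ?thesis unfolding eq
        by (intro order_trans[OF abs_triangle_ineq] add_mono) (auto simp: abs_mult intro!: mult_right_mono)
    qed
    then have "ennreal \<bar>LINT t|lborel. W b t\<bar> \<le> ennreal (r powr (s - 1)) * ennreal \<bar>integral {r..c} F\<bar> + ennreal (r powr (s - 1)) * ennreal \<bar>integral {c..b} F\<bar>"
      by (simp add: ennreal_leI flip: ennreal_mult ennreal_plus)
    also have "\<dots> \<le> ennreal (r powr (s - 1)) * dir_hilbert g v x + ennreal (r powr (s - 1)) * dir_hilbert g v x"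
      using c(1) by (intro add_mono mult_left_mono Jb) auto
    also have "\<dots> = ennreal (2 * r powr (s - 1)) * dir_hilbert g v x"
      by (simp add: ennreal_mult mult_2[symmetric] mult.assoc)
    finally show ?thesis .
  qed
  \<comment> \<open>The bound on [r, b] is independent of b. Dominated convergence along b = r + n,
    with majorant 2 K / r times the weight, reaches the infinite range.\<close>
  have lim: "(\<lambda>n. LINT t|lborel. W (r + real n) t) \<longlonglongrightarrow> (LINT t|lborel. indicator {r..} t * (bessel_weight s t * F t))"
  proof (rule integral_dominated_convergence[OF _ _ dom])
    show "AE t in lborel. (\<lambda>n. W (r + real n) t) \<longlonglongrightarrow> indicator {r..} t * (bessel_weight s t * F t)"
    proof (intro AE_I2 tendsto_eventually)
      fix t
      obtain m :: nat where "t - r \<le> real m" using real_arch_simple by blast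
      then show "\<forall>\<^sub>F n in sequentially. W (r + real n) t = indicator {r..} t * (bessel_weight s t * F t)"
        by (intro eventually_sequentiallyI[of m]) (auto simp: W_def indicator_def)
    qed
    show "AE t in lborel. norm (W (r + real n) t) \<le> 2 * K / r * (indicator {0<..} t * bessel_weight s t)" for n
      using Wb r K0 by (intro AE_I2) (auto simp: W_def indicator_def)
  qed (unfold W_def[abs_def], measurable)
  have "(\<lambda>n. ennreal \<bar>LINT t|lborel. W (r + real n) t\<bar>) \<longlonglongrightarrow> ennreal \<bar>LINT t|lborel. indicator {r..} t * (bessel_weight s t * F t)\<bar>"
    by (intro tendsto_ennrealI tendsto_rabs lim)
  then show ?thesis
    unfolding F_def[symmetric] by (rule LIMSEQ_le_const2) (use cut in auto)
qed

text \<open>The average over directions of the method of rotations, taken over all vectors with a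
  Gaussian weight. The factor \<open>norm v\<close> is what Cauchy-Schwarz leaves of the inner
  product with h once \<open>norm h\<close> is taken out.\<close>

definition hilbert_avg :: "('a::euclidean_space \<Rightarrow> real) \<Rightarrow> 'a \<Rightarrow> ennreal" where
  "hilbert_avg g x = (\<integral>\<^sup>+v. ennreal (norm v * gauss v) * dir_hilbert g v x \<partial>lborel)"

text \<open>
  The first order term of the far part is odd in \<open>v\<close>; symmetrising it produces, direction by direction,
  truncated Hilbert transforms.
\<close>

lemma far_first_order_le:
  fixes g :: "'a::euclidean_space \<Rightarrow> real"
  assumes s: "0 < s" "s < 1" and g[measurable]: "g \<in> borel_measurable borel" and K: "\<And>x. \<bar>g x\<bar> \<le> K" and h: "h \<noteq> 0"
  shows "ennreal \<bar>LINT t|lborel. indicator {norm h..} t * (bessel_weight s t * ((LINT v|lborel. (h \<bullet> v) * gauss v * g (x - t *\<^sub>R v)) / t))\<bar>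
    \<le> ennreal (norm h powr s) * hilbert_avg g x"
proof -
  define r where "r = norm h"
  have r: "0 < r" using h by (simp add: r_def)
  have K0: "0 \<le> K" using K[of 0] by linarith
  have hv: "\<bar>(h \<bullet> v) * gauss v\<bar> \<le> r * (norm v * gauss v)" for v
    unfolding r_def mult.assoc[symmetric] abs_mult using Cauchy_Schwarz_ineq2[of h v]
    by (intro mult_mono) auto
  have hvi: "integrable lborel (\<lambda>v. (h \<bullet> v) * gauss v)"
  proof (rule Bochner_Integration.integrable_bound)
    show "integrable lborel (\<lambda>v::'a. r * (norm v * gauss v))" by (intro integrable_mult_right integrable_norm_gauss)
    have "norm ((h \<bullet> v) * gauss v) \<le> norm (r * (norm v * gauss v))" for v
      using order_trans[OF hv abs_ge_self] by simp
    then show "AE v in lborel. norm ((h \<bullet> v) * gauss v) \<le> norm (r * (norm v * gauss v))" by blast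
  qed measurable
  have m: "(\<lambda>v. (h \<bullet> v) * gauss v) \<in> borel_measurable borel" by measurable
  \<comment> \<open>Under v to -v the kernel changes sign, so \<open>g\<close> may be replaced by
    half its antisymmetric difference.\<close>
  have odd: "(LINT v|lborel. (h \<bullet> v) * gauss v * g (x - t *\<^sub>R v))
    = (LINT v|lborel. (h \<bullet> v) * gauss v * (g (x - t *\<^sub>R v) - g (x + t *\<^sub>R v))) / 2" for t
  proof -
    note i1 = integrable_gauss_mult[OF g m K hvi, of x "- t", simplified]
    note i2 = integrable_gauss_mult[OF g m K hvi, of x t, simplified]
    have "lborel = distr lborel borel (uminus :: 'a \<Rightarrow> 'a)"
      using lborel_affine[of "-1" "0::'a"] by (simp add: density_1)
    then have "(LINT v|lborel. (h \<bullet> v) * gauss v * g (x + t *\<^sub>R v))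
       = (LINT v|distr lborel borel (uminus :: 'a \<Rightarrow> 'a). (h \<bullet> v) * gauss v * g (x + t *\<^sub>R v))" by simp
    also have "\<dots> = - (LINT v|lborel. (h \<bullet> v) * gauss v * g (x - t *\<^sub>R v))"
      by (subst integral_distr) (simp_all add: mult.assoc)
    finally have "(LINT v|lborel. (h \<bullet> v) * gauss v * g (x + t *\<^sub>R v)) = - (LINT v|lborel. (h \<bullet> v) * gauss v * g (x - t *\<^sub>R v))" .
    then show ?thesis unfolding right_diff_distrib using i1 i2 by (subst Bochner_Integration.integral_diff) (simp_all add: mult.assoc)
  qed
  define F where "F t v = indicator {r..} t * (bessel_weight s t * ((h \<bullet> v) * gauss v * ((g (x - t *\<^sub>R v) - g (x + t *\<^sub>R v)) / t)))" for t v
  have [measurable]: "(\<lambda>(t, v). F t v) \<in> borel_measurable (borel \<Otimes>\<^sub>M borel)"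
    unfolding F_def[abs_def] split_beta' by measurable
  \<comment> \<open>Fubini rests on the boundedness of \<open>g\<close>: for t \<ge> r the quotient
    is at most 2 K / r, and this 1 / r cancels the factor r from \<open>hv\<close>.\<close>
  have "(\<integral>\<^sup>+t. \<integral>\<^sup>+v. ennreal (norm (F t v)) \<partial>lborel \<partial>lborel)
    \<le> (\<integral>\<^sup>+t. \<integral>\<^sup>+v. ennreal (2 * K) * ennreal (norm (indicator {0<..} t * bessel_weight s t)) * ennreal (norm v * gauss (v::'a)) \<partial>lborel \<partial>lborel)"
  proof (intro nn_integral_mono)
    fix t v
    show "ennreal (norm (F t v)) \<le> ennreal (2 * K) * ennreal (norm (indicator {0<..} t * bessel_weight s t)) * ennreal (norm v * gauss v)"
    proof (cases "r \<le> t")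
      case True
      have "\<bar>g (x - t *\<^sub>R v) - g (x + t *\<^sub>R v)\<bar> \<le> 2 * K"
        using K[of "x - t *\<^sub>R v"] K[of "x + t *\<^sub>R v"] by linarith
      then have "\<bar>(g (x - t *\<^sub>R v) - g (x + t *\<^sub>R v)) / t\<bar> \<le> 2 * K / r"
        unfolding abs_divide using True r K0 by (intro frac_le) auto
      then have "\<bar>(h \<bullet> v) * gauss v\<bar> * \<bar>(g (x - t *\<^sub>R v) - g (x + t *\<^sub>R v)) / t\<bar> \<le> (r * (norm v * gauss v)) * (2 * K / r)"
        using r by (intro mult_mono hv) auto
      also have "\<dots> = 2 * K * (norm v * gauss v)" using r by simp
      finally have "bessel_weight s t * (\<bar>(h \<bullet> v) * gauss v\<bar> * \<bar>(g (x - t *\<^sub>R v) - g (x + t *\<^sub>R v)) / t\<bar>)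
        \<le> bessel_weight s t * (2 * K * (norm v * gauss v))"
        by (rule mult_left_mono) simp
      then have "norm (F t v) \<le> bessel_weight s t * (2 * K * (norm v * gauss v))"
        using True unfolding F_def by (simp add: abs_mult)
      then show ?thesis using True r K0 by (simp add: ac_simps flip: ennreal_mult)
    qed (simp add: F_def)
  qed
  also have "\<dots> = ennreal (2 * K) * (\<integral>\<^sup>+t. ennreal (norm (indicator {0<..} t * bessel_weight s t)) \<partial>lborel) * (\<integral>\<^sup>+v. ennreal (norm v * gauss (v::'a)) \<partial>lborel)"
    by (subst nn_integral_cmult, measurable, subst nn_integral_multc, measurable, subst nn_integral_cmult) auto
  also have "\<dots> < \<infinity>"
    using integrable_bessel_weight[OF s] integrable_norm_gauss[where 'a='a]
    by (simp add: integrable_iff_bounded ennreal_mult_less_top)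
  finally have fin: "(\<integral>\<^sup>+t. \<integral>\<^sup>+v. ennreal (norm (F t v)) \<partial>lborel \<partial>lborel) < \<infinity>" .
  have "(LINT t|lborel. indicator {r..} t * (bessel_weight s t * ((LINT v|lborel. (h \<bullet> v) * gauss v * g (x - t *\<^sub>R v)) / t)))
      = (LINT t|lborel. (LINT v|lborel. F t v) / 2)"
  proof (intro Bochner_Integration.integral_cong refl)
    fix t
    have "(LINT v|lborel. F t v) = indicator {r..} t * (bessel_weight s t * ((LINT v|lborel. (h \<bullet> v) * gauss v * (g (x - t *\<^sub>R v) - g (x + t *\<^sub>R v))) / t))"
      unfolding F_def times_divide_eq_right by (simp only: integral_mult_right_zero integral_divide_zero)
    then show "indicator {r..} t * (bessel_weight s t * ((LINT v|lborel. (h \<bullet> v) * gauss v * g (x - t *\<^sub>R v)) / t)) = (LINT v|lborel. F t v) / 2"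
      unfolding odd by simp
  qed
  also have "\<dots> = (LINT v|lborel. LINT t|lborel. F t v) / 2"
    unfolding integral_divide_zero by (subst lborel_Fubini_swap[OF _ fin]) auto
  finally have eq: "(LINT t|lborel. indicator {r..} t * (bessel_weight s t * ((LINT v|lborel. (h \<bullet> v) * gauss v * g (x - t *\<^sub>R v)) / t)))
    = (LINT v|lborel. LINT t|lborel. F t v) / 2" .
  have "ennreal \<bar>(LINT v|lborel. LINT t|lborel. F t v) / 2\<bar> = ennreal (1 / 2) * ennreal (norm (LINT v|lborel. LINT t|lborel. F t v))"
    by (subst ennreal_mult[symmetric]) (simp_all only: abs_divide real_norm_def abs_ge_zero, simp_all)
  also have "\<dots> \<le> ennreal (1 / 2) * (\<integral>\<^sup>+v. ennreal (norm (LINT t|lborel. F t v)) \<partial>lborel)"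
    by (intro mult_left_mono norm_integral_le_nn_integral) auto
  also have "\<dots> \<le> ennreal (1 / 2) * (\<integral>\<^sup>+v. ennreal (2 * r powr s) * (ennreal (norm v * gauss v) * dir_hilbert g v x) \<partial>lborel)"
  proof (intro mult_left_mono nn_integral_mono)
    fix v
    let ?L = "LINT t|lborel. indicator {r..} t * (bessel_weight s t * ((g (x - t *\<^sub>R v) - g (x + t *\<^sub>R v)) / t))"
    have "(LINT t|lborel. F t v) = (h \<bullet> v) * gauss v * ?L"
      unfolding F_def by (subst integral_mult_right_zero[symmetric]) (simp add: ac_simps)
    then have "ennreal (norm (LINT t|lborel. F t v)) = ennreal \<bar>(h \<bullet> v) * gauss v\<bar> * ennreal \<bar>?L\<bar>"
      by (simp add: abs_mult flip: ennreal_mult)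
    also have "\<dots> \<le> ennreal (r * (norm v * gauss v)) * (ennreal (2 * r powr (s - 1)) * dir_hilbert g v x)"
      by (intro mult_mono ennreal_leI hv weighted_hilbert_le[OF s g K r]) auto
    also have "\<dots> = ennreal (r * (norm v * gauss v) * (2 * r powr (s - 1))) * dir_hilbert g v x"
      using r by (subst ennreal_mult) (simp_all add: mult.assoc)
    \<comment> \<open>One power of r = norm h turns r^(s - 1) into r^s; the factor 2 will cancel
      against the 1 / 2 of the symmetrisation.\<close>
    also have "r * (norm v * gauss v) * (2 * r powr (s - 1)) = (2 * r powr s) * (norm v * gauss v)"
      using r by (simp add: powr_diff)
    also have "ennreal \<dots> * dir_hilbert g v x = ennreal (2 * r powr s) * (ennreal (norm v * gauss v) * dir_hilbert g v x)"
      by (subst ennreal_mult) (simp_all add: mult.assoc)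
    finally show "ennreal (norm (LINT t|lborel. F t v)) \<le> ennreal (2 * r powr s) * (ennreal (norm v * gauss v) * dir_hilbert g v x)" .
  qed auto
  also have "\<dots> = ennreal (1 / 2) * (ennreal (2 * r powr s) * hilbert_avg g x)"
    unfolding hilbert_avg_def using borel_measurable_dir_hilbert[OF g]
    by (subst nn_integral_cmult) auto
  also have "\<dots> = ennreal (r powr s) * hilbert_avg g x"
    unfolding mult.assoc[symmetric] by (subst ennreal_mult[symmetric]) simp_all
  finally show ?thesis unfolding eq[symmetric] r_def .
qed

text \<open>The scales are split at r = norm h. Below r the averages at the two points are bounded
  separately, at the cost of r^s / s each. Above r the difference is expanded in h / t: the
  remainder gains (r / t)^2 and integrates to r^s / (2 - s), and the linear term is left to
  \<open>far_first_order_le\<close>.\<close>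

theorem bessel_avg_difference:
  obtains C where "0 < C" "\<And>s (g :: 'a::euclidean_space \<Rightarrow> real) K x h. 0 < s \<Longrightarrow> s < 1 \<Longrightarrow> g \<in> borel_measurable borel \<Longrightarrow>
    (\<And>x. \<bar>g x\<bar> \<le> K) \<Longrightarrow> h \<noteq> 0 \<Longrightarrow>
    ennreal (s * \<bar>bessel_avg s g (x + h) - bessel_avg s g x\<bar>) \<le> ennreal (C * norm h powr s) *
      (max_fun (\<lambda>y. ennreal \<bar>g y\<bar>) x + max_fun (\<lambda>y. ennreal \<bar>g y\<bar>) (x + h) + hilbert_avg g x)"
proof -
  define c1 where "c1 = fact (0 + Suc DIM('a)) * exp (2::real) * 2 ^ (DIM('a) + 2)"
  define c2 where "c2 = 2 ^ Suc DIM('a) * (fact (2 + Suc DIM('a)) * exp (2::real))"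
  define c3 where "c3 = c2 * 2 ^ (DIM('a) + 2)"
  have c: "0 < c1" "0 < c2" "0 < c3" by (auto simp: c1_def c2_def c3_def)
  \<comment> \<open>\<open>c1\<close> serves the small scales, \<open>c3\<close> the remainder, and
    1 the linear term.\<close>
  define C where "C = c1 + c3 + 1"
  have "0 < C" using c by (simp add: C_def)
  then show ?thesis
  proof (rule that)
    fix s K :: real and g :: "'a \<Rightarrow> real" and x h :: 'a
    assume s: "0 < s" "s < 1" and g[measurable]: "g \<in> borel_measurable borel" and K: "\<And>x. \<bar>g x\<bar> \<le> K" and h: "h \<noteq> 0"
    define r where "r = norm h"
    have r: "0 < r" using h by (simp add: r_def)
    let ?M = "max_fun (\<lambda>y. ennreal \<bar>g y\<bar>)"
    let ?w = "bessel_weight s"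
    have [measurable]: "(\<lambda>t. gauss_avg t g y) \<in> borel_measurable borel" for y
      unfolding gauss_avg_def by measurable
    have avg: "ennreal \<bar>gauss_avg t g y\<bar> \<le> ennreal c1 * ?M y" if "0 < t" for t y
      unfolding gauss_avg_def c1_def using norm_power_gauss_le[of _ 0] that
      by (intro kernel_avg_le_max_fun g) auto
    have avgK: "\<bar>gauss_avg t g y\<bar> \<le> K * (LINT v|lborel. gauss (v::'a))" for t y
    proof -
      have "\<bar>gauss_avg t g y\<bar> \<le> (LINT v|lborel. K * gauss (v::'a))"
        unfolding gauss_avg_def
      proof (rule integral_abs_bound_integral)
        show "integrable lborel (\<lambda>v. gauss v * g (y - t *\<^sub>R v))"
          using integrable_gauss_mult[OF g borel_measurable_gauss K integrable_gauss, of y "- t"] by simp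
        show "\<bar>gauss v * g (y - t *\<^sub>R v)\<bar> \<le> K * gauss v" for v
          using mult_right_mono[OF K[of "y - t *\<^sub>R v"], of "gauss v"] by (simp add: abs_mult mult.commute)
      qed (intro integrable_mult_right integrable_gauss)
      then show ?thesis by simp
    qed
    have wi: "integrable lborel (\<lambda>t. indicator S t * (?w t * G t))"
      if [measurable]: "S \<in> sets borel" "G \<in> borel_measurable borel" and S: "S \<subseteq> {0<..}" and G: "\<And>t. t \<in> S \<Longrightarrow> \<bar>G t\<bar> \<le> B" for S G B
    proof (rule Bochner_Integration.integrable_bound)
      show "integrable lborel (\<lambda>t. \<bar>B\<bar> * (indicator {0<..} t * ?w t))" by (intro integrable_mult_right integrable_bessel_weight s)
      have "norm (indicator S t * (?w t * G t)) \<le> norm (\<bar>B\<bar> * (indicator {0<..} t * ?w t))" for t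
      proof (cases "t \<in> S")
        case True
        then show ?thesis
          using S mult_left_mono[OF order_trans[OF G[OF True] abs_ge_self], of "?w t"]
          by (auto simp: abs_mult mult.commute)
      qed simp
      then show "AE t in lborel. norm (indicator S t * (?w t * G t)) \<le> norm (\<bar>B\<bar> * (indicator {0<..} t * ?w t))" by blast
    qed measurable
    define I where "I y = (LINT t|lborel. indicator {0<..<r} t * (?w t * gauss_avg t g y))" for y
    define J where "J y = (LINT t|lborel. indicator {r..} t * (?w t * gauss_avg t g y))" for y
    have split: "bessel_avg s g y = I y + J y" for y
    proof -
      have i1: "integrable lborel (\<lambda>t. indicator {0<..<r} t * (?w t * gauss_avg t g y))"
        by (rule wi[OF _ _ _ avgK]) auto
      have i2: "integrable lborel (\<lambda>t. indicator {r..} t * (?w t * gauss_avg t g y))"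
        using r by (intro wi[OF _ _ _ avgK]) auto
      show ?thesis
        unfolding bessel_avg_def I_def J_def Bochner_Integration.integral_add[OF i1 i2, symmetric] using r
        by (intro Bochner_Integration.integral_cong refl) (simp add: indicator_def)
    qed
    have near: "ennreal (s * \<bar>I y\<bar>) \<le> ennreal (c1 * r powr s) * ?M y" for y
    proof -
      have "ennreal \<bar>I y\<bar> \<le> (\<integral>\<^sup>+t. ennreal (norm (indicator {0<..<r} t * (?w t * gauss_avg t g y))) \<partial>lborel)"
        unfolding I_def real_norm_def[symmetric] by (rule norm_integral_le_nn_integral)
      also have "\<dots> \<le> (\<integral>\<^sup>+t. (ennreal c1 * ?M y) * (ennreal (t powr (s - 1)) * indicator {0<..<r} t) \<partial>lborel)"
      proof (rule nn_integral_mono)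
        fix t
        show "ennreal (norm (indicator {0<..<r} t * (?w t * gauss_avg t g y)))
          \<le> (ennreal c1 * ?M y) * (ennreal (t powr (s - 1)) * indicator {0<..<r} t)"
        proof (cases "t \<in> {0<..<r}")
          case True
          then have "ennreal (?w t) * ennreal \<bar>gauss_avg t g y\<bar> \<le> ennreal (t powr (s - 1)) * (ennreal c1 * ?M y)"
            by (intro mult_mono avg ennreal_leI bessel_weight_le) auto
          then show ?thesis using True by (simp add: abs_mult ennreal_mult mult.commute)
        qed simp
      qed
      also have "\<dots> = (ennreal c1 * ?M y) * ennreal (r powr s / s)"
        using s r by (subst nn_integral_cmult) (auto simp: nn_integral_powr_from_0)
      finally have "ennreal s * ennreal \<bar>I y\<bar> \<le> ennreal s * ((ennreal c1 * ?M y) * ennreal (r powr s / s))"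
        by (rule mult_left_mono) simp
      also have "\<dots> = (ennreal s * ennreal c1 * ennreal (r powr s / s)) * ?M y" by (simp only: ac_simps)
      also have "ennreal s * ennreal c1 * ennreal (r powr s / s) = ennreal (c1 * r powr s)"
        using s c by (simp flip: ennreal_mult)
      finally show ?thesis using s by (simp add: ennreal_mult)
    qed
    define R where "R t = (LINT v|lborel. gauss_rem (h /\<^sub>R t) v * g (x - t *\<^sub>R v))" for t
    define B where "B t = (LINT v|lborel. (h \<bullet> v) * gauss v * g (x - t *\<^sub>R v))" for t
    have [measurable]: "R \<in> borel_measurable borel" "B \<in> borel_measurable borel"
      unfolding R_def[abs_def] B_def[abs_def] gauss_rem_def by measurable
    have hvi: "integrable lborel (\<lambda>v. (h \<bullet> v) * gauss v)"
    proof (rule Bochner_Integration.integrable_bound)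
      show "integrable lborel (\<lambda>v::'a. r * (norm v * gauss v))" by (intro integrable_mult_right integrable_norm_gauss)
      have "norm ((h \<bullet> v) * gauss v) \<le> norm (r * (norm v * gauss v))" for v
        unfolding r_def mult.assoc[symmetric] norm_mult using Cauchy_Schwarz_ineq2[of h v]
        by (intro mult_mono) auto
      then show "AE v in lborel. norm ((h \<bullet> v) * gauss v) \<le> norm (r * (norm v * gauss v))" by blast
    qed measurable
    \<comment> \<open>The step is h / t, so the first order part of the kernel difference is - (h
      \<bullet> v) / (2 t) gauss v.\<close>
    have taylor: "gauss_avg t g (x + h) - gauss_avg t g x = R t - B t / (2 * t)" if t: "0 < t" for t
    proof -
      have tr: "integrable lborel (\<lambda>v::'a. gauss (v + h /\<^sub>R t))"
        using lborel_integrable_affine_translate[OF integrable_gauss] by blast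
      note i1 = integrable_gauss_mult[OF g _ K tr, of x "- t", simplified]
      note i2 = integrable_gauss_mult[OF g _ K integrable_gauss, of x "- t", simplified]
      note i3 = integrable_gauss_mult[OF g _ K hvi, of x "- t", simplified]
      have "R t = (LINT v|lborel. (gauss (v + h /\<^sub>R t) * g (x - t *\<^sub>R v) - gauss v * g (x - t *\<^sub>R v)) + 1 / (2 * t) * ((h \<bullet> v) * gauss v * g (x - t *\<^sub>R v)))"
      proof -
        have "((h /\<^sub>R t) \<bullet> v) / 2 = 1 / (2 * t) * (h \<bullet> v)" for v
          by (simp only: inner_scaleR_left divide_inverse inverse_mult_distrib mult_1_left mult_ac)
        then show ?thesis
          unfolding R_def gauss_rem_def by (simp only: left_diff_distrib distrib_right mult.assoc)
      qed
      also have "\<dots> = (gauss_avg t g (x + h) - gauss_avg t g x) + 1 / (2 * t) * B t"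
        unfolding gauss_avg_translate[OF g less_imp_neq[OF t, symmetric]] unfolding B_def gauss_avg_def
        by (simp only: integral_mult_right_zero
          Bochner_Integration.integral_add[OF Bochner_Integration.integrable_diff[OF i1 i2] integrable_mult_right[OF i3]]
          Bochner_Integration.integral_diff[OF i1 i2])
      finally show ?thesis by simp
    qed
    have Bb: "\<bar>B t\<bar> \<le> K * (LINT v|lborel. \<bar>(h \<bullet> v) * gauss v\<bar>)" for t
    proof -
      have "\<bar>B t\<bar> \<le> (LINT v|lborel. K * \<bar>(h \<bullet> v) * gauss v\<bar>)"
        unfolding B_def
      proof (rule integral_abs_bound_integral)
        show "integrable lborel (\<lambda>v. (h \<bullet> v) * gauss v * g (x - t *\<^sub>R v))"
          using integrable_gauss_mult[OF g _ K hvi, of x "- t"] by simp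
        show "integrable lborel (\<lambda>v. K * \<bar>(h \<bullet> v) * gauss v\<bar>)" by (intro integrable_mult_right integrable_abs hvi)
        show "\<bar>(h \<bullet> v) * gauss v * g (x - t *\<^sub>R v)\<bar> \<le> K * \<bar>(h \<bullet> v) * gauss v\<bar>" for v
          using mult_right_mono[OF K[of "x - t *\<^sub>R v"], of "\<bar>(h \<bullet> v) * gauss v\<bar>"] by (simp add: abs_mult mult.commute)
      qed
      then show ?thesis by simp
    qed
    have iB: "integrable lborel (\<lambda>t. indicator {r..} t * (?w t * (B t / (2 * t))))"
    proof (rule wi)
      fix t assume "t \<in> {r..}"
      then show "\<bar>B t / (2 * t)\<bar> \<le> K * (LINT v|lborel. \<bar>(h \<bullet> v) * gauss v\<bar>) / (2 * r)"
        unfolding abs_divide using r Bb[of t] by (intro frac_le order_trans[OF abs_ge_zero Bb]) auto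
    qed (use r in auto)
    have iD: "integrable lborel (\<lambda>t. indicator {r..} t * (?w t * gauss_avg t g y))" for y
      using r by (intro wi[OF _ _ _ avgK]) auto
    have eqR: "indicator {r..} t * (?w t * R t) = indicator {r..} t * (?w t * gauss_avg t g (x + h))
        - indicator {r..} t * (?w t * gauss_avg t g x) + indicator {r..} t * (?w t * (B t / (2 * t)))" for t
    proof (cases "r \<le> t")
      case True
      then have "R t = gauss_avg t g (x + h) - gauss_avg t g x + B t / (2 * t)" using taylor[of t] r by simp
      then show ?thesis using True by (simp add: right_diff_distrib distrib_left)
    qed simp
    have J: "J (x + h) - J x = (LINT t|lborel. indicator {r..} t * (?w t * R t)) - (LINT t|lborel. indicator {r..} t * (?w t * (B t / (2 * t))))"
      unfolding J_def eqR
      by (simp only: Bochner_Integration.integral_add[OF Bochner_Integration.integrable_diff[OF iD iD] iB]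
        Bochner_Integration.integral_diff[OF iD iD] add_diff_cancel_right')
    \<comment> \<open>For t \<ge> r the step h / t has norm at most 1, as
      \<open>gauss_rem_bound\<close> demands. Its square turns t^(s - 1) into r^2 t^(s - 3), which
      is integrable at infinity uniformly in s.\<close>
    have far2: "ennreal \<bar>LINT t|lborel. indicator {r..} t * (?w t * R t)\<bar> \<le> ennreal (c3 * r powr s) * ?M x"
    proof -
      have "ennreal \<bar>LINT t|lborel. indicator {r..} t * (?w t * R t)\<bar> \<le> (\<integral>\<^sup>+t. ennreal (norm (indicator {r..} t * (?w t * R t))) \<partial>lborel)"
        unfolding real_norm_def[symmetric] by (rule norm_integral_le_nn_integral)
      also have "\<dots> \<le> (\<integral>\<^sup>+t. (ennreal (r\<^sup>2 * c3) * ?M x) * (ennreal (t powr (s - 3)) * indicator {r..} t) \<partial>lborel)"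
      proof (rule nn_integral_mono)
        fix t
        show "ennreal (norm (indicator {r..} t * (?w t * R t))) \<le> (ennreal (r\<^sup>2 * c3) * ?M x) * (ennreal (t powr (s - 3)) * indicator {r..} t)"
        proof (cases "r \<le> t")
          case True
          then have t: "0 < t" using r by simp
          have ne: "norm (h /\<^sub>R t) = r / t" using t by (simp add: r_def divide_inverse mult.commute)
          have "ennreal \<bar>R t\<bar> \<le> ennreal ((norm (h /\<^sub>R t))\<^sup>2 * c2 * 2 ^ (DIM('a) + 2)) * ?M x"
            unfolding R_def
          proof (intro kernel_avg_le_max_fun g t)
            show "gauss_rem (h /\<^sub>R t) \<in> borel_measurable borel" unfolding gauss_rem_def[abs_def] by measurable
            show "\<bar>gauss_rem (h /\<^sub>R t) v\<bar> \<le> (norm (h /\<^sub>R t))\<^sup>2 * c2 * (1 / (1 + norm v) ^ Suc DIM('a))" for v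
              unfolding c2_def by (intro gauss_rem_bound) (unfold ne, use True t in simp)
          qed (use c in auto)
          also have "(norm (h /\<^sub>R t))\<^sup>2 * c2 * 2 ^ (DIM('a) + 2) = (r / t)\<^sup>2 * c3" unfolding ne by (simp add: c3_def)
          finally have "ennreal (?w t) * ennreal \<bar>R t\<bar> \<le> ennreal (t powr (s - 1)) * (ennreal ((r / t)\<^sup>2 * c3) * ?M x)"
            by (intro mult_mono ennreal_leI bessel_weight_le) auto
          also have "\<dots> = ennreal (t powr (s - 1) * ((r / t)\<^sup>2 * c3)) * ?M x"
            using c by (simp add: ennreal_mult mult.assoc)
          also have "t powr (s - 1) * ((r / t)\<^sup>2 * c3) = (r\<^sup>2 * c3) * t powr (s - 3)"
          proof -
            have "t powr (s - 1) = t powr (s - 3) * t\<^sup>2"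
              using t by (simp add: powr_add[symmetric] flip: powr_numeral)
            then show ?thesis using t by (simp add: power_divide)
          qed
          finally show ?thesis using True c by (simp add: abs_mult ennreal_mult ac_simps)
        qed simp
      qed
      also have "\<dots> = (ennreal (r\<^sup>2 * c3) * ?M x) * ennreal (- (r powr (s - 3 + 1) / (s - 3 + 1)))"
        using s r by (subst nn_integral_cmult) (auto simp: nn_integral_powr_to_inf)
      also have "\<dots> = ennreal (r\<^sup>2 * c3 * (r powr (s - 2) / (2 - s))) * ?M x"
      proof -
        have "- (a / (s - 2)) = a / (2 - s)" for a by (metis minus_diff_eq minus_divide_right)
        moreover have "s - 3 + 1 = s - 2" by simp
        ultimately have eq: "- (r powr (s - 3 + 1) / (s - 3 + 1)) = r powr (s - 2) / (2 - s)" by (simp only:)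
        have "ennreal a * m * ennreal b = ennreal (a * b) * m" if "0 \<le> a" for a b m
          using that by (simp add: ennreal_mult' mult_ac)
        then show ?thesis unfolding eq using c by simp
      qed
      also have "\<dots> \<le> ennreal (c3 * r powr s) * ?M x"
      proof (intro mult_right_mono ennreal_leI)
        have "r\<^sup>2 * r powr (s - 2) = r powr s"
          using r by (simp add: powr_add[symmetric] flip: powr_numeral)
        then have "r\<^sup>2 * c3 * (r powr (s - 2) / (2 - s)) = c3 * r powr s / (2 - s)" by (simp add: ac_simps)
        also have "\<dots> \<le> c3 * r powr s / 1" using s c by (intro divide_left_mono) auto
        also have "\<dots> = c3 * r powr s" by simp
        finally show "r\<^sup>2 * c3 * (r powr (s - 2) / (2 - s)) \<le> c3 * r powr s" .
      qed simp
      finally show ?thesis .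
    qed
    have far1: "ennreal \<bar>LINT t|lborel. indicator {r..} t * (?w t * (B t / (2 * t)))\<bar> \<le> ennreal (r powr s) * hilbert_avg g x"
    proof -
      have "(LINT t|lborel. indicator {r..} t * (?w t * (B t / (2 * t)))) = (LINT t|lborel. indicator {r..} t * (?w t * (B t / t)) / 2)"
        by (intro Bochner_Integration.integral_cong) auto
      also have "\<dots> = (LINT t|lborel. indicator {r..} t * (?w t * (B t / t))) / 2" by (rule integral_divide_zero)
      finally have "ennreal \<bar>LINT t|lborel. indicator {r..} t * (?w t * (B t / (2 * t)))\<bar>
        \<le> ennreal \<bar>LINT t|lborel. indicator {r..} t * (?w t * (B t / t))\<bar>" by (simp only: abs_divide) (intro ennreal_leI, simp)
      also have "\<dots> \<le> ennreal (r powr s) * hilbert_avg g x"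
        unfolding B_def r_def by (rule far_first_order_le[OF s g K h])
      finally show ?thesis .
    qed
    have "s * \<bar>bessel_avg s g (x + h) - bessel_avg s g x\<bar>
      \<le> s * \<bar>I (x + h)\<bar> + s * \<bar>I x\<bar> + \<bar>LINT t|lborel. indicator {r..} t * (?w t * R t)\<bar> + \<bar>LINT t|lborel. indicator {r..} t * (?w t * (B t / (2 * t)))\<bar>"
    proof -
      \<comment> \<open>The factor s is kept on the small scales, where it cancels 1 / s, and
        dropped on the large ones, where s < 1.\<close>
      have "s * \<bar>a + b - (a' + b')\<bar> \<le> s * \<bar>a\<bar> + s * \<bar>a'\<bar> + \<bar>e\<bar> + \<bar>f\<bar>" if "b - b' = e - f" for a b a' b' e f
      proof -
        have "s * \<bar>a + b - (a' + b')\<bar> \<le> s * (\<bar>a\<bar> + \<bar>a'\<bar> + (\<bar>e\<bar> + \<bar>f\<bar>))" using s that by (intro mult_left_mono) linarith+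
        moreover have "s * (\<bar>e\<bar> + \<bar>f\<bar>) \<le> 1 * (\<bar>e\<bar> + \<bar>f\<bar>)" using s by (intro mult_right_mono) auto
        ultimately show ?thesis by (simp add: distrib_left)
      qed
      from this[OF J] show ?thesis unfolding split .
    qed
    then have "ennreal (s * \<bar>bessel_avg s g (x + h) - bessel_avg s g x\<bar>)
      \<le> ennreal (s * \<bar>I (x + h)\<bar>) + ennreal (s * \<bar>I x\<bar>) + ennreal \<bar>LINT t|lborel. indicator {r..} t * (?w t * R t)\<bar>
        + ennreal \<bar>LINT t|lborel. indicator {r..} t * (?w t * (B t / (2 * t)))\<bar>"
    proof -
      have "ennreal q \<le> ennreal a + ennreal b + ennreal d + ennreal e"
        if "q \<le> a + b + d + e" "0 \<le> a" "0 \<le> b" "0 \<le> d" "0 \<le> e" for q a b d e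
        using that by (simp add: ennreal_leI flip: ennreal_plus)
      then show "s * \<bar>bessel_avg s g (x + h) - bessel_avg s g x\<bar>
          \<le> s * \<bar>I (x + h)\<bar> + s * \<bar>I x\<bar> + \<bar>LINT t|lborel. indicator {r..} t * (?w t * R t)\<bar> + \<bar>LINT t|lborel. indicator {r..} t * (?w t * (B t / (2 * t)))\<bar> \<Longrightarrow> ?thesis"
        using s by simp
    qed
    also have "\<dots> \<le> ennreal (c1 * r powr s) * ?M (x + h) + ennreal (c1 * r powr s) * ?M x + ennreal (c3 * r powr s) * ?M x + ennreal (r powr s) * hilbert_avg g x"
      by (intro add_mono near far1 far2)
    also have "\<dots> = ennreal (c1 * r powr s) * ?M (x + h) + ennreal ((c1 + c3) * r powr s) * ?M x + ennreal (1 * r powr s) * hilbert_avg g x"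
      using c by (simp add: distrib_right add.assoc)
    also have "\<dots> \<le> ennreal (C * r powr s) * ?M (x + h) + ennreal (C * r powr s) * ?M x + ennreal (C * r powr s) * hilbert_avg g x"
    proof -
      have "c1 \<le> C" "c1 + c3 \<le> C" "1 \<le> C" using c by (auto simp: C_def)
      then show ?thesis by (intro add_mono mult_right_mono ennreal_leI) auto
    qed
    also have "\<dots> = ennreal (C * norm h powr s) * (?M x + ?M (x + h) + hilbert_avg g x)"
      unfolding r_def by (simp only: distrib_left ac_simps)
    finally show "ennreal (s * \<bar>bessel_avg s g (x + h) - bessel_avg s g x\<bar>)
      \<le> ennreal (C * norm h powr s) * (?M x + ?M (x + h) + hilbert_avg g x)" .
  qed
qed

section \<open>The weak-type bound for Bessel averages\<close>

text \<open>A crude Jensen inequality: c \<le> l + l^(1 - p) c^p is integrated against the weight,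
  and l is taken to be the p-th root of the integral on the right. The two terms then add up to (m +
  1) l.\<close>

lemma nn_integral_weighted_powr_le:
  fixes w H :: "'a::euclidean_space \<Rightarrow> ennreal" and m p :: real
  assumes [measurable]: "w \<in> borel_measurable borel" "H \<in> borel_measurable borel"
    and w: "(\<integral>\<^sup>+v. w v \<partial>lborel) \<le> ennreal m" and m: "0 \<le> m" and p: "1 < p"
  shows "ennpowr (\<integral>\<^sup>+v. w v * H v \<partial>lborel) p \<le> ennreal ((m + 1) powr p) * (\<integral>\<^sup>+v. w v * ennpowr (H v) p \<partial>lborel)"
proof -
  let ?S = "\<integral>\<^sup>+v. w v * H v \<partial>lborel" and ?D = "\<integral>\<^sup>+v. w v * ennpowr (H v) p \<partial>lborel"
  have pw: "c \<le> ennreal l + ennreal (l powr (1 - p)) * ennpowr c p" if l: "0 < l" for c :: ennreal and l :: real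
  proof (cases c)
    case (real a)
    have "a \<le> l + l powr (1 - p) * a powr p"
    proof (cases "a \<le> l")
      case False
      then have "l powr (p - 1) \<le> a powr (p - 1)" using l p by (intro powr_mono2) auto
      then have "l powr (1 - p) * l powr (p - 1) \<le> l powr (1 - p) * a powr (p - 1)" by (intro mult_left_mono) auto
      then have "1 \<le> l powr (1 - p) * a powr (p - 1)" using l by (simp add: powr_add[symmetric])
      then have "a * 1 \<le> a * (l powr (1 - p) * a powr (p - 1))" using False l by (intro mult_left_mono) auto
      also have "\<dots> = l powr (1 - p) * a powr p" using False l by (simp add: powr_diff)
      finally show ?thesis using l by simp
    qed (use l in \<open>simp add: add_increasing2\<close>)
    then show ?thesis using real l by (simp add: ennreal_leI flip: ennreal_mult ennreal_plus)
  next
    case top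
    then show ?thesis using l by (simp add: ennreal_mult_top)
  qed
  have bound: "?S \<le> ennreal (l * m) + ennreal (l powr (1 - p)) * ?D" if l: "0 < l" for l
  proof -
    have "?S \<le> (\<integral>\<^sup>+v. ennreal l * w v + ennreal (l powr (1 - p)) * (w v * ennpowr (H v) p) \<partial>lborel)"
    proof (rule nn_integral_mono)
      fix v
      have "w v * H v \<le> w v * (ennreal l + ennreal (l powr (1 - p)) * ennpowr (H v) p)"
        by (intro mult_left_mono pw l) auto
      then show "w v * H v \<le> ennreal l * w v + ennreal (l powr (1 - p)) * (w v * ennpowr (H v) p)"
        by (simp only: distrib_left ac_simps)
    qed
    also have "\<dots> = ennreal l * (\<integral>\<^sup>+v. w v \<partial>lborel) + ennreal (l powr (1 - p)) * ?D"
      by (subst nn_integral_add, measurable, subst (1 2) nn_integral_cmult) auto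
    also have "\<dots> \<le> ennreal l * ennreal m + ennreal (l powr (1 - p)) * ?D"
      by (intro add_mono mult_left_mono w order_refl) auto
    finally show ?thesis using l m by (simp add: ennreal_mult)
  qed
  show ?thesis
  proof (cases ?D)
    case top
    then show ?thesis using m by (simp add: ennreal_mult_top)
  next
    case (real d)
    show ?thesis
    proof (cases "d = 0")
      case True
      \<comment> \<open>When the integral on the right vanishes no l is optimal, and letting l tend
        to 0 shows that the left side vanishes too.\<close>
      have "?S \<le> 0 + ennreal e" if "0 < e" for e
      proof -
        have "?S \<le> ennreal (e / (m + 1) * m)" using bound[of "e / (m + 1)"] real True that m by simp
        also have "\<dots> \<le> ennreal e" using that m by (intro ennreal_leI) (simp add: divide_le_eq algebra_simps)
        finally show ?thesis by simp
      qed
      then have "?S = 0" using ennreal_le_epsilon[of 0 ?S] by simp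
      then show ?thesis by simp
    next
      case False
      then have d: "0 < d" using real by simp
      define l where "l = d powr (1 / p)"
      have "l powr (1 - p) * d = l"
      proof -
        have "1 / p * (1 - p) = 1 / p - 1" using p by (simp add: field_simps)
        then have "l powr (1 - p) = d powr (1 / p) / d" using d unfolding l_def powr_powr by (simp add: powr_diff)
        then show ?thesis using d by (simp add: l_def)
      qed
      then have "?S \<le> ennreal ((m + 1) * l)"
        using bound[of l] d m real by (simp add: l_def distrib_right mult.commute flip: ennreal_mult ennreal_plus)
      then have "ennpowr ?S p \<le> ennpowr (ennreal ((m + 1) * l)) p"
        using p by (intro ennpowr_mono) auto
      also have "\<dots> = ennreal ((m + 1) powr p * d)"
        using m d p by (simp add: l_def powr_mult powr_powr)
      also have "\<dots> = ennreal ((m + 1) powr p) * ?D"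
        using real d by (simp add: ennreal_mult)
      finally show ?thesis .
    qed
  qed
qed

text \<open>For finite \<open>P\<close> the set lies in a ball whose radius satisfies \<rho>^N = P /
  k, and the volume of that ball is linear in \<open>P\<close>.\<close>

lemma emeasure_norm_power_sublevel:
  fixes x :: "'a::euclidean_space"
  assumes k: "0 < k"
  shows "emeasure lborel {y. ennreal (k * norm (x - y) ^ DIM('a)) \<le> P} \<le> ennreal (unit_vol TYPE('a) / k) * P"
proof (cases P)
  case top
  then show ?thesis using unit_vol_pos[where 'a='a] k by (simp add: ennreal_mult_top)
next
  case (real q)
  define \<rho> where "\<rho> = root DIM('a) (q / k)"
  have \<rho>: "0 \<le> \<rho>" "\<rho> ^ DIM('a) = q / k" using real k by (auto simp: \<rho>_def)
  have "{y. ennreal (k * norm (x - y) ^ DIM('a)) \<le> P} \<subseteq> cball x \<rho>"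
  proof clarify
    fix y assume "ennreal (k * norm (x - y) ^ DIM('a)) \<le> P"
    then have "norm (x - y) ^ DIM('a) \<le> q / k" using real k by (simp add: field_simps)
    then have "norm (x - y) ^ DIM('a) \<le> \<rho> ^ DIM('a)" using \<rho> by simp
    then have "norm (x - y) \<le> \<rho>" using \<rho> by (subst (asm) power_mono_iff) auto
    then show "y \<in> cball x \<rho>" by (simp add: dist_norm)
  qed
  then have "emeasure lborel {y. ennreal (k * norm (x - y) ^ DIM('a)) \<le> P} \<le> emeasure lborel (cball x \<rho>)"
    by (intro emeasure_mono) auto
  also have "\<dots> = ennreal (measure lborel (cball x \<rho>))"
    using emeasure_lborel_cball_finite[of x \<rho>] by (subst emeasure_eq_ennreal_measure) auto
  also have "measure lborel (cball x \<rho>) = measure lborel (ball x \<rho>)"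
    using content_cball_conv_ball[of x \<rho>] by simp
  also have "ennreal (measure lborel (ball x \<rho>)) = emeasure lborel (ball x \<rho>)"
    using emeasure_lborel_ball_finite[of x \<rho>] by (subst emeasure_eq_ennreal_measure) auto
  also have "\<dots> = ennreal (unit_vol TYPE('a) * (q / k))" using \<rho> by (simp add: emeasure_ball_unit_vol)
  also have "\<dots> = ennreal (unit_vol TYPE('a) / k) * P" using real k unit_vol_pos[where 'a='a] by (simp flip: ennreal_mult)
  finally show ?thesis .
qed

text \<open>Slicing: the point at which \<Psi> is evaluated is fixed, and the other one ranges over
  a ball of volume proportional to \<Psi>. The two alternatives are mirror images, hence the factor
  2.\<close>

lemma emeasure_diagonal_neighbourhood:
  fixes \<Psi> :: "'a::euclidean_space \<Rightarrow> ennreal"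
  assumes [measurable]: "\<Psi> \<in> borel_measurable borel" and k: "0 < k"
  shows "emeasure lborel {(x, y). ennreal (k * norm (x - y) ^ DIM('a)) \<le> \<Psi> x \<or> ennreal (k * norm (x - y) ^ DIM('a)) \<le> \<Psi> y}
    \<le> ennreal (2 * unit_vol TYPE('a) / k) * (\<integral>\<^sup>+x. \<Psi> x \<partial>lborel)"
proof -
  define E1 where "E1 = {z. ennreal (k * norm (fst z - snd z) ^ DIM('a)) \<le> \<Psi> (fst z)}"
  define E2 where "E2 = {z. ennreal (k * norm (fst z - snd z) ^ DIM('a)) \<le> \<Psi> (snd z)}"
  have [measurable]: "E1 \<in> sets (borel \<Otimes>\<^sub>M borel)" "E2 \<in> sets (borel \<Otimes>\<^sub>M borel)"
  proof -
    have "{z \<in> space (borel \<Otimes>\<^sub>M borel). ennreal (k * norm (fst z - snd z) ^ DIM('a)) \<le> \<Psi> (fst z)} \<in> sets (borel \<Otimes>\<^sub>M borel)"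
      "{z \<in> space (borel \<Otimes>\<^sub>M borel). ennreal (k * norm (fst z - snd z) ^ DIM('a)) \<le> \<Psi> (snd z)} \<in> sets (borel \<Otimes>\<^sub>M borel)"
      by measurable
    then show "E1 \<in> sets (borel \<Otimes>\<^sub>M borel)" "E2 \<in> sets (borel \<Otimes>\<^sub>M borel)"
      by (simp_all add: E1_def E2_def space_pair_measure)
  qed
  have sec: "{y. (x, y) \<in> E1} = {y. ennreal (k * norm (x - y) ^ DIM('a)) \<le> \<Psi> x}"
    "{y. (y, x) \<in> E2} = {y. ennreal (k * norm (x - y) ^ DIM('a)) \<le> \<Psi> x}" for x
    by (auto simp: E1_def E2_def norm_minus_commute)
  have meas: "{y. ennreal (k * norm (x - y) ^ DIM('a)) \<le> \<Psi> x} \<in> sets borel" for x by measurable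
  let ?b = "(\<integral>\<^sup>+x. ennreal (unit_vol TYPE('a) / k) * \<Psi> x \<partial>lborel)"
  have "emeasure (lborel \<Otimes>\<^sub>M lborel) E1 = (\<integral>\<^sup>+x. \<integral>\<^sup>+y. indicator E1 (x, y) \<partial>lborel \<partial>lborel)"
    by (rule lborel.emeasure_pair_measure) simp
  also have "\<dots> = (\<integral>\<^sup>+x. emeasure lborel {y. ennreal (k * norm (x - y) ^ DIM('a)) \<le> \<Psi> x} \<partial>lborel)"
    unfolding sec[symmetric]
  proof (intro nn_integral_cong)
    fix x
    have "(\<integral>\<^sup>+y. indicator E1 (x, y) \<partial>lborel) = (\<integral>\<^sup>+y. indicator {y. (x, y) \<in> E1} y \<partial>lborel)"
      by (intro nn_integral_cong) (auto simp: indicator_def)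
    then show "(\<integral>\<^sup>+y. indicator E1 (x, y) \<partial>lborel) = emeasure lborel {y. (x, y) \<in> E1}"
      using meas[of x] by (simp add: sec)
  qed
  also have "\<dots> \<le> ?b" by (intro nn_integral_mono emeasure_norm_power_sublevel k)
  finally have 1: "emeasure (lborel \<Otimes>\<^sub>M lborel) E1 \<le> ?b" .
  have "emeasure (lborel \<Otimes>\<^sub>M lborel) E2 = (\<integral>\<^sup>+y. \<integral>\<^sup>+x. indicator E2 (x, y) \<partial>lborel \<partial>lborel)"
    by (subst lborel.emeasure_pair_measure, simp, rule lborel_pair.Fubini') measurable
  also have "\<dots> = (\<integral>\<^sup>+x. emeasure lborel {y. ennreal (k * norm (x - y) ^ DIM('a)) \<le> \<Psi> x} \<partial>lborel)"
  proof (intro nn_integral_cong)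
    fix x
    have "(\<integral>\<^sup>+y. indicator E2 (y, x) \<partial>lborel) = (\<integral>\<^sup>+y. indicator {y. ennreal (k * norm (x - y) ^ DIM('a)) \<le> \<Psi> x} y \<partial>lborel)"
      unfolding sec(2)[symmetric] by (intro nn_integral_cong) (auto simp: indicator_def)
    then show "(\<integral>\<^sup>+y. indicator E2 (y, x) \<partial>lborel) = emeasure lborel {y. ennreal (k * norm (x - y) ^ DIM('a)) \<le> \<Psi> x}"
      using meas[of x] by simp
  qed
  also have "\<dots> \<le> ?b" by (intro nn_integral_mono emeasure_norm_power_sublevel k)
  finally have 2: "emeasure (lborel \<Otimes>\<^sub>M lborel) E2 \<le> ?b" .
  have "{(x, y). ennreal (k * norm (x - y) ^ DIM('a)) \<le> \<Psi> x \<or> ennreal (k * norm (x - y) ^ DIM('a)) \<le> \<Psi> y} = E1 \<union> E2"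
    by (auto simp: E1_def E2_def)
  also have "emeasure lborel (E1 \<union> E2) \<le> emeasure (lborel \<Otimes>\<^sub>M lborel) E1 + emeasure (lborel \<Otimes>\<^sub>M lborel) E2"
    unfolding lborel_prod[symmetric] by (intro emeasure_subadditive) auto
  also have "\<dots> \<le> ?b + ?b" by (intro add_mono 1 2)
  also have "\<dots> = ennreal (2 * unit_vol TYPE('a) / k) * (\<integral>\<^sup>+x. \<Psi> x \<partial>lborel)"
  proof -
    have "ennreal (2 * unit_vol TYPE('a) / k) = ennreal (unit_vol TYPE('a) / k) + ennreal (unit_vol TYPE('a) / k)"
      using k unit_vol_pos[where 'a='a] by (subst ennreal_plus[symmetric]) auto
    moreover have "?b = ennreal (unit_vol TYPE('a) / k) * (\<integral>\<^sup>+x. \<Psi> x \<partial>lborel)" by (rule nn_integral_cmult) simp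
    ultimately show ?thesis by (simp only: distrib_right)
  qed
  finally show ?thesis .
qed

text \<open>The superlevel set of the difference quotient with the denominator cleared. The diagonal
  is removed, since there the cleared inequality reads 0 \<le> 0 although the quotient is 0. The
  general target covers complex functions and their real and imaginary parts.\<close>

definition large_quotient :: "real \<Rightarrow> real \<Rightarrow> real \<Rightarrow> ('a::euclidean_space \<Rightarrow> 'b::real_normed_vector) \<Rightarrow> ('a \<times> 'a) set" where
  "large_quotient p s l f = {(x, y). x \<noteq> y \<and> l * norm (x - y) powr (real DIM('a) / p + s) \<le> norm (f x - f y)}"

text \<open>The power |x - y|^s of \<open>bessel_avg_difference\<close> cancels against the one in
  the quotient. What remains bounds l |x - y|^(N / p), and its p-th power has the form treated in
  \<open>emeasure_diagonal_neighbourhood\<close>.\<close>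

theorem bessel_avg_weak:
  fixes p :: real
  assumes p: "1 < p"
  obtains C where "0 < C" "\<And>s (g :: 'a::euclidean_space \<Rightarrow> real) K l. 0 < s \<Longrightarrow> s < 1 \<Longrightarrow> g \<in> borel_measurable borel \<Longrightarrow>
    (\<And>x. \<bar>g x\<bar> \<le> K) \<Longrightarrow> 0 < l \<Longrightarrow>
    emeasure lborel (large_quotient p s l (\<lambda>x. s * bessel_avg s g x))
      \<le> ennreal (C / l powr p) * (\<integral>\<^sup>+x. ennreal (\<bar>g x\<bar> powr p) \<partial>lborel)"
proof -
  obtain C0 where C0: "0 < C0" "\<And>s (g :: 'a \<Rightarrow> real) K x h. 0 < s \<Longrightarrow> s < 1 \<Longrightarrow> g \<in> borel_measurable borel \<Longrightarrow>
    (\<And>x. \<bar>g x\<bar> \<le> K) \<Longrightarrow> h \<noteq> 0 \<Longrightarrow>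
    ennreal (s * \<bar>bessel_avg s g (x + h) - bessel_avg s g x\<bar>) \<le> ennreal (C0 * norm h powr s) *
      (max_fun (\<lambda>y. ennreal \<bar>g y\<bar>) x + max_fun (\<lambda>y. ennreal \<bar>g y\<bar>) (x + h) + hilbert_avg g x)"
    using bessel_avg_difference by blast
  obtain C1 where C1: "0 < C1" "\<And>f :: 'a \<Rightarrow> ennreal. f \<in> borel_measurable borel \<Longrightarrow>
    (\<integral>\<^sup>+x. ennpowr (max_fun f x) p \<partial>lborel) \<le> ennreal C1 * (\<integral>\<^sup>+x. ennpowr (f x) p \<partial>lborel)"
    using max_fun_strong[OF p, where 'a='a] by blast
  obtain C2 where C2: "0 < C2" "\<And>(g :: 'a \<Rightarrow> real) K v. g \<in> borel_measurable borel \<Longrightarrow> (\<And>x. \<bar>g x\<bar> \<le> K) \<Longrightarrow>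
    (\<integral>\<^sup>+x. ennpowr (dir_hilbert g v x) p \<partial>lborel) \<le> ennreal C2 * (\<integral>\<^sup>+x. ennreal (\<bar>g x\<bar> powr p) \<partial>lborel)"
    using dir_hilbert_Lp[OF p, where 'a='a] by blast
  define m where "m = (LINT v|lborel. norm v * gauss (v::'a))"
  have m: "0 \<le> m" unfolding m_def by (intro integral_nonneg_AE) auto
  have mm: "(\<integral>\<^sup>+v. ennreal (norm v * gauss (v::'a)) \<partial>lborel) = ennreal m"
    unfolding m_def by (intro nn_integral_eq_integral integrable_norm_gauss) auto
  \<comment> \<open>m + 3 = 1 + 1 + (m + 1): two maximal functions and the Hilbert average, each
    measured in units of \<Psi>^(1 / p).\<close>
  define B where "B = (C0 * (m + 3)) powr p"
  have B: "0 < B" using C0 m by (simp add: B_def)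
  define C where "C = 2 * unit_vol TYPE('a) * B * (C1 + m * C2)"
  show ?thesis
  proof (rule that)
    show "0 < C" unfolding C_def using B C1 C2 m unit_vol_pos[where 'a='a] by (intro mult_pos_pos add_pos_nonneg) auto
    fix s K l :: real and g :: "'a \<Rightarrow> real"
    assume s: "0 < s" "s < 1" and g[measurable]: "g \<in> borel_measurable borel" and K: "\<And>x. \<bar>g x\<bar> \<le> K" and l: "0 < l"
    let ?M = "max_fun (\<lambda>y. ennreal \<bar>g y\<bar>)" and ?I = "\<integral>\<^sup>+x. ennreal (\<bar>g x\<bar> powr p) \<partial>lborel"
    note [measurable] = borel_measurable_dir_hilbert[OF g]
    \<comment> \<open>The average of p-th powers dominates the p-th power of
      \<open>hilbert_avg\<close> up to a constant, and unlike that power it is integrated directly,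
      by Fubini and the uniform bound over directions.\<close>
    define D where "D x = (\<integral>\<^sup>+v. ennreal (norm v * gauss v) * ennpowr (dir_hilbert g v x) p \<partial>lborel)" for x
    define \<Psi> where "\<Psi> x = ennpowr (?M x) p + D x" for x
    have [measurable]: "D \<in> borel_measurable borel" unfolding D_def[abs_def] by measurable
    have [measurable]: "\<Psi> \<in> borel_measurable borel" unfolding \<Psi>_def[abs_def] by measurable
    have "(\<integral>\<^sup>+x. D x \<partial>lborel) = (\<integral>\<^sup>+v. \<integral>\<^sup>+x. ennreal (norm v * gauss v) * ennpowr (dir_hilbert g v x) p \<partial>lborel \<partial>lborel)"
      unfolding D_def by (rule lborel_pair.Fubini'[symmetric]) measurable
    also have "\<dots> = (\<integral>\<^sup>+v. ennreal (norm v * gauss v) * (\<integral>\<^sup>+x. ennpowr (dir_hilbert g v x) p \<partial>lborel) \<partial>lborel)"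
      by (intro nn_integral_cong nn_integral_cmult) measurable
    also have "\<dots> \<le> (\<integral>\<^sup>+v. ennreal (norm v * gauss (v::'a)) * (ennreal C2 * ?I) \<partial>lborel)"
      by (intro nn_integral_mono mult_left_mono C2(2)[OF g K]) auto
    also have "\<dots> = ennreal m * (ennreal C2 * ?I)" by (subst nn_integral_multc) (simp_all add: mm)
    finally have intD: "(\<integral>\<^sup>+x. D x \<partial>lborel) \<le> ennreal m * (ennreal C2 * ?I)" .
    have "(\<integral>\<^sup>+x. \<Psi> x \<partial>lborel) = (\<integral>\<^sup>+x. ennpowr (?M x) p \<partial>lborel) + (\<integral>\<^sup>+x. D x \<partial>lborel)"
      unfolding \<Psi>_def by (rule nn_integral_add) measurable
    also have "\<dots> \<le> ennreal C1 * (\<integral>\<^sup>+x. ennpowr (ennreal \<bar>g x\<bar>) p \<partial>lborel) + ennreal m * (ennreal C2 * ?I)"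
      by (intro add_mono C1(2) intD) measurable
    also have "\<dots> = ennreal (C1 + m * C2) * ?I"
      using C1 C2 m by (simp add: ennreal_mult distrib_right mult.assoc)
    finally have int\<Psi>: "(\<integral>\<^sup>+x. \<Psi> x \<partial>lborel) \<le> ennreal (C1 + m * C2) * ?I" .
    have M\<Psi>: "?M x \<le> ennpowr (\<Psi> x) (1 / p)" for x
    proof -
      have "ennpowr (ennpowr (?M x) p) (1 / p) \<le> ennpowr (\<Psi> x) (1 / p)"
        unfolding \<Psi>_def using p by (intro ennpowr_mono) auto
      then show ?thesis using p by (simp add: ennpowr_inverse)
    qed
    have S\<Psi>: "hilbert_avg g x \<le> ennreal (m + 1) * ennpowr (\<Psi> x) (1 / p)" for x
    proof -
      have "ennpowr (hilbert_avg g x) p \<le> ennreal ((m + 1) powr p) * D x"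
        unfolding hilbert_avg_def D_def using mm m p by (intro nn_integral_weighted_powr_le) auto
      also have "\<dots> \<le> ennreal ((m + 1) powr p) * \<Psi> x" unfolding \<Psi>_def by (intro mult_left_mono) auto
      finally have "ennpowr (ennpowr (hilbert_avg g x) p) (1 / p) \<le> ennpowr (ennreal ((m + 1) powr p) * \<Psi> x) (1 / p)"
        using p by (intro ennpowr_mono) auto
      also have "\<dots> = ennreal (m + 1) * ennpowr (\<Psi> x) (1 / p)"
        using p m by (subst ennpowr_cmult) (auto simp: powr_powr)
      finally show ?thesis using p by (simp add: ennpowr_inverse)
    qed
    define k where "k = l powr p / B"
    have k: "0 < k" using l B by (simp add: k_def)
    have sub: "large_quotient p s l (\<lambda>x. s * bessel_avg s g x)
      \<subseteq> {(x, y). ennreal (k * norm (x - y) ^ DIM('a)) \<le> \<Psi> x \<or> ennreal (k * norm (x - y) ^ DIM('a)) \<le> \<Psi> y}"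
    proof clarify
      fix x y assume xy: "(x, y) \<in> large_quotient p s l (\<lambda>x. s * bessel_avg s g x)" and ny: "\<not> ennreal (k * norm (x - y) ^ DIM('a)) \<le> \<Psi> y"
      define r where "r = norm (x - y)"
      have r: "0 < r" and big: "l * r powr (real DIM('a) / p + s) \<le> \<bar>s * bessel_avg s g x - s * bessel_avg s g y\<bar>"
        using xy by (auto simp: large_quotient_def r_def)
      have "\<bar>s * bessel_avg s g x - s * bessel_avg s g y\<bar> = s * \<bar>bessel_avg s g (x + (y - x)) - bessel_avg s g x\<bar>"
        using s by (simp add: right_diff_distrib[symmetric] abs_mult abs_minus_commute)
      then have "ennreal (l * r powr (real DIM('a) / p + s)) \<le> ennreal (s * \<bar>bessel_avg s g (x + (y - x)) - bessel_avg s g x\<bar>)"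
        using big by (intro ennreal_leI) simp
      also have "\<dots> \<le> ennreal (C0 * norm (y - x) powr s) * (?M x + ?M (x + (y - x)) + hilbert_avg g x)"
        using r by (intro C0(2)[OF s g K]) (auto simp: r_def)
      also have "\<dots> = ennreal (C0 * r powr s) * (?M x + ?M y + hilbert_avg g x)"
        by (simp add: r_def norm_minus_commute)
      \<comment> \<open>The larger of \<Psi> x and \<Psi> y bounds all three terms, although the
        Hilbert average enters at x only. This is the source of the alternative in the target
        set.\<close>
      also have "\<dots> \<le> ennreal (C0 * r powr s) * (ennreal 1 * ennpowr (max (\<Psi> x) (\<Psi> y)) (1 / p)
          + ennreal 1 * ennpowr (max (\<Psi> x) (\<Psi> y)) (1 / p) + ennreal (m + 1) * ennpowr (max (\<Psi> x) (\<Psi> y)) (1 / p))"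
      proof (intro mult_left_mono add_mono)
        have mono: "ennpowr (\<Psi> x) (1 / p) \<le> ennpowr (max (\<Psi> x) (\<Psi> y)) (1 / p)" "ennpowr (\<Psi> y) (1 / p) \<le> ennpowr (max (\<Psi> x) (\<Psi> y)) (1 / p)"
          using p by (auto intro!: ennpowr_mono)
        show "?M x \<le> ennreal 1 * ennpowr (max (\<Psi> x) (\<Psi> y)) (1 / p)" "?M y \<le> ennreal 1 * ennpowr (max (\<Psi> x) (\<Psi> y)) (1 / p)"
          using order_trans[OF M\<Psi>[of x] mono(1)] order_trans[OF M\<Psi>[of y] mono(2)] by simp_all
        show "hilbert_avg g x \<le> ennreal (m + 1) * ennpowr (max (\<Psi> x) (\<Psi> y)) (1 / p)"
          by (rule order_trans[OF S\<Psi>[of x]]) (intro mult_left_mono mono, simp)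
      qed simp
      also have "\<dots> = ennreal (r powr s * (C0 * (m + 3))) * ennpowr (max (\<Psi> x) (\<Psi> y)) (1 / p)"
      proof -
        have "ennreal 1 + ennreal 1 + ennreal (m + 1) = ennreal (m + 3)"
          by (simp only: ennreal_plus[symmetric] zero_le_one add_nonneg_nonneg m) (rule arg_cong[where f=ennreal], simp)
        moreover have "ennreal (C0 * r powr s) * ennreal (m + 3) = ennreal (r powr s * (C0 * (m + 3)))"
          using C0(1) m by (subst ennreal_mult[symmetric]) (auto simp: ac_simps)
        ultimately show ?thesis by (simp only: distrib_right[symmetric] mult.assoc[symmetric])
      qed
      finally have "ennreal (r powr s * (l * r powr (real DIM('a) / p))) \<le> ennreal (r powr s) * (ennreal (C0 * (m + 3)) * ennpowr (max (\<Psi> x) (\<Psi> y)) (1 / p))"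
        using C0 m by (simp add: powr_add ennreal_mult ac_simps)
      then have "ennreal (r powr s) * ennreal (l * r powr (real DIM('a) / p)) \<le> ennreal (r powr s) * (ennreal (C0 * (m + 3)) * ennpowr (max (\<Psi> x) (\<Psi> y)) (1 / p))"
        using l by (simp add: ennreal_mult)
      then have "ennreal (l * r powr (real DIM('a) / p)) \<le> ennreal (C0 * (m + 3)) * ennpowr (max (\<Psi> x) (\<Psi> y)) (1 / p)"
        using r by (subst (asm) ennreal_mult_le_mult_iff) auto
      then have "ennpowr (ennreal (l * r powr (real DIM('a) / p))) p \<le> ennpowr (ennreal (C0 * (m + 3)) * ennpowr (max (\<Psi> x) (\<Psi> y)) (1 / p)) p"
        using p by (intro ennpowr_mono) auto
      also have "\<dots> = ennreal B * max (\<Psi> x) (\<Psi> y)"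
        using p C0 m by (subst ennpowr_cmult) (auto simp: B_def ennpowr_inverse)
      also have "ennpowr (ennreal (l * r powr (real DIM('a) / p))) p = ennreal (l powr p * r ^ DIM('a))"
        using l p r by (simp add: powr_mult powr_powr powr_realpow)
      finally have "ennreal (l powr p * r ^ DIM('a)) \<le> ennreal B * max (\<Psi> x) (\<Psi> y)" .
      moreover have "ennreal (l powr p * r ^ DIM('a)) = ennreal B * ennreal (k * r ^ DIM('a))"
        using B k r by (subst ennreal_mult[symmetric]) (auto simp: k_def)
      ultimately have "ennreal (k * r ^ DIM('a)) \<le> max (\<Psi> x) (\<Psi> y)"
        using B by (simp add: ennreal_mult_le_mult_iff)
      then show "ennreal (k * norm (x - y) ^ DIM('a)) \<le> \<Psi> x" using ny unfolding r_def le_max_iff_disj by blast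
    qed
    have "emeasure lborel (large_quotient p s l (\<lambda>x. s * bessel_avg s g x))
      \<le> emeasure lborel {(x, y). ennreal (k * norm (x - y) ^ DIM('a)) \<le> \<Psi> x \<or> ennreal (k * norm (x - y) ^ DIM('a)) \<le> \<Psi> y}"
    proof (rule emeasure_mono[OF sub])
      have "{z \<in> space (borel \<Otimes>\<^sub>M borel). ennreal (k * norm (fst z - snd z) ^ DIM('a)) \<le> \<Psi> (fst z) \<or> ennreal (k * norm (fst z - snd z) ^ DIM('a)) \<le> \<Psi> (snd z)} \<in> sets (borel \<Otimes>\<^sub>M borel)"
        by measurable
      then show "{(x, y). ennreal (k * norm (x - y) ^ DIM('a)) \<le> \<Psi> x \<or> ennreal (k * norm (x - y) ^ DIM('a)) \<le> \<Psi> y} \<in> sets lborel"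
        unfolding sets_lborel borel_prod[symmetric] by (simp add: split_beta' space_pair_measure)
    qed
    also have "\<dots> \<le> ennreal (2 * unit_vol TYPE('a) / k) * (\<integral>\<^sup>+x. \<Psi> x \<partial>lborel)"
      by (intro emeasure_diagonal_neighbourhood k) measurable
    also have "\<dots> \<le> ennreal (2 * unit_vol TYPE('a) / k) * (ennreal (C1 + m * C2) * ?I)"
      by (intro mult_left_mono int\<Psi>) auto
    also have "\<dots> = ennreal (C / l powr p) * ?I"
      using k C1 C2 m l B unit_vol_pos[where 'a='a]
      by (subst mult.assoc[symmetric], subst ennreal_mult[symmetric]) (auto simp: C_def k_def)
    finally show "emeasure lborel (large_quotient p s l (\<lambda>x. s * bessel_avg s g x)) \<le> ennreal (C / l powr p) * ?I" .
  qed
qed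

text \<open>
  For complex \<open>g\<close> in $L^p$ the double integral need not be iterated; it converges absolutely
  wherever the maximal function of \<open>\<bar>g\<bar>\<close> is finite.
\<close>

definition bessel_kernel :: "real \<Rightarrow> real \<times> 'a::euclidean_space \<Rightarrow> real" where
  "bessel_kernel s z = indicator {0<..} (fst z) * bessel_weight s (fst z) * gauss (snd z)"

definition bessel_int :: "real \<Rightarrow> ('a::euclidean_space \<Rightarrow> complex) \<Rightarrow> 'a \<Rightarrow> complex" where
  "bessel_int s g x = (LINT z|(lborel \<Otimes>\<^sub>M lborel). bessel_kernel s z *\<^sub>R g (x - fst z *\<^sub>R snd z))"

lemma borel_measurable_bessel_kernel [measurable]: "bessel_kernel s \<in> borel_measurable (borel \<Otimes>\<^sub>M borel)"
  unfolding bessel_kernel_def[abs_def] by measurable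

lemma bessel_kernel_nonneg [simp]: "0 \<le> bessel_kernel s z"
  by (simp add: bessel_kernel_def)

lemma borel_measurable_bessel_int [measurable]:
  fixes g :: "'a::euclidean_space \<Rightarrow> complex"
  assumes [measurable]: "g \<in> borel_measurable borel"
  shows "bessel_int s g \<in> borel_measurable borel"
proof -
  have [measurable]: "(\<lambda>(x, z). bessel_kernel s z *\<^sub>R g (x - fst z *\<^sub>R snd z)) \<in> borel_measurable (borel \<Otimes>\<^sub>M (lborel \<Otimes>\<^sub>M lborel))"
    by measurable
  interpret L: sigma_finite_measure "lborel \<Otimes>\<^sub>M lborel :: (real \<times> 'a) measure" unfolding lborel_prod by (rule sigma_finite_lborel)
  show ?thesis unfolding bessel_int_def[abs_def] by measurable
qed

text \<open>At every scale t the Gaussian average is at most a constant, independent of t, times the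
  maximal function; only the integral of the weight is left.\<close>

lemma bessel_kernel_nn_integral_le:
  fixes g :: "'a::euclidean_space \<Rightarrow> ennreal"
  assumes [measurable]: "g \<in> borel_measurable borel"
  shows "(\<integral>\<^sup>+z. ennreal (bessel_kernel s z) * g (x - fst z *\<^sub>R snd z) \<partial>(lborel \<Otimes>\<^sub>M lborel))
    \<le> (\<integral>\<^sup>+t. ennreal (indicator {0<..} t * bessel_weight s t) \<partial>lborel) * (ennreal (fact (0 + Suc DIM('a)) * exp 2 * 2 ^ (DIM('a) + 2)) * max_fun g x)"
proof -
  let ?c = "fact (0 + Suc DIM('a)) * exp (2::real)"
  have "(\<integral>\<^sup>+z. ennreal (bessel_kernel s z) * g (x - fst z *\<^sub>R snd z) \<partial>(lborel \<Otimes>\<^sub>M lborel))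
    = (\<integral>\<^sup>+t. \<integral>\<^sup>+v. ennreal (bessel_kernel s (t, v)) * g (x - t *\<^sub>R v) \<partial>lborel \<partial>lborel)"
    by (subst lborel.nn_integral_fst[symmetric]) auto
  also have "\<dots> \<le> (\<integral>\<^sup>+t. ennreal (indicator {0<..} t * bessel_weight s t) * (ennreal (?c * 2 ^ (DIM('a) + 2)) * max_fun g x) \<partial>lborel)"
  proof (rule nn_integral_mono)
    fix t :: real
    show "(\<integral>\<^sup>+v. ennreal (bessel_kernel s (t, v)) * g (x - t *\<^sub>R v) \<partial>lborel)
      \<le> ennreal (indicator {0<..} t * bessel_weight s t) * (ennreal (?c * 2 ^ (DIM('a) + 2)) * max_fun g x)"
    proof (cases "0 < t")
      case True
      have "(\<integral>\<^sup>+v. ennreal (bessel_kernel s (t, v)) * g (x - t *\<^sub>R v) \<partial>lborel)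
        \<le> (\<integral>\<^sup>+v. ennreal (bessel_weight s t * ?c) * (ennreal (1 / (1 + norm v) ^ Suc DIM('a)) * g (x - t *\<^sub>R v)) \<partial>lborel)"
      proof (rule nn_integral_mono)
        fix v :: 'a
        have "gauss v \<le> ?c * (1 / (1 + norm v) ^ Suc DIM('a))" using norm_power_gauss_le[of v 0] by simp
        then have "bessel_weight s t * gauss v \<le> bessel_weight s t * (?c * (1 / (1 + norm v) ^ Suc DIM('a)))"
          by (rule mult_left_mono) simp
        moreover have "bessel_kernel s (t, v) = bessel_weight s t * gauss v" using True by (simp add: bessel_kernel_def)
        ultimately have "bessel_kernel s (t, v) \<le> bessel_weight s t * ?c * (1 / (1 + norm v) ^ Suc DIM('a))"
          by (simp only: mult.assoc)
        then have "ennreal (bessel_kernel s (t, v)) \<le> ennreal (bessel_weight s t * ?c) * ennreal (1 / (1 + norm v) ^ Suc DIM('a))"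
          by (subst ennreal_mult[symmetric]) (auto intro!: ennreal_leI simp del: fact_Suc power_Suc)
        then show "ennreal (bessel_kernel s (t, v)) * g (x - t *\<^sub>R v)
          \<le> ennreal (bessel_weight s t * ?c) * (ennreal (1 / (1 + norm v) ^ Suc DIM('a)) * g (x - t *\<^sub>R v))"
          unfolding mult.assoc[symmetric] by (rule mult_right_mono) simp
      qed
      also have "\<dots> = ennreal (bessel_weight s t * ?c) * (\<integral>\<^sup>+v. ennreal (1 / (1 + norm v) ^ Suc DIM('a)) * g (x - t *\<^sub>R v) \<partial>lborel)"
        by (rule nn_integral_cmult) measurable
      also have "\<dots> \<le> ennreal (bessel_weight s t * ?c) * (ennreal (2 ^ (DIM('a) + 2)) * max_fun g x)"
        by (intro mult_left_mono max_fun_kernel True) auto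
      also have "\<dots> = ennreal (indicator {0<..} t * bessel_weight s t) * (ennreal (?c * 2 ^ (DIM('a) + 2)) * max_fun g x)"
      proof -
        have "ennreal (w * c) * (ennreal b * m) = ennreal w * (ennreal (c * b) * m)" if "0 \<le> w" "0 \<le> c" for w c b m
          using that by (simp add: ennreal_mult' mult.assoc)
        then show ?thesis using True by simp
      qed
      finally show ?thesis .
    qed (simp add: bessel_kernel_def)
  qed
  also have "\<dots> = (\<integral>\<^sup>+t. ennreal (indicator {0<..} t * bessel_weight s t) \<partial>lborel) * (ennreal (?c * 2 ^ (DIM('a) + 2)) * max_fun g x)"
    by (rule nn_integral_multc) measurable
  finally show ?thesis .
qed

lemma bessel_int_integrable:
  fixes g :: "'a::euclidean_space \<Rightarrow> complex"
  assumes [measurable]: "g \<in> borel_measurable borel" and s: "0 < s" "s < 1"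
    and fin: "max_fun (\<lambda>y. ennreal (norm (g y))) x < \<infinity>"
  shows "integrable (lborel \<Otimes>\<^sub>M lborel) (\<lambda>z. bessel_kernel s z *\<^sub>R g (x - fst z *\<^sub>R snd z))"
proof (rule integrableI_bounded)
  have "(\<integral>\<^sup>+t. ennreal (indicator {0<..} t * bessel_weight s t) \<partial>lborel) < \<infinity>"
    using integrable_bessel_weight[OF s] by (simp add: integrable_iff_bounded abs_mult)
  then have "(\<integral>\<^sup>+t. ennreal (indicator {0<..} t * bessel_weight s t) \<partial>lborel) *
      (ennreal (fact (0 + Suc DIM('a)) * exp 2 * 2 ^ (DIM('a) + 2)) * max_fun (\<lambda>y. ennreal (norm (g y))) x) < \<infinity>"
    using fin by (simp add: ennreal_mult_less_top del: fact_Suc power_Suc)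
  then have "(\<integral>\<^sup>+z. ennreal (bessel_kernel s z) * ennreal (norm (g (x - fst z *\<^sub>R snd z))) \<partial>(lborel \<Otimes>\<^sub>M lborel)) < \<infinity>"
    by (rule le_less_trans[OF bessel_kernel_nn_integral_le, rotated]) measurable
  then show "(\<integral>\<^sup>+z. ennreal (norm (bessel_kernel s z *\<^sub>R g (x - fst z *\<^sub>R snd z))) \<partial>(lborel \<Otimes>\<^sub>M lborel)) < \<infinity>"
    by (simp add: ennreal_mult)
qed measurable

text \<open>A bounded function has a bounded maximal function, so the double integral converges
  absolutely and may be iterated.\<close>

lemma bessel_int_bounded:
  fixes g :: "'a::euclidean_space \<Rightarrow> complex"
  assumes [measurable]: "g \<in> borel_measurable borel" and s: "0 < s" "s < 1" and K: "\<And>x. norm (g x) \<le> K"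
  shows "Re (bessel_int s g x) = bessel_avg s (\<lambda>x. Re (g x)) x" "Im (bessel_int s g x) = bessel_avg s (\<lambda>x. Im (g x)) x"
proof -
  have "max_fun (\<lambda>y. ennreal (norm (g y))) x \<le> max_fun (\<lambda>_. ennreal K) x"
    by (intro max_fun_mono ennreal_leI K)
  also have "\<dots> \<le> ennreal (unit_vol TYPE('a) * K)" by (rule max_fun_const_le)
  also have "\<dots> < \<infinity>" by simp
  finally have i: "integrable (lborel \<Otimes>\<^sub>M lborel) (\<lambda>z. bessel_kernel s z *\<^sub>R g (x - fst z *\<^sub>R snd z))"
    by (intro bessel_int_integrable s) auto
  have *: "(LINT z|(lborel \<Otimes>\<^sub>M lborel). bessel_kernel s z * f (x - fst z *\<^sub>R snd z)) = bessel_avg s f x"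
    if "integrable (lborel \<Otimes>\<^sub>M lborel) (\<lambda>z. bessel_kernel s z * f (x - fst z *\<^sub>R snd z))" for f :: "'a \<Rightarrow> real"
  proof -
    have "(LINT z|(lborel \<Otimes>\<^sub>M lborel). bessel_kernel s z * f (x - fst z *\<^sub>R snd z))
      = (LINT t|lborel. LINT v|lborel. bessel_kernel s (t, v) * f (x - t *\<^sub>R v))"
      using lborel_pair.integral_fst'[OF that] by simp
    also have "\<dots> = bessel_avg s f x"
      unfolding bessel_avg_def gauss_avg_def bessel_kernel_def fst_conv snd_conv mult.assoc
      by (simp only: integral_mult_right_zero)
    finally show ?thesis .
  qed
  show "Re (bessel_int s g x) = bessel_avg s (\<lambda>x. Re (g x)) x"
    unfolding bessel_int_def integral_Re[OF i, symmetric] using integrable_Re[OF i] by (simp add: *[of "\<lambda>x. Re (g x)"])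
  show "Im (bessel_int s g x) = bessel_avg s (\<lambda>x. Im (g x)) x"
    unfolding bessel_int_def integral_Im[OF i, symmetric] using integrable_Im[OF i] by (simp add: *[of "\<lambda>x. Im (g x)"])
qed

text \<open>Since |z| \<le> |Re z| + |Im z|, one of the two parts reaches half the level.\<close>

lemma large_quotient_complex_subset:
  assumes "0 < l"
  shows "large_quotient p s l f \<subseteq> large_quotient p s (l / 2) (\<lambda>x. Re (f x)) \<union> large_quotient p s (l / 2) (\<lambda>x. Im (f x))"
proof clarify
  fix x y assume xy: "(x, y) \<in> large_quotient p s l f" and n: "(x, y) \<notin> large_quotient p s (l / 2) (\<lambda>x. Im (f x))"
  have "norm (f x - f y) \<le> \<bar>Re (f x) - Re (f y)\<bar> + \<bar>Im (f x) - Im (f y)\<bar>"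
    using cmod_le[of "f x - f y"] by simp
  then show "(x, y) \<in> large_quotient p s (l / 2) (\<lambda>x. Re (f x))"
    using xy n by (auto simp: large_quotient_def)
qed

lemma sets_large_quotient [measurable]:
  fixes f :: "'a::euclidean_space \<Rightarrow> 'b::{real_normed_vector, second_countable_topology}"
  assumes [measurable]: "f \<in> borel_measurable borel"
  shows "large_quotient p s l f \<in> sets borel"
proof -
  have "{z \<in> space (borel \<Otimes>\<^sub>M borel). fst z \<noteq> snd z \<and> l * norm (fst z - snd z) powr (real DIM('a) / p + s) \<le> norm (f (fst z) - f (snd z))} \<in> sets (borel \<Otimes>\<^sub>M borel)"
    by measurable
  then show ?thesis unfolding large_quotient_def borel_prod[symmetric] by (simp add: split_beta' space_pair_measure)
qed

text \<open>Truncating \<open>g\<close> at height n gives bounded functions whose averages converge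
  wherever the maximal function is finite. A pair in the limit set belongs to all late sets at level
  l / 2, and the measure of such a lower limit inherits the uniform bound.\<close>

theorem bessel_int_weak:
  fixes p :: real
  assumes p: "1 < p"
  obtains C where "0 < C" "\<And>s (g :: 'a::euclidean_space \<Rightarrow> complex) l. 0 < s \<Longrightarrow> s < 1 \<Longrightarrow> g \<in> borel_measurable borel \<Longrightarrow> 0 < l \<Longrightarrow>
    emeasure lborel (large_quotient p s l (\<lambda>x. s *\<^sub>R bessel_int s g x) \<inter>
        {(x, y). max_fun (\<lambda>y. ennreal (norm (g y))) x < \<infinity> \<and> max_fun (\<lambda>y. ennreal (norm (g y))) y < \<infinity>})
      \<le> ennreal (C / l powr p) * (\<integral>\<^sup>+x. ennreal (norm (g x) powr p) \<partial>lborel)"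
proof -
  obtain C where C: "0 < C" "\<And>s (g :: 'a \<Rightarrow> real) K l. 0 < s \<Longrightarrow> s < 1 \<Longrightarrow> g \<in> borel_measurable borel \<Longrightarrow>
    (\<And>x. \<bar>g x\<bar> \<le> K) \<Longrightarrow> 0 < l \<Longrightarrow>
    emeasure lborel (large_quotient p s l (\<lambda>x. s * bessel_avg s g x))
      \<le> ennreal (C / l powr p) * (\<integral>\<^sup>+x. ennreal (\<bar>g x\<bar> powr p) \<partial>lborel)"
    using bessel_avg_weak[OF p] by blast
  show ?thesis
  proof (rule that)
    \<comment> \<open>The level is halved twice, by the limit and by the separation into real and
      imaginary parts, hence 4^p; the 2 counts the two parts.\<close>
    show "0 < 2 * C * 4 powr p" using C by simp
    fix s l :: real and g :: "'a \<Rightarrow> complex"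
    assume s: "0 < s" "s < 1" and g[measurable]: "g \<in> borel_measurable borel" and l: "0 < l"
    let ?M = "max_fun (\<lambda>y. ennreal (norm (g y)))" and ?I = "\<integral>\<^sup>+x. ennreal (norm (g x) powr p) \<partial>lborel"
    define gn where "gn n x = (if norm (g x) \<le> real n then g x else 0)" for n x
    have [measurable]: "gn n \<in> borel_measurable borel" for n unfolding gn_def[abs_def] by measurable
    have gn: "norm (gn n x) \<le> real n" "norm (gn n x) \<le> norm (g x)" for n x by (auto simp: gn_def)
    define W where "W n = (\<lambda>x. s *\<^sub>R bessel_int s (gn n) x)" for n
    have [measurable]: "W n \<in> borel_measurable borel" for n unfolding W_def by measurable
    have conv: "(\<lambda>n. W n x) \<longlonglongrightarrow> s *\<^sub>R bessel_int s g x" if fin: "?M x < \<infinity>" for x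
      unfolding W_def bessel_int_def
    proof (intro tendsto_scaleR tendsto_const integral_dominated_convergence)
      show "integrable (lborel \<Otimes>\<^sub>M lborel) (\<lambda>z. norm (bessel_kernel s z *\<^sub>R g (x - fst z *\<^sub>R snd z)))"
        by (intro integrable_norm bessel_int_integrable g s fin)
      show "AE z in lborel \<Otimes>\<^sub>M lborel. (\<lambda>n. bessel_kernel s z *\<^sub>R gn n (x - fst z *\<^sub>R snd z)) \<longlonglongrightarrow> bessel_kernel s z *\<^sub>R g (x - fst z *\<^sub>R snd z)"
      proof (intro AE_I2 tendsto_scaleR tendsto_const tendsto_eventually)
        fix z :: "real \<times> 'a"
        obtain m :: nat where "norm (g (x - fst z *\<^sub>R snd z)) \<le> real m" using real_arch_simple by blast
        then show "\<forall>\<^sub>F n in sequentially. gn n (x - fst z *\<^sub>R snd z) = g (x - fst z *\<^sub>R snd z)"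
          by (intro eventually_sequentiallyI[of m]) (auto simp: gn_def)
      qed
      show "AE z in lborel \<Otimes>\<^sub>M lborel. norm (bessel_kernel s z *\<^sub>R gn n (x - fst z *\<^sub>R snd z)) \<le> norm (bessel_kernel s z *\<^sub>R g (x - fst z *\<^sub>R snd z))" for n
        using gn(2) by (intro AE_I2) (simp add: mult_left_mono)
    qed measurable
    define A where "A n = large_quotient p s (l / 2) (W n)" for n
    have [measurable]: "A n \<in> sets borel" for n unfolding A_def by (intro sets_large_quotient) measurable
    have part: "emeasure lborel (large_quotient p s (l / 2 / 2) (\<lambda>x. s * bessel_avg s f x)) \<le> ennreal (C / (l / 4) powr p) * ?I"
      if [measurable]: "f \<in> borel_measurable borel" and f: "\<And>x. \<bar>f x\<bar> \<le> norm (gn n x)" for f n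
    proof -
      have "emeasure lborel (large_quotient p s (l / 2 / 2) (\<lambda>x. s * bessel_avg s f x)) \<le> ennreal (C / (l / 2 / 2) powr p) * (\<integral>\<^sup>+x. ennreal (\<bar>f x\<bar> powr p) \<partial>lborel)"
        using order_trans[OF f gn(1)] l by (intro C(2)[OF s]) auto
      also have "\<dots> \<le> ennreal (C / (l / 2 / 2) powr p) * ?I"
        using order_trans[OF f gn(2)] p by (intro mult_left_mono nn_integral_mono ennreal_leI powr_mono2) auto
      finally show ?thesis by simp
    qed
    have An: "emeasure lborel (A n) \<le> ennreal (2 * C * 4 powr p / l powr p) * ?I" for n
    proof -
      have eq: "(\<lambda>x. Re (W n x)) = (\<lambda>x. s * bessel_avg s (\<lambda>x. Re (gn n x)) x)" "(\<lambda>x. Im (W n x)) = (\<lambda>x. s * bessel_avg s (\<lambda>x. Im (gn n x)) x)"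
        unfolding W_def by (simp_all add: bessel_int_bounded[OF _ s gn(1)])
      have [measurable]: "(\<lambda>x. Re (W n x)) \<in> borel_measurable borel" "(\<lambda>x. Im (W n x)) \<in> borel_measurable borel" by measurable
      have "emeasure lborel (A n) \<le> emeasure lborel (large_quotient p s (l / 2 / 2) (\<lambda>x. Re (W n x)) \<union> large_quotient p s (l / 2 / 2) (\<lambda>x. Im (W n x)))"
        unfolding A_def using l by (intro emeasure_mono large_quotient_complex_subset) auto
      also have "\<dots> \<le> emeasure lborel (large_quotient p s (l / 2 / 2) (\<lambda>x. Re (W n x))) + emeasure lborel (large_quotient p s (l / 2 / 2) (\<lambda>x. Im (W n x)))"
        by (intro emeasure_subadditive) auto
      also have "\<dots> \<le> ennreal (C / (l / 4) powr p) * ?I + ennreal (C / (l / 4) powr p) * ?I"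
        unfolding eq by (intro add_mono part[of _ n] abs_Re_le_cmod abs_Im_le_cmod) measurable
      also have "\<dots> = ennreal (2 * C * 4 powr p / l powr p) * ?I"
      proof -
        have "C / (l / 4) powr p + C / (l / 4) powr p = 2 * C * 4 powr p / l powr p" using l by (simp add: powr_divide)
        then have "ennreal (C / (l / 4) powr p) + ennreal (C / (l / 4) powr p) = ennreal (2 * C * 4 powr p / l powr p)"
          using C(1) by (subst ennreal_plus[symmetric]) auto
        then show ?thesis by (simp only: distrib_right[symmetric])
      qed
      finally show ?thesis .
    qed
    have "large_quotient p s l (\<lambda>x. s *\<^sub>R bessel_int s g x) \<inter> {(x, y). ?M x < \<infinity> \<and> ?M y < \<infinity>} \<subseteq> (\<Union>m. \<Inter>n\<in>{m..}. A n)"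
    proof clarify
      fix x y assume xy: "(x, y) \<in> large_quotient p s l (\<lambda>x. s *\<^sub>R bessel_int s g x)" and fin: "?M x < \<infinity>" "?M y < \<infinity>"
      define q where "q = l * norm (x - y) powr (real DIM('a) / p + s)"
      have q: "0 < q" "x \<noteq> y" "q \<le> norm (s *\<^sub>R bessel_int s g x - s *\<^sub>R bessel_int s g y)"
        using xy l by (auto simp: large_quotient_def q_def)
      have "(\<lambda>n. norm (W n x - W n y)) \<longlonglongrightarrow> norm (s *\<^sub>R bessel_int s g x - s *\<^sub>R bessel_int s g y)"
        by (intro tendsto_norm tendsto_diff conv fin)
      \<comment> \<open>A limit of at least q > 0 ensures only that the approximants eventually
        exceed q / 2, not q.\<close>
      then have "\<forall>\<^sub>F n in sequentially. q / 2 < norm (W n x - W n y)"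
        using q by (intro order_tendstoD(1)) auto
      then obtain m where "\<And>n. m \<le> n \<Longrightarrow> q / 2 < norm (W n x - W n y)" by (auto simp: eventually_sequentially)
      then have "(x, y) \<in> A n" if "m \<le> n" for n
        using that q(2) unfolding A_def large_quotient_def q_def by (fastforce intro: less_imp_le)
      then show "(x, y) \<in> (\<Union>m. \<Inter>n\<in>{m..}. A n)" by auto
    qed
    moreover have [measurable]: "(\<Inter>n\<in>{m..}. A n) \<in> sets borel" for m by (rule sets.countable_INT') auto
    ultimately have "emeasure lborel (large_quotient p s l (\<lambda>x. s *\<^sub>R bessel_int s g x) \<inter> {(x, y). ?M x < \<infinity> \<and> ?M y < \<infinity>})
      \<le> emeasure lborel (\<Union>m. \<Inter>n\<in>{m..}. A n)"
      by (intro emeasure_mono) auto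
    also have "\<dots> = (SUP m. emeasure lborel (\<Inter>n\<in>{m..}. A n))"
      by (rule SUP_emeasure_incseq[symmetric])
        (auto simp: incseq_def intro!: sets.countable_INT')
    also have "\<dots> \<le> ennreal (2 * C * 4 powr p / l powr p) * ?I"
    proof (rule SUP_least)
      fix m
      have "emeasure lborel (\<Inter>n\<in>{m..}. A n) \<le> emeasure lborel (A m)"
        by (intro emeasure_mono) auto
      then show "emeasure lborel (\<Inter>n\<in>{m..}. A n) \<le> ennreal (2 * C * 4 powr p / l powr p) * ?I"
        using An[of m] by (rule order_trans)
    qed
    finally show "emeasure lborel (large_quotient p s l (\<lambda>x. s *\<^sub>R bessel_int s g x) \<inter> {(x, y). ?M x < \<infinity> \<and> ?M y < \<infinity>})
      \<le> ennreal (2 * C * 4 powr p / l powr p) * ?I" .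
  qed
qed

section \<open>Gaussian mixtures as Schwartz functions\<close>

text \<open>Each derivative of exp (- \<sigma> |x - a|^2) brings down one factor \<sigma>; the
  exponent \<open>k\<close> counts them.\<close>

definition gauss_mix :: "'c measure \<Rightarrow> ('c \<Rightarrow> real) \<Rightarrow> ('c \<Rightarrow> real) \<Rightarrow> nat \<Rightarrow> 'a::euclidean_space \<Rightarrow> 'a \<Rightarrow> real" where
  "gauss_mix M \<omega> \<sigma> k a x = (LINT t|M. \<omega> t * \<sigma> t ^ k * exp (- (\<sigma> t * (norm (x - a))\<^sup>2)))"

text \<open>
  Smoothness is propagated through a class of functions closed under differentiation: polynomials
  times the Gaussian mixtures with an additional power of the inverse width.
\<close>

inductive_set gauss_class :: "'c measure \<Rightarrow> ('c \<Rightarrow> real) \<Rightarrow> ('c \<Rightarrow> real) \<Rightarrow> 'a::euclidean_space \<Rightarrow> ('a \<Rightarrow> complex) set"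
  for M \<omega> \<sigma> a where
  mix: "(\<lambda>x. of_real (gauss_mix M \<omega> \<sigma> k a x)) \<in> gauss_class M \<omega> \<sigma> a"
| linear: "f \<in> gauss_class M \<omega> \<sigma> a \<Longrightarrow> (\<lambda>x. of_real ((x - a) \<bullet> b) * f x) \<in> gauss_class M \<omega> \<sigma> a"
| add: "f \<in> gauss_class M \<omega> \<sigma> a \<Longrightarrow> g \<in> gauss_class M \<omega> \<sigma> a \<Longrightarrow> (\<lambda>x. f x + g x) \<in> gauss_class M \<omega> \<sigma> a"
| scale: "f \<in> gauss_class M \<omega> \<sigma> a \<Longrightarrow> (\<lambda>x. c * f x) \<in> gauss_class M \<omega> \<sigma> a"

text \<open>Arbitrarily wide Gaussians, with \<sigma> near 0, are allowed. The upper bound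
  \<open>B\<close> on \<sigma> controls the derivatives, and the moments of 1 / \<sigma> make the
  mixture decay faster than every power.\<close>

context
  fixes M :: "'c measure" and \<omega> \<sigma> :: "'c \<Rightarrow> real" and B :: real
  assumes meas[measurable]: "\<omega> \<in> borel_measurable M" "\<sigma> \<in> borel_measurable M"
    and \<omega>: "\<And>t. 0 \<le> \<omega> t" and \<sigma>: "\<And>t. 0 < \<sigma> t" "\<And>t. \<sigma> t \<le> B"
    and mom: "\<And>j. integrable M (\<lambda>t. \<omega> t * (1 + 1 / \<sigma> t) ^ j)"
begin

lemma gauss_mix_integrable:
  fixes a :: "'a::euclidean_space"
  assumes "0 \<le> C" "h \<in> borel_measurable M" "\<And>t. \<bar>h t\<bar> \<le> C * (1 + 1 / \<sigma> t) ^ j"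
  shows "integrable M (\<lambda>t. \<omega> t * \<sigma> t ^ k * h t)"
    and "\<bar>LINT t|M. \<omega> t * \<sigma> t ^ k * h t\<bar> \<le> B ^ k * C * (LINT t|M. \<omega> t * (1 + 1 / \<sigma> t) ^ j)"
proof -
  note [measurable] = assms(2)
  have le: "\<bar>\<omega> t * \<sigma> t ^ k * h t\<bar> \<le> B ^ k * C * (\<omega> t * (1 + 1 / \<sigma> t) ^ j)" for t
  proof -
    have "\<bar>\<omega> t * \<sigma> t ^ k * h t\<bar> = \<omega> t * (\<sigma> t ^ k * \<bar>h t\<bar>)"
      using \<omega>[of t] \<sigma>(1)[of t] by (simp add: abs_mult)
    also have "\<dots> \<le> \<omega> t * (B ^ k * (C * (1 + 1 / \<sigma> t) ^ j))"
      using assms \<omega>[of t] \<sigma>[of t] by (intro mult_left_mono mult_mono power_mono) (auto intro: less_imp_le order_trans[OF less_imp_le])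
    finally show ?thesis by (simp add: ac_simps)
  qed
  have i: "integrable M (\<lambda>t. B ^ k * C * (\<omega> t * (1 + 1 / \<sigma> t) ^ j))" by (intro integrable_mult_right mom)
  show int: "integrable M (\<lambda>t. \<omega> t * \<sigma> t ^ k * h t)"
  proof (rule Bochner_Integration.integrable_bound[OF i])
    show "AE t in M. norm (\<omega> t * \<sigma> t ^ k * h t) \<le> norm (B ^ k * C * (\<omega> t * (1 + 1 / \<sigma> t) ^ j))"
      using order_trans[OF le abs_ge_self] by (intro AE_I2) simp
  qed measurable
  have "norm (LINT t|M. \<omega> t * \<sigma> t ^ k * h t) \<le> (LINT t|M. norm (\<omega> t * \<sigma> t ^ k * h t))" by (rule integral_norm_bound)
  also have "\<dots> \<le> (LINT t|M. B ^ k * C * (\<omega> t * (1 + 1 / \<sigma> t) ^ j))"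
    using le int by (intro integral_mono i integrable_norm) auto
  also have "\<dots> = B ^ k * C * (LINT t|M. \<omega> t * (1 + 1 / \<sigma> t) ^ j)" by (rule integral_mult_right_zero)
  finally show "\<bar>LINT t|M. \<omega> t * \<sigma> t ^ k * h t\<bar> \<le> B ^ k * C * (LINT t|M. \<omega> t * (1 + 1 / \<sigma> t) ^ j)" by simp
qed

lemma gauss_exp: "exp (- (\<sigma> t * (norm z)\<^sup>2)) = gauss ((2 * sqrt (\<sigma> t)) *\<^sub>R z)"
  using \<sigma>(1)[of t] by (simp add: gauss_def power_mult_distrib)

text \<open>The Taylor remainder of one Gaussian is rescaled by 2 sqrt \<sigma>. As \<sigma> \<le>
  B, the radius 1 / (2 sqrt B) serves all widths at once, and the error stays quadratic after
  integration.\<close>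

lemma gauss_mix_has_derivative:
  fixes a :: "'a::euclidean_space"
  shows "(gauss_mix M \<omega> \<sigma> k a has_derivative (\<lambda>h. - 2 * ((x - a) \<bullet> h) * gauss_mix M \<omega> \<sigma> (Suc k) a x)) (at x)"
proof -
  let ?E = "\<lambda>t z. exp (- (\<sigma> t * (norm z)\<^sup>2))"
  define c where "c = 2 ^ Suc DIM('a) * (fact (2 + Suc DIM('a)) * exp (2::real))"
  have c: "0 < c" by (simp add: c_def)
  have B: "0 < B" using \<sigma> less_le_trans by blast
  define D where "D = B ^ Suc k * (4 * c) * (LINT t|M. \<omega> t * (1 + 1 / \<sigma> t) ^ 0)"
  have exp1: "integrable M (\<lambda>t. \<omega> t * \<sigma> t ^ k * ?E t z)" for k and z :: 'a
  proof (rule gauss_mix_integrable[of 1 _ 0])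
    show "\<bar>?E t z\<bar> \<le> 1 * (1 + 1 / \<sigma> t) ^ 0" for t
      using \<sigma>(1)[of t] by simp
  qed auto
  have rem: "\<bar>gauss_mix M \<omega> \<sigma> k a y - gauss_mix M \<omega> \<sigma> k a x - (- 2 * ((x - a) \<bullet> (y - x)) * gauss_mix M \<omega> \<sigma> (Suc k) a x)\<bar>
      \<le> D * (norm (y - x))\<^sup>2" if y: "dist y x < 1 / (2 * sqrt B)" for y
  proof -
    define h where "h = y - x"
    define z where "z = x - a"
    \<comment> \<open>Division by \<sigma> cancels the \<sigma> in |2 sqrt \<sigma> h|^2, so that
      \<open>R\<close> has a bound free of t; the factor taken out raises the exponent to
      \<open>Suc k\<close>.\<close>
    define R where "R t = (?E t (z + h) - ?E t z + 2 * \<sigma> t * (z \<bullet> h) * ?E t z) / \<sigma> t" for t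
    have Rb: "\<bar>R t\<bar> \<le> (4 * c * (norm h)\<^sup>2) * (1 + 1 / \<sigma> t) ^ 0" for t
    proof -
      let ?s = "2 * sqrt (\<sigma> t)"
      have s: "0 < ?s" "?s\<^sup>2 = 4 * \<sigma> t" "?s \<le> 2 * sqrt B" using \<sigma>[of t] by (auto simp: power_mult_distrib)
      have "norm (?s *\<^sub>R h) = ?s * norm h" using s(1) by simp
      also have "\<dots> \<le> (2 * sqrt B) * (1 / (2 * sqrt B))"
        using y s by (intro mult_mono) (auto simp: h_def dist_norm)
      also have "\<dots> = 1" using B by simp
      finally have n1: "norm (?s *\<^sub>R h) \<le> 1" .
      have "R t * \<sigma> t = gauss_rem (?s *\<^sub>R h) (?s *\<^sub>R z)"
      proof -
        have "(?s *\<^sub>R h) \<bullet> (?s *\<^sub>R z) / 2 = ?s\<^sup>2 * (z \<bullet> h) / 2"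
          by (simp add: power2_eq_square inner_commute)
        also have "\<dots> = 2 * \<sigma> t * (z \<bullet> h)" unfolding s(2) by simp
        finally show ?thesis
          using \<sigma>(1)[of t] unfolding R_def gauss_rem_def gauss_exp by (simp add: scaleR_right_distrib)
      qed
      then have "\<bar>R t\<bar> * \<sigma> t = \<bar>gauss_rem (?s *\<^sub>R h) (?s *\<^sub>R z)\<bar>"
        using \<sigma>(1)[of t] by (metis abs_mult abs_of_pos)
      also have "\<dots> \<le> (norm (?s *\<^sub>R h))\<^sup>2 * c * (1 / (1 + norm (?s *\<^sub>R z)) ^ Suc DIM('a))"
        unfolding c_def by (rule gauss_rem_bound[OF n1])
      also have "\<dots> \<le> (norm (?s *\<^sub>R h))\<^sup>2 * c * 1"
      proof (intro mult_left_mono)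
        have "1 \<le> (1 + norm (?s *\<^sub>R z)) ^ Suc DIM('a)" by (rule one_le_power) simp
        then show "1 / (1 + norm (?s *\<^sub>R z)) ^ Suc DIM('a) \<le> 1" by simp
      qed (use c in auto)
      also have "\<dots> = ?s\<^sup>2 * (norm h)\<^sup>2 * c" by (simp add: power_mult_distrib)
      also have "\<dots> = (4 * c * (norm h)\<^sup>2) * \<sigma> t" unfolding s(2) by simp
      finally show ?thesis using \<sigma>(1)[of t] by simp
    qed
    have [measurable]: "R \<in> borel_measurable M" unfolding R_def[abs_def] by measurable
    have ya: "y - a = z + h" by (simp add: z_def h_def)
    have "gauss_mix M \<omega> \<sigma> k a y - gauss_mix M \<omega> \<sigma> k a x - (- 2 * ((x - a) \<bullet> (y - x)) * gauss_mix M \<omega> \<sigma> (Suc k) a x)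
      = (LINT t|M. \<omega> t * \<sigma> t ^ k * ?E t (z + h) - \<omega> t * \<sigma> t ^ k * ?E t z + 2 * (z \<bullet> h) * (\<omega> t * \<sigma> t ^ Suc k * ?E t z))"
      unfolding gauss_mix_def ya z_def[symmetric] h_def[symmetric]
      using exp1[of k] exp1[of "Suc k"] by simp
    also have "\<dots> = (LINT t|M. \<omega> t * \<sigma> t ^ Suc k * R t)"
    proof (intro Bochner_Integration.integral_cong refl)
      fix t
      have "\<sigma> t * R t = ?E t (z + h) - ?E t z + 2 * \<sigma> t * (z \<bullet> h) * ?E t z" using \<sigma>(1)[of t] by (simp add: R_def)
      then have "\<omega> t * \<sigma> t ^ Suc k * R t = \<omega> t * \<sigma> t ^ k * (?E t (z + h) - ?E t z + 2 * \<sigma> t * (z \<bullet> h) * ?E t z)"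
        by (simp only: power_Suc mult.assoc mult.left_commute[of _ "\<sigma> t"]) simp
      then show "\<omega> t * \<sigma> t ^ k * ?E t (z + h) - \<omega> t * \<sigma> t ^ k * ?E t z + 2 * (z \<bullet> h) * (\<omega> t * \<sigma> t ^ Suc k * ?E t z) = \<omega> t * \<sigma> t ^ Suc k * R t"
        by (simp add: algebra_simps)
    qed
    finally have "gauss_mix M \<omega> \<sigma> k a y - gauss_mix M \<omega> \<sigma> k a x - (- 2 * ((x - a) \<bullet> (y - x)) * gauss_mix M \<omega> \<sigma> (Suc k) a x)
      = (LINT t|M. \<omega> t * \<sigma> t ^ Suc k * R t)" .
    moreover have "\<bar>LINT t|M. \<omega> t * \<sigma> t ^ Suc k * R t\<bar> \<le> B ^ Suc k * (4 * c * (norm h)\<^sup>2) * (LINT t|M. \<omega> t * (1 + 1 / \<sigma> t) ^ 0)"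
      using c by (intro gauss_mix_integrable(2) Rb) auto
    ultimately show ?thesis by (simp add: D_def h_def ac_simps)
  qed
  show ?thesis
  proof (rule has_derivativeI_sandwich[of "1 / (2 * sqrt B)"])
    show "0 < 1 / (2 * sqrt B)" using B by simp
    show "bounded_linear (\<lambda>h. - 2 * ((x - a) \<bullet> h) * gauss_mix M \<omega> \<sigma> (Suc k) a x)"
      by (intro bounded_linear_mult_const bounded_linear_const_mult bounded_linear_inner_right)
    show "((\<lambda>y. D * norm (y - x)) \<longlongrightarrow> 0) (at x)" by (auto intro!: tendsto_eq_intros)
    fix y assume y: "y \<noteq> x" "dist y x < 1 / (2 * sqrt B)"
    show "norm (gauss_mix M \<omega> \<sigma> k a y - gauss_mix M \<omega> \<sigma> k a x - (- 2 * ((x - a) \<bullet> (y - x)) * gauss_mix M \<omega> \<sigma> (Suc k) a x)) / norm (y - x) \<le> D * norm (y - x)"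
      using rem[OF y(2)] y(1) unfolding real_norm_def by (subst pos_divide_le_eq) (auto simp: power2_eq_square mult.assoc)
  qed
qed

lemma gauss_class_derivative:
  fixes a :: "'a::euclidean_space"
  assumes "f \<in> gauss_class M \<omega> \<sigma> a"
  shows "\<exists>f'. (\<forall>x. (f has_derivative f' x) (at x)) \<and> (\<forall>b. (\<lambda>x. f' x b) \<in> gauss_class M \<omega> \<sigma> a)"
  using assms
proof induction
  case (mix k)
  have "((\<lambda>x. complex_of_real (gauss_mix M \<omega> \<sigma> k a x)) has_derivative
      (\<lambda>h. of_real (- 2 * ((x - a) \<bullet> h) * gauss_mix M \<omega> \<sigma> (Suc k) a x))) (at x)" for x
    by (rule has_derivative_of_real[OF gauss_mix_has_derivative])
  moreover have "(\<lambda>x. complex_of_real (- 2 * ((x - a) \<bullet> b) * gauss_mix M \<omega> \<sigma> (Suc k) a x)) \<in> gauss_class M \<omega> \<sigma> a" for b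
    using gauss_class.scale[OF gauss_class.linear[OF gauss_class.mix[of M \<omega> \<sigma> "Suc k" a], of b], of "- 2"]
    by (simp add: mult.assoc)
  ultimately show ?case by (intro exI conjI allI)
next
  case (linear f c)
  then obtain f' where f': "\<And>x. (f has_derivative f' x) (at x)" "\<And>b. (\<lambda>x. f' x b) \<in> gauss_class M \<omega> \<sigma> a" by blast
  have "((\<lambda>x. complex_of_real ((x - a) \<bullet> c)) has_derivative (\<lambda>h. of_real (h \<bullet> c))) (at x)" for x
    by (auto intro!: derivative_eq_intros)
  from has_derivative_mult[OF this f'(1)]
  have "((\<lambda>x. of_real ((x - a) \<bullet> c) * f x) has_derivative (\<lambda>h. of_real ((x - a) \<bullet> c) * f' x h + of_real (h \<bullet> c) * f x)) (at x)" for x .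
  moreover have "(\<lambda>x. of_real ((x - a) \<bullet> c) * f' x b + of_real (b \<bullet> c) * f x) \<in> gauss_class M \<omega> \<sigma> a" for b
    by (intro gauss_class.add gauss_class.linear gauss_class.scale f' linear)
  ultimately show ?case by (intro exI conjI allI)
next
  case (add f g)
  then obtain f' g' where "\<And>x. (f has_derivative f' x) (at x)" "\<And>b. (\<lambda>x. f' x b) \<in> gauss_class M \<omega> \<sigma> a"
    "\<And>x. (g has_derivative g' x) (at x)" "\<And>b. (\<lambda>x. g' x b) \<in> gauss_class M \<omega> \<sigma> a" by blast
  then show ?case
    by (intro exI[of _ "\<lambda>x h. f' x h + g' x h"] conjI allI has_derivative_add gauss_class.add)
next
  case (scale f c)
  then obtain f' where "\<And>x. (f has_derivative f' x) (at x)" "\<And>b. (\<lambda>x. f' x b) \<in> gauss_class M \<omega> \<sigma> a" by blast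
  then show ?case
    by (intro exI[of _ "\<lambda>x h. c * f' x h"] conjI allI has_derivative_mult_right gauss_class.scale)
qed

text \<open>A linear factor costs one power of 1 + |x|, so the induction runs over all
  \<open>m\<close> simultaneously. For the mixture itself, powers of |x| are exchanged for powers of
  1 / \<sigma>.\<close>

lemma gauss_class_bounded:
  fixes a :: "'a::euclidean_space"
  assumes "f \<in> gauss_class M \<omega> \<sigma> a"
  shows "\<exists>C. \<forall>x. (1 + norm x) ^ m * norm (f x) \<le> C"
  using assms
proof (induction arbitrary: m)
  case (mix k)
  have B: "0 < B" using \<sigma> less_le_trans by blast
  define C where "C = (1 + norm a) ^ m * (2 ^ m * (fact m * exp 2))"
  have "(1 + norm x) ^ m * \<bar>gauss_mix M \<omega> \<sigma> k a x\<bar> \<le> B ^ k * C * (LINT t|M. \<omega> t * (1 + 1 / \<sigma> t) ^ m)" for x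
  proof -
    define h where "h t = (1 + norm x) ^ m * exp (- (\<sigma> t * (norm (x - a))\<^sup>2))" for t
    have [measurable]: "h \<in> borel_measurable M" unfolding h_def[abs_def] by measurable
    have hb: "\<bar>h t\<bar> \<le> C * (1 + 1 / \<sigma> t) ^ m" for t
    proof -
      define r where "r = norm (x - a)"
      define s where "s = sqrt (\<sigma> t)"
      have s: "0 < s" "s\<^sup>2 = \<sigma> t" using \<sigma>(1)[of t] by (auto simp: s_def)
      have r: "0 \<le> r" by (simp add: r_def)
      \<comment> \<open>The aim is 1 + |x| \<le> (1 + |a|) (1 + 1 / (2 s)) (1 + 2 s r): the Gaussian
        in 2 s r absorbs the last factor, and the moments of 1 / \<sigma> the middle one.\<close>
      have "1 / (2 * s) \<le> 1 + 1 / s\<^sup>2"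
      proof -
        have "0 \<le> (1 / s - 1)\<^sup>2" by simp
        then have "2 * (1 / s) \<le> 1 + 1 / s\<^sup>2" by (simp add: power2_diff power_divide)
        moreover have "1 / (2 * s) \<le> 2 * (1 / s)" using s by (simp add: field_simps)
        ultimately show ?thesis by linarith
      qed
      moreover have "0 < 1 / \<sigma> t" using \<sigma>(1)[of t] by simp
      moreover have "1 + u \<le> 2 * (1 + w)" if "u \<le> 1 + w" "0 < w" for u w :: real
        using that by simp
      ultimately have q: "1 + 1 / (2 * s) \<le> 2 * (1 + 1 / \<sigma> t)" unfolding s(2) by blast
      have q0: "0 \<le> 2 * (1 + 1 / \<sigma> t)" using \<sigma>(1)[of t] by simp
      have e: "(1 + 2 * s * r) ^ m * exp (- (2 * s * r)\<^sup>2 / 4) \<le> fact m * exp 2"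
        using s r by (intro power_times_gauss_bound) simp
      have "norm x \<le> norm a + r" using norm_triangle_ineq[of a "x - a"] by (simp add: r_def)
      also have "\<dots> \<le> norm a + r + norm a * r" using r by simp
      finally have "1 + norm x \<le> (1 + norm a) * (1 + r)" by (simp add: algebra_simps)
      also have "1 + r \<le> (1 + 1 / (2 * s)) * (1 + 2 * s * r)"
        using s r by (simp add: algebra_simps)
      finally have "1 + norm x \<le> (1 + norm a) * ((1 + 1 / (2 * s)) * (1 + 2 * s * r))" by (simp add: mult_left_mono)
      then have "(1 + norm x) ^ m \<le> ((1 + norm a) * ((1 + 1 / (2 * s)) * (1 + 2 * s * r))) ^ m" by (intro power_mono) auto
      then have "h t \<le> ((1 + norm a) * ((1 + 1 / (2 * s)) * (1 + 2 * s * r))) ^ m * exp (- (2 * s * r)\<^sup>2 / 4)"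
        unfolding h_def r_def[symmetric] using s by (simp add: power_mult_distrib mult_right_mono)
      also have "\<dots> = (1 + norm a) ^ m * ((1 + 1 / (2 * s)) ^ m * ((1 + 2 * s * r) ^ m * exp (- (2 * s * r)\<^sup>2 / 4)))"
        by (simp add: power_mult_distrib mult.assoc)
      also have "\<dots> \<le> (1 + norm a) ^ m * ((2 * (1 + 1 / \<sigma> t)) ^ m * (fact m * exp 2))"
        using s r q zero_le_power[OF q0, of m] by (intro mult_left_mono mult_mono[OF _ e] power_mono) auto
      also have "\<dots> = C * (1 + 1 / \<sigma> t) ^ m" unfolding C_def power_mult_distrib by (simp only: mult_ac)
      finally show ?thesis by (simp add: h_def)
    qed
    have "(1 + norm x) ^ m * gauss_mix M \<omega> \<sigma> k a x = (LINT t|M. \<omega> t * \<sigma> t ^ k * h t)"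
      unfolding gauss_mix_def h_def integral_mult_right_zero[symmetric]
      by (intro Bochner_Integration.integral_cong) auto
    moreover have "\<bar>LINT t|M. \<omega> t * \<sigma> t ^ k * h t\<bar> \<le> B ^ k * C * (LINT t|M. \<omega> t * (1 + 1 / \<sigma> t) ^ m)"
      by (intro gauss_mix_integrable(2) hb) (auto simp: C_def)
    moreover have "(1 + norm x) ^ m * \<bar>gauss_mix M \<omega> \<sigma> k a x\<bar> = \<bar>(1 + norm x) ^ m * gauss_mix M \<omega> \<sigma> k a x\<bar>"
      by (simp add: abs_mult)
    ultimately show ?thesis by simp
  qed
  then show ?case by (intro exI[of _ "B ^ k * C * (LINT t|M. \<omega> t * (1 + 1 / \<sigma> t) ^ m)"]) simp
next
  case (linear f b)
  obtain C where C: "\<And>x. (1 + norm x) ^ Suc m * norm (f x) \<le> C" using linear(2) by blast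
  have "(1 + norm x) ^ m * norm (of_real ((x - a) \<bullet> b) * f x) \<le> (1 + norm a) * norm b * C" for x
  proof -
    have "norm (x - a) \<le> norm x + norm a" by (rule norm_triangle_ineq4)
    also have "\<dots> \<le> (1 + norm a) * (1 + norm x)" by (simp add: algebra_simps)
    finally have "norm (x - a) * norm b \<le> ((1 + norm a) * (1 + norm x)) * norm b" by (rule mult_right_mono) simp
    then have "\<bar>(x - a) \<bullet> b\<bar> \<le> ((1 + norm a) * (1 + norm x)) * norm b"
      using Cauchy_Schwarz_ineq2[of "x - a" b] by linarith
    then have "(1 + norm x) ^ m * norm (of_real ((x - a) \<bullet> b) * f x) \<le> (1 + norm x) ^ m * ((((1 + norm a) * (1 + norm x)) * norm b) * norm (f x))"
      unfolding norm_mult norm_of_real by (intro mult_left_mono mult_right_mono) auto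
    also have "\<dots> = (1 + norm a) * norm b * ((1 + norm x) ^ Suc m * norm (f x))" by (simp add: ac_simps)
    also have "\<dots> \<le> (1 + norm a) * norm b * C" by (intro mult_left_mono C) auto
    finally show ?thesis .
  qed
  then show ?case by blast
next
  case (add f g)
  obtain C D where CD: "\<And>x. (1 + norm x) ^ m * norm (f x) \<le> C" "\<And>x. (1 + norm x) ^ m * norm (g x) \<le> D"
    using add by blast
  have "(1 + norm x) ^ m * norm (f x + g x) \<le> C + D" for x
  proof -
    have "(1 + norm x) ^ m * norm (f x + g x) \<le> (1 + norm x) ^ m * (norm (f x) + norm (g x))"
      by (intro mult_left_mono norm_triangle_ineq) auto
    then show ?thesis using CD[of x] by (simp add: distrib_left)
  qed
  then show ?case by blast
next
  case (scale f c)
  obtain C where C: "\<And>x. (1 + norm x) ^ m * norm (f x) \<le> C" using scale by blast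
  have "(1 + norm x) ^ m * norm (c * f x) \<le> norm c * C" for x
    using mult_left_mono[OF C[of x], of "norm c"] by (simp add: norm_mult ac_simps)
  then show ?case by blast
qed

lemma gauss_mix_schwartz:
  fixes a :: "'a::euclidean_space"
  shows "(\<lambda>x. complex_of_real (gauss_mix M \<omega> \<sigma> 0 a x)) \<in> schwartz"
proof -
  let ?f = "\<lambda>x. complex_of_real (gauss_mix M \<omega> \<sigma> 0 a x)"
  have cls: "iter_partial bs ?f \<in> gauss_class M \<omega> \<sigma> a" for bs
  proof (induction bs)
    case Nil
    show ?case using gauss_class.mix[of M \<omega> \<sigma> 0 a] by simp
  next
    case (Cons b bs)
    obtain f' where f': "\<And>x. (iter_partial bs ?f has_derivative f' x) (at x)" "\<And>b. (\<lambda>x. f' x b) \<in> gauss_class M \<omega> \<sigma> a"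
      using gauss_class_derivative[OF Cons] by blast
    have "frechet_derivative (iter_partial bs ?f) (at x) = f' x" for x
      using frechet_derivative_at[OF f'(1)] by simp
    then show ?case using f'(2)[of b] by simp
  qed
  have "iter_partial bs ?f differentiable at x" for bs x
    using gauss_class_derivative[OF cls[of bs]] unfolding differentiable_def by blast
  moreover have "bounded (range (\<lambda>x. (1 + norm x) ^ k * norm (iter_partial bs ?f x)))" for k bs
  proof -
    obtain C where "\<And>x. (1 + norm x) ^ k * norm (iter_partial bs ?f x) \<le> C"
      using gauss_class_bounded[OF cls] by blast
    then show ?thesis by (intro boundedI[of _ C]) auto
  qed
  ultimately show ?thesis by (auto simp: schwartz_def smooth_def)
qed

end

section \<open>Fourier transforms of heat kernels\<close>

lemma lborel_integral_prod:
  fixes f :: "'a::euclidean_space \<Rightarrow> real \<Rightarrow> complex"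
  assumes int: "\<And>b. b \<in> Basis \<Longrightarrow> integrable lborel (f b)"
  shows "(LINT x|lborel. (\<Prod>b\<in>Basis. f b (x \<bullet> b))) = (\<Prod>b\<in>Basis. LINT x|lborel. f b x)"
proof -
  interpret product_sigma_finite "\<lambda>_::'a. lborel :: real measure" by standard
  have [measurable]: "f b \<in> borel_measurable borel" if "b \<in> Basis" for b
    using borel_measurable_integrable[OF int[OF that]] by simp
  have "(LINT x|lborel. (\<Prod>b\<in>Basis. f b (x \<bullet> b)))
    = (LINT x|distr (\<Pi>\<^sub>M b\<in>Basis. lborel) borel (\<lambda>f. \<Sum>b\<in>Basis. f b *\<^sub>R (b::'a)). (\<Prod>b\<in>Basis. f b (x \<bullet> b)))"
    by (subst lborel_eq) rule
  also have "\<dots> = (LINT y|(\<Pi>\<^sub>M b\<in>Basis. lborel). (\<Prod>b\<in>Basis. f b ((\<Sum>b\<in>Basis. y b *\<^sub>R (b::'a)) \<bullet> b)))"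
    by (rule integral_distr) measurable
  also have "\<dots> = (LINT y|(\<Pi>\<^sub>M b\<in>Basis. lborel). (\<Prod>b\<in>Basis. f b (y b)))"
    by (intro Bochner_Integration.integral_cong refl prod.cong) (auto simp: inner_sum_left_Basis)
  also have "\<dots> = (\<Prod>b\<in>Basis. LINT x|lborel. f b x)"
    using int by (intro product_integral_prod) auto
  finally show ?thesis .
qed

lemma integrable_gauss_affine:
  fixes a :: "'a::euclidean_space"
  assumes "c \<noteq> 0"
  shows "integrable lborel (\<lambda>v. gauss (a + c *\<^sub>R v))"
proof (rule integrableI_bounded)
  have fin: "(\<integral>\<^sup>+x. ennreal (gauss (x::'a)) \<partial>lborel) < \<infinity>"
    using integrable_gauss[where 'a='a] by (simp add: integrable_iff_bounded)
  have "(\<integral>\<^sup>+x. ennreal (gauss (x::'a)) \<partial>lborel) = ennreal (\<bar>c\<bar> ^ DIM('a)) * (\<integral>\<^sup>+v. ennreal (gauss (a + c *\<^sub>R v)) \<partial>lborel)"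
    by (rule nn_integral_lborel_affine[OF _ assms]) simp
  with fin show "(\<integral>\<^sup>+v. ennreal (norm (gauss (a + c *\<^sub>R v))) \<partial>lborel) < \<infinity>"
    using assms by (auto simp: ennreal_mult_less_top)
qed simp

lemma exp_norm_gauss: "0 \<le> c \<Longrightarrow> exp (- (c * (norm x)\<^sup>2)) = gauss (0 + (2 * sqrt c) *\<^sub>R x)"
  by (simp add: gauss_def power_mult_distrib)

lemma integrable_exp_norm:
  assumes "0 < c"
  shows "integrable lborel (\<lambda>x::'a::euclidean_space. exp (- (c * (norm x)\<^sup>2)))"
  using assms integrable_gauss_affine[of "2 * sqrt c" "0::'a"] by (simp add: exp_norm_gauss)

lemma integrable_exp_norm_cis:
  assumes "0 < c" and [measurable]: "k \<in> borel_measurable borel"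
  shows "integrable lborel (\<lambda>x::'a::euclidean_space. complex_of_real (exp (- (c * (norm x)\<^sup>2))) * cis (k x))"
proof (rule Bochner_Integration.integrable_bound[OF integrable_exp_norm[OF assms(1)]])
  show "(\<lambda>x::'a. complex_of_real (exp (- (c * (norm x)\<^sup>2))) * cis (k x)) \<in> borel_measurable lborel"
    unfolding cis_conv_exp by measurable
qed (simp add: norm_mult)

text \<open>The characteristic function of the standard normal law, rescaled by sqrt (2 c).\<close>

lemma gauss_fourier_1d:
  fixes c k :: real
  assumes c: "0 < c"
  shows "(LINT x|lborel. complex_of_real (exp (- (c * x\<^sup>2))) * cis (x * k)) = of_real ((pi / c) powr (1 / 2) * exp (- (k\<^sup>2 / (4 * c))))"
proof -
  define t where "t = k / sqrt (2 * c)"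
  have "of_real (exp (- (t\<^sup>2) / 2)) = (LINT x|std_normal_distribution. iexp (t * x))"
    using fun_cong[OF char_std_normal_distribution, of t] by (simp add: char_def)
  also have "\<dots> = (LINT x|lborel. std_normal_density x *\<^sub>R iexp (t * x))"
    by (rule integral_density) auto
  also have "\<dots> = \<bar>sqrt (2 * c)\<bar> *\<^sub>R (LINT x|lborel. std_normal_density (0 + sqrt (2 * c) * x) *\<^sub>R iexp (t * (0 + sqrt (2 * c) * x)))"
    using c by (intro lborel_integral_real_affine) simp
  also have "\<dots> = sqrt (2 * c) *\<^sub>R (LINT x|lborel. (1 / sqrt (2 * pi)) *\<^sub>R (complex_of_real (exp (- (c * x\<^sup>2))) * cis (x * k)))"
  proof -
    have "std_normal_density (0 + sqrt (2 * c) * x) *\<^sub>R iexp (t * (0 + sqrt (2 * c) * x)) = (1 / sqrt (2 * pi)) *\<^sub>R (complex_of_real (exp (- (c * x\<^sup>2))) * cis (x * k))" for x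
    proof -
      have k: "t * (0 + sqrt (2 * c) * x) = x * k" using c by (simp add: t_def)
      moreover have "(sqrt (2 * c) * x)\<^sup>2 / 2 = c * x\<^sup>2" using c by (simp add: power_mult_distrib)
      ultimately show ?thesis
        unfolding k by (simp add: std_normal_density_def cis_conv_exp scaleR_conv_of_real)
    qed
    then show ?thesis using c by simp
  qed
  also have "\<dots> = (sqrt (2 * c) / sqrt (2 * pi)) *\<^sub>R (LINT x|lborel. complex_of_real (exp (- (c * x\<^sup>2))) * cis (x * k))"
    by (subst integral_scaleR_right) simp
  finally have eq: "of_real (exp (- (t\<^sup>2) / 2)) = (sqrt (2 * c) / sqrt (2 * pi)) *\<^sub>R (LINT x|lborel. complex_of_real (exp (- (c * x\<^sup>2))) * cis (x * k))" .
  define I where "I = (LINT x|lborel. complex_of_real (exp (- (c * x\<^sup>2))) * cis (x * k))"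
  have r: "sqrt (2 * c) / sqrt (2 * pi) = 1 / sqrt (pi / c)" using c by (simp add: real_sqrt_divide real_sqrt_mult)
  have "sqrt (pi / c) *\<^sub>R complex_of_real (exp (- (t\<^sup>2) / 2)) = I"
    using eq c unfolding I_def[symmetric] r by simp
  moreover have "t\<^sup>2 / 2 = k\<^sup>2 / (4 * c)" using c by (simp add: t_def power_divide)
  ultimately show ?thesis
    unfolding I_def[symmetric] using c by (auto simp: powr_half_sqrt scaleR_conv_of_real)
qed

text \<open>The Gaussian and the character both factor over the coordinates, which reduces the
  integral to dimension one.\<close>

lemma gauss_fourier:
  fixes \<xi> :: "'a::euclidean_space"
  assumes c: "0 < c"
  shows "(LINT x|lborel. complex_of_real (exp (- (c * (norm x)\<^sup>2))) * cis (x \<bullet> \<xi>))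
    = of_real ((pi / c) powr (real DIM('a) / 2) * exp (- ((norm \<xi>)\<^sup>2 / (4 * c))))"
proof -
  let ?f = "\<lambda>b x. complex_of_real (exp (- (c * x\<^sup>2))) * cis (x * (\<xi> \<bullet> b))"
  have nrm: "(norm x)\<^sup>2 = (\<Sum>b\<in>Basis. (x \<bullet> b)\<^sup>2)" for x :: 'a
    unfolding power2_norm_eq_inner by (subst euclidean_inner) (simp add: power2_eq_square)
  have cis_sum: "cis (\<Sum>b\<in>A. h b) = (\<Prod>b\<in>A. cis (h b))" if "finite A" for A :: "'a set" and h
    using that by induction (auto simp: cis_mult[symmetric])
  have "(LINT x|lborel. complex_of_real (exp (- (c * (norm x)\<^sup>2))) * cis (x \<bullet> \<xi>)) = (LINT x|lborel. (\<Prod>b\<in>Basis. ?f b (x \<bullet> b)))"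
  proof (intro Bochner_Integration.integral_cong refl)
    fix x :: 'a
    have "exp (- (c * (norm x)\<^sup>2)) = (\<Prod>b\<in>Basis. exp (- (c * (x \<bullet> b)\<^sup>2)))"
      by (simp add: nrm sum_distrib_left exp_sum flip: sum_negf)
    moreover have "cis (x \<bullet> \<xi>) = (\<Prod>b\<in>Basis. cis ((x \<bullet> b) * (\<xi> \<bullet> b)))"
      by (subst euclidean_inner, subst cis_sum) simp_all
    ultimately show "complex_of_real (exp (- (c * (norm x)\<^sup>2))) * cis (x \<bullet> \<xi>) = (\<Prod>b\<in>Basis. ?f b (x \<bullet> b))"
      by (simp add: prod.distrib)
  qed
  also have "\<dots> = (\<Prod>b\<in>Basis. LINT x|lborel. ?f b x)"
    using integrable_exp_norm_cis[OF c, where 'a=real] by (intro lborel_integral_prod) auto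
  also have "\<dots> = (\<Prod>b\<in>Basis. of_real ((pi / c) powr (1 / 2) * exp (- ((\<xi> \<bullet> b)\<^sup>2 / (4 * c)))))"
    by (intro prod.cong refl gauss_fourier_1d c)
  also have "\<dots> = of_real (\<Prod>b\<in>(Basis::'a set). (pi / c) powr (1 / 2) * exp (- ((\<xi> \<bullet> b)\<^sup>2 / (4 * c))))"
    by simp
  also have "(\<Prod>b\<in>(Basis::'a set). (pi / c) powr (1 / 2) * exp (- ((\<xi> \<bullet> b)\<^sup>2 / (4 * c))))
    = (pi / c) powr (real DIM('a) / 2) * exp (- ((norm \<xi>)\<^sup>2 / (4 * c)))"
  proof -
    have "((pi / c) powr (1 / 2)) ^ DIM('a) = (pi / c) powr (real DIM('a) / 2)"
      using c by (simp add: powr_realpow[symmetric] powr_powr)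
    moreover have "(\<Prod>b\<in>(Basis::'a set). exp (- ((\<xi> \<bullet> b)\<^sup>2 / (4 * c)))) = exp (- ((norm \<xi>)\<^sup>2 / (4 * c)))"
      by (simp add: nrm sum_divide_distrib exp_sum flip: sum_negf)
    ultimately show ?thesis by (simp add: prod.distrib)
  qed
  finally show ?thesis .
qed

definition heat :: "real \<Rightarrow> 'a::euclidean_space \<Rightarrow> real" where
  "heat t x = (4 * pi * t) powr (- (real DIM('a) / 2)) * exp (- (1 / (4 * t) * (norm x)\<^sup>2))"

lemma heat_nonneg [simp]: "0 \<le> heat t x"
  by (simp add: heat_def)

lemma borel_measurable_heat [measurable]: "(\<lambda>(t, x). heat t x) \<in> borel_measurable (borel \<Otimes>\<^sub>M borel)"
  unfolding heat_def split_beta' by measurable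

lemma heat_fourier:
  fixes a \<xi> :: "'a::euclidean_space"
  assumes t: "0 < t"
  shows "(LINT x|lborel. complex_of_real (heat t (x - a)) * cis (2 * pi * (x \<bullet> \<xi>)))
    = cis (2 * pi * (a \<bullet> \<xi>)) * of_real (exp (- (4 * pi\<^sup>2 * t * (norm \<xi>)\<^sup>2)))"
proof -
  let ?F = "\<lambda>x. complex_of_real (heat t (x - a)) * cis (2 * pi * (x \<bullet> \<xi>))"
  have "(LINT x|lborel. ?F x) = (LINT x|distr lborel borel ((+) a). ?F x)" by (simp add: lborel_distr_plus)
  also have "\<dots> = (LINT x|lborel. ?F (a + x))" 
    by (rule integral_distr) (auto simp: cis_conv_exp)
  also have "\<dots> = (LINT x|lborel. (cis (2 * pi * (a \<bullet> \<xi>)) * of_real ((4 * pi * t) powr (- (real DIM('a) / 2)))) *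
       (complex_of_real (exp (- (1 / (4 * t) * (norm x)\<^sup>2))) * cis (x \<bullet> ((2 * pi) *\<^sub>R \<xi>))))"
    by (intro Bochner_Integration.integral_cong refl)
      (simp add: heat_def inner_add_left distrib_left cis_mult[symmetric] mult_ac)
  also have "\<dots> = (cis (2 * pi * (a \<bullet> \<xi>)) * of_real ((4 * pi * t) powr (- (real DIM('a) / 2)))) *
     of_real ((pi / (1 / (4 * t))) powr (real DIM('a) / 2) * exp (- ((norm ((2 * pi) *\<^sub>R \<xi>))\<^sup>2 / (4 * (1 / (4 * t))))))"
    unfolding integral_mult_right_zero using t by (subst gauss_fourier) auto
  also have "(pi / (1 / (4 * t))) powr (real DIM('a) / 2) = (4 * pi * t) powr (real DIM('a) / 2)" by (simp add: mult_ac)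
  also have "(norm ((2 * pi) *\<^sub>R \<xi>))\<^sup>2 / (4 * (1 / (4 * t))) = 4 * pi\<^sup>2 * t * (norm \<xi>)\<^sup>2"
    using t by (simp add: power_mult_distrib)
  finally have eq: "(LINT x|lborel. ?F x) = cis (2 * pi * (a \<bullet> \<xi>)) * of_real ((4 * pi * t) powr (- (real DIM('a) / 2))) *
     of_real ((4 * pi * t) powr (real DIM('a) / 2) * exp (- (4 * pi\<^sup>2 * t * (norm \<xi>)\<^sup>2)))" .
  have "complex_of_real ((4 * pi * t) powr (- (real DIM('a) / 2))) * of_real ((4 * pi * t) powr (real DIM('a) / 2) * E) = of_real E" for E
    unfolding of_real_mult[symmetric] mult.assoc[symmetric] powr_add[symmetric] using t by simp
  then show ?thesis unfolding eq mult.assoc[of "cis z" for z] by (simp only:)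
qed

lemma heat_inv_fourier:
  fixes a x :: "'a::euclidean_space"
  assumes t: "0 < t"
  shows "(LINT \<xi>|lborel. cis (2 * pi * (a \<bullet> \<xi>)) * of_real (exp (- (4 * pi\<^sup>2 * t * (norm \<xi>)\<^sup>2))) * cis (- (2 * pi * (\<xi> \<bullet> x))))
    = of_real (heat t (x - a))"
proof -
  have "(LINT \<xi>|lborel. cis (2 * pi * (a \<bullet> \<xi>)) * of_real (exp (- (4 * pi\<^sup>2 * t * (norm \<xi>)\<^sup>2))) * cis (- (2 * pi * (\<xi> \<bullet> x))))
    = (LINT \<xi>|lborel. complex_of_real (exp (- ((4 * pi\<^sup>2 * t) * (norm \<xi>)\<^sup>2))) * cis (\<xi> \<bullet> ((2 * pi) *\<^sub>R (a - x))))"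
  proof (intro Bochner_Integration.integral_cong refl)
    fix \<xi> :: 'a
    have "cis (2 * pi * (a \<bullet> \<xi>)) * cis (- (2 * pi * (\<xi> \<bullet> x))) = cis (\<xi> \<bullet> ((2 * pi) *\<^sub>R (a - x)))"
      by (simp add: cis_mult inner_diff_right inner_commute right_diff_distrib)
    then show "cis (2 * pi * (a \<bullet> \<xi>)) * of_real (exp (- (4 * pi\<^sup>2 * t * (norm \<xi>)\<^sup>2))) * cis (- (2 * pi * (\<xi> \<bullet> x)))
      = complex_of_real (exp (- ((4 * pi\<^sup>2 * t) * (norm \<xi>)\<^sup>2))) * cis (\<xi> \<bullet> ((2 * pi) *\<^sub>R (a - x)))"
      by (simp add: mult.commute mult.left_commute)
  qed
  also have "\<dots> = of_real ((pi / (4 * pi\<^sup>2 * t)) powr (real DIM('a) / 2) * exp (- ((norm ((2 * pi) *\<^sub>R (a - x)))\<^sup>2 / (4 * (4 * pi\<^sup>2 * t)))))"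
    using t by (intro gauss_fourier) simp
  also have "pi / (4 * pi\<^sup>2 * t) = inverse (4 * pi * t)" using t by (simp add: power2_eq_square field_simps)
  also have "(norm ((2 * pi) *\<^sub>R (a - x)))\<^sup>2 / (4 * (4 * pi\<^sup>2 * t)) = 1 / (4 * t) * (norm (x - a))\<^sup>2"
    using t by (simp add: power_mult_distrib norm_minus_commute)
  also have "inverse (4 * pi * t) powr (real DIM('a) / 2) = (4 * pi * t) powr (- (real DIM('a) / 2))"
    using t by (subst inverse_powr) (auto simp: powr_minus)
  finally show ?thesis by (simp only: heat_def)
qed

lemma heat_nn_integral:
  assumes t: "0 < t"
  shows "integrable lborel (\<lambda>x::'a::euclidean_space. heat t (x - a))"
    and "(\<integral>\<^sup>+x. ennreal (heat t (x - a)) \<partial>lborel) = 1"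
proof -
  show i: "integrable lborel (\<lambda>x::'a. heat t (x - a))"
    unfolding heat_def using lborel_integrable_affine_translate[OF integrable_exp_norm[of "1 / (4 * t)"], of "- a"] t by simp
  \<comment> \<open>The total mass is the Fourier transform at frequency 0.\<close>
  have "complex_of_real (LINT x|lborel. heat t (x - a)) = 1"
    using heat_fourier[OF t, of a 0] by (simp add: cis_zero integral_complex_of_real[symmetric] del: integral_complex_of_real)
  then have "(LINT x|lborel. heat t (x - a)) = 1" by (metis of_real_eq_1_iff)
  then show "(\<integral>\<^sup>+x. ennreal (heat t (x - a)) \<partial>lborel) = 1"
    by (subst nn_integral_eq_integral[OF i]) auto
qed

text \<open>In closed form this is Gamma (s / 2) / 2.\<close>

definition bessel_mass :: "real \<Rightarrow> real" where
  "bessel_mass s = (LINT t|lborel. indicator {0<..} t * bessel_weight s t)"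

text \<open>On (0, 1) the factor exp (-t^2) is at least 1 / e. This growth like 1 / s is what makes
  the final constant uniform as s tends to 0.\<close>

lemma bessel_mass_ge:
  assumes s: "0 < s" "s < 1"
  shows "1 / (exp 1 * s) \<le> bessel_mass s"
proof -
  have "ennreal (1 / (exp 1 * s)) = ennreal (exp (- 1)) * ennreal (1 powr s / s)"
    using s by (subst ennreal_mult[symmetric]) (auto simp: exp_minus divide_inverse)
  also have "\<dots> = ennreal (exp (- 1)) * (\<integral>\<^sup>+t. ennreal (t powr (s - 1)) * indicator {0<..<1} t \<partial>lborel)"
    using s by (simp add: nn_integral_powr_from_0)
  also have "\<dots> = (\<integral>\<^sup>+t. ennreal (exp (- 1)) * (ennreal (t powr (s - 1)) * indicator {0<..<1} t) \<partial>lborel)"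
    by (rule nn_integral_cmult[symmetric]) measurable
  also have "\<dots> \<le> (\<integral>\<^sup>+t. ennreal (indicator {0<..} t * bessel_weight s t) \<partial>lborel)"
  proof (rule nn_integral_mono)
    fix t :: real
    have "exp (- 1) * t powr (s - 1) \<le> bessel_weight s t" if "0 < t" "t < 1"
    proof -
      have "t\<^sup>2 \<le> 1" using that by (intro power_le_one) auto
      then have "exp (- 1) \<le> exp (- t\<^sup>2)" by simp
      then show ?thesis unfolding bessel_weight_def mult.commute[of _ "exp (- t\<^sup>2)"] by (intro mult_right_mono) auto
    qed
    then show "ennreal (exp (- 1)) * (ennreal (t powr (s - 1)) * indicator {0<..<1} t) \<le> ennreal (indicator {0<..} t * bessel_weight s t)"
      by (auto simp: indicator_def ennreal_leI simp flip: ennreal_mult)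
  qed
  also have "\<dots> = ennreal (bessel_mass s)"
    unfolding bessel_mass_def using integrable_bessel_weight[OF s] by (intro nn_integral_eq_integral) auto
  finally show ?thesis
    unfolding bessel_mass_def by (subst (asm) ennreal_le_iff) (auto intro!: integral_nonneg_AE)
qed

lemma bessel_mass_pos: "0 < s \<Longrightarrow> s < 1 \<Longrightarrow> 0 < bessel_mass s"
  by (rule less_le_trans[OF _ bessel_mass_ge]) auto

text \<open>The substitution t to sqrt c t. With c = 1 + 4 pi^2 |\<xi>|^2 it exhibits the reciprocal
  of the symbol as a superposition of Gaussians in \<xi>.\<close>

lemma bessel_weight_scale:
  assumes s: "0 < s" "s < 1" and c: "0 < c"
  shows "integrable lborel (\<lambda>t. indicator {0<..} t * (t powr (s - 1) * exp (- (c * t\<^sup>2))))"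
    and "(LINT t|lborel. indicator {0<..} t * (t powr (s - 1) * exp (- (c * t\<^sup>2)))) = c powr (- (s / 2)) * bessel_mass s"
proof -
  let ?f = "\<lambda>t. indicator {0<..} t * bessel_weight s t" and ?g = "\<lambda>t. indicator {0<..} t * (t powr (s - 1) * exp (- (c * t\<^sup>2)))"
  have eq: "?f (0 + sqrt c * t) = c powr ((s - 1) / 2) * ?g t" for t
  proof (cases "0 < t")
    case True
    then have "(sqrt c * t) powr (s - 1) = c powr ((s - 1) / 2) * t powr (s - 1)"
      using c by (simp add: powr_mult powr_half_sqrt[symmetric] powr_powr)
    then show ?thesis using True c by (simp add: bessel_weight_def power_mult_distrib)
  next
    case False
    then have "\<not> 0 < sqrt c * t" using c by (simp add: zero_less_mult_iff)
    then show ?thesis using False by simp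
  qed
  have "integrable lborel (\<lambda>t. ?f (0 + sqrt c * t))"
    using c by (intro lborel_integrable_real_affine integrable_bessel_weight s) auto
  then have "integrable lborel (\<lambda>t. c powr ((s - 1) / 2) * ?g t)" unfolding eq .
  then have "integrable lborel (\<lambda>t. inverse (c powr ((s - 1) / 2)) * (c powr ((s - 1) / 2) * ?g t))"
    by (rule integrable_mult_right)
  then show i: "integrable lborel ?g" unfolding mult.assoc[symmetric, of "inverse (c powr ((s - 1) / 2))"] using c by simp
  have "bessel_mass s = \<bar>sqrt c\<bar> *\<^sub>R (LINT t|lborel. ?f (0 + sqrt c * t))"
    unfolding bessel_mass_def using c by (intro lborel_integral_real_affine) simp
  also have "\<dots> = (sqrt c * c powr ((s - 1) / 2)) * (LINT t|lborel. ?g t)"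
    unfolding eq using c by simp
  also have "sqrt c * c powr ((s - 1) / 2) = c powr (s / 2)"
    using c by (simp add: powr_half_sqrt[symmetric] diff_divide_distrib flip: powr_add)
  finally show "(LINT t|lborel. ?g t) = c powr (- (s / 2)) * bessel_mass s"
    using c by (simp add: powr_minus)
qed

text \<open>The potential of order \<open>s\<close> of the heat kernel at time \<tau> centred at
  \<open>a\<close>, written by the semigroup law as a superposition of heat kernels at later
  times.\<close>

definition bessel_test :: "real \<Rightarrow> real \<Rightarrow> 'a::euclidean_space \<Rightarrow> 'a \<Rightarrow> real" where
  "bessel_test s \<tau> a x = (LINT t|lborel. indicator {0<..} t * bessel_weight s t * heat (\<tau> + t\<^sup>2) (x - a)) / bessel_mass s"

lemma heat_schwartz:
  fixes a :: "'a::euclidean_space"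
  assumes t: "0 < t"
  shows "(\<lambda>x. complex_of_real (heat t (x - a))) \<in> schwartz"
proof -
  \<comment> \<open>A single Gaussian is a mixture over a one-point space.\<close>
  let ?M = "count_space (UNIV :: unit set)"
  have "(\<lambda>x. complex_of_real (gauss_mix ?M (\<lambda>_. (4 * pi * t) powr (- (real DIM('a) / 2))) (\<lambda>_. 1 / (4 * t)) 0 a x)) \<in> schwartz"
    using t by (intro gauss_mix_schwartz[where B = "1 / (4 * t)"]) (auto intro: integrable_count_space)
  then show ?thesis by (simp add: gauss_mix_def heat_def lebesgue_integral_count_space_finite)
qed

text \<open>A mixture with 1 / \<sigma> = 4 (\<tau> + t^2). Positivity of \<tau> bounds \<sigma>
  from above, and the moments, polynomial in t, are paid for by half of the exponent in exp
  (-t^2).\<close>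

lemma bessel_test_schwartz:
  fixes a :: "'a::euclidean_space"
  assumes s: "0 < s" "s < 1" and \<tau>: "0 < \<tau>"
  shows "(\<lambda>x. complex_of_real (bessel_test s \<tau> a x)) \<in> schwartz"
proof -
  define \<omega> where "\<omega> t = indicator {0<..} t * bessel_weight s t * (4 * pi * (\<tau> + t\<^sup>2)) powr (- (real DIM('a) / 2)) / bessel_mass s" for t
  define \<sigma> where "\<sigma> t = 1 / (4 * (\<tau> + t\<^sup>2))" for t :: real
  have m: "0 < bessel_mass s" by (rule bessel_mass_pos[OF s])
  have p: "0 < \<tau> + t\<^sup>2" for t using \<tau> by (intro add_pos_nonneg) auto
  have [measurable]: "\<omega> \<in> borel_measurable lborel" "\<sigma> \<in> borel_measurable lborel"
    unfolding \<omega>_def[abs_def] \<sigma>_def[abs_def] by measurable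
  have "(\<lambda>x. complex_of_real (gauss_mix lborel \<omega> \<sigma> 0 a x)) \<in> schwartz"
  proof (rule gauss_mix_schwartz[where B = "1 / (4 * \<tau>)"])
    show "0 \<le> \<omega> t" for t using m by (simp add: \<omega>_def)
    show "0 < \<sigma> t" for t using p[of t] by (simp add: \<sigma>_def)
    show "\<sigma> t \<le> 1 / (4 * \<tau>)" for t unfolding \<sigma>_def using \<tau> p[of t] by (intro divide_left_mono mult_pos_pos) auto
    fix j
    \<comment> \<open>Three sources: the prefactor of the heat kernel, largest at t = 0; the
      estimate 1 + 1 / \<sigma> \<le> (5 + 4 \<tau>) (1 + t)^2; and the bound for (1 + t)^(2 j) exp
      (-t^2 / 2) from \<open>power_times_gauss_bound\<close>.\<close>
    define A where "A = (4 * pi * \<tau>) powr (- (real DIM('a) / 2)) / bessel_mass s * ((5 + 4 * \<tau>) ^ j * (fact (2 * j) * exp 2))"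
    have A: "0 \<le> A" using m \<tau> by (simp add: A_def)
    show "integrable lborel (\<lambda>t. \<omega> t * (1 + 1 / \<sigma> t) ^ j)"
    proof (rule Bochner_Integration.integrable_bound)
      show "integrable lborel (\<lambda>t. A * (indicator {0<..} t * (t powr (s - 1) * exp (- (1 / 2 * t\<^sup>2)))))"
        by (intro integrable_mult_right bessel_weight_scale s) simp
      show "AE t in lborel. norm (\<omega> t * (1 + 1 / \<sigma> t) ^ j) \<le> norm (A * (indicator {0<..} t * (t powr (s - 1) * exp (- (1 / 2 * t\<^sup>2)))))"
      proof (rule AE_I2)
        fix t :: real
        show "norm (\<omega> t * (1 + 1 / \<sigma> t) ^ j) \<le> norm (A * (indicator {0<..} t * (t powr (s - 1) * exp (- (1 / 2 * t\<^sup>2)))))"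
        proof (cases "0 < t")
          case True
          have "1 + 1 / \<sigma> t \<le> (5 + 4 * \<tau>) * (1 + t)\<^sup>2"
          proof -
            have "1 + 1 / \<sigma> t = 1 + 4 * \<tau> + 4 * t\<^sup>2" by (simp add: \<sigma>_def)
            also have "\<dots> \<le> (5 + 4 * \<tau>) * (1 + 2 * t + t\<^sup>2)"
              using True \<tau> by (simp add: algebra_simps add_nonneg_nonneg)
            finally show ?thesis by (simp add: power2_sum algebra_simps)
          qed
          then have "(1 + 1 / \<sigma> t) ^ j \<le> ((5 + 4 * \<tau>) * (1 + t)\<^sup>2) ^ j"
            using p[of t] by (intro power_mono) (auto simp: \<sigma>_def)
          also have "\<dots> = (5 + 4 * \<tau>) ^ j * (1 + t) ^ (2 * j)" by (simp add: power_mult_distrib power_mult)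
          finally have j1: "(1 + 1 / \<sigma> t) ^ j \<le> (5 + 4 * \<tau>) ^ j * (1 + t) ^ (2 * j)" .
          have "(1 + t) ^ (2 * j) * exp (- (1 / 2 * t\<^sup>2)) \<le> (1 + t) ^ (2 * j) * exp (- t\<^sup>2 / 4)"
            using True by (intro mult_left_mono) auto
          also have "\<dots> \<le> fact (2 * j) * exp 2" using True by (intro power_times_gauss_bound) simp
          finally have j2: "(1 + t) ^ (2 * j) * exp (- (1 / 2 * t\<^sup>2)) \<le> fact (2 * j) * exp 2" .
          have "exp (- t\<^sup>2) * (1 + 1 / \<sigma> t) ^ j \<le> exp (- t\<^sup>2) * ((5 + 4 * \<tau>) ^ j * (1 + t) ^ (2 * j))"
            by (intro mult_left_mono j1) simp
          also have "\<dots> = (5 + 4 * \<tau>) ^ j * ((1 + t) ^ (2 * j) * exp (- (1 / 2 * t\<^sup>2))) * exp (- (1 / 2 * t\<^sup>2))"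
            by (simp add: mult_ac flip: exp_add)
          also have "\<dots> \<le> (5 + 4 * \<tau>) ^ j * (fact (2 * j) * exp 2) * exp (- (1 / 2 * t\<^sup>2))"
            using \<tau> by (intro mult_right_mono mult_left_mono j2) auto
          finally have j3: "exp (- t\<^sup>2) * (1 + 1 / \<sigma> t) ^ j \<le> (5 + 4 * \<tau>) ^ j * (fact (2 * j) * exp 2) * exp (- (1 / 2 * t\<^sup>2))" .
          have j4: "(4 * pi * (\<tau> + t\<^sup>2)) powr (- (real DIM('a) / 2)) \<le> (4 * pi * \<tau>) powr (- (real DIM('a) / 2))"
            using \<tau> by (intro powr_mono2') auto
          have "\<omega> t * (1 + 1 / \<sigma> t) ^ j = t powr (s - 1) / bessel_mass s * ((4 * pi * (\<tau> + t\<^sup>2)) powr (- (real DIM('a) / 2)) * (exp (- t\<^sup>2) * (1 + 1 / \<sigma> t) ^ j))"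
            using True by (simp add: \<omega>_def bessel_weight_def)
          also have "\<dots> \<le> t powr (s - 1) / bessel_mass s * ((4 * pi * \<tau>) powr (- (real DIM('a) / 2)) * ((5 + 4 * \<tau>) ^ j * (fact (2 * j) * exp 2) * exp (- (1 / 2 * t\<^sup>2))))"
            using m p[of t] by (intro mult_left_mono mult_mono j3 j4) (auto simp: \<sigma>_def)
          also have "\<dots> = A * (indicator {0<..} t * (t powr (s - 1) * exp (- (1 / 2 * t\<^sup>2))))"
            using True by (simp add: A_def)
          finally have "\<omega> t * (1 + 1 / \<sigma> t) ^ j \<le> A * (indicator {0<..} t * (t powr (s - 1) * exp (- (1 / 2 * t\<^sup>2))))" .
          moreover have "0 \<le> \<omega> t * (1 + 1 / \<sigma> t) ^ j" using m p[of t] by (auto simp: \<omega>_def \<sigma>_def)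
          ultimately show ?thesis by simp
        qed (simp add: \<omega>_def)
      qed
    qed measurable
  qed measurable
  moreover have "gauss_mix lborel \<omega> \<sigma> 0 a x = bessel_test s \<tau> a x" for x
    unfolding gauss_mix_def bessel_test_def integral_divide_zero[symmetric]
    by (intro Bochner_Integration.integral_cong refl) (simp add: \<omega>_def \<sigma>_def heat_def)
  ultimately show ?thesis by simp
qed

lemma bessel_test_measurable [measurable]: "bessel_test s \<tau> a \<in> borel_measurable borel"
  unfolding bessel_test_def[abs_def] by measurable

text \<open>Fubini and the transform of the heat kernel leave the weight t^(s - 1) exp (-(1 + 4 pi^2
  |\<xi>|^2) t^2), which \<open>bessel_weight_scale\<close> integrates to the reciprocal
  symbol.\<close>

lemma bessel_test_fourier:
  fixes a \<xi> :: "'a::euclidean_space"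
  assumes s: "0 < s" "s < 1" and \<tau>: "0 < \<tau>"
  shows "(LINT x|lborel. complex_of_real (bessel_test s \<tau> a x) * cis (2 * pi * (x \<bullet> \<xi>)))
    = of_real ((1 + 4 * pi\<^sup>2 * (norm \<xi>)\<^sup>2) powr (- (s / 2))) * (cis (2 * pi * (a \<bullet> \<xi>)) * of_real (exp (- (4 * pi\<^sup>2 * \<tau> * (norm \<xi>)\<^sup>2))))"
proof -
  have m: "0 < bessel_mass s" by (rule bessel_mass_pos[OF s])
  have p: "0 < \<tau> + t\<^sup>2" for t using \<tau> by (intro add_pos_nonneg) auto
  let ?w = "\<lambda>t. indicator {0<..} t * bessel_weight s t"
  let ?F = "\<lambda>x t. complex_of_real (?w t) * (of_real (heat (\<tau> + t\<^sup>2) (x - a)) * cis (2 * pi * (x \<bullet> \<xi>)))"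
  have [measurable]: "(\<lambda>(x, t). ?F x t) \<in> borel_measurable (lborel \<Otimes>\<^sub>M lborel)"
    unfolding cis_conv_exp split_beta' by measurable
  have "(\<integral>\<^sup>+x. \<integral>\<^sup>+t. ennreal (norm (?F x t)) \<partial>lborel \<partial>lborel) = (\<integral>\<^sup>+t. \<integral>\<^sup>+x. ennreal (?w t) * ennreal (heat (\<tau> + t\<^sup>2) (x - a)) \<partial>lborel \<partial>lborel)"
    by (subst lborel_pair.Fubini') (auto simp: norm_mult split_beta' simp flip: ennreal_mult)
  also have "\<dots> = (\<integral>\<^sup>+t. ennreal (?w t) \<partial>lborel)"
  proof (rule nn_integral_cong)
    fix t
    have "(\<integral>\<^sup>+x. ennreal (?w t) * ennreal (heat (\<tau> + t\<^sup>2) (x - a)) \<partial>lborel) = ennreal (?w t) * (\<integral>\<^sup>+x. ennreal (heat (\<tau> + t\<^sup>2) (x - a)) \<partial>lborel)"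
      by (rule nn_integral_cmult) measurable
    then show "(\<integral>\<^sup>+x. ennreal (?w t) * ennreal (heat (\<tau> + t\<^sup>2) (x - a)) \<partial>lborel) = ennreal (?w t)"
      by (simp only: heat_nn_integral(2)[OF p] mult_1_right)
  qed
  also have "\<dots> < \<infinity>" using integrable_bessel_weight[OF s] by (simp add: integrable_iff_bounded abs_mult)
  finally have fin: "(\<integral>\<^sup>+x. \<integral>\<^sup>+t. ennreal (norm (?F x t)) \<partial>lborel \<partial>lborel) < \<infinity>" .
  have "(LINT x|lborel. complex_of_real (bessel_test s \<tau> a x) * cis (2 * pi * (x \<bullet> \<xi>))) = (LINT x|lborel. (LINT t|lborel. ?F x t) / of_real (bessel_mass s))"
  proof (intro Bochner_Integration.integral_cong refl)
    fix x
    have "(LINT t|lborel. ?F x t) = (LINT t|lborel. complex_of_real (?w t * heat (\<tau> + t\<^sup>2) (x - a)) * cis (2 * pi * (x \<bullet> \<xi>)))"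
      by (intro Bochner_Integration.integral_cong) auto
    also have "\<dots> = of_real (LINT t|lborel. ?w t * heat (\<tau> + t\<^sup>2) (x - a)) * cis (2 * pi * (x \<bullet> \<xi>))"
      by (simp only: integral_mult_left_zero integral_complex_of_real)
    finally show "complex_of_real (bessel_test s \<tau> a x) * cis (2 * pi * (x \<bullet> \<xi>)) = (LINT t|lborel. ?F x t) / of_real (bessel_mass s)"
      by (simp add: bessel_test_def)
  qed
  also have "\<dots> = (LINT t|lborel. LINT x|lborel. ?F x t) / of_real (bessel_mass s)"
  proof -
    have "(LINT x|lborel. LINT t|lborel. ?F x t) = (LINT t|lborel. LINT x|lborel. ?F x t)"
      by (rule lborel_Fubini_swap[OF _ fin]) fact
    then show ?thesis unfolding integral_divide_zero by simp
  qed
  also have "(LINT t|lborel. LINT x|lborel. ?F x t) = (LINT t|lborel. (cis (2 * pi * (a \<bullet> \<xi>)) * of_real (exp (- (4 * pi\<^sup>2 * \<tau> * (norm \<xi>)\<^sup>2)))) *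
      of_real (indicator {0<..} t * (t powr (s - 1) * exp (- ((1 + 4 * pi\<^sup>2 * (norm \<xi>)\<^sup>2) * t\<^sup>2)))))"
  proof (intro Bochner_Integration.integral_cong refl)
    fix t
    have "(LINT x|lborel. ?F x t) = complex_of_real (?w t) * (cis (2 * pi * (a \<bullet> \<xi>)) * of_real (exp (- (4 * pi\<^sup>2 * (\<tau> + t\<^sup>2) * (norm \<xi>)\<^sup>2))))"
      unfolding integral_mult_right_zero heat_fourier[OF p] ..
    moreover have "exp (- t\<^sup>2) * exp (- (4 * pi\<^sup>2 * (\<tau> + t\<^sup>2) * (norm \<xi>)\<^sup>2)) = exp (- (4 * pi\<^sup>2 * \<tau> * (norm \<xi>)\<^sup>2)) * exp (- ((1 + 4 * pi\<^sup>2 * (norm \<xi>)\<^sup>2) * t\<^sup>2))"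
      unfolding exp_add[symmetric] by (simp add: algebra_simps)
    then have "?w t * exp (- (4 * pi\<^sup>2 * (\<tau> + t\<^sup>2) * (norm \<xi>)\<^sup>2)) = exp (- (4 * pi\<^sup>2 * \<tau> * (norm \<xi>)\<^sup>2)) * (indicator {0<..} t * (t powr (s - 1) * exp (- ((1 + 4 * pi\<^sup>2 * (norm \<xi>)\<^sup>2) * t\<^sup>2))))"
      unfolding bessel_weight_def by (simp only: mult.assoc) (simp only: mult_ac)
    then have "complex_of_real (?w t) * of_real (exp (- (4 * pi\<^sup>2 * (\<tau> + t\<^sup>2) * (norm \<xi>)\<^sup>2))) = of_real (exp (- (4 * pi\<^sup>2 * \<tau> * (norm \<xi>)\<^sup>2))) * of_real (indicator {0<..} t * (t powr (s - 1) * exp (- ((1 + 4 * pi\<^sup>2 * (norm \<xi>)\<^sup>2) * t\<^sup>2))))"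
      by (simp only: of_real_mult[symmetric])
    ultimately show "(LINT x|lborel. ?F x t) = (cis (2 * pi * (a \<bullet> \<xi>)) * of_real (exp (- (4 * pi\<^sup>2 * \<tau> * (norm \<xi>)\<^sup>2)))) *
      of_real (indicator {0<..} t * (t powr (s - 1) * exp (- ((1 + 4 * pi\<^sup>2 * (norm \<xi>)\<^sup>2) * t\<^sup>2))))"
      by (simp only: mult.assoc mult.left_commute[of "complex_of_real (?w t)"])
  qed
  also have "\<dots> = (cis (2 * pi * (a \<bullet> \<xi>)) * of_real (exp (- (4 * pi\<^sup>2 * \<tau> * (norm \<xi>)\<^sup>2)))) *
      of_real ((1 + 4 * pi\<^sup>2 * (norm \<xi>)\<^sup>2) powr (- (s / 2)) * bessel_mass s)"
  proof -
    have "0 < 1 + 4 * pi\<^sup>2 * (norm \<xi>)\<^sup>2" by (intro add_pos_nonneg) auto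
    then show ?thesis
      unfolding integral_mult_right_zero integral_complex_of_real by (subst bessel_weight_scale(2)[OF s]) simp_all
  qed
  finally show ?thesis using m by (simp add: mult_ac)
qed

lemma borel_measurable_cis [measurable]: "cis \<in> borel_measurable borel"
  by (intro borel_measurable_continuous_onI continuous_on_cis continuous_on_id)

text \<open>An identity between test functions: by definition the operator acts on its argument,
  where the symbol cancels against the transform of \<open>bessel_test\<close>. The Gaussian that is
  left is transformed into the heat kernel.\<close>

lemma bessel_multiplier_test:
  fixes a :: "'a::euclidean_space"
  assumes s: "0 < s" "s < 1" and \<tau>: "0 < \<tau>"
  shows "bessel_op s U (\<lambda>x. complex_of_real (bessel_test s \<tau> a x)) = U (\<lambda>x. complex_of_real (heat \<tau> (x - a)))"
proof -
  let ?m = "\<lambda>\<xi>::'a. complex_of_real ((1 + 4 * pi\<^sup>2 * (norm \<xi>)\<^sup>2) powr (s / 2))"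
  let ?e = "\<lambda>\<xi>::'a. cis (2 * pi * (a \<bullet> \<xi>)) * complex_of_real (exp (- (4 * pi\<^sup>2 * \<tau> * (norm \<xi>)\<^sup>2)))"
  let ?\<phi> = "\<lambda>x. complex_of_real (bessel_test s \<tau> a x)"
  have "inv_fourier ?\<phi> \<xi> = of_real ((1 + 4 * pi\<^sup>2 * (norm \<xi>)\<^sup>2) powr (- (s / 2))) * ?e \<xi>" for \<xi>
  proof -
    have "inv_fourier ?\<phi> \<xi> = (LINT x|lborel. ?\<phi> x * cis (2 * pi * (x \<bullet> \<xi>)))"
      unfolding inv_fourier_def inner_commute[of \<xi>] by (rule integral_completion) measurable
    then show ?thesis using bessel_test_fourier[OF s \<tau>] by simp
  qed
  then have "?m \<xi> * inv_fourier ?\<phi> \<xi> = ?e \<xi>" for \<xi>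
  proof -
    have "0 < 1 + 4 * pi\<^sup>2 * (norm \<xi>)\<^sup>2" by (intro add_pos_nonneg) auto
    then have "(1 + 4 * pi\<^sup>2 * (norm \<xi>)\<^sup>2) powr (s / 2) * (1 + 4 * pi\<^sup>2 * (norm \<xi>)\<^sup>2) powr (- (s / 2)) = 1"
      by (simp flip: powr_add)
    then have "?m \<xi> * of_real ((1 + 4 * pi\<^sup>2 * (norm \<xi>)\<^sup>2) powr (- (s / 2))) = 1" by (metis of_real_1 of_real_mult)
    then show "(\<And>\<xi>. inv_fourier ?\<phi> \<xi> = of_real ((1 + 4 * pi\<^sup>2 * (norm \<xi>)\<^sup>2) powr (- (s / 2))) * ?e \<xi>) \<Longrightarrow> ?thesis"
      by (simp only: mult.assoc[symmetric]) simp
  qed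
  then have "bessel_op s U ?\<phi> = U (fourier ?e)"
    unfolding bessel_op_def fourier_multiplier_def distr_inv_fourier_def distr_mult_def distr_fourier_def by simp
  also have "fourier ?e = (\<lambda>x. complex_of_real (heat \<tau> (x - a)))"
  proof
    fix x
    have "fourier ?e x = (LINT \<xi>|lborel. ?e \<xi> * cis (- (2 * pi * (\<xi> \<bullet> x))))"
      unfolding fourier_def by (rule integral_completion) measurable
    then show "fourier ?e x = complex_of_real (heat \<tau> (x - a))" using heat_inv_fourier[OF \<tau>, of a x] by simp
  qed
  finally show ?thesis .
qed

section \<open>Bessel potentials as superpositions of heat kernels\<close>

text \<open>The semigroup law for the times \<tau> and t^2. Completing the square in v isolates a
  heat kernel in v of time \<tau> / (\<tau> + t^2), whose total mass is 1.\<close>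

lemma gauss_heat_convolution:
  fixes b :: "'a::euclidean_space"
  assumes \<tau>: "0 < \<tau>"
  shows "(\<integral>\<^sup>+v. ennreal (gauss v * heat \<tau> (b + t *\<^sub>R v)) \<partial>lborel)
    = ennreal ((4 * pi) powr (real DIM('a) / 2) * heat (\<tau> + t\<^sup>2) b)"
proof -
  define q where "q = \<tau> + t\<^sup>2"
  define c where "c = - ((t / q) *\<^sub>R b)"
  let ?d = "real DIM('a) / 2"
  have q: "0 < q" using \<tau> by (auto simp: q_def intro: add_pos_nonneg)
  \<comment> \<open>The completed square, with A, B and C standing for |v|^2, |b|^2 and the inner
    product of v and b.\<close>
  have sq: "1 / 4 * A + 1 / (4 * \<tau>) * (B + 2 * t * C + t\<^sup>2 * A) = 1 / (4 * q) * B + 1 / (4 * (\<tau> / q)) * (A + 2 * (t / q) * C + (t / q)\<^sup>2 * B)"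
    for A B C :: real
  proof -
    have "1 / (4 * q) * B + 1 / (4 * (\<tau> / q)) * (A + 2 * (t / q) * C + (t / q)\<^sup>2 * B)
      = (q / (4 * \<tau>)) * A + (t / (2 * \<tau>)) * C + ((\<tau> + t\<^sup>2) / (4 * \<tau> * q)) * B"
      using q \<tau> by (simp add: field_simps power2_eq_square)
    also have "(\<tau> + t\<^sup>2) / (4 * \<tau> * q) = 1 / (4 * \<tau>)" using q by (simp flip: q_def)
    also have "q / (4 * \<tau>) = 1 / 4 + t\<^sup>2 / (4 * \<tau>)" using \<tau> by (simp add: q_def field_simps)
    finally show ?thesis using \<tau> by (simp add: algebra_simps)
  qed
  have "gauss v * heat \<tau> (b + t *\<^sub>R v) = (4 * pi) powr ?d * heat q b * heat (\<tau> / q) (v - c)" for v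
  proof -
    have "(norm (b + t *\<^sub>R v))\<^sup>2 = b \<bullet> b + 2 * t * (v \<bullet> b) + t\<^sup>2 * (v \<bullet> v)"
      unfolding power2_norm_eq_inner by (simp add: inner_add_left inner_add_right inner_commute power2_eq_square algebra_simps)
    moreover have "(norm (v - c))\<^sup>2 = v \<bullet> v + 2 * (t / q) * (v \<bullet> b) + (t / q)\<^sup>2 * (b \<bullet> b)"
      unfolding power2_norm_eq_inner by (simp add: c_def inner_add_left inner_add_right inner_commute power2_eq_square algebra_simps)
    ultimately have e: "exp (- (norm v)\<^sup>2 / 4) * exp (- (1 / (4 * \<tau>) * (norm (b + t *\<^sub>R v))\<^sup>2))
      = exp (- (1 / (4 * q) * (norm b)\<^sup>2)) * exp (- (1 / (4 * (\<tau> / q)) * (norm (v - c))\<^sup>2))"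
      using sq[of "v \<bullet> v" "b \<bullet> b" "v \<bullet> b"] unfolding exp_add[symmetric] by (simp add: power2_norm_eq_inner)
    have QS: "(4 * pi * q) powr (- ?d) * (4 * pi * (\<tau> / q)) powr (- ?d) = (4 * pi) powr (- ?d) * (4 * pi * \<tau>) powr (- ?d)"
      using q \<tau> by (simp flip: powr_mult)
    have P: "(4 * pi) powr ?d * (4 * pi) powr (- ?d) = 1" by (simp flip: powr_add)
    have *: "E1 * (T * E2) = P * (Q * F1) * (S * F2)" if "Q * S = P' * T" "P * P' = 1" "E1 * E2 = F1 * F2" for E1 E2 F1 F2 P P' Q S T :: real
    proof -
      have "P * (Q * F1) * (S * F2) = P * (Q * S) * (F1 * F2)" by (simp only: mult_ac)
      also have "\<dots> = (P * P') * (T * (E1 * E2))" unfolding that(1) that(3) by (simp only: mult_ac)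
      finally show ?thesis unfolding that(2) by (simp only: mult_ac mult_1_left)
    qed
    show ?thesis unfolding gauss_def heat_def by (rule *[OF QS P e])
  qed
  then have "(\<integral>\<^sup>+v. ennreal (gauss v * heat \<tau> (b + t *\<^sub>R v)) \<partial>lborel)
    = (\<integral>\<^sup>+v. ennreal ((4 * pi) powr ?d * heat q b) * ennreal (heat (\<tau> / q) (v - c)) \<partial>lborel)"
    by (simp add: ennreal_mult)
  also have "\<dots> = ennreal ((4 * pi) powr ?d * heat q b) * (\<integral>\<^sup>+v. ennreal (heat (\<tau> / q) (v - c)) \<partial>lborel)"
    by (rule nn_integral_cmult) measurable
  finally show ?thesis using heat_nn_integral(2)[of "\<tau> / q" c] q \<tau> by (simp add: q_def)
qed

lemma bessel_kernel_heat:
  fixes a y :: "'a::euclidean_space"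
  assumes s: "0 < s" "s < 1" and \<tau>: "0 < \<tau>"
  shows "(\<integral>\<^sup>+z. ennreal (bessel_kernel s z * heat \<tau> (y - a + fst z *\<^sub>R snd z)) \<partial>(lborel \<Otimes>\<^sub>M lborel))
    = ennreal ((4 * pi) powr (real DIM('a) / 2) * bessel_mass s * bessel_test s \<tau> a y)"
proof -
  let ?\<kappa> = "(4 * pi) powr (real DIM('a) / 2)" and ?w = "\<lambda>t. indicator {0<..} t * bessel_weight s t"
  have i: "integrable lborel (\<lambda>t. ?w t * heat (\<tau> + t\<^sup>2) (y - a))"
  proof (rule Bochner_Integration.integrable_bound)
    show "integrable lborel (\<lambda>t. ?w t * (4 * pi * \<tau>) powr (- (real DIM('a) / 2)))"
      by (intro integrable_mult_left integrable_bessel_weight s)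
    show "AE t in lborel. norm (?w t * heat (\<tau> + t\<^sup>2) (y - a)) \<le> norm (?w t * (4 * pi * \<tau>) powr (- (real DIM('a) / 2)))"
    proof (rule AE_I2)
      fix t :: real
      have "(4 * pi * (\<tau> + t\<^sup>2)) powr (- (real DIM('a) / 2)) \<le> (4 * pi * \<tau>) powr (- (real DIM('a) / 2))"
        using \<tau> by (intro powr_mono2') auto
      then have "heat (\<tau> + t\<^sup>2) (y - a) \<le> (4 * pi * \<tau>) powr (- (real DIM('a) / 2)) * 1"
        unfolding heat_def using \<tau> by (intro mult_mono) (auto intro!: divide_nonneg_nonneg)
      then have "?w t * heat (\<tau> + t\<^sup>2) (y - a) \<le> ?w t * (4 * pi * \<tau>) powr (- (real DIM('a) / 2))"
        by (intro mult_left_mono) auto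
      then show "norm (?w t * heat (\<tau> + t\<^sup>2) (y - a)) \<le> norm (?w t * (4 * pi * \<tau>) powr (- (real DIM('a) / 2)))"
        by (simp add: abs_mult)
    qed
  qed measurable
  have "(\<integral>\<^sup>+z. ennreal (bessel_kernel s z * heat \<tau> (y - a + fst z *\<^sub>R snd z)) \<partial>(lborel \<Otimes>\<^sub>M lborel))
    = (\<integral>\<^sup>+t. \<integral>\<^sup>+v. ennreal (bessel_kernel s (t, v) * heat \<tau> (y - a + t *\<^sub>R v)) \<partial>lborel \<partial>lborel)"
    by (subst lborel.nn_integral_fst[symmetric]) auto
  also have "\<dots> = (\<integral>\<^sup>+t. ennreal (?\<kappa> * (?w t * heat (\<tau> + t\<^sup>2) (y - a))) \<partial>lborel)"
  proof (rule nn_integral_cong)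
    fix t :: real
    have "(\<integral>\<^sup>+v. ennreal (bessel_kernel s (t, v) * heat \<tau> (y - a + t *\<^sub>R v)) \<partial>lborel)
      = (\<integral>\<^sup>+v. ennreal (?w t) * ennreal (gauss v * heat \<tau> (y - a + t *\<^sub>R v)) \<partial>lborel)"
      by (simp add: bessel_kernel_def ennreal_mult mult.assoc)
    also have "\<dots> = ennreal (?w t) * (\<integral>\<^sup>+v. ennreal (gauss v * heat \<tau> (y - a + t *\<^sub>R v)) \<partial>lborel)"
      by (rule nn_integral_cmult) measurable
    also have "\<dots> = ennreal (?\<kappa> * (?w t * heat (\<tau> + t\<^sup>2) (y - a)))"
      unfolding gauss_heat_convolution[OF \<tau>] by (subst ennreal_mult[symmetric]) (auto simp: mult_ac)
    finally show "(\<integral>\<^sup>+v. ennreal (bessel_kernel s (t, v) * heat \<tau> (y - a + t *\<^sub>R v)) \<partial>lborel)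
      = ennreal (?\<kappa> * (?w t * heat (\<tau> + t\<^sup>2) (y - a)))" .
  qed
  also have "\<dots> = ennreal (LINT t|lborel. ?\<kappa> * (?w t * heat (\<tau> + t\<^sup>2) (y - a)))"
    by (intro nn_integral_eq_integral integrable_mult_right i) auto
  also have "(LINT t|lborel. ?\<kappa> * (?w t * heat (\<tau> + t\<^sup>2) (y - a))) = ?\<kappa> * bessel_mass s * bessel_test s \<tau> a y"
    using bessel_mass_pos[OF s] by (simp only: integral_mult_right_zero bessel_test_def) simp
  finally show ?thesis .
qed

lemma bessel_test_nonneg: "0 < s \<Longrightarrow> s < 1 \<Longrightarrow> 0 \<le> bessel_test s \<tau> a x"
  unfolding bessel_test_def using bessel_mass_pos[of s] by (intro divide_nonneg_pos integral_nonneg_AE) auto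

lemma lborel_integral_affine:
  fixes f :: "'a::euclidean_space \<Rightarrow> 'b::{banach, second_countable_topology}"
  assumes [measurable]: "f \<in> borel_measurable borel" and "c \<noteq> 0"
  shows "(LINT x|lborel. f x) = \<bar>c\<bar> ^ DIM('a) *\<^sub>R (LINT v|lborel. f (a + c *\<^sub>R v))"
  by (subst lborel_affine[OF assms(2), of a]) (simp add: integral_density integral_distr)

text \<open>Fubini and a translation move the averaging from \<open>g\<close> onto the heat kernel,
  where it produces \<open>bessel_test\<close>. Integrability against that test function makes the
  double integral absolutely convergent, which also yields the integrability of the left
  side.\<close>

lemma bessel_int_test:
  fixes g :: "'a::euclidean_space \<Rightarrow> complex"
  assumes [measurable]: "g \<in> borel_measurable borel" and s: "0 < s" "s < 1" and \<tau>: "0 < \<tau>"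
    and int: "integrable lborel (\<lambda>x. g x * of_real (bessel_test s \<tau> a x))"
  shows "integrable lborel (\<lambda>x. bessel_int s g x * of_real (heat \<tau> (x - a)))"
    and "(LINT x|lborel. bessel_int s g x * of_real (heat \<tau> (x - a)))
      = of_real ((4 * pi) powr (real DIM('a) / 2) * bessel_mass s) * (LINT x|lborel. g x * of_real (bessel_test s \<tau> a x))"
proof -
  let ?\<kappa> = "(4 * pi) powr (real DIM('a) / 2) * bessel_mass s"
  let ?F = "\<lambda>x (z::real \<times> 'a). (bessel_kernel s z * heat \<tau> (x - a)) *\<^sub>R g (x - fst z *\<^sub>R snd z)"
  let ?G = "\<lambda>x (z::real \<times> 'a). (bessel_kernel s z * heat \<tau> (x - a + fst z *\<^sub>R snd z)) *\<^sub>R g x"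
  have mb: "f \<in> borel_measurable (lborel \<Otimes>\<^sub>M lborel)"
    if "f \<in> borel_measurable (borel \<Otimes>\<^sub>M (borel \<Otimes>\<^sub>M borel))" for f :: "'a \<times> (real \<times> 'a) \<Rightarrow> complex"
  proof -
    have eq: "sets (lborel \<Otimes>\<^sub>M lborel :: ('a \<times> (real \<times> 'a)) measure) = sets (borel \<Otimes>\<^sub>M (borel \<Otimes>\<^sub>M borel))"
      unfolding borel_prod lborel_prod by simp
    from that show ?thesis unfolding measurable_cong_sets[OF eq refl] .
  qed
  have F: "(\<lambda>(x, z). ?F x z) \<in> borel_measurable (lborel \<Otimes>\<^sub>M lborel)" by (rule mb) measurable
  have G: "(\<lambda>(x, z). ?G x z) \<in> borel_measurable (lborel \<Otimes>\<^sub>M lborel)" by (rule mb) measurable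
  note [measurable] = F G
  have nF: "(\<lambda>p. ennreal (norm (?F (fst p) (snd p)))) \<in> borel_measurable (lborel \<Otimes>\<^sub>M lborel)"
    using F unfolding split_beta' by (rule measurable_compose) measurable
  have nG: "(\<lambda>p. ennreal (norm (?G (fst p) (snd p)))) \<in> borel_measurable (lborel \<Otimes>\<^sub>M lborel)"
    using G unfolding split_beta' by (rule measurable_compose) measurable
  have m: "0 \<le> ?\<kappa>" using bessel_mass_pos[OF s] by simp
  \<comment> \<open>Translating x by t v is the change of variables that turns \<open>?F\<close>
    into \<open>?G\<close>.\<close>
  have shift: "?F (fst z *\<^sub>R snd z + x) z = ?G x z" for x z by (simp add: algebra_simps)
  have [measurable]: "?F x \<in> borel_measurable borel" "?G x \<in> borel_measurable borel" for x
    unfolding borel_prod[symmetric] by measurable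
  have finG: "(\<integral>\<^sup>+x. \<integral>\<^sup>+z. ennreal (norm (?G x z)) \<partial>lborel \<partial>lborel) < \<infinity>"
  proof -
    have "(\<integral>\<^sup>+z. ennreal (norm (?G x z)) \<partial>lborel) = ennreal ?\<kappa> * ennreal (norm (g x * of_real (bessel_test s \<tau> a x)))" for x
    proof -
      have "(\<integral>\<^sup>+z. ennreal (norm (?G x z)) \<partial>lborel)
        = (\<integral>\<^sup>+z. ennreal (bessel_kernel s z * heat \<tau> (x - a + fst z *\<^sub>R snd z)) * ennreal (norm (g x)) \<partial>(lborel \<Otimes>\<^sub>M lborel))"
        unfolding lborel_prod by (simp add: ennreal_mult)
      also have "\<dots> = (\<integral>\<^sup>+z. ennreal (bessel_kernel s z * heat \<tau> (x - a + fst z *\<^sub>R snd z)) \<partial>(lborel \<Otimes>\<^sub>M lborel)) * ennreal (norm (g x))"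
        by (rule nn_integral_multc) measurable
      also have "\<dots> = ennreal ?\<kappa> * ennreal (norm (g x * of_real (bessel_test s \<tau> a x)))"
        unfolding bessel_kernel_heat[OF s \<tau>] using m bessel_test_nonneg[OF s, of \<tau> a x]
        by (subst ennreal_mult[symmetric], simp, simp)+ (simp add: norm_mult mult_ac)
      finally show ?thesis .
    qed
    then have "(\<integral>\<^sup>+x. \<integral>\<^sup>+z. ennreal (norm (?G x z)) \<partial>lborel \<partial>lborel)
      = ennreal ?\<kappa> * (\<integral>\<^sup>+x. ennreal (norm (g x * of_real (bessel_test s \<tau> a x))) \<partial>lborel)"
      by (simp only:) (rule nn_integral_cmult, measurable)
    also have "\<dots> < \<infinity>" using int by (simp add: integrable_iff_bounded ennreal_mult_less_top)
    finally show ?thesis .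
  qed
  have "(\<integral>\<^sup>+x. \<integral>\<^sup>+z. ennreal (norm (?F x z)) \<partial>lborel \<partial>lborel) = (\<integral>\<^sup>+z. \<integral>\<^sup>+x. ennreal (norm (?F x z)) \<partial>lborel \<partial>lborel)"
    by (rule lborel_pair.Fubini'[symmetric]) (use nF in \<open>simp only: split_beta'\<close>)
  also have "\<dots> = (\<integral>\<^sup>+z. \<integral>\<^sup>+x. ennreal (norm (?G x z)) \<partial>lborel \<partial>lborel)"
  proof (rule nn_integral_cong)
    fix z :: "real \<times> 'a"
    have "(\<integral>\<^sup>+x. ennreal (norm (?F x z)) \<partial>lborel) = (\<integral>\<^sup>+x. ennreal (norm (?F (fst z *\<^sub>R snd z + 1 *\<^sub>R x) z)) \<partial>lborel)"
      by (subst nn_integral_lborel_affine[of _ 1 "fst z *\<^sub>R snd z"]) auto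
    then show "(\<integral>\<^sup>+x. ennreal (norm (?F x z)) \<partial>lborel) = (\<integral>\<^sup>+x. ennreal (norm (?G x z)) \<partial>lborel)"
      by (simp only: scaleR_one shift)
  qed
  also have "\<dots> = (\<integral>\<^sup>+x. \<integral>\<^sup>+z. ennreal (norm (?G x z)) \<partial>lborel \<partial>lborel)"
    by (rule lborel_pair.Fubini') (use nG in \<open>simp only: split_beta'\<close>)
  finally have finF: "(\<integral>\<^sup>+x. \<integral>\<^sup>+z. ennreal (norm (?F x z)) \<partial>lborel \<partial>lborel) < \<infinity>" using finG by simp
  have Fi: "(LINT z|lborel. ?F x z) = bessel_int s g x * of_real (heat \<tau> (x - a))" for x
  proof -
    have "(LINT z|lborel. ?F x z) = (LINT z|(lborel \<Otimes>\<^sub>M lborel). heat \<tau> (x - a) *\<^sub>R (bessel_kernel s z *\<^sub>R g (x - fst z *\<^sub>R snd z)))"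
      unfolding lborel_prod by (simp add: mult_ac)
    also have "\<dots> = heat \<tau> (x - a) *\<^sub>R bessel_int s g x" unfolding bessel_int_def by (rule integral_scaleR_right)
    finally show ?thesis by (simp add: scaleR_conv_of_real mult.commute)
  qed
  have Gi: "(LINT z|lborel. ?G x z) = of_real ?\<kappa> * (g x * of_real (bessel_test s \<tau> a x))" for x
  proof -
    have "(LINT z|lborel. ?G x z) = (LINT z|(lborel \<Otimes>\<^sub>M lborel). bessel_kernel s z * heat \<tau> (x - a + fst z *\<^sub>R snd z)) *\<^sub>R g x"
      unfolding lborel_prod[symmetric]
    proof (rule integral_scaleR_left)
      show "integrable (lborel \<Otimes>\<^sub>M lborel) (\<lambda>z. bessel_kernel s z * heat \<tau> (x - a + fst z *\<^sub>R snd z))"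
        by (rule integrableI_bounded) (auto simp: bessel_kernel_heat[OF s \<tau>])
    qed
    also have "(LINT z|(lborel \<Otimes>\<^sub>M lborel). bessel_kernel s z * heat \<tau> (x - a + fst z *\<^sub>R snd z)) = ?\<kappa> * bessel_test s \<tau> a x"
      using m bessel_test_nonneg[OF s, of \<tau> a x] by (subst integral_eq_nn_integral) (auto simp: bessel_kernel_heat[OF s \<tau>])
    finally show ?thesis by (simp add: scaleR_conv_of_real mult_ac)
  qed
  have "integrable (lborel \<Otimes>\<^sub>M lborel) (\<lambda>(x, z). ?F x z)"
    using finF lborel.nn_integral_fst[OF nF] by (intro integrableI_bounded F) (simp only: split_beta' fst_conv snd_conv)
  from lborel_pair.integrable_fst'[OF this]
  show "integrable lborel (\<lambda>x. bessel_int s g x * of_real (heat \<tau> (x - a)))"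
    by (simp only: prod.case Fi)
  have "(LINT x|lborel. bessel_int s g x * of_real (heat \<tau> (x - a))) = (LINT x|lborel. LINT z|lborel. ?F x z)"
    by (simp only: Fi)
  also have "\<dots> = (LINT z|lborel. LINT x|lborel. ?F x z)" by (rule lborel_Fubini_swap[OF F finF])
  also have "\<dots> = (LINT z|lborel. LINT x|lborel. ?G x z)"
  proof (rule Bochner_Integration.integral_cong[OF refl])
    fix z :: "real \<times> 'a"
    have "(LINT x|lborel. ?F x z) = \<bar>1\<bar> ^ DIM('a) *\<^sub>R (LINT x|lborel. ?F (fst z *\<^sub>R snd z + 1 *\<^sub>R x) z)"
      by (rule lborel_integral_affine) auto
    then show "(LINT x|lborel. ?F x z) = (LINT x|lborel. ?G x z)"
      by (simp only: scaleR_one shift abs_one power_one)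
  qed
  also have "\<dots> = (LINT x|lborel. LINT z|lborel. ?G x z)" by (rule lborel_Fubini_swap[OF G finG, symmetric])
  also have "\<dots> = of_real ?\<kappa> * (LINT x|lborel. g x * of_real (bessel_test s \<tau> a x))"
    by (simp only: Gi integral_mult_right_zero)
  finally show "(LINT x|lborel. bessel_int s g x * of_real (heat \<tau> (x - a)))
    = of_real ?\<kappa> * (LINT x|lborel. g x * of_real (bessel_test s \<tau> a x))" .
qed

text \<open>On the support |x| \<le> R + |v|, hence |v|^2 \<ge> |x|^2 / 2 - R^2. Half of the
  Gaussian in v thus pays for a Gaussian in x, uniformly in r.\<close>

lemma gauss_bump_bound:
  fixes \<psi> :: "'a::euclidean_space \<Rightarrow> real"
  assumes \<psi>: "\<And>x. \<bar>\<psi> x\<bar> \<le> 1" "\<And>x. R < norm x \<Longrightarrow> \<psi> x = 0" and r: "0 \<le> r" "r \<le> 1"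
  shows "gauss v * \<bar>\<psi> (x - r *\<^sub>R v)\<bar> \<le> exp (R\<^sup>2 / 8) * exp (- (1 / 16 * (norm x)\<^sup>2)) * exp (- (1 / 8 * (norm v)\<^sup>2))"
proof (cases "norm (x - r *\<^sub>R v) \<le> R")
  case True
  have "norm (r *\<^sub>R v) \<le> norm v" using r by (simp add: mult_left_le_one_le)
  then have "norm x \<le> R + norm v" using norm_triangle_sub[of x "r *\<^sub>R v"] True by linarith
  then have "(norm x)\<^sup>2 \<le> (R + norm v)\<^sup>2" by (intro power_mono) auto
  also have "\<dots> \<le> 2 * R\<^sup>2 + 2 * (norm v)\<^sup>2" using sum_squares_bound[of R "norm v"] by (simp add: power2_sum)
  finally have "- (norm v)\<^sup>2 / 4 \<le> R\<^sup>2 / 8 + - (1 / 16 * (norm x)\<^sup>2) + - (1 / 8 * (norm v)\<^sup>2)" by simp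
  then have "gauss v \<le> exp (R\<^sup>2 / 8) * exp (- (1 / 16 * (norm x)\<^sup>2)) * exp (- (1 / 8 * (norm v)\<^sup>2))"
    unfolding gauss_def exp_add[symmetric] by simp
  then show ?thesis by (rule order_trans[rotated]) (simp add: mult_right_le_one_le \<psi>)
qed (simp add: \<psi>(2))

text \<open>The bump is smoothed by heat kernels of time r^2. Each smoothed integral vanishes by
  hypothesis, and as r tends to 0 the smoothed bumps converge to a positive multiple of
  \<psi>.\<close>

lemma heat_determines_bump:
  fixes f \<psi> :: "'a::euclidean_space \<Rightarrow> real"
  assumes [measurable]: "f \<in> borel_measurable borel"
    and int: "\<And>\<tau> a. 0 < \<tau> \<Longrightarrow> integrable lborel (\<lambda>x. f x * heat \<tau> (x - a))"
    and zero: "\<And>\<tau> a. 0 < \<tau> \<Longrightarrow> (LINT x|lborel. f x * heat \<tau> (x - a)) = 0"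
    and cont: "continuous_on UNIV \<psi>" and \<psi>: "\<And>x. \<bar>\<psi> x\<bar> \<le> 1" "\<And>x. R < norm x \<Longrightarrow> \<psi> x = 0"
  shows "integrable lborel (\<lambda>x. f x * \<psi> x)" "(LINT x|lborel. f x * \<psi> x) = 0"
proof -
  have [measurable]: "\<psi> \<in> borel_measurable borel" using cont by (rule borel_measurable_continuous_onI)
  have e8: "integrable lborel (\<lambda>v::'a. exp (- (1 / 8 * (norm v)\<^sup>2)))" by (rule integrable_exp_norm) simp
  define Z where "Z = (LINT v|lborel. exp (- (1 / 8 * (norm (v::'a))\<^sup>2)))"
  \<comment> \<open>The majorant is a multiple of |f| times the heat kernel of time 4, whose
    exponent 1 / 16 is the one of \<open>gauss_bump_bound\<close>; it is integrable by hypothesis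
    and independent of r.\<close>
  define w where "w x = \<bar>f x\<bar> * (exp (R\<^sup>2 / 8) * exp (- (1 / 16 * (norm x)\<^sup>2)) * Z)" for x
  have Z: "0 \<le> Z" by (simp add: Z_def)
  have w: "integrable lborel w"
  proof -
    have eq: "w = (\<lambda>x. (exp (R\<^sup>2 / 8) * Z * (4 * pi * 4) powr (real DIM('a) / 2)) * \<bar>f x * heat 4 (x - 0)\<bar>)"
    proof
      fix x
      have "(4 * pi * 4) powr (real DIM('a) / 2) * (4 * pi * 4) powr (- (real DIM('a) / 2)) = 1"
        unfolding powr_add[symmetric] by simp
      moreover have "F * (E * G * Z) = E * Z * P * (F * (P' * G))" if "P * P' = 1" for F E G P P' :: real
      proof -
        have "E * Z * P * (F * (P' * G)) = (P * P') * (F * (E * G * Z))" by (simp only: mult_ac)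
        then show ?thesis using that by simp
      qed
      ultimately show "w x = (exp (R\<^sup>2 / 8) * Z * (4 * pi * 4) powr (real DIM('a) / 2)) * \<bar>f x * heat 4 (x - 0)\<bar>"
        unfolding w_def heat_def abs_mult by simp
    qed
    show ?thesis unfolding eq by (intro integrable_mult_right integrable_abs int) simp
  qed
  have gi: "integrable lborel (\<lambda>v. gauss v * \<psi> (x - r *\<^sub>R v))" for x r
  proof (rule Bochner_Integration.integrable_bound[OF integrable_gauss])
    show "AE v in lborel. norm (gauss v * \<psi> (x - r *\<^sub>R v)) \<le> norm (gauss v)"
      using \<psi>(1) by (auto simp: abs_mult intro!: AE_I2 mult_right_le_one_le)
  qed measurable
  have le_w: "\<bar>f x\<bar> * (LINT v|lborel. gauss v * \<bar>\<psi> (x - r *\<^sub>R v)\<bar>) \<le> w x" if "0 \<le> r" "r \<le> 1" for r x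
  proof -
    have "integrable lborel (\<lambda>v. gauss v * \<bar>\<psi> (x - r *\<^sub>R v)\<bar>)" using integrable_abs[OF gi[of x r]] by (simp add: abs_mult)
    then have "(LINT v|lborel. gauss v * \<bar>\<psi> (x - r *\<^sub>R v)\<bar>) \<le> (LINT v|lborel. exp (R\<^sup>2 / 8) * exp (- (1 / 16 * (norm x)\<^sup>2)) * exp (- (1 / 8 * (norm (v::'a))\<^sup>2)))"
      by (rule integral_mono[OF _ integrable_mult_right[OF e8]]) (intro gauss_bump_bound \<psi> that)
    then show ?thesis unfolding w_def Z_def integral_mult_right_zero by (intro mult_left_mono) auto
  qed
  have dom: "AE x in lborel. norm (f x * gauss_avg r \<psi> x) \<le> w x" if r: "0 < r" "r \<le> 1" for r
  proof (rule AE_I2)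
    fix x
    have "\<bar>gauss_avg r \<psi> x\<bar> \<le> (LINT v|lborel. gauss v * \<bar>\<psi> (x - r *\<^sub>R v)\<bar>)"
      unfolding gauss_avg_def using integral_abs_bound[of lborel "\<lambda>v. gauss v * \<psi> (x - r *\<^sub>R v)"] by (simp add: abs_mult)
    then have "\<bar>f x\<bar> * \<bar>gauss_avg r \<psi> x\<bar> \<le> \<bar>f x\<bar> * (LINT v|lborel. gauss v * \<bar>\<psi> (x - r *\<^sub>R v)\<bar>)"
      by (intro mult_left_mono) auto
    also have "\<dots> \<le> w x" using le_w[of r x] r by simp
    finally show "norm (f x * gauss_avg r \<psi> x) \<le> w x" by (simp add: abs_mult)
  qed
  \<comment> \<open>Up to the constant \<open>k\<close>, averaging at scale r is convolution with
    the heat kernel of time r^2; Fubini then exposes the vanishing integrals of f against heat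
    kernels.\<close>
  have avg: "(LINT x|lborel. f x * gauss_avg r \<psi> x) = 0" if r: "0 < r" "r \<le> 1" for r
  proof -
    let ?\<tau> = "r\<^sup>2"
    define k where "k = r ^ DIM('a) * (4 * pi * r\<^sup>2) powr (- (real DIM('a) / 2))"
    have \<tau>: "0 < ?\<tau>" and k: "0 < k" using r by (auto simp: k_def)
    have heat: "heat ?\<tau> (r *\<^sub>R v) = (4 * pi * r\<^sup>2) powr (- (real DIM('a) / 2)) * gauss v" for v :: 'a
      using r by (simp add: heat_def gauss_def power_mult_distrib)
    have hsym: "heat ?\<tau> (y - x) = heat ?\<tau> (x - y)" for x y :: 'a by (simp add: heat_def norm_minus_commute)
    have avg_eq: "(LINT y|lborel. heat ?\<tau> (x - y) * \<phi> y) = k * (LINT v|lborel. gauss v * \<phi> (x - r *\<^sub>R v))"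
      if [measurable]: "\<phi> \<in> borel_measurable borel" for x and \<phi> :: "'a \<Rightarrow> real"
    proof -
      have "(LINT y|lborel. heat ?\<tau> (x - y) * \<phi> y) = \<bar>- r\<bar> ^ DIM('a) *\<^sub>R (LINT v|lborel. heat ?\<tau> (x - (x + (- r) *\<^sub>R v)) * \<phi> (x + (- r) *\<^sub>R v))"
        using r by (intro lborel_integral_affine) auto
      also have "\<dots> = r ^ DIM('a) * (LINT v|lborel. (4 * pi * r\<^sup>2) powr (- (real DIM('a) / 2)) * (gauss v * \<phi> (x - r *\<^sub>R v)))"
        using r by (simp add: heat mult.assoc)
      finally show ?thesis by (simp add: k_def)
    qed
    let ?F = "\<lambda>x y. f x * (heat ?\<tau> (x - y) * \<psi> y)"
    have hi: "integrable lborel (\<lambda>y. heat ?\<tau> (x - y) * \<bar>\<psi> y\<bar>)" for x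
    proof (rule Bochner_Integration.integrable_bound[OF heat_nn_integral(1)[OF \<tau>, of x]])
      show "AE y in lborel. norm (heat ?\<tau> (x - y) * \<bar>\<psi> y\<bar>) \<le> norm (heat ?\<tau> (y - x))"
        using \<psi>(1) by (auto simp: abs_mult hsym[of _ x] intro!: AE_I2 mult_right_le_one_le)
    qed measurable
    have "(\<integral>\<^sup>+y. ennreal (norm (?F x y)) \<partial>lborel) \<le> ennreal (k * w x)" for x
    proof -
      have "(\<integral>\<^sup>+y. ennreal (norm (?F x y)) \<partial>lborel) = (\<integral>\<^sup>+y. ennreal (\<bar>f x\<bar> * (heat ?\<tau> (x - y) * \<bar>\<psi> y\<bar>)) \<partial>lborel)"
        by (simp add: abs_mult)
      also have "\<dots> = ennreal (LINT y|lborel. \<bar>f x\<bar> * (heat ?\<tau> (x - y) * \<bar>\<psi> y\<bar>))"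
        by (intro nn_integral_eq_integral integrable_mult_right hi) auto
      also have "(LINT y|lborel. \<bar>f x\<bar> * (heat ?\<tau> (x - y) * \<bar>\<psi> y\<bar>)) = k * (\<bar>f x\<bar> * (LINT v|lborel. gauss v * \<bar>\<psi> (x - r *\<^sub>R v)\<bar>))"
        by (simp only: integral_mult_right_zero avg_eq[of "\<lambda>y. \<bar>\<psi> y\<bar>"] borel_measurable_abs \<open>\<psi> \<in> borel_measurable borel\<close> mult.left_commute)
      finally show ?thesis using le_w[of r x] r k by (auto intro!: ennreal_leI mult_left_mono)
    qed
    then have "(\<integral>\<^sup>+x. \<integral>\<^sup>+y. ennreal (norm (?F x y)) \<partial>lborel \<partial>lborel) \<le> (\<integral>\<^sup>+x. ennreal (k * w x) \<partial>lborel)"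
      by (intro nn_integral_mono)
    also have "\<dots> < \<infinity>"
      using integrable_mult_right[OF w, of k] k Z by (subst nn_integral_eq_integral) (auto simp: w_def)
    finally have fin: "(\<integral>\<^sup>+x. \<integral>\<^sup>+y. ennreal (norm (?F x y)) \<partial>lborel \<partial>lborel) < \<infinity>" .
    have "(LINT x|lborel. k * (f x * gauss_avg r \<psi> x)) = (LINT x|lborel. LINT y|lborel. ?F x y)"
      by (simp only: integral_mult_right_zero avg_eq[of \<psi>] \<open>\<psi> \<in> borel_measurable borel\<close> gauss_avg_def mult.left_commute)
    also have "\<dots> = (LINT y|lborel. LINT x|lborel. ?F x y)"
      by (rule lborel_Fubini_swap[OF _ fin]) measurable
    also have "\<dots> = (LINT y|lborel. (LINT x|lborel. f x * heat ?\<tau> (x - y)) * \<psi> y)"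
      by (simp only: mult.assoc[symmetric] integral_mult_left_zero)
    also have "\<dots> = 0" by (simp add: zero[OF \<tau>])
    finally show ?thesis using k by simp
  qed
  define r where "r n = 1 / real (Suc n)" for n
  have r: "0 < r n" "r n \<le> 1" for n by (auto simp: r_def)
  have r0: "r \<longlonglongrightarrow> 0" unfolding r_def[abs_def] by (rule LIMSEQ_Suc[OF lim_1_over_n])
  define c where "c = (LINT v|lborel. gauss (v::'a))"
  have lim: "(\<lambda>n. gauss_avg (r n) \<psi> x) \<longlonglongrightarrow> c * \<psi> x" for x
  proof -
    have "(\<lambda>n. LINT v|lborel. gauss v * \<psi> (x - r n *\<^sub>R v)) \<longlonglongrightarrow> (LINT v|lborel. gauss (v::'a) * \<psi> x)"
    proof (rule integral_dominated_convergence[where w = "gauss :: 'a \<Rightarrow> real"])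
      show "AE v in lborel. (\<lambda>n. gauss v * \<psi> (x - r n *\<^sub>R v)) \<longlonglongrightarrow> gauss v * \<psi> x"
      proof (rule AE_I2)
        fix v
        have "(\<lambda>n. x - r n *\<^sub>R v) \<longlonglongrightarrow> x - 0 *\<^sub>R v" by (intro tendsto_intros r0)
        then have "(\<lambda>n. \<psi> (x - r n *\<^sub>R v)) \<longlonglongrightarrow> \<psi> x"
          using cont by (intro continuous_on_tendsto_compose[OF cont]) auto
        then show "(\<lambda>n. gauss v * \<psi> (x - r n *\<^sub>R v)) \<longlonglongrightarrow> gauss v * \<psi> x" by (rule tendsto_mult_left)
      qed
      show "AE v in lborel. norm (gauss v * \<psi> (x - r n *\<^sub>R v)) \<le> gauss v" for n
        using \<psi>(1) by (auto simp: abs_mult intro!: AE_I2 mult_right_le_one_le)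
    qed (auto intro: integrable_gauss)
    then show ?thesis by (simp add: gauss_avg_def c_def)
  qed
  have c: "0 < c"
  proof -
    have "c \<noteq> 0"
      unfolding c_def using integral_nonneg_eq_0_iff_AE[OF integrable_gauss[where 'a='a]]
      by (simp add: eventually_False ae_filter_eq_bot_iff)
    moreover have "0 \<le> c" by (simp add: c_def)
    ultimately show ?thesis by simp
  qed
  have AEl: "AE x in lborel. (\<lambda>n. f x * gauss_avg (r n) \<psi> x) \<longlonglongrightarrow> f x * (c * \<psi> x)"
    by (intro AE_I2 tendsto_mult_left lim)
  have m1: "(\<lambda>x. f x * (c * \<psi> x)) \<in> borel_measurable lborel" by measurable
  have m2: "(\<lambda>x. f x * gauss_avg (r n) \<psi> x) \<in> borel_measurable lborel" for n unfolding gauss_avg_def by measurable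
  have "integrable lborel (\<lambda>x. c * (f x * \<psi> x))"
    using integrable_dominated_convergence[OF m1 m2 w AEl dom[OF r]] by (simp add: mult_ac)
  then have "integrable lborel (\<lambda>x. inverse c * (c * (f x * \<psi> x)))" by (rule integrable_mult_right)
  then show "integrable lborel (\<lambda>x. f x * \<psi> x)" using c by (simp flip: mult.assoc)
  have "(\<lambda>n. LINT x|lborel. f x * gauss_avg (r n) \<psi> x) \<longlonglongrightarrow> (LINT x|lborel. f x * (c * \<psi> x))"
    by (rule integral_dominated_convergence[OF m1 m2 w AEl dom[OF r]])
  then have "(LINT x|lborel. c * (f x * \<psi> x)) = 0"
    using avg[OF r] by (simp add: LIMSEQ_const_iff mult.left_commute)
  then show "(LINT x|lborel. f x * \<psi> x) = 0" using c by simp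
qed

text \<open>For a compact set on which f is positive, bumps converging to its indicator show that
  the integral of f over it is 0, so the set is null. Inner regularity extends this to the whole set
  where f is positive.\<close>

lemma heat_determines_nonpos:
  fixes f :: "'a::euclidean_space \<Rightarrow> real"
  assumes [measurable]: "f \<in> borel_measurable borel"
    and int: "\<And>\<tau> a. 0 < \<tau> \<Longrightarrow> integrable lborel (\<lambda>x. f x * heat \<tau> (x - a))"
    and zero: "\<And>\<tau> a. 0 < \<tau> \<Longrightarrow> (LINT x|lborel. f x * heat \<tau> (x - a)) = 0"
  shows "AE x in lborel. f x \<le> 0"
proof -
  have compact_null: "emeasure lborel K = 0" if K: "compact K" and pos: "\<And>x. x \<in> K \<Longrightarrow> 0 < f x" for K
  proof (cases "K = {}")
    case False
    have Kc: "closed K" using K by (rule compact_imp_closed)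
    have [measurable]: "K \<in> sets borel" using Kc by simp
    obtain B where B: "\<And>x. x \<in> K \<Longrightarrow> norm x \<le> B" using compact_imp_bounded[OF K] by (auto simp: bounded_iff)
    \<comment> \<open>Lipschitz bumps that vanish beyond distance 1 / (n + 1) from \<open>K\<close>.
      They decrease to the indicator of \<open>K\<close>, so the one for n = 0 dominates.\<close>
    define \<psi> where "\<psi> n x = max 0 (1 - real (Suc n) * infdist x K)" for n x
    have \<psi>1: "\<bar>\<psi> n x\<bar> \<le> 1" for n x by (auto simp: \<psi>_def infdist_nonneg)
    have \<psi>_supp: "\<psi> n x = 0" if "B + 1 < norm x" for n x
    proof -
      have "1 \<le> infdist x K"
        unfolding infdist_notempty[OF False]
      proof (rule cINF_greatest[OF False])
        fix y assume "y \<in> K"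
        then show "1 \<le> dist x y" using B[of y] that norm_triangle_sub[of x y] by (simp add: dist_norm)
      qed
      then have "1 * 1 \<le> real (Suc n) * infdist x K" by (intro mult_mono) auto
      then show ?thesis by (simp add: \<psi>_def)
    qed
    have \<psi>_cont: "continuous_on UNIV (\<psi> n)" for n unfolding \<psi>_def[abs_def] by (intro continuous_intros)
    then have [measurable]: "\<psi> n \<in> borel_measurable borel" for n by (rule borel_measurable_continuous_onI)
    have lim: "(\<lambda>n. \<psi> n x) \<longlonglongrightarrow> indicator K x" for x
    proof (cases "x \<in> K")
      case True
      then show ?thesis by (simp add: \<psi>_def)
    next
      case nK: False
      then have d: "0 < infdist x K" by (rule infdist_pos_not_in_closed[OF Kc False])
      obtain n0 where n0: "1 / infdist x K < real n0" using reals_Archimedean2 by blast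
      have "\<psi> n x = 0" if "n0 \<le> n" for n
      proof -
        have "1 / infdist x K \<le> real (Suc n)" using n0 that by simp
        then have "1 \<le> real (Suc n) * infdist x K" using d by (simp add: pos_divide_le_eq del: of_nat_Suc)
        then show ?thesis by (simp add: \<psi>_def)
      qed
      then have "\<forall>\<^sub>F n in sequentially. \<psi> n x = 0" by (auto simp: eventually_sequentially)
      then show ?thesis using nK by (simp add: tendsto_eventually)
    qed
    have bump: "integrable lborel (\<lambda>x. f x * \<psi> n x)" "(LINT x|lborel. f x * \<psi> n x) = 0" for n
      by (rule heat_determines_bump[OF assms(1) int zero \<psi>_cont[of n] \<psi>1 \<psi>_supp]; assumption)+
    have w: "integrable lborel (\<lambda>x. \<bar>f x * \<psi> 0 x\<bar>)" by (intro integrable_abs bump(1))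
    have m1: "(\<lambda>x. f x * indicator K x) \<in> borel_measurable lborel" by measurable
    have m2: "(\<lambda>x. f x * \<psi> n x) \<in> borel_measurable lborel" for n by measurable
    have AEl: "AE x in lborel. (\<lambda>n. f x * \<psi> n x) \<longlonglongrightarrow> f x * indicator K x"
      by (intro AE_I2 tendsto_mult_left lim)
    have dom: "AE x in lborel. norm (f x * \<psi> n x) \<le> \<bar>f x * \<psi> 0 x\<bar>" for n
    proof (rule AE_I2)
      fix x
      have "1 * infdist x K \<le> real (Suc n) * infdist x K" by (intro mult_right_mono infdist_nonneg) simp
      then have "\<bar>\<psi> n x\<bar> \<le> \<bar>\<psi> 0 x\<bar>" by (simp add: \<psi>_def del: of_nat_Suc)
      then show "norm (f x * \<psi> n x) \<le> \<bar>f x * \<psi> 0 x\<bar>" by (simp add: abs_mult mult_left_mono)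
    qed
    have "(LINT x|lborel. f x * indicator K x) = 0"
      using integral_dominated_convergence[OF m1 m2 w AEl dom] by (simp add: LIMSEQ_const_iff bump(2))
    moreover have "integrable lborel (\<lambda>x. f x * indicator K x)"
      by (rule integrable_dominated_convergence[OF m1 m2 w AEl dom])
    moreover have nn: "0 \<le> f x * indicator K x" for x using pos[of x] by (auto simp: indicator_def)
    ultimately have "AE x in lborel. f x * indicator K x = 0"
      using integral_nonneg_eq_0_iff_AE[of lborel "\<lambda>x. f x * indicator K x"] by simp
    then have "AE x in lborel. x \<notin> K" by eventually_elim (use pos in \<open>force simp: indicator_def\<close>)
    then show ?thesis by (subst (asm) AE_iff_null_sets[symmetric]) auto
  qed simp
  \<comment> \<open>Bounded pieces, so that the closed subsets supplied by inner regularity are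
    compact.\<close>
  define S where "S n = {x. 0 < f x} \<inter> cball 0 (real n)" for n
  have [measurable]: "S n \<in> sets borel" for n unfolding S_def by measurable
  have null: "S n \<in> null_sets lborel" for n
  proof -
    have le: "emeasure lborel (S n) \<le> 0 + ennreal e" if e0: "0 < e" for e :: real
    proof -
      have S: "S n \<in> sets lebesgue" by simp
      obtain T where T: "closed T" "T \<subseteq> S n" and e: "emeasure lebesgue (S n - T) < ennreal e"
        by (rule sets_lebesgue_inner_closed[OF S e0]) (rule that)
      have "compact T" using T by (auto simp: compact_eq_bounded_closed S_def intro: bounded_subset[OF bounded_cball])
      then have T0: "emeasure lborel T = 0" using T(2) by (intro compact_null) (auto simp: S_def)
      have "emeasure lborel (S n) \<le> emeasure lborel (T \<union> (S n - T))" using T(1) by (intro emeasure_mono) auto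
      also have "\<dots> \<le> emeasure lborel T + emeasure lborel (S n - T)" using T(1) by (intro emeasure_subadditive) auto
      also have "\<dots> \<le> 0 + ennreal e" using e T(1) by (simp add: T0)
      finally show ?thesis .
    qed
    have "emeasure lborel (S n) \<le> 0" by (rule ennreal_le_epsilon) (rule le)
    then show ?thesis by (intro null_setsI) auto
  qed
  have "AE x in lborel. \<forall>n. x \<notin> S n" using null by (simp add: AE_all_countable AE_not_in)
  then show ?thesis
  proof eventually_elim
    case (elim x)
    obtain n where "norm x \<le> real n" using real_arch_simple by blast
    then show ?case using elim by (force simp: S_def)
  qed
qed

text \<open>The one-sided result is applied to both signs of the real and the imaginary
  part.\<close>

lemma heat_determines:
  fixes f :: "'a::euclidean_space \<Rightarrow> complex"
  assumes [measurable]: "f \<in> borel_measurable borel"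
    and int: "\<And>\<tau> a. 0 < \<tau> \<Longrightarrow> integrable lborel (\<lambda>x. f x * of_real (heat \<tau> (x - a)))"
    and zero: "\<And>\<tau> a. 0 < \<tau> \<Longrightarrow> (LINT x|lborel. f x * of_real (heat \<tau> (x - a))) = 0"
  shows "AE x in lborel. f x = 0"
proof -
  have r: "integrable lborel (\<lambda>x. Re (f x) * heat \<tau> (x - a))" "(LINT x|lborel. Re (f x) * heat \<tau> (x - a)) = 0"
    and i: "integrable lborel (\<lambda>x. Im (f x) * heat \<tau> (x - a))" "(LINT x|lborel. Im (f x) * heat \<tau> (x - a)) = 0"
    if "0 < \<tau>" for \<tau> a
    using integrable_Re[OF int[OF that, of a]] integral_Re[OF int[OF that, of a]]
      integrable_Im[OF int[OF that, of a]] integral_Im[OF int[OF that, of a]] zero[OF that, of a] by auto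
  have "AE x in lborel. Re (f x) \<le> 0" "AE x in lborel. Im (f x) \<le> 0"
    by (intro heat_determines_nonpos r i; measurable)+
  moreover have "AE x in lborel. - Re (f x) \<le> 0" "AE x in lborel. - Im (f x) \<le> 0"
    by (rule heat_determines_nonpos; use r i in simp)+
  ultimately show ?thesis by eventually_elim (simp add: complex_eq_iff)
qed

text \<open>Maximal functions and product integrals are set up for Borel functions, whereas
  \<open>represents\<close> supplies Lebesgue measurable ones.\<close>

lemma borel_version:
  fixes f :: "'a::euclidean_space \<Rightarrow> complex"
  assumes "f \<in> borel_measurable lebesgue"
  obtains f' where "f' \<in> borel_measurable borel" "AE x in lborel. f x = f' x"
proof -
  have "(\<lambda>x. Re (f x)) \<in> borel_measurable lebesgue" "(\<lambda>x. Im (f x)) \<in> borel_measurable lebesgue"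
    using assms by (auto intro: measurable_compose)
  from this[THEN completion_ex_borel_measurable_real]
  obtain h k where [measurable]: "h \<in> borel_measurable borel" "k \<in> borel_measurable borel"
    and ae: "AE x in lborel. Re (f x) = h x" "AE x in lborel. Im (f x) = k x" by auto
  have [measurable]: "(\<lambda>x. Complex (h x) (k x)) \<in> borel_measurable borel"
    by (simp add: borel_measurable_complex_iff)
  show ?thesis
  proof (rule that)
    show "(\<lambda>x. Complex (h x) (k x)) \<in> borel_measurable borel" by measurable
    show "AE x in lborel. f x = Complex (h x) (k x)" using ae by eventually_elim (simp add: complex_eq_iff)
  qed
qed

text \<open>The value of \<open>U\<close> at a heat kernel is that of \<open>bessel_op s U\<close>
  at \<open>bessel_test\<close>, that is, the integral of g' against \<open>bessel_test\<close>,
  which \<open>bessel_int_test\<close> turns into an integral of \<open>bessel_int\<close> against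
  the heat kernel. The difference of the two sides is thus annihilated by all heat kernels.\<close>

lemma bessel_representation:
  fixes u g :: "'a::euclidean_space \<Rightarrow> complex"
  assumes s: "0 < s" "s < 1" and U: "represents u U" "represents g (bessel_op s U)"
    and [measurable]: "u' \<in> borel_measurable borel" "g' \<in> borel_measurable borel"
    and ae: "AE x in lborel. u x = u' x" "AE x in lborel. g x = g' x"
  shows "AE x in lborel. u' x = (1 / ((4 * pi) powr (real DIM('a) / 2) * bessel_mass s)) *\<^sub>R bessel_int s g' x"
proof -
  let ?\<kappa> = "(4 * pi) powr (real DIM('a) / 2) * bessel_mass s"
  have \<kappa>: "0 < ?\<kappa>" using bessel_mass_pos[OF s] by simp
  have transfer: "integrable lborel (\<lambda>x. f' x * \<phi> x) \<and> (LINT x|lebesgue. f x * \<phi> x) = (LINT x|lborel. f' x * \<phi> x)"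
    if [measurable]: "f \<in> borel_measurable lebesgue" "f' \<in> borel_measurable borel" "\<phi> \<in> borel_measurable borel"
      and ae: "AE x in lborel. f x = f' x" and i: "integrable lebesgue (\<lambda>x. f x * \<phi> x)"
    for f f' \<phi> :: "'a \<Rightarrow> complex"
  proof -
    have m: "(\<lambda>x. f' x * \<phi> x) \<in> borel_measurable lebesgue" by (rule measurable_completion) measurable
    have aem: "AE x in lebesgue. f x * \<phi> x = f' x * \<phi> x"
      using AE_completion[OF ae] by eventually_elim simp
    have "integrable lebesgue (\<lambda>x. f' x * \<phi> x)"
      using i by (rule integrable_cong_AE_imp[OF _ m]) (use aem in \<open>auto elim!: eventually_mono\<close>)
    moreover have "(LINT x|lebesgue. f x * \<phi> x) = (LINT x|lebesgue. f' x * \<phi> x)"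
      using aem m borel_measurable_integrable[OF i] by (intro integral_cong_AE) auto
    ultimately show ?thesis by (simp add: integrable_completion integral_completion)
  qed
  have test: "integrable lborel (\<lambda>x. (u' x - (1 / ?\<kappa>) *\<^sub>R bessel_int s g' x) * of_real (heat \<tau> (x - a))) \<and>
    (LINT x|lborel. (u' x - (1 / ?\<kappa>) *\<^sub>R bessel_int s g' x) * of_real (heat \<tau> (x - a))) = 0"
    if \<tau>: "0 < \<tau>" for \<tau> a
  proof -
    let ?h = "\<lambda>x. complex_of_real (heat \<tau> (x - a))" and ?b = "\<lambda>x. complex_of_real (bessel_test s \<tau> a x)"
    have m: "?h \<in> borel_measurable borel" "?b \<in> borel_measurable borel" by measurable
    have u: "integrable lborel (\<lambda>x. u' x * ?h x)" "U ?h = (LINT x|lborel. u' x * ?h x)"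
      using U(1) heat_schwartz[OF \<tau>, of a] transfer[OF _ _ m(1) ae(1)] unfolding represents_def by auto
    have g: "integrable lborel (\<lambda>x. g' x * ?b x)" "bessel_op s U ?b = (LINT x|lborel. g' x * ?b x)"
      using U(2) bessel_test_schwartz[OF s \<tau>, of a] transfer[OF _ _ m(2) ae(2)] unfolding represents_def by auto
    note b = bessel_int_test[OF _ s \<tau> g(1)]
    have bi: "integrable lborel (\<lambda>x. (1 / ?\<kappa>) *\<^sub>R (bessel_int s g' x * ?h x))"
      by (intro integrable_scaleR_right b(1)) simp
    have "(LINT x|lborel. (1 / ?\<kappa>) *\<^sub>R (bessel_int s g' x * ?h x)) = (1 / ?\<kappa>) *\<^sub>R (of_real ?\<kappa> * U ?h)"
      using b(2) g(2) bessel_multiplier_test[OF s \<tau>, of U a] by (subst integral_scaleR_right) simp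
    also have "\<dots> = U ?h" using bessel_mass_pos[OF s] by (simp add: scaleR_conv_of_real)
    finally have "(LINT x|lborel. u' x * ?h x - (1 / ?\<kappa>) *\<^sub>R (bessel_int s g' x * ?h x)) = 0"
      using Bochner_Integration.integral_diff[OF u(1) bi] u(2) by simp
    moreover have "integrable lborel (\<lambda>x. u' x * ?h x - (1 / ?\<kappa>) *\<^sub>R (bessel_int s g' x * ?h x))"
      by (intro Bochner_Integration.integrable_diff u bi)
    ultimately show ?thesis by (simp only: left_diff_distrib mult_scaleR_left)
  qed
  have "AE x in lborel. u' x - (1 / ?\<kappa>) *\<^sub>R bessel_int s g' x = 0"
    using test by (intro heat_determines) auto
  then show ?thesis by eventually_elim simp
qed

section \<open>The weak-type inequality\<close>

lemma max_fun_finite_AE: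
  fixes f :: "'a::euclidean_space \<Rightarrow> ennreal"
  assumes "1 < p" and [measurable]: "f \<in> borel_measurable borel" and fin: "(\<integral>\<^sup>+x. ennpowr (f x) p \<partial>lborel) < \<infinity>"
  shows "AE x in lborel. max_fun f x < \<infinity>"
proof -
  obtain C where C: "(\<integral>\<^sup>+x. ennpowr (max_fun f x) p \<partial>lborel) \<le> ennreal C * (\<integral>\<^sup>+x. ennpowr (f x) p \<partial>lborel)"
    using max_fun_strong[OF assms(1), where 'a='a] assms(2) by blast
  also have "\<dots> < \<infinity>" using fin by (simp add: ennreal_mult_less_top)
  finally have "AE x in lborel. ennpowr (max_fun f x) p \<noteq> \<infinity>" by (intro nn_integral_PInf_AE) auto
  then show ?thesis by eventually_elim (metis ennpowr_top(1) infinity_ennreal_def less_top)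
qed

lemma null_sets_cylinder:
  fixes N :: "'a::euclidean_space set"
  assumes "N \<in> null_sets lborel"
  shows "N \<times> (UNIV :: 'b::euclidean_space set) \<in> null_sets lborel" "(UNIV :: 'b set) \<times> N \<in> null_sets lborel"
proof -
  have N: "N \<in> sets borel" "emeasure lborel N = 0" using assms by auto
  then have "N \<times> (UNIV :: 'b set) \<in> sets borel" "(UNIV :: 'b set) \<times> N \<in> sets borel" by (auto intro: borel_Times)
  moreover have "emeasure (lborel \<Otimes>\<^sub>M lborel) (N \<times> (UNIV :: 'b set)) = 0" "emeasure (lborel \<Otimes>\<^sub>M lborel) ((UNIV :: 'b set) \<times> N) = 0"
    using N by (simp_all add: lborel.emeasure_pair_measure_Times)
  ultimately show "N \<times> (UNIV :: 'b::euclidean_space set) \<in> null_sets lborel" "(UNIV :: 'b set) \<times> N \<in> null_sets lborel"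
    by (auto simp: null_sets_def lborel_prod)
qed

text \<open>The representation of u holds off a null set only; the exceptional pairs are added to a
  Borel set, on which the completed measure agrees with the original one.\<close>

lemma emeasure_lebesgue_le_mod_null:
  assumes "S \<subseteq> T \<union> N" "T \<in> sets lborel" "N \<in> null_sets lborel"
  shows "emeasure lebesgue S \<le> emeasure lborel T"
proof -
  have TN: "T \<union> N \<in> sets lborel" using assms by (intro sets.Un) auto
  have "emeasure lebesgue S \<le> emeasure lebesgue (T \<union> N)" using TN by (intro emeasure_mono assms sets_completionI_sets)
  also have "\<dots> = emeasure lborel (T \<union> N)" using TN by simp
  also have "\<dots> = emeasure lborel T" by (intro emeasure_Un_null_set assms)
  finally show ?thesis .
qed

text \<open>Almost everywhere u is k s times the average of g, where k = 1 / (\<kappa> s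
  \<open>bessel_mass s\<close>). The lower bound on the mass bounds k for all s at once, and the
  level l for u becomes the level l / k for the average.\<close>

theorem theorem1p2:
  fixes p :: real
  assumes "1 < p"
  shows "\<exists>C::real. \<forall>s\<in>{0<..<1}. \<forall>U \<in> bessel_potential_space s p. \<forall>u g :: real ^ 'n \<Rightarrow> complex.
    represents u U \<longrightarrow> g \<in> Lp_space p \<longrightarrow> represents g (bessel_op s U) \<longrightarrow>
      weak_Lp_norm p (\<lambda>(x, y). (u x - u y) / of_real (norm (x - y) powr (real CARD('n) / p + s)))
        \<le> ennreal (C * Lp_norm p g)"
proof -
  have p: "0 < p" using assms by simp
  obtain C where C: "0 < C" and weak: "\<And>s g l. 0 < s \<Longrightarrow> s < 1 \<Longrightarrow> g \<in> borel_measurable borel \<Longrightarrow> 0 < l \<Longrightarrow>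
    emeasure lborel (large_quotient p s l (\<lambda>x::real ^ 'n. s *\<^sub>R bessel_int s g x) \<inter>
      {(x, y). max_fun (\<lambda>y. ennreal (norm (g y))) x < \<infinity> \<and> max_fun (\<lambda>y. ennreal (norm (g y))) y < \<infinity>})
    \<le> ennreal (C / l powr p) * (\<integral>\<^sup>+x. ennreal (norm (g x) powr p) \<partial>lborel)"
    by (rule bessel_int_weak[OF assms, where 'a="real ^ 'n"]) (rule that)
  define \<kappa> where "\<kappa> = (4 * pi) powr (real DIM(real ^ 'n) / 2)"
  have \<kappa>: "0 < \<kappa>" by (simp add: \<kappa>_def)
  \<comment> \<open>By \<open>bessel_mass_ge\<close> the product s \<open>bessel_mass s\<close> is
    at least 1 / e, so e / \<kappa> bounds every k.\<close>
  define K where "K = exp 1 / \<kappa>"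
  have K: "0 < K" using \<kappa> by (simp add: K_def)
  show ?thesis
  proof (intro exI[of _ "C powr (1 / p) * K"] ballI allI impI)
    fix s U and u g :: "real ^ 'n \<Rightarrow> complex"
    assume "s \<in> {0<..<1}" and U: "represents u U" "represents g (bessel_op s U)" and g: "g \<in> Lp_space p"
    then have s: "0 < s" "s < 1" by auto
    let ?F = "\<lambda>(x, y). (u x - u y) / of_real (norm (x - y) powr (real CARD('n) / p + s))"
    obtain u' where u'[measurable]: "u' \<in> borel_measurable borel" and u_ae: "AE x in lborel. u x = u' x"
      using U(1) borel_version unfolding represents_def by metis
    obtain g' where g'[measurable]: "g' \<in> borel_measurable borel" and g_ae: "AE x in lborel. g x = g' x"
      using U(2) borel_version unfolding represents_def by metis
    define J where "J = (LINT x|lebesgue. norm (g x) powr p)"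
    have J: "0 \<le> J" by (simp add: J_def)
    have gJ: "(\<integral>\<^sup>+x. ennreal (norm (g' x) powr p) \<partial>lborel) = ennreal J"
    proof -
      have "(\<integral>\<^sup>+x. ennreal (norm (g' x) powr p) \<partial>lborel) = (\<integral>\<^sup>+x. ennreal (norm (g' x) powr p) \<partial>lebesgue)"
        by (rule nn_integral_completion[symmetric])
      also have "\<dots> = (\<integral>\<^sup>+x. ennreal (norm (g x) powr p) \<partial>lebesgue)"
        using AE_completion[OF g_ae] by (intro nn_integral_cong_AE) (auto elim!: eventually_mono)
      also have "\<dots> = ennreal J"
        unfolding J_def using g by (intro nn_integral_eq_integral) (auto simp: Lp_space_def)
      finally show ?thesis .
    qed
    let ?M = "max_fun (\<lambda>y. ennreal (norm (g' y)))"
    have M_ae: "AE x in lborel. ?M x < \<infinity>" using gJ by (intro max_fun_finite_AE[OF assms]) auto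
    define k where "k = 1 / (\<kappa> * bessel_mass s * s)"
    have k: "0 < k" using bessel_mass_pos[OF s] \<kappa> s by (simp add: k_def)
    have kK: "k \<le> K"
    proof -
      have "1 \<le> exp 1 * (bessel_mass s * s)" using bessel_mass_ge[OF s] s by (simp add: field_simps)
      then have "1 / (bessel_mass s * s) \<le> exp 1" using bessel_mass_pos[OF s] s by (simp add: divide_le_eq)
      then have "1 / (bessel_mass s * s) / \<kappa> \<le> K" unfolding K_def using \<kappa> by (intro divide_right_mono) auto
      then show ?thesis by (simp add: k_def mult_ac)
    qed
    have "AE x in lborel. u x = k *\<^sub>R (s *\<^sub>R bessel_int s g' x) \<and> ?M x < \<infinity>"
      using u_ae M_ae bessel_representation[OF s U u' g' u_ae g_ae]
      by eventually_elim (use s in \<open>simp add: k_def \<kappa>_def\<close>)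
    then obtain N where N: "N \<in> null_sets lborel" and good: "\<And>x. x \<notin> N \<Longrightarrow> u x = k *\<^sub>R (s *\<^sub>R bessel_int s g' x) \<and> ?M x < \<infinity>"
      by (rule AE_E3) auto
    have level: "emeasure lebesgue {z. l \<le> norm (?F z)} \<le> ennreal (C / (l / k) powr p) * ennreal J" if l: "0 < l" for l
    proof -
      let ?T = "large_quotient p s (l / k) (\<lambda>x. s *\<^sub>R bessel_int s g' x) \<inter> {(x, y). ?M x < \<infinity> \<and> ?M y < \<infinity>}"
      have "{z \<in> space (borel \<Otimes>\<^sub>M borel). ?M (fst z) < \<infinity> \<and> ?M (snd z) < \<infinity>} \<in> sets (borel \<Otimes>\<^sub>M borel)" by measurable
      moreover have "{z \<in> space (borel \<Otimes>\<^sub>M borel). ?M (fst z) < \<infinity> \<and> ?M (snd z) < \<infinity>} = {(x, y). ?M x < \<infinity> \<and> ?M y < \<infinity>}"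
        by (auto simp: space_pair_measure)
      ultimately have "{(x, y). ?M x < \<infinity> \<and> ?M y < \<infinity>} \<in> sets borel" by (simp only: borel_prod)
      then have T: "?T \<in> sets lborel" by simp
      \<comment> \<open>A positive level excludes the diagonal, where the quotient is 0. Pairs with
        a coordinate in \<open>N\<close> fill two null cylinders.\<close>
      have "{z. l \<le> norm (?F z)} \<subseteq> ?T \<union> (N \<times> UNIV \<union> UNIV \<times> N)"
      proof -
        have "(x, y) \<in> ?T" if xy: "l \<le> norm ((u x - u y) / complex_of_real (norm (x - y) powr (real CARD('n) / p + s)))"
          and n: "x \<notin> N" "y \<notin> N" for x y
        proof -
          have ne: "x \<noteq> y" using xy l by auto
          define q where "q = norm (x - y) powr (real CARD('n) / p + s)"
          have q: "0 < q" using ne by (simp add: q_def)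
          have "l * q \<le> norm (u x - u y)"
            using xy q unfolding q_def[symmetric] by (simp add: norm_divide pos_le_divide_eq)
          also have "u x - u y = k *\<^sub>R (s *\<^sub>R bessel_int s g' x - s *\<^sub>R bessel_int s g' y)"
            using good[of x] good[of y] n by (simp add: scaleR_diff_right)
          finally have "l * q \<le> k * norm (s *\<^sub>R bessel_int s g' x - s *\<^sub>R bessel_int s g' y)"
            using k by simp
          then have "l / k * q \<le> norm (s *\<^sub>R bessel_int s g' x - s *\<^sub>R bessel_int s g' y)"
            using k by (simp add: field_simps)
          then show ?thesis
            using ne good[of x] good[of y] n unfolding large_quotient_def q_def by simp
        qed
        note inT = this
        show ?thesis
        proof
          fix z assume z: "z \<in> {z. l \<le> norm (?F z)}"
          obtain x y where xy: "z = (x, y)" by (cases z)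
          show "z \<in> ?T \<union> (N \<times> UNIV \<union> UNIV \<times> N)"
          proof (cases "x \<in> N \<or> y \<in> N")
            case False
            then have "(x, y) \<in> ?T" using z unfolding xy by (intro inT) auto
            then show ?thesis unfolding xy by (rule UnI1)
          qed (auto simp: xy)
        qed
      qed
      then have "emeasure lebesgue {z. l \<le> norm (?F z)} \<le> emeasure lborel ?T"
        by (rule emeasure_lebesgue_le_mod_null[OF _ T null_sets.Un[OF null_sets_cylinder[OF N]]])
      also have "\<dots> \<le> ennreal (C / (l / k) powr p) * ennreal J"
        using weak[OF s g', of "l / k"] l k unfolding gJ by simp
      finally show ?thesis .
    qed
    show "weak_Lp_norm p ?F \<le> ennreal (C powr (1 / p) * K * Lp_norm p g)"
      unfolding weak_Lp_norm_def
    proof (rule SUP_least)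
      fix l :: real assume "l \<in> {0<..}"
      then have l: "0 < l" by simp
      have "ennreal (l powr p) * emeasure lebesgue {z. l \<le> norm (?F z)} \<le> ennreal (l powr p) * (ennreal (C / (l / k) powr p) * ennreal J)"
        by (intro mult_left_mono level l) simp
      also have "\<dots> = ennreal (l powr p * (C / (l / k) powr p * J))"
      proof -
        have "ennreal a * (ennreal b * ennreal c) = ennreal (a * (b * c))" if "0 \<le> a" "0 \<le> b" "0 \<le> c" for a b c
          using that by (simp add: ennreal_mult)
        then show ?thesis using C J by simp
      qed
      \<comment> \<open>The level l cancels, so the bound holds for the supremum over all
        levels.\<close>
      also have "l powr p * (C / (l / k) powr p * J) = C * k powr p * J"
        using l k by (simp add: powr_divide)
      also have "ennreal (C * k powr p * J) \<le> ennreal (C * K powr p * J)"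
        using C J k kK p by (intro ennreal_leI mult_right_mono mult_left_mono powr_mono2) auto
      finally have "ennpowr (ennreal (l powr p) * emeasure lebesgue {z. l \<le> norm (?F z)}) (1 / p) \<le> ennpowr (ennreal (C * K powr p * J)) (1 / p)"
        by (rule ennpowr_mono) (use p in simp)
      also have "\<dots> = ennreal ((C * K powr p * J) powr (1 / p))" by (rule ennpowr_ennreal) (use C J in simp)
      also have "(C * K powr p * J) powr (1 / p) = C powr (1 / p) * K * Lp_norm p g"
      proof -
        have "(K powr p) powr (1 / p) = K" using K p by (simp add: powr_powr)
        then show ?thesis unfolding Lp_norm_def J_def[symmetric] by (simp only: powr_mult)
      qed
      finally show "ennpowr (ennreal (l powr p) * emeasure lebesgue {z. l \<le> norm (?F z)}) (1 / p) \<le> ennreal (C powr (1 / p) * K * Lp_norm p g)" .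
    qed
  qed
qed

end
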